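(* Let $G$ be an infinitesimal group scheme of height at most $r$ over $k$, let $M$ be a finite-dimensional $G$-module, let $U\subseteq\mathbb{P}(G)$ be open, and let $a_1,\dots,a_p$ be non-negative integers. The module $M$ has constant Jordan type $[p]^{a_p}[p-1]^{a_{p-1}}\cdots[1]^{a_1}$ on $U$ if and only if for each $1\le i\le p$ the sheaf $\mathscr{F}_i(M)|_U$ is locally free of rank $a_i$.
   Context: $k$ is an algebraically closed field of characteristic $p>0$. A group scheme $G$ over $k$ is infinitesimal of height at most $r$ if its coordinate algebra $k[G]$ is a finite-dimensional local ring and $x^{p^r}=0$ for all $x$ in the maximal ideal. Its group algebra is $kG=\mathrm{Hom}_k(k[G],k)$; a $G$-module is a $kG$-module. $\mathbb{G}_{a(r)}$ is the $r$-th Frobenius kernel of the additive group: $k[\mathbb{G}_{a(r)}]=k[t]/t^{p^r}$ with $t$ primitive, and $k\mathbb{G}_{a(r)}=k[u_1,\dots,u_r]/(u_1^p,\dots,u_r^p)$ with $u_i$ dual to $t^{p^{i-1}}$ in the monomial basis. $V(G)=\operatorname{Spec}k[V(G)]$ is the affine scheme representing the functor $R\mapsto \mathrm{Hom}_{R\text{-grp}}(\mathbb{G}_{a(r),R},G_R)$ on commutative $k$-algebras. The ring $k[V(G)]$ is a finitely generated connected graded $k$-algebra with generators in degrees $p^i$, $0\le i<r$; the grading comes from the action of $\mathbb{A}^1$ on $V(G)$ in which $b\in R$ acts by precomposition with the endomorphism $t\mapsto bt$ of $\mathbb{G}_{a(r),R}$. $\mathbb{P}(G)=\operatorname{Proj}(k[V(G)]/\mathfrak{N})$,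 with $\mathfrak{N}$ the nilradical. The universal one-parameter subgroup $\mathcal{U}_G:\mathbb{G}_{a(r),k[V(G)]}\to G_{k[V(G)]}$ (corresponding to the identity of $k[V(G)]$) induces a map $\mathcal{U}_{G,*}$ on group algebras; put $\Theta_G=\mathcal{U}_{G,*}(1\otimes u_r)\in k[V(G)]\otimes_k kG$. For a finite-dimensional $G$-module $M$ let $\widetilde{M}=\mathcal{O}_{\mathbb{P}(G)}\otimes_k M$; the action of $\Theta_G$ on $k[V(G)]\otimes_k M$ is homogeneous of degree $p^{r-1}$ and induces the global operator $\Theta_M:\widetilde{M}\to\widetilde{M}(p^{r-1})$. (The sheaves $\mathcal{O}_{\mathbb{P}(G)}(dp^{r-1})$, $d\in\mathbb{Z}$, are invertible, and $\Theta_M^p=0$.) $\ker\Theta_M\subseteq\widetilde{M}$ is the kernel of $\Theta_M$; for $j\ge0$, $\operatorname{im}\Theta_M^j\subseteq\widetilde{M}$ is the image of the $j$-fold composite $\widetilde{M}(-jp^{r-1})\to\widetilde{M}$ of shifts of $\Theta_M$ (so $\operatorname{im}\Theta_M^0=\widetilde{M}$). For $1\le i\le p$, $$\mathscr{F}_i(M)=\frac{\ker\Theta_M\cap\operatorname{im}\Theta_M^{i-1}}{\ker\Theta_M\cap\operatorname{im}\Theta_M^{i}}.$$ For $v\in\mathbb{P}(G)$ the local operator $\theta_{v,M}$ is the $k(v)$-linear, $p$-nilpotent operator on $k(v)\otimes_k M$ obtained by specializing $\Theta_M$ at $v$. The local Jordan type of $M$ at $v$ is $[p]^{a_p}\cdots[1]^{a_1}$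 where $a_i$ is the number of Jordan blocks of size $i$ of $\theta_{v,M}$. $M$ has constant Jordan type $[p]^{a_p}\cdots[1]^{a_1}$ on $U$ if this is its local Jordan type at every $v\in U$. *)

theory Defs
  imports
    "HOL-Algebra.Algebra"
    "HOL-Algebra.Algebraic_Closure_Type"
    "HOL-Library.Poly_Mapping"
begin

section \<open>Infinitesimal group schemes and their modules\<close>

text \<open>
  An affine group scheme over a field \<open>k\<close> is given by its coordinate algebra, a commutative Hopf
  algebra.  A comultiplication with values in \<open>k[G] \<otimes> k[G]\<close> is given by representatives: the
  list \<open>[(x\<^sub>1,y\<^sub>1), \<dots>]\<close> stands for \<open>x\<^sub>1 \<otimes> y\<^sub>1 + \<dots>\<close>.  Two such sums are equal in a tensor product
  of vector spaces iff all multilinear forms agree on them, and this is how identities between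
  tensors are stated below.
\<close>

record ('k, 'h) group_scheme =
  scl :: "'k \<Rightarrow> 'h \<Rightarrow> 'h"
  comul :: "'h \<Rightarrow> ('h \<times> 'h) list"
  counit :: "'h \<Rightarrow> 'k"
  antipode :: "'h \<Rightarrow> 'h"

definition tens :: "('a \<Rightarrow> 'b \<Rightarrow> 'c::comm_monoid_add) \<Rightarrow> ('a \<times> 'b) list \<Rightarrow> 'c" where
  "tens \<beta> xs = (\<Sum>(x, y)\<leftarrow>xs. \<beta> x y)"

definition form1 :: "('k::field, 'h::ab_group_add) group_scheme \<Rightarrow> ('h \<Rightarrow> 'k) \<Rightarrow> bool" where
  "form1 G f \<longleftrightarrow> Vector_Spaces.linear (scl G) (*) f"

definition form2 :: "('k::field, 'h::ab_group_add) group_scheme \<Rightarrow> ('h \<Rightarrow> 'h \<Rightarrow> 'k) \<Rightarrow> bool" where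
  "form2 G \<beta> \<longleftrightarrow> (\<forall>x. form1 G (\<lambda>y. \<beta> x y)) \<and> (\<forall>y. form1 G (\<lambda>x. \<beta> x y))"

definition form3 ::
  "('k::field, 'h::ab_group_add) group_scheme \<Rightarrow> ('h \<Rightarrow> 'h \<Rightarrow> 'h \<Rightarrow> 'k) \<Rightarrow> bool" where
  "form3 G \<tau> \<longleftrightarrow> (\<forall>x. form2 G (\<lambda>y z. \<tau> x y z)) \<and> (\<forall>y z. form1 G (\<lambda>x. \<tau> x y z))"

locale affine_group_scheme =
  fixes G :: "('k::field, 'h::comm_ring_1) group_scheme"
  assumes vector_space_scl: "vector_space (scl G)"
    and scl_mult: "scl G c x * y = scl G c (x * y)"
    and comul_add: "form2 G \<beta> \<Longrightarrow>
          tens \<beta> (comul G (x + y)) = tens \<beta> (comul G x) + tens \<beta> (comul G y)"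
    and comul_scl: "form2 G \<beta> \<Longrightarrow> tens \<beta> (comul G (scl G c x)) = c * tens \<beta> (comul G x)"
    and comul_one: "form2 G \<beta> \<Longrightarrow> tens \<beta> (comul G 1) = \<beta> 1 1"
    and comul_mult: "form2 G \<beta> \<Longrightarrow> tens \<beta> (comul G (x * y)) =
          tens (\<lambda>x1 x2. tens (\<lambda>y1 y2. \<beta> (x1 * y1) (x2 * y2)) (comul G y)) (comul G x)"
    and coassoc: "form3 G \<tau> \<Longrightarrow>
          tens (\<lambda>y z. tens (\<lambda>y1 y2. \<tau> y1 y2 z) (comul G y)) (comul G x) =
          tens (\<lambda>y z. tens (\<lambda>z1 z2. \<tau> y z1 z2) (comul G z)) (comul G x)"
    and counit_linear: "Vector_Spaces.linear (scl G) (*) (counit G)"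
    and counit_one: "counit G 1 = 1"
    and counit_mult: "counit G (x * y) = counit G x * counit G y"
    and counit_left: "tens (\<lambda>y z. scl G (counit G y) z) (comul G x) = x"
    and counit_right: "tens (\<lambda>y z. scl G (counit G z) y) (comul G x) = x"
    and antipode_linear: "Vector_Spaces.linear (scl G) (scl G) (antipode G)"
    and antipode_left: "tens (\<lambda>y z. antipode G y * z) (comul G x) = scl G (counit G x) 1"
    and antipode_right: "tens (\<lambda>y z. y * antipode G z) (comul G x) = scl G (counit G x) 1"

text \<open>The maximal ideal of a local ring is its set of non-units.\<close>

definition infinitesimal_group_scheme ::
  "('k::field, 'h::comm_ring_1) group_scheme \<Rightarrow> nat \<Rightarrow> bool" where
  "infinitesimal_group_scheme G r \<longleftrightarrow>
    affine_group_scheme G \<and>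
    (\<exists>B. finite B \<and> Modules.module.span (scl G) B = UNIV) \<and>
    (\<forall>x y :: 'h. \<not> x dvd 1 \<longrightarrow> \<not> y dvd 1 \<longrightarrow> \<not> x + y dvd 1) \<and>
    (\<forall>x :: 'h. \<not> x dvd 1 \<longrightarrow> x ^ (CHAR('k) ^ r) = 0)"

text \<open>The group algebra \<open>kG\<close> is the dual of \<open>k[G]\<close>, with unit \<open>counit G\<close> and convolution product.\<close>

definition group_algebra :: "('k::field, 'h::comm_ring_1) group_scheme \<Rightarrow> ('h \<Rightarrow> 'k) set" where
  "group_algebra G = {f. Vector_Spaces.linear (scl G) (*) f}"

definition convolution ::
  "('k::field, 'h::comm_ring_1) group_scheme \<Rightarrow> ('h \<Rightarrow> 'k) \<Rightarrow> ('h \<Rightarrow> 'k) \<Rightarrow> 'h \<Rightarrow> 'k" where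
  "convolution G f g = (\<lambda>x. tens (\<lambda>y z. f y * g z) (comul G x))"

record ('k, 'h, 'm) G_mod =
  mscl :: "'k \<Rightarrow> 'm \<Rightarrow> 'm"
  act :: "('h \<Rightarrow> 'k) \<Rightarrow> 'm \<Rightarrow> 'm"

locale fin_dim_G_module =
  fixes G :: "('k::field, 'h::comm_ring_1) group_scheme"
    and M :: "('k, 'h, 'm::ab_group_add) G_mod"
  assumes vector_space_mscl: "vector_space (mscl M)"
    and finite_dim_M: "\<exists>B. finite B \<and> Modules.module.span (mscl M) B = UNIV"
    and act_linear: "f \<in> group_algebra G \<Longrightarrow> Vector_Spaces.linear (mscl M) (mscl M) (act M f)"
    and act_add: "f \<in> group_algebra G \<Longrightarrow> g \<in> group_algebra G \<Longrightarrow>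
          act M (\<lambda>x. f x + g x) m = act M f m + act M g m"
    and act_scl: "f \<in> group_algebra G \<Longrightarrow> act M (\<lambda>x. c * f x) m = mscl M c (act M f m)"
    and act_one: "act M (counit G) m = m"
    and act_mult: "f \<in> group_algebra G \<Longrightarrow> g \<in> group_algebra G \<Longrightarrow>
          act M (convolution G f g) m = act M f (act M g m)"


section \<open>The scheme of one-parameter subgroups\<close>

text \<open>
  A homomorphism \<open>\<G>\<^sub>a\<^sub>(\<^sub>r\<^sub>),\<^sub>R \<rightarrow> G\<^sub>R\<close> over a commutative \<open>k\<close>-algebra \<open>\<eta> : k \<rightarrow> R\<close> is the same as a
  \<open>k\<close>-algebra homomorphism \<open>k[G] \<rightarrow> R[t]/t\<^sup>q\<close> with \<open>q = p\<^sup>r\<close>, written here as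
  \<open>x \<mapsto> \<Sum>i<q. \<phi> x i t\<^sup>i\<close>, that is compatible with the comultiplications and the counits.
  Comparing the coefficients of \<open>t\<^sup>j \<otimes> t\<^sup>l\<close> in \<open>\<Sum>i. \<phi> x i (t \<otimes> 1 + 1 \<otimes> t)\<^sup>i\<close> and in the image of
  \<open>comul G x\<close> gives the condition with the binomial coefficient; if \<open>j + l \<ge> q\<close> its left hand side
  vanishes, because \<open>\<phi>\<close> is extended by \<open>0\<close> to all indices.
\<close>

definition one_parameter_subgroup ::
  "('k::field, 'h::comm_ring_1) group_scheme \<Rightarrow> nat \<Rightarrow> ('k \<Rightarrow> 'r::comm_ring_1) \<Rightarrow>
    ('h \<Rightarrow> nat \<Rightarrow> 'r) \<Rightarrow> bool" where
  "one_parameter_subgroup G r \<eta> \<phi> \<longleftrightarrow>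
    (let q = CHAR('k) ^ r in
      (\<forall>x i. q \<le> i \<longrightarrow> \<phi> x i = 0) \<and>
      (\<forall>x y i. \<phi> (x + y) i = \<phi> x i + \<phi> y i) \<and>
      (\<forall>c x i. \<phi> (scl G c x) i = \<eta> c * \<phi> x i) \<and>
      (\<forall>i. \<phi> 1 i = (if i = 0 then 1 else 0)) \<and>
      (\<forall>x y. \<forall>i<q. \<phi> (x * y) i = (\<Sum>j\<le>i. \<phi> x j * \<phi> y (i - j))) \<and>
      (\<forall>x. \<forall>j<q. \<forall>l<q. of_nat ((j + l) choose j) * \<phi> x (j + l) =
          tens (\<lambda>y z. \<phi> y j * \<phi> z l) (comul G x)) \<and>
      (\<forall>x. \<phi> x 0 = \<eta> (counit G x)))"

text \<open>
  \<open>k[V(G)]\<close> is the quotient of the polynomial ring in variables \<open>X x i\<close> (\<open>x \<in> k[G]\<close>, \<open>i \<in> \<nat>\<close>) by the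
  relations saying that \<open>X\<close> is a one-parameter subgroup.  The universal property is proved below
  in \<open>coord_ring_represents\<close>.
\<close>

type_synonym ('k, 'h) pring = "(('h \<times> nat) \<Rightarrow>\<^sub>0 nat) \<Rightarrow>\<^sub>0 'k"

definition const_pol :: "'k::comm_ring_1 \<Rightarrow> ('k, 'h) pring" where
  "const_pol c = Poly_Mapping.single 0 c"

definition X_pol :: "'h \<Rightarrow> nat \<Rightarrow> ('k::comm_ring_1, 'h) pring" where
  "X_pol x i = Poly_Mapping.single (Poly_Mapping.single (x, i) 1) 1"

definition V_relations ::
  "('k::field, 'h::comm_ring_1) group_scheme \<Rightarrow> nat \<Rightarrow> ('k, 'h) pring set" where
  "V_relations G r =
    (let q = CHAR('k) ^ r in
      {X_pol x i | x i. q \<le> i} \<union>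
      {X_pol (x + y) i - (X_pol x i + X_pol y i) | x y i. True} \<union>
      {X_pol (scl G c x) i - const_pol c * X_pol x i | c x i. True} \<union>
      {X_pol 1 i - (if i = 0 then 1 else 0) | i. True} \<union>
      {X_pol (x * y) i - (\<Sum>j\<le>i. X_pol x j * X_pol y (i - j)) | x y i. i < q} \<union>
      {of_nat ((j + l) choose j) * X_pol x (j + l)
          - tens (\<lambda>y z. X_pol y j * X_pol z l) (comul G x) | x j l. j < q \<and> l < q} \<union>
      {X_pol x 0 - const_pol (counit G x) | x. True})"

definition V_ideal ::
  "('k::field, 'h::comm_ring_1) group_scheme \<Rightarrow> nat \<Rightarrow> ('k, 'h) pring set" where
  "V_ideal G r = genideal ring_of_type_algebra (V_relations G r)"

definition coord_ring ::
  "('k::field, 'h::comm_ring_1) group_scheme \<Rightarrow> nat \<Rightarrow> ('k, 'h) pring set ring" where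
  "coord_ring G r = ring_of_type_algebra Quot V_ideal G r"

definition coord_class ::
  "('k::field, 'h::comm_ring_1) group_scheme \<Rightarrow> nat \<Rightarrow> ('k, 'h) pring \<Rightarrow> ('k, 'h) pring set" where
  "coord_class G r f = V_ideal G r +>\<^bsub>ring_of_type_algebra\<^esub> f"

definition pol_eval ::
  "('k::field \<Rightarrow> 'r::comm_ring_1) \<Rightarrow> ('h \<Rightarrow> nat \<Rightarrow> 'r) \<Rightarrow> ('k, 'h) pring \<Rightarrow> 'r" where
  "pol_eval \<eta> \<phi> f = (\<Sum>m\<in>Poly_Mapping.keys f. \<eta> (Poly_Mapping.lookup f m) *
     (\<Prod>v\<in>Poly_Mapping.keys m. \<phi> (fst v) (snd v) ^ Poly_Mapping.lookup m v))"

lemma poly_mapping_single_induct [case_names zero add]: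
  fixes f :: "'a \<Rightarrow>\<^sub>0 'b::comm_monoid_add"
  assumes "P 0" and "\<And>f k c. P f \<Longrightarrow> P (f + Poly_Mapping.single k c)"
  shows "P f"
proof (induction f rule: update_induct)
  case const
  show ?case by (fact assms(1))
next
  case (update f a b)
  have "Poly_Mapping.update a b f = f + Poly_Mapping.single a b"
    using update(1) by (intro poly_mapping_eqI)
      (auto simp: lookup_update lookup_add lookup_single when_def in_keys_iff)
  then show ?case using assms(2)[OF update(3)] by simp
qed

lemma monomial_eval_add:
  fixes \<phi> :: "'v \<Rightarrow> 'r::comm_ring_1" and m m' :: "'v \<Rightarrow>\<^sub>0 nat"
  shows "(\<Prod>v\<in>Poly_Mapping.keys (m + m'). \<phi> v ^ Poly_Mapping.lookup (m + m') v) =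
    (\<Prod>v\<in>Poly_Mapping.keys m. \<phi> v ^ Poly_Mapping.lookup m v) *
    (\<Prod>v\<in>Poly_Mapping.keys m'. \<phi> v ^ Poly_Mapping.lookup m' v)"
proof -
  let ?A = "Poly_Mapping.keys m \<union> Poly_Mapping.keys m'"
  have "(\<Prod>v\<in>Poly_Mapping.keys n. \<phi> v ^ Poly_Mapping.lookup n v) = (\<Prod>v\<in>?A. \<phi> v ^ Poly_Mapping.lookup n v)"
    if "Poly_Mapping.keys n \<subseteq> ?A" for n
    using that by (intro prod.mono_neutral_left) (auto simp: in_keys_iff)
  note * = this
  have "Poly_Mapping.keys (m + m') \<subseteq> ?A" by (rule keys_add)
  then show ?thesis
    by (subst *[of "m + m'"], assumption, subst *[of m], blast, subst *[of m'], blast)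
      (simp add: lookup_add power_add prod.distrib)
qed

context
  fixes \<eta> :: "'k::field \<Rightarrow> 'r::comm_ring_1" and \<phi> :: "'h \<Rightarrow> nat \<Rightarrow> 'r"
  assumes \<eta>: "\<eta> \<in> ring_hom ring_of_type_algebra ring_of_type_algebra"
begin

lemma eta_simps: "\<eta> (a + b) = \<eta> a + \<eta> b" "\<eta> (a * b) = \<eta> a * \<eta> b" "\<eta> 1 = 1" "\<eta> 0 = 0"
proof -
  show *: "\<eta> (a + b) = \<eta> a + \<eta> b" for a b
    using ring_hom_add[OF \<eta>, of a b] by (simp add: ring_of_type_algebra_def)
  show "\<eta> (a * b) = \<eta> a * \<eta> b"
    using ring_hom_mult[OF \<eta>, of a b] by (simp add: ring_of_type_algebra_def)
  show "\<eta> 1 = 1" using ring_hom_one[OF \<eta>] by (simp add: ring_of_type_algebra_def)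
  show "\<eta> 0 = 0" using *[of 0 0] by simp
qed

lemma pol_eval_zero: "pol_eval \<eta> \<phi> 0 = 0" by (simp add: pol_eval_def)

lemma pol_eval_single: "pol_eval \<eta> \<phi> (Poly_Mapping.single m c) =
    \<eta> c * (\<Prod>v\<in>Poly_Mapping.keys m. \<phi> (fst v) (snd v) ^ Poly_Mapping.lookup m v)"
  by (cases "c = 0") (simp_all add: pol_eval_def eta_simps)

lemma pol_eval_add: "pol_eval \<eta> \<phi> (f + g) = pol_eval \<eta> \<phi> f + pol_eval \<eta> \<phi> g"
  unfolding pol_eval_def
  by (rule setsum_keys_plus_distrib) (simp_all add: eta_simps algebra_simps)

lemma pol_eval_mult_single:
  "pol_eval \<eta> \<phi> (f * Poly_Mapping.single m c) = pol_eval \<eta> \<phi> f * pol_eval \<eta> \<phi> (Poly_Mapping.single m c)"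
proof (induction f rule: poly_mapping_single_induct)
  case (add f k d)
  have "pol_eval \<eta> \<phi> (Poly_Mapping.single k d * Poly_Mapping.single m c) =
     pol_eval \<eta> \<phi> (Poly_Mapping.single k d) * pol_eval \<eta> \<phi> (Poly_Mapping.single m c)"
    unfolding mult_single pol_eval_single eta_simps
      monomial_eval_add[of "\<lambda>v. \<phi> (fst v) (snd v)" k m] by (simp add: ac_simps)
  with add show ?case by (simp add: distrib_right pol_eval_add)
qed (simp add: pol_eval_zero)

lemma pol_eval_mult: "pol_eval \<eta> \<phi> (f * g) = pol_eval \<eta> \<phi> f * pol_eval \<eta> \<phi> g"
  by (induction g rule: poly_mapping_single_induct)
    (simp_all add: distrib_left pol_eval_add pol_eval_mult_single pol_eval_zero)

lemma pol_eval_const: "pol_eval \<eta> \<phi> (const_pol c) = \<eta> c"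
  by (simp add: const_pol_def pol_eval_single)

lemma pol_eval_X: "pol_eval \<eta> \<phi> (X_pol x i) = \<phi> x i"
  by (simp add: X_pol_def pol_eval_single eta_simps)

lemma pol_eval_one: "pol_eval \<eta> \<phi> 1 = 1"
  using pol_eval_const[of 1] by (simp add: const_pol_def eta_simps)

lemma pol_eval_unique:
  assumes add: "\<And>f g. H (f + g) = H f + H g" and mult: "\<And>f g. H (f * g) = H f * H g"
    and const: "\<And>c. H (const_pol c) = \<eta> c" and X: "\<And>x i. H (X_pol x i) = \<phi> x i"
  shows "H f = pol_eval \<eta> \<phi> f"
proof (induction f rule: poly_mapping_single_induct)
  case zero
  show ?case using add[of 0 0] by (simp add: pol_eval_zero)
next
  case (add f m c)
  have one: "H 1 = 1" using const[of 1] by (simp add: const_pol_def eta_simps)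
  have sX: "H (Poly_Mapping.single (Poly_Mapping.single v n) 1) =
      pol_eval \<eta> \<phi> (Poly_Mapping.single (Poly_Mapping.single v n) 1)" for v n
  proof (induction n)
    case 0
    show ?case using one pol_eval_one by simp
  next
    case (Suc n)
    have e: "Poly_Mapping.single (Poly_Mapping.single v (Suc n)) (1::'k) =
       Poly_Mapping.single (Poly_Mapping.single v n) 1 * X_pol (fst v) (snd v)"
      by (simp add: X_pol_def mult_single flip: single_add)
    show ?case unfolding e mult pol_eval_mult Suc by (simp add: X pol_eval_X)
  qed
  have mon: "H (Poly_Mapping.single m 1) = pol_eval \<eta> \<phi> (Poly_Mapping.single m 1)"
  proof (induction m rule: poly_mapping_single_induct)
    case zero
    show ?case using one pol_eval_one by simp
  next
    case (add m v n)
    have e: "Poly_Mapping.single (m + Poly_Mapping.single v n) (1::'k) =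
       Poly_Mapping.single m 1 * Poly_Mapping.single (Poly_Mapping.single v n) 1"
      by (simp add: mult_single)
    show ?case unfolding e mult pol_eval_mult add sX ..
  qed
  have e: "Poly_Mapping.single m c = const_pol c * Poly_Mapping.single m 1"
    by (simp add: const_pol_def mult_single)
  have "H (Poly_Mapping.single m c) = pol_eval \<eta> \<phi> (Poly_Mapping.single m c)"
    unfolding e mult pol_eval_mult const mon pol_eval_const ..
  then show ?case by (simp add: add pol_eval_add assms(1))
qed

end

lemma V_ideal_ideal: "ideal (V_ideal G r) ring_of_type_algebra"
  unfolding V_ideal_def
  by (rule ring.genideal_ideal[OF ring_from_type_algebra]) (simp add: ring_of_type_algebra_def)

lemma one_parameter_subgroup_iff_relations:
  fixes G :: "('k::field, 'h::comm_ring_1) group_scheme" and H :: "('k, 'h) pring \<Rightarrow> 'r::comm_ring_1"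
  assumes add: "\<And>f g. H (f + g) = H f + H g" and mult: "\<And>f g. H (f * g) = H f * H g"
    and const: "\<And>c. H (const_pol c) = \<eta> c" and one: "H 1 = 1"
  shows "one_parameter_subgroup G r \<eta> (\<lambda>x i. H (X_pol x i)) \<longleftrightarrow> (\<forall>f\<in>V_relations G r. H f = 0)"
proof -
  have zero: "H 0 = 0" using add[of 0 0] by simp
  have minus: "H (f - g) = H f - H g" for f g
    using add[of "f - g" g] by simp
  have ofnat: "H (of_nat n) = of_nat n" for n
    by (induction n) (simp_all add: zero one add)
  have sum: "H (sum F S) = (\<Sum>j\<in>S. H (F j))" for S :: "nat set" and F
    by (induction S rule: infinite_finite_induct) (simp_all add: zero add)
  have tens: "H (tens \<beta> xs) = tens (\<lambda>y z. H (\<beta> y z)) xs" for \<beta> and xs :: "('b \<times> 'b) list"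
    unfolding tens_def by (induction xs) (auto simp: zero add)
  show ?thesis
  proof
    assume L: "one_parameter_subgroup G r \<eta> (\<lambda>x i. H (X_pol x i))"
    note L' = L[unfolded one_parameter_subgroup_def Let_def]
    show "\<forall>f\<in>V_relations G r. H f = 0"
      unfolding V_relations_def Let_def
    proof (intro ballI, elim UnE CollectE exE conjE)
    qed (use L' in \<open>simp_all add: minus add mult const tens ofnat sum zero one\<close>)
  next
    assume "\<forall>f\<in>V_relations G r. H f = 0"
    then have R: "f \<in> V_relations G r \<Longrightarrow> H f = 0" for f by blast
    let ?q = "CHAR('k) ^ r"
    have "H (X_pol x i) = 0" if "?q \<le> i" for x i
      using R[of "X_pol x i"] that unfolding V_relations_def Let_def by blast
    moreover have "H (X_pol (x + y) i - (X_pol x i + X_pol y i)) = 0" for x y i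
      by (rule R) (unfold V_relations_def Let_def, blast)
    moreover have "H (X_pol (scl G c x) i - const_pol c * X_pol x i) = 0" for c x i
      by (rule R) (unfold V_relations_def Let_def, blast)
    moreover have "H (X_pol 1 i - (if i = 0 then 1 else 0)) = 0" for i
      by (rule R) (unfold V_relations_def Let_def, blast)
    moreover have "H (X_pol (x * y) i - (\<Sum>j\<le>i. X_pol x j * X_pol y (i - j))) = 0" if "i < ?q" for x y i
      by (rule R) (use that in \<open>unfold V_relations_def Let_def, blast\<close>)
    moreover have "H (of_nat ((j + l) choose j) * X_pol x (j + l)
        - tens (\<lambda>y z. X_pol y j * X_pol z l) (comul G x)) = 0" if "j < ?q" "l < ?q" for x j l
      by (rule R) (use that in \<open>unfold V_relations_def Let_def, blast\<close>)
    moreover have "H (X_pol x 0 - const_pol (counit G x)) = 0" for x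
      by (rule R) (unfold V_relations_def Let_def, blast)
    ultimately show "one_parameter_subgroup G r \<eta> (\<lambda>x i. H (X_pol x i))"
      unfolding one_parameter_subgroup_def Let_def
      by (simp add: minus add mult const tens ofnat sum zero one if_distrib[of H] cong: if_cong)
  qed
qed

lemma ring_of_type_simps:
  "carrier ring_of_type_algebra = UNIV"
  "x \<otimes>\<^bsub>ring_of_type_algebra\<^esub> y = x * y"
  "x \<oplus>\<^bsub>ring_of_type_algebra\<^esub> y = x + y"
  "\<one>\<^bsub>ring_of_type_algebra\<^esub> = 1"
  "\<zero>\<^bsub>ring_of_type_algebra\<^esub> = 0"
  by (simp_all add: ring_of_type_algebra_def)

theorem coord_ring_represents:
  fixes \<eta> :: "'k::field \<Rightarrow> 'r::comm_ring_1" and G :: "('k, 'h::comm_ring_1) group_scheme"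
  assumes \<eta>: "\<eta> \<in> ring_hom ring_of_type_algebra ring_of_type_algebra"
  shows "bij_betw (\<lambda>\<psi> x i. \<psi> (coord_class G r (X_pol x i)))
     {\<psi> \<in> extensional (carrier (coord_ring G r)).
        \<psi> \<in> ring_hom (coord_ring G r) ring_of_type_algebra \<and>
        (\<forall>c. \<psi> (coord_class G r (const_pol c)) = \<eta> c)}
     {\<phi>. one_parameter_subgroup G r \<eta> \<phi>}"
    (is "bij_betw ?F ?A ?B")
proof -
  interpret I: ideal "V_ideal G r" "ring_of_type_algebra :: ('k, 'h) pring ring"
    by (rule V_ideal_ideal)
  let ?S = "ring_of_type_algebra :: ('k, 'h) pring ring"
  note defs = ring_of_type_simps
  have cl: "coord_class G r \<in> ring_hom ?S (coord_ring G r)"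
    using I.rcos_ring_hom by (simp add: coord_class_def[abs_def] coord_ring_def)
  have carr: "carrier (coord_ring G r) = range (coord_class G r)"
  proof -
    have "carrier ?S = UNIV" by (simp add: defs)
    then show ?thesis
      by (auto simp: coord_ring_def FactRing_def A_RCOSETS_def' coord_class_def)
  qed
  have cl_add: "coord_class G r (f + g) = coord_class G r f \<oplus>\<^bsub>coord_ring G r\<^esub> coord_class G r g" for f g
    using ring_hom_add[OF cl, of f g] by (simp add: defs)
  have cl_mult: "coord_class G r (f * g) = coord_class G r f \<otimes>\<^bsub>coord_ring G r\<^esub> coord_class G r g" for f g
    using ring_hom_mult[OF cl, of f g] by (simp add: defs)
  have cl_one: "coord_class G r 1 = \<one>\<^bsub>coord_ring G r\<^esub>"
    using ring_hom_one[OF cl] by (simp add: defs)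
  have cl_eq: "coord_class G r f = coord_class G r g \<longleftrightarrow> f - g \<in> V_ideal G r" for f g
  proof -
    have "f \<ominus>\<^bsub>?S\<^esub> g = f - g"
    proof -
      have "\<ominus>\<^bsub>?S\<^esub> g = - g"
        by (rule abelian_group.minus_equality[OF I.is_abelian_group]) (simp_all add: defs)
      then show ?thesis by (simp add: a_minus_def defs)
    qed
    then show ?thesis
      using I.quotient_eq_iff_same_a_r_cos[OF V_ideal_ideal, of f g G r] by (simp add: coord_class_def defs)
  qed
  have hom: "\<psi> (coord_class G r (f + g)) = \<psi> (coord_class G r f) + \<psi> (coord_class G r g)"
    "\<psi> (coord_class G r (f * g)) = \<psi> (coord_class G r f) * \<psi> (coord_class G r g)"
    "\<psi> (coord_class G r 1) = 1"
    if "\<psi> \<in> ?A" for \<psi> f g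
  proof -
    from that have \<psi>: "\<psi> \<in> ring_hom (coord_ring G r) ring_of_type_algebra" by simp
    show "\<psi> (coord_class G r (f + g)) = \<psi> (coord_class G r f) + \<psi> (coord_class G r g)"
      using ring_hom_add[OF \<psi>, of "coord_class G r f" "coord_class G r g"]
      by (simp add: carr cl_add defs)
    show "\<psi> (coord_class G r (f * g)) = \<psi> (coord_class G r f) * \<psi> (coord_class G r g)"
      using ring_hom_mult[OF \<psi>, of "coord_class G r f" "coord_class G r g"]
      by (simp add: carr cl_mult defs)
    show "\<psi> (coord_class G r 1) = 1"
      using ring_hom_one[OF \<psi>] by (simp add: cl_one defs)
  qed
  have const: "\<psi> (coord_class G r (const_pol c)) = \<eta> c" if "\<psi> \<in> ?A" for \<psi> c
    using that by blast
  have rel: "f \<in> V_ideal G r" if "f \<in> V_relations G r" for f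
    using that I.genideal_self[of "V_relations G r"] by (simp add: V_ideal_def defs subset_iff)
  have toB: "?F \<psi> \<in> ?B" if \<psi>: "\<psi> \<in> ?A" for \<psi>
  proof -
    have 0: "\<psi> (coord_class G r 0) = 0" using hom(1)[OF \<psi>, of 0 0] by simp
    have "\<forall>f\<in>V_relations G r. \<psi> (coord_class G r f) = 0"
    proof
      fix f assume "f \<in> V_relations G r"
      then have "coord_class G r f = coord_class G r 0" by (simp add: cl_eq rel)
      then show "\<psi> (coord_class G r f) = 0" using 0 by simp
    qed
    then show ?thesis
      using one_parameter_subgroup_iff_relations[of "\<lambda>f. \<psi> (coord_class G r f)" \<eta> G r]
        hom[OF \<psi>] \<psi> by simp
  qed
  have inj: "inj_on ?F ?A"
  proof (rule inj_onI)
    fix \<psi> \<psi>' assume \<psi>: "\<psi> \<in> ?A" and \<psi>': "\<psi>' \<in> ?A" and eq: "?F \<psi> = ?F \<psi>'"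
    have "\<psi> (coord_class G r f) = pol_eval \<eta> (?F \<psi>) f" for f
      by (rule pol_eval_unique[OF \<eta>]) (simp_all only: hom[OF \<psi>] const[OF \<psi>])
    moreover have "\<psi>' (coord_class G r f) = pol_eval \<eta> (?F \<psi>) f" for f
      by (rule pol_eval_unique[OF \<eta>])
        (simp_all only: hom[OF \<psi>'] const[OF \<psi>'] fun_cong[OF fun_cong[OF eq]])
    ultimately have *: "\<psi> (coord_class G r f) = \<psi>' (coord_class G r f)" for f by metis
    show "\<psi> = \<psi>'"
    proof (rule extensionalityI)
      show "\<psi> \<in> extensional (carrier (coord_ring G r))" using \<psi> by blast
      show "\<psi>' \<in> extensional (carrier (coord_ring G r))" using \<psi>' by blast
      show "\<psi> Y = \<psi>' Y" if "Y \<in> carrier (coord_ring G r)" for Y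
        using that * unfolding carr by blast
    qed
  qed
  have surj: "\<phi> \<in> ?F ` ?A" if \<phi>: "\<phi> \<in> ?B" for \<phi>
  proof -
    define E where "E = pol_eval \<eta> \<phi>"
    note E = pol_eval_add[OF \<eta>, of \<phi>, folded E_def] pol_eval_mult[OF \<eta>, of \<phi>, folded E_def]
      pol_eval_const[OF \<eta>, of \<phi>, folded E_def] pol_eval_X[OF \<eta>, of \<phi>, folded E_def]
      pol_eval_one[OF \<eta>, of \<phi>, folded E_def]
    have E0: "E 0 = 0" using E(1)[of 0 0] by simp
    have Em: "E (f - g) = E f - E g" for f g using E(1)[of "f - g" g] by simp
    have "\<forall>f\<in>V_relations G r. E f = 0"
      using one_parameter_subgroup_iff_relations[of E \<eta> G r] E \<phi> by simp
    moreover have "ideal {f. E f = 0} ?S"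
    proof (rule idealI)
      show "ring ?S" by (rule I.ring_axioms)
      show "subgroup {f. E f = 0} (add_monoid ?S)"
      proof (rule group.subgroupI)
        show "group (add_monoid ?S)" by (rule I.add.is_group)
        show "inv\<^bsub>add_monoid ?S\<^esub> f \<in> {f. E f = 0}" if "f \<in> {f. E f = 0}" for f
        proof -
          have "f \<oplus>\<^bsub>?S\<^esub> (inv\<^bsub>add_monoid ?S\<^esub> f) = 0"
            using I.r_neg[of f] by (simp only: a_inv_def defs UNIV_I)
          then have "E (f + inv\<^bsub>add_monoid ?S\<^esub> f) = 0" by (simp add: defs E0)
          then show ?thesis using that by (simp add: E)
        qed
      qed (auto simp: defs E0 E intro: exI[of _ 0])
    qed (auto simp: defs E)
    ultimately have ker: "V_ideal G r \<subseteq> {f. E f = 0}"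
      unfolding V_ideal_def by (intro I.genideal_minimal) (auto simp: defs)
    define \<psi> where "\<psi> = (\<lambda>Y\<in>carrier (coord_ring G r). E (SOME f. coord_class G r f = Y))"
    have \<psi>: "\<psi> (coord_class G r f) = E f" for f
    proof -
      have "coord_class G r (SOME g. coord_class G r g = coord_class G r f) = coord_class G r f"
        by (rule someI) (rule refl)
      then have "E (SOME g. coord_class G r g = coord_class G r f) = E f"
        using ker Em by (auto simp: cl_eq)
      then show ?thesis by (simp add: \<psi>_def carr)
    qed
    have "\<psi> \<in> ring_hom (coord_ring G r) ring_of_type_algebra"
    proof (rule ring_hom_memI)
      show "\<psi> Y \<in> carrier ring_of_type_algebra" for Y by (simp add: defs)
      show "\<psi> \<one>\<^bsub>coord_ring G r\<^esub> = \<one>\<^bsub>ring_of_type_algebra\<^esub>"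
        by (simp only: cl_one[symmetric] \<psi> E defs)
      fix Y Z assume "Y \<in> carrier (coord_ring G r)" "Z \<in> carrier (coord_ring G r)"
      then obtain f g where fg: "Y = coord_class G r f" "Z = coord_class G r g"
        unfolding carr by blast
      show "\<psi> (Y \<otimes>\<^bsub>coord_ring G r\<^esub> Z) = \<psi> Y \<otimes>\<^bsub>ring_of_type_algebra\<^esub> \<psi> Z"
        by (simp only: fg cl_mult[symmetric] \<psi> E defs)
      show "\<psi> (Y \<oplus>\<^bsub>coord_ring G r\<^esub> Z) = \<psi> Y \<oplus>\<^bsub>ring_of_type_algebra\<^esub> \<psi> Z"
        by (simp only: fg cl_add[symmetric] \<psi> E defs)
    qed
    then have "\<psi> \<in> ?A" by (auto simp: \<psi> E) (simp add: \<psi>_def)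
    moreover have "?F \<psi> = \<phi>" by (simp add: \<psi> E)
    ultimately show ?thesis by blast
  qed
  show ?thesis
    unfolding bij_betw_def using inj toB surj by blast
qed

text \<open>
  The element \<open>b\<close> of the monoid \<open>\<A>\<^sup>1\<close> acts by \<open>\<phi> x i \<mapsto> b\<^sup>i \<phi> x i\<close>, so the coaction sends \<open>X x i\<close> to
  \<open>X x i b\<^sup>i\<close>; hence \<open>X x i\<close> has degree \<open>i\<close>.
\<close>

definition weighted_homogeneous :: "nat \<Rightarrow> ('k::comm_ring_1, 'h) pring \<Rightarrow> bool" where
  "weighted_homogeneous n f \<longleftrightarrow>
    (\<forall>m\<in>Poly_Mapping.keys f. (\<Sum>(x, i)\<in>Poly_Mapping.keys m. Poly_Mapping.lookup m (x, i) * i) = n)"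

definition nilradical :: "('a, 'b) ring_scheme \<Rightarrow> 'a set" where
  "nilradical R = {x \<in> carrier R. \<exists>n::nat. x [^]\<^bsub>R\<^esub> n = \<zero>\<^bsub>R\<^esub>}"

definition red_ring ::
  "('k::field, 'h::comm_ring_1) group_scheme \<Rightarrow> nat \<Rightarrow> ('k, 'h) pring set set ring" where
  "red_ring G r = coord_ring G r Quot nilradical (coord_ring G r)"

definition red_class ::
  "('k::field, 'h::comm_ring_1) group_scheme \<Rightarrow> nat \<Rightarrow> ('k, 'h) pring set \<Rightarrow> ('k, 'h) pring set set"
  where "red_class G r x = nilradical (coord_ring G r) +>\<^bsub>coord_ring G r\<^esub> x"

definition red_grading ::
  "('k::field, 'h::comm_ring_1) group_scheme \<Rightarrow> nat \<Rightarrow> nat \<Rightarrow> ('k, 'h) pring set set set" where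
  "red_grading G r n = (\<lambda>f. red_class G r (coord_class G r f)) ` {f. weighted_homogeneous n f}"


section \<open>Proj of a graded ring and its twisting sheaves\<close>

text \<open>A graded ring is a ring \<open>R\<close> together with its family \<open>D\<close> of homogeneous components.\<close>

definition Proj :: "('a, 'b) ring_scheme \<Rightarrow> (nat \<Rightarrow> 'a set) \<Rightarrow> 'a set set" where
  "Proj R D = {P. primeideal P R \<and> P = genideal R (P \<inter> (\<Union>n. D n)) \<and> \<not> (\<Union>n\<in>{0<..}. D n) \<subseteq> P}"

definition proj_open :: "('a, 'b) ring_scheme \<Rightarrow> (nat \<Rightarrow> 'a set) \<Rightarrow> 'a set set \<Rightarrow> bool" where
  "proj_open R D U \<longleftrightarrow> (\<exists>E \<subseteq> (\<Union>n. D n). U = {P \<in> Proj R D. \<not> E \<subseteq> P})"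

definition fraction :: "('a, 'b) ring_scheme \<Rightarrow> 'a set \<Rightarrow> 'a \<Rightarrow> 'a \<Rightarrow> ('a \<times> 'a) set" where
  "fraction R T x f = {(y, g). y \<in> carrier R \<and> g \<in> T \<and>
     (\<exists>h\<in>T. h \<otimes>\<^bsub>R\<^esub> (g \<otimes>\<^bsub>R\<^esub> x) = h \<otimes>\<^bsub>R\<^esub> (f \<otimes>\<^bsub>R\<^esub> y))}"

definition localization :: "('a, 'b) ring_scheme \<Rightarrow> 'a set \<Rightarrow> ('a \<times> 'a) set ring" where
  "localization R T =
    \<lparr>carrier = {fraction R T x f | x f. x \<in> carrier R \<and> f \<in> T},
     monoid.mult = (\<lambda>A B. \<Union>(x, f)\<in>A. \<Union>(y, g)\<in>B. fraction R T (x \<otimes>\<^bsub>R\<^esub> y) (f \<otimes>\<^bsub>R\<^esub> g)),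
     monoid.one = fraction R T \<one>\<^bsub>R\<^esub> \<one>\<^bsub>R\<^esub>,
     ring.zero = fraction R T \<zero>\<^bsub>R\<^esub> \<one>\<^bsub>R\<^esub>,
     ring.add = (\<lambda>A B. \<Union>(x, f)\<in>A. \<Union>(y, g)\<in>B.
       fraction R T ((g \<otimes>\<^bsub>R\<^esub> x) \<oplus>\<^bsub>R\<^esub> (f \<otimes>\<^bsub>R\<^esub> y)) (f \<otimes>\<^bsub>R\<^esub> g))\<rparr>"

definition homog_away :: "(nat \<Rightarrow> 'a set) \<Rightarrow> 'a set \<Rightarrow> 'a set" where
  "homog_away D P = (\<Union>n. D n) - P"

abbreviation homog_loc ::
  "('a, 'b) ring_scheme \<Rightarrow> (nat \<Rightarrow> 'a set) \<Rightarrow> 'a set \<Rightarrow> ('a \<times> 'a) set ring" where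
  "homog_loc R D P \<equiv> localization R (homog_away D P)"

text \<open>\<open>homog_frac D n x f\<close>: the fraction \<open>x / f\<close> is homogeneous of degree \<open>n\<close>.\<close>

definition homog_frac :: "(nat \<Rightarrow> 'a set) \<Rightarrow> int \<Rightarrow> 'a \<Rightarrow> 'a \<Rightarrow> bool" where
  "homog_frac D n x f \<longleftrightarrow> (\<exists>e m. f \<in> D e \<and> x \<in> D m \<and> int m = int e + n)"

text \<open>The stalk of \<open>\<O>(n)\<close> at \<open>P\<close>.\<close>

definition loc_deg ::
  "('a, 'b) ring_scheme \<Rightarrow> (nat \<Rightarrow> 'a set) \<Rightarrow> 'a set \<Rightarrow> int \<Rightarrow> ('a \<times> 'a) set set" where
  "loc_deg R D P n = {fraction R (homog_away D P) x f | x f. homog_frac D n x f \<and> f \<notin> P}"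

definition stalk_ring ::
  "('a, 'b) ring_scheme \<Rightarrow> (nat \<Rightarrow> 'a set) \<Rightarrow> 'a set \<Rightarrow> ('a \<times> 'a) set ring" where
  "stalk_ring R D P = (homog_loc R D P)\<lparr>carrier := loc_deg R D P 0\<rparr>"

definition stalk_max_ideal ::
  "('a, 'b) ring_scheme \<Rightarrow> (nat \<Rightarrow> 'a set) \<Rightarrow> 'a set \<Rightarrow> ('a \<times> 'a) set set" where
  "stalk_max_ideal R D P =
    {fraction R (homog_away D P) x f | x f. homog_frac D 0 x f \<and> f \<notin> P \<and> x \<in> P}"

definition residue_field ::
  "('a, 'b) ring_scheme \<Rightarrow> (nat \<Rightarrow> 'a set) \<Rightarrow> 'a set \<Rightarrow> ('a \<times> 'a) set set ring" where
  "residue_field R D P = stalk_ring R D P Quot stalk_max_ideal R D P"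

text \<open>Sections of \<open>\<O>(n)\<close> over \<open>W\<close>: functions to the stalks that are locally fractions of degree \<open>n\<close>.\<close>

definition twist ::
  "('a, 'b) ring_scheme \<Rightarrow> (nat \<Rightarrow> 'a set) \<Rightarrow> int \<Rightarrow> 'a set set \<Rightarrow> ('a set \<Rightarrow> ('a \<times> 'a) set) set" where
  "twist R D n W = {s \<in> (\<Pi>\<^sub>E P\<in>W. loc_deg R D P n).
     \<forall>P\<in>W. \<exists>V. proj_open R D V \<and> P \<in> V \<and> V \<subseteq> W \<and>
       (\<exists>x f. homog_frac D n x f \<and> (\<forall>Q\<in>V. f \<notin> Q \<and> s Q = fraction R (homog_away D Q) x f))}"


section \<open>Sheaves of modules on Proj\<close>

text \<open>
  All sheaves are realised by sections that are functions to the stalks, with pointwise module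
  operations and with restriction of functions as restriction map.
\<close>

record ('x, 'r, 'm) mod_sheaf =
  sections :: "'x set \<Rightarrow> ('x \<Rightarrow> 'm) set"
  stalk :: "'x \<Rightarrow> ('r, 'm) module"

definition sheaf_add ::
  "('x, 'r, 'm) mod_sheaf \<Rightarrow> 'x set \<Rightarrow> ('x \<Rightarrow> 'm) \<Rightarrow> ('x \<Rightarrow> 'm) \<Rightarrow> 'x \<Rightarrow> 'm" where
  "sheaf_add F W s t = (\<lambda>P\<in>W. s P \<oplus>\<^bsub>stalk F P\<^esub> t P)"

definition sheaf_smult ::
  "('x, 'r, 'm) mod_sheaf \<Rightarrow> 'x set \<Rightarrow> ('x \<Rightarrow> 'r) \<Rightarrow> ('x \<Rightarrow> 'm) \<Rightarrow> 'x \<Rightarrow> 'm" where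
  "sheaf_smult F W c s = (\<lambda>P\<in>W. c P \<odot>\<^bsub>stalk F P\<^esub> s P)"

definition sheaf_iso_on ::
  "('a, 'b) ring_scheme \<Rightarrow> (nat \<Rightarrow> 'a set) \<Rightarrow> 'a set set \<Rightarrow>
   ('a set, ('a \<times> 'a) set, 'm) mod_sheaf \<Rightarrow> ('a set, ('a \<times> 'a) set, 'n) mod_sheaf \<Rightarrow> bool" where
  "sheaf_iso_on R D V F F' \<longleftrightarrow> (\<exists>\<phi>. \<forall>W. proj_open R D W \<and> W \<subseteq> V \<longrightarrow>
     bij_betw (\<phi> W) (sections F W) (sections F' W) \<and>
     (\<forall>s\<in>sections F W. \<forall>t\<in>sections F W.
        \<phi> W (sheaf_add F W s t) = sheaf_add F' W (\<phi> W s) (\<phi> W t)) \<and>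
     (\<forall>c\<in>twist R D 0 W. \<forall>s\<in>sections F W.
        \<phi> W (sheaf_smult F W c s) = sheaf_smult F' W c (\<phi> W s)) \<and>
     (\<forall>W'. proj_open R D W' \<and> W' \<subseteq> W \<longrightarrow>
        (\<forall>s\<in>sections F W. \<phi> W' (restrict s W') = restrict (\<phi> W s) W')))"

definition free_module :: "('r, 'b) ring_scheme \<Rightarrow> 'i set \<Rightarrow> ('r, 'i \<Rightarrow> 'r) module" where
  "free_module K B =
    \<lparr>carrier = B \<rightarrow>\<^sub>E carrier K, monoid.mult = undefined, monoid.one = undefined,
     ring.zero = (\<lambda>b\<in>B. \<zero>\<^bsub>K\<^esub>), ring.add = (\<lambda>x y. \<lambda>b\<in>B. x b \<oplus>\<^bsub>K\<^esub> y b),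
     module.smult = (\<lambda>c x. \<lambda>b\<in>B. c \<otimes>\<^bsub>K\<^esub> x b)\<rparr>"

text \<open>Sections of \<open>\<O>(n)\<^sup>B\<close>.\<close>

definition twist_power ::
  "('a, 'b) ring_scheme \<Rightarrow> (nat \<Rightarrow> 'a set) \<Rightarrow> int \<Rightarrow> 'i set \<Rightarrow> 'a set set \<Rightarrow>
   ('a set \<Rightarrow> 'i \<Rightarrow> ('a \<times> 'a) set) set" where
  "twist_power R D n B W = {s \<in> (\<Pi>\<^sub>E P\<in>W. B \<rightarrow>\<^sub>E loc_deg R D P n).
     \<forall>b\<in>B. (\<lambda>P\<in>W. s P b) \<in> twist R D n W}"

definition free_sheaf ::
  "('a, 'b) ring_scheme \<Rightarrow> (nat \<Rightarrow> 'a set) \<Rightarrow> 'i set \<Rightarrow>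
   ('a set, ('a \<times> 'a) set, 'i \<Rightarrow> ('a \<times> 'a) set) mod_sheaf" where
  "free_sheaf R D B =
    \<lparr>sections = twist_power R D 0 B, stalk = (\<lambda>P. free_module (stalk_ring R D P) B)\<rparr>"

definition locally_free_of_rank ::
  "('a, 'b) ring_scheme \<Rightarrow> (nat \<Rightarrow> 'a set) \<Rightarrow> 'a set set \<Rightarrow>
   ('a set, ('a \<times> 'a) set, 'm) mod_sheaf \<Rightarrow> nat \<Rightarrow> bool" where
  "locally_free_of_rank R D U F n \<longleftrightarrow>
    (\<forall>P\<in>U. \<exists>V. proj_open R D V \<and> P \<in> V \<and> V \<subseteq> U \<and> sheaf_iso_on R D V F (free_sheaf R D {..<n}))"

text \<open>
  For subsheaves \<open>B \<subseteq> A\<close> of a sheaf with stalks \<open>N P\<close>, the quotient sheaf \<open>A / B\<close> is the sheafification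
  of \<open>W \<mapsto> A W / B W\<close>: its stalks are \<open>A\<^sub>P / B\<^sub>P\<close>, and its sections are the functions to these
  stalks that locally come from sections of \<open>A\<close>.
\<close>

definition stalk_of ::
  "('a, 'b) ring_scheme \<Rightarrow> (nat \<Rightarrow> 'a set) \<Rightarrow> ('a set set \<Rightarrow> ('a set \<Rightarrow> 'm) set) \<Rightarrow> 'a set \<Rightarrow> 'm set"
  where "stalk_of R D A P = {s P | s W. proj_open R D W \<and> P \<in> W \<and> s \<in> A W}"

definition quotient_module :: "('r, 'm) module \<Rightarrow> 'm set \<Rightarrow> 'm set \<Rightarrow> ('r, 'm set) module" where
  "quotient_module N A B =
    \<lparr>carrier = {B +>\<^bsub>N\<^esub> x | x. x \<in> A}, monoid.mult = undefined, monoid.one = undefined,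
     ring.zero = B, ring.add = set_add N, module.smult = (\<lambda>c Y. \<Union>y\<in>Y. B +>\<^bsub>N\<^esub> (c \<odot>\<^bsub>N\<^esub> y))\<rparr>"

definition quotient_sheaf ::
  "('a, 'b) ring_scheme \<Rightarrow> (nat \<Rightarrow> 'a set) \<Rightarrow> ('a set \<Rightarrow> (('a \<times> 'a) set, 'm) module) \<Rightarrow>
   ('a set set \<Rightarrow> ('a set \<Rightarrow> 'm) set) \<Rightarrow> ('a set set \<Rightarrow> ('a set \<Rightarrow> 'm) set) \<Rightarrow>
   ('a set, ('a \<times> 'a) set, 'm set) mod_sheaf" where
  "quotient_sheaf R D N A B =
    \<lparr>sections = (\<lambda>W. {\<sigma> \<in> extensional W. \<forall>P\<in>W. \<exists>V. proj_open R D V \<and> P \<in> V \<and> V \<subseteq> W \<and>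
        (\<exists>s\<in>A V. \<forall>Q\<in>V. \<sigma> Q = stalk_of R D B Q +>\<^bsub>N Q\<^esub> s Q)}),
     stalk = (\<lambda>P. quotient_module (N P) (stalk_of R D A P) (stalk_of R D B P))\<rparr>"


section \<open>Operators given by homogeneous matrices\<close>

text \<open>
  A matrix \<open>A\<close> over \<open>R\<close> indexed by a finite set \<open>B\<close>, with homogeneous entries of degree \<open>d\<close>, defines
  the operator \<open>\<O>(n)\<^sup>B \<rightarrow> \<O>(n + d)\<^sup>B\<close> for all \<open>n\<close>.
\<close>

definition matrix_op ::
  "('a, 'b) ring_scheme \<Rightarrow> (nat \<Rightarrow> 'a set) \<Rightarrow> 'i set \<Rightarrow> ('i \<Rightarrow> 'i \<Rightarrow> 'a) \<Rightarrow> 'a set \<Rightarrow>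
   ('i \<Rightarrow> ('a \<times> 'a) set) \<Rightarrow> 'i \<Rightarrow> ('a \<times> 'a) set" where
  "matrix_op R D B A P x = (\<lambda>b'\<in>B. \<Oplus>\<^bsub>homog_loc R D P\<^esub> b\<in>B.
     fraction R (homog_away D P) (A b' b) \<one>\<^bsub>R\<^esub> \<otimes>\<^bsub>homog_loc R D P\<^esub> x b)"

definition ker_sheaf ::
  "('a, 'b) ring_scheme \<Rightarrow> (nat \<Rightarrow> 'a set) \<Rightarrow> 'i set \<Rightarrow> ('i \<Rightarrow> 'i \<Rightarrow> 'a) \<Rightarrow> 'a set set \<Rightarrow>
   ('a set \<Rightarrow> 'i \<Rightarrow> ('a \<times> 'a) set) set" where
  "ker_sheaf R D B A W = {s \<in> twist_power R D 0 B W.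
     \<forall>P\<in>W. matrix_op R D B A P (s P) = (\<lambda>b\<in>B. \<zero>\<^bsub>homog_loc R D P\<^esub>)}"

definition im_sheaf ::
  "('a, 'b) ring_scheme \<Rightarrow> (nat \<Rightarrow> 'a set) \<Rightarrow> 'i set \<Rightarrow> nat \<Rightarrow> ('i \<Rightarrow> 'i \<Rightarrow> 'a) \<Rightarrow> nat \<Rightarrow>
   'a set set \<Rightarrow> ('a set \<Rightarrow> 'i \<Rightarrow> ('a \<times> 'a) set) set" where
  "im_sheaf R D B d A j W = {s \<in> twist_power R D 0 B W.
     \<forall>P\<in>W. \<exists>V. proj_open R D V \<and> P \<in> V \<and> V \<subseteq> W \<and>
       (\<exists>t\<in>twist_power R D (- int (j * d)) B V. \<forall>Q\<in>V. s Q = (matrix_op R D B A Q ^^ j) (t Q))}"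

text \<open>
  The fibre at \<open>P\<close> of \<open>\<O>\<^sup>B \<rightarrow> \<O>(d)\<^sup>B\<close> becomes an operator on \<open>k(P)\<^sup>B\<close> after trivialising \<open>\<O>(d)\<close> at \<open>P\<close>;
  this uses a homogeneous element \<open>f \<notin> P\<close> of degree \<open>d\<close>.  Another choice of \<open>f\<close> multiplies the
  operator by a nonzero scalar, which does not affect its Jordan type when it is nilpotent.
\<close>

definition local_op ::
  "('a, 'b) ring_scheme \<Rightarrow> (nat \<Rightarrow> 'a set) \<Rightarrow> 'i set \<Rightarrow> nat \<Rightarrow> ('i \<Rightarrow> 'i \<Rightarrow> 'a) \<Rightarrow> 'a set \<Rightarrow>
   ('i \<Rightarrow> ('a \<times> 'a) set set) \<Rightarrow> 'i \<Rightarrow> ('a \<times> 'a) set set" where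
  "local_op R D B d A P x =
    (let f = (SOME f. f \<in> D d \<and> f \<notin> P); K = residue_field R D P in
      (\<lambda>b'\<in>B. \<Oplus>\<^bsub>K\<^esub> b\<in>B.
        (stalk_max_ideal R D P +>\<^bsub>stalk_ring R D P\<^esub> fraction R (homog_away D P) (A b' b) f) \<otimes>\<^bsub>K\<^esub> x b))"


section \<open>Jordan types\<close>

definition is_basis_family ::
  "('r, 'b) ring_scheme \<Rightarrow> ('r, 'm) module \<Rightarrow> 'i set \<Rightarrow> ('i \<Rightarrow> 'm) \<Rightarrow> bool" where
  "is_basis_family K V I v \<longleftrightarrow> v ` I \<subseteq> carrier V \<and>
    (\<forall>w\<in>carrier V. \<exists>!c. c \<in> (I \<rightarrow>\<^sub>E carrier K) \<and> w = (\<Oplus>\<^bsub>V\<^esub> i\<in>I. c i \<odot>\<^bsub>V\<^esub> v i))"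

text \<open>
  \<open>\<theta>\<close> has Jordan type \<open>[p]\<^bsup>a p\<^esup>\<dots>[1]\<^bsup>a 1\<^esup>\<close> if the space has a basis consisting of Jordan
  chains \<open>x, \<theta> x, \<dots>, \<theta>\<^bsup>i-1\<^esup> x\<close> with \<open>\<theta>\<^sup>i x = 0\<close>, of which \<open>a i\<close> have length \<open>i\<close>.
\<close>

definition has_jordan_type ::
  "('r, 'b) ring_scheme \<Rightarrow> ('r, 'm) module \<Rightarrow> ('m \<Rightarrow> 'm) \<Rightarrow> nat \<Rightarrow> (nat \<Rightarrow> nat) \<Rightarrow> bool" where
  "has_jordan_type K V \<theta> p a \<longleftrightarrow> (\<exists>x :: nat \<Rightarrow> nat \<Rightarrow> 'm.
    (\<forall>i\<in>{1..p}. \<forall>c<a i. x i c \<in> carrier V \<and> (\<theta> ^^ i) (x i c) = \<zero>\<^bsub>V\<^esub>) \<and>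
    is_basis_family K V {(i, c, j). i \<in> {1..p} \<and> c < a i \<and> j < i} (\<lambda>(i, c, j). (\<theta> ^^ j) (x i c)))"


section \<open>The global operator\<close>

abbreviation PG_open ::
  "('k::field, 'h::comm_ring_1) group_scheme \<Rightarrow> nat \<Rightarrow> ('k, 'h) pring set set set set \<Rightarrow> bool" where
  "PG_open G r U \<equiv> proj_open (red_ring G r) (red_grading G r) U"

text \<open>
  An element of \<open>k\<G>\<^sub>a\<^sub>(\<^sub>r\<^sub>)\<close> is given by its values on the monomials \<open>t\<^sup>i\<close>, \<open>i < p\<^sup>r\<close>; \<open>u_elem p s\<close> is the
  element dual to \<open>t\<close> to the power \<open>p\<^bsup>s-1\<^esup>\<close>.  The group algebra of \<open>G\<close> over \<open>k[V(G)]\<close> is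
  \<open>k[V(G)] \<otimes> kG = Hom\<^sub>k(k[G], k[V(G)])\<close>, and \<open>universal_push G r w\<close> is the image of \<open>1 \<otimes> w\<close> under
  the universal one-parameter subgroup \<open>x \<mapsto> \<Sum>i. X x i t\<^sup>i\<close>.
\<close>

definition u_elem :: "nat \<Rightarrow> nat \<Rightarrow> nat \<Rightarrow> 'k::field" where
  "u_elem p s i = (if i = p ^ (s - 1) then 1 else 0)"

definition universal_push ::
  "('k::field, 'h::comm_ring_1) group_scheme \<Rightarrow> nat \<Rightarrow> (nat \<Rightarrow> 'k) \<Rightarrow> 'h \<Rightarrow> ('k, 'h) pring set" where
  "universal_push G r w x = coord_class G r (\<Sum>i<CHAR('k) ^ r. const_pol (w i) * X_pol x i)"

definition Theta_G ::
  "('k::field, 'h::comm_ring_1) group_scheme \<Rightarrow> nat \<Rightarrow> 'h \<Rightarrow> ('k, 'h) pring set" where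
  "Theta_G G r = universal_push G r (u_elem CHAR('k) r)"

definition basis_G :: "('k::field, 'h::comm_ring_1) group_scheme \<Rightarrow> 'h set" where
  "basis_G G = vector_space.extend_basis (scl G) {}"

definition basis_M :: "('k::field, 'h, 'm::ab_group_add) G_mod \<Rightarrow> 'm set" where
  "basis_M M = vector_space.extend_basis (mscl M) {}"

text \<open>
  Let \<open>B = basis_M M\<close>; then \<open>\<O> \<otimes> M = \<O>\<^sup>B\<close>.  For a basis \<open>E\<close> of \<open>k[G]\<close> with dual basis \<open>e\<^sup>*\<close> one has
  \<open>\<Theta>\<^sub>G = \<Sum>e\<in>E. \<Theta>\<^sub>G(e) \<otimes> e\<^sup>*\<close>, which gives the matrix of \<open>\<Theta>\<^sub>G\<close> acting on \<open>k[V(G)] \<otimes> M\<close>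
  (row \<open>b'\<close>, column \<open>b\<close>).
\<close>

definition Theta_matrix ::
  "('k::field, 'h::comm_ring_1) group_scheme \<Rightarrow> nat \<Rightarrow> ('k, 'h, 'm::ab_group_add) G_mod \<Rightarrow>
   'm \<Rightarrow> 'm \<Rightarrow> ('k, 'h) pring set" where
  "Theta_matrix G r M b' b = (\<Oplus>\<^bsub>coord_ring G r\<^esub> e\<in>basis_G G.
     Theta_G G r e \<otimes>\<^bsub>coord_ring G r\<^esub> coord_class G r (const_pol
       (Modules.module.representation (mscl M) (basis_M M)
         (act M (\<lambda>x. Modules.module.representation (scl G) (basis_G G) x e) b) b')))"

definition Theta_red ::
  "('k::field, 'h::comm_ring_1) group_scheme \<Rightarrow> nat \<Rightarrow> ('k, 'h, 'm::ab_group_add) G_mod \<Rightarrow>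
   'm \<Rightarrow> 'm \<Rightarrow> ('k, 'h) pring set set" where
  "Theta_red G r M b' b = red_class G r (Theta_matrix G r M b' b)"

definition F_sheaf ::
  "('k::field, 'h::comm_ring_1) group_scheme \<Rightarrow> nat \<Rightarrow> ('k, 'h, 'm::ab_group_add) G_mod \<Rightarrow> nat \<Rightarrow>
   (('k, 'h) pring set set set, (('k, 'h) pring set set \<times> ('k, 'h) pring set set) set,
    ('m \<Rightarrow> (('k, 'h) pring set set \<times> ('k, 'h) pring set set) set) set) mod_sheaf" where
  "F_sheaf G r M i =
    (let R = red_ring G r; D = red_grading G r; B = basis_M M; A = Theta_red G r M;
         d = CHAR('k) ^ (r - 1);
         K = ker_sheaf R D B A; I = im_sheaf R D B d A
     in quotient_sheaf R D (stalk (free_sheaf R D B))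
          (\<lambda>W. K W \<inter> I (i - 1) W) (\<lambda>W. K W \<inter> I i W))"

definition constant_jordan_type_on ::
  "('k::field, 'h::comm_ring_1) group_scheme \<Rightarrow> nat \<Rightarrow> ('k, 'h, 'm::ab_group_add) G_mod \<Rightarrow>
   ('k, 'h) pring set set set set \<Rightarrow> (nat \<Rightarrow> nat) \<Rightarrow> bool" where
  "constant_jordan_type_on G r M U a \<longleftrightarrow>
    (let R = red_ring G r; D = red_grading G r; B = basis_M M; d = CHAR('k) ^ (r - 1) in
      \<forall>v\<in>U. has_jordan_type (residue_field R D v) (free_module (residue_field R D v) B)
        (local_op R D B d (Theta_red G r M) v) CHAR('k) a)"

definition F_locally_free_on ::
  "('k::field, 'h::comm_ring_1) group_scheme \<Rightarrow> nat \<Rightarrow> ('k, 'h, 'm::ab_group_add) G_mod \<Rightarrow> nat \<Rightarrow>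
   ('k, 'h) pring set set set set \<Rightarrow> nat \<Rightarrow> bool" where
  "F_locally_free_on G r M i U n \<longleftrightarrow>
    locally_free_of_rank (red_ring G r) (red_grading G r) U (F_sheaf G r M i) n"

end

theory Submission
  imports Defs
begin

text \<open>
  Being locally free is a statement about the germs at a point \<open>P\<close>.  Let \<open>S\<close> be the local ring of
  \<open>\<P>(G)\<close> at \<open>P\<close> and \<open>N = S\<^sup>B\<close> the stalk of the free sheaf \<open>\<O> \<otimes> M\<close>.  A homogeneous element \<open>f\<close> of degree
  \<open>d = p\<^bsup>r-1\<^esup>\<close> that does not vanish at \<open>P\<close> turns \<open>\<Theta>\<close> into an operator \<open>\<theta> = \<Theta>/f\<close> of \<open>N\<close> with
  \<open>\<theta>\<^sup>p = 0\<close>.  The stalk of \<open>\<F>\<^sub>i\<close> is \<open>(ker \<theta> \<inter> im \<theta>\<^bsup>i-1\<^esup>) / (ker \<theta> \<inter> im \<theta>\<^sup>i)\<close>, and the local operator is \<open>\<theta>\<close>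
  modulo the maximal ideal \<open>m\<close> of \<open>S\<close>, up to a unit.

  Suppose that every \<open>\<F>\<^sub>i\<close> is free of rank \<open>a\<^sub>i\<close> near \<open>P\<close>.  Elements of a basis of \<open>\<F>\<^sub>i\<close> at \<open>P\<close> are
  represented by vectors \<open>\<theta>\<^bsup>i-1\<^esup> x\<close> in the kernel of \<open>\<theta>\<close>, so each \<open>x\<close> generates a chain of length \<open>i\<close>.
  Because \<open>\<theta>\<close> is nilpotent, all these chains together form a basis of \<open>N\<close>; this is linear algebra
  over an arbitrary ring (\<open>chains_basis\<close>).  Modulo \<open>m\<close> they become a Jordan basis of the local operator
  (\<open>jordan_type_of_locally_free\<close>).

  Conversely, suppose that the local Jordan type is \<open>a\<close> at all points near \<open>P\<close>.  Lift the first vectors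
  of the chains of a Jordan basis at \<open>P\<close> to vectors \<open>x\<close> of \<open>N\<close>.  Their truncated chains form a basis of
  \<open>N\<close> by Nakayama's lemma, but \<open>\<theta>\<^sup>i x\<close> need only vanish modulo \<open>m\<close>.  The dimension of the image
  of \<open>\<theta>\<^sup>k\<close> is the same at all points near \<open>P\<close>, so that image is spanned by the members of the truncated
  chains from the \<open>k\<close>-th on: the other coordinates of \<open>\<theta>\<^sup>k w\<close> vanish at every point near \<open>P\<close>
  (\<open>coords_in_mx\<close>).  A function on a reduced scheme that vanishes at every point is zero
  (\<open>sec_reduced\<close>), hence the same holds over \<open>S\<close> (\<open>rank_condition\<close>).  In particular
  \<open>\<theta>\<^sup>i x = \<theta>\<^sup>i z\<close> with \<open>z \<in> m N\<close>, and replacing \<open>x\<close> by \<open>x - z\<close> yields a basis of \<open>N\<close> by honest Jordan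
  chains (\<open>lift_chains\<close>).  It extends to a neighbourhood, and there the coordinates at the ends of the
  chains of length \<open>i\<close> identify \<open>\<F>\<^sub>i\<close> with the free sheaf of rank \<open>a\<^sub>i\<close> (\<open>quotient_iso\<close>).

  This argument concerns a matrix of homogeneous elements of degree \<open>d\<close> over any graded ring that
  satisfies three conditions, which have to be verified for \<open>k[V(G)]\<close> modulo its nilradical.  Every point
  of Proj has a nonvanishing element of degree \<open>d\<close> (\<open>red_degree\<close>): if all coordinates \<open>X x p\<^sup>s\<close>
  with \<open>s < r\<close> vanish at a point, then so do all \<open>X x i\<close> with \<open>i > 0\<close>, because \<open>i choose p\<^sup>v\<close> is prime to \<open>p\<close>
  when \<open>p\<^sup>v\<close> is the exact power of \<open>p\<close> dividing \<open>i\<close>.  A homogeneous element that vanishes at all points of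
  a basic open set is annihilated by the element defining it (\<open>red_vanishing\<close>), since enough
  homogeneous primes exist.  Finally \<open>\<Theta>\<^sup>p = 0\<close> (\<open>push_matrix_nilpotent\<close>): the operators \<open>T\<^sub>n\<close> given by
  the coefficient of \<open>t\<^sup>n\<close> in the universal one-parameter subgroup satisfy
  \<open>T\<^sub>m T\<^sub>n = (m + n choose m) T\<^bsub>m+n\<^esub>\<close>, so \<open>\<Theta>\<^sup>n = T\<^sub>d\<^sup>n\<close> is a multiple of \<open>T\<^bsub>nd\<^esub>\<close> for \<open>n \<le> p\<close>, and
  \<open>T\<^bsub>pd\<^esub> = 0\<close>.
\<close>

section \<open>Bases of modules\<close>

locale plain_module = module R M for R (structure) and M :: "('r, 'm) module" (structure)
begin

declare Pi_iff [simp]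

definition lincomb :: "'i set \<Rightarrow> ('i \<Rightarrow> 'r) \<Rightarrow> ('i \<Rightarrow> 'm) \<Rightarrow> 'm" where
  "lincomb I c v = (\<Oplus>\<^bsub>M\<^esub> i\<in>I. c i \<odot>\<^bsub>M\<^esub> v i)"

definition independent_family :: "'i set \<Rightarrow> ('i \<Rightarrow> 'm) \<Rightarrow> bool" where
  "independent_family I v \<longleftrightarrow>
    (\<forall>c\<in>I \<rightarrow> carrier R. lincomb I c v = \<zero>\<^bsub>M\<^esub> \<longrightarrow> (\<forall>i\<in>I. c i = \<zero>))"

lemma lincomb_closed [simp, intro]:
  "c \<in> I \<rightarrow> carrier R \<Longrightarrow> v \<in> I \<rightarrow> carrier M \<Longrightarrow> lincomb I c v \<in> carrier M"
  unfolding lincomb_def by (intro M.finsum_closed) auto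

lemma lincomb_cong:
  assumes "I = I'" "\<And>i. i \<in> I' \<Longrightarrow> c i = c' i" "\<And>i. i \<in> I' \<Longrightarrow> v i = v' i"
    "c' \<in> I' \<rightarrow> carrier R" "v' \<in> I' \<rightarrow> carrier M"
  shows "lincomb I c v = lincomb I' c' v'"
  unfolding lincomb_def using assms by (intro M.finsum_cong') (auto simp: Pi_iff)

lemma lincomb_add:
  assumes "c \<in> I \<rightarrow> carrier R" "d \<in> I \<rightarrow> carrier R" "v \<in> I \<rightarrow> carrier M"
  shows "lincomb I (\<lambda>i. c i \<oplus> d i) v = lincomb I c v \<oplus>\<^bsub>M\<^esub> lincomb I d v"
proof -
  have "lincomb I (\<lambda>i. c i \<oplus> d i) v = (\<Oplus>\<^bsub>M\<^esub> i\<in>I. c i \<odot>\<^bsub>M\<^esub> v i \<oplus>\<^bsub>M\<^esub> d i \<odot>\<^bsub>M\<^esub> v i)"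
    unfolding lincomb_def using assms by (intro M.finsum_cong') (auto simp: Pi_iff smult_l_distr)
  then show ?thesis unfolding lincomb_def using assms by (subst (asm) M.finsum_addf) (auto simp: Pi_iff)
qed

lemma lincomb_smult:
  assumes "finite I" "c \<in> I \<rightarrow> carrier R" "v \<in> I \<rightarrow> carrier M" "s \<in> carrier R"
  shows "lincomb I (\<lambda>i. s \<otimes> c i) v = s \<odot>\<^bsub>M\<^esub> lincomb I c v"
  unfolding lincomb_def using assms
  by (subst finsum_smult_ldistr) (auto simp: Pi_iff smult_assoc1 intro!: M.finsum_cong')

lemma lincomb_minus:
  assumes "finite I" "c \<in> I \<rightarrow> carrier R" "v \<in> I \<rightarrow> carrier M"
  shows "lincomb I (\<lambda>i. \<ominus> c i) v = \<ominus>\<^bsub>M\<^esub> lincomb I c v"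
proof -
  have "lincomb I (\<lambda>i. \<ominus> c i) v = lincomb I (\<lambda>i. (\<ominus> \<one>) \<otimes> c i) v"
    using assms by (intro lincomb_cong) (auto simp: Pi_iff R.l_minus)
  also have "\<dots> = (\<ominus> \<one>) \<odot>\<^bsub>M\<^esub> lincomb I c v"
    using assms by (intro lincomb_smult) auto
  finally show ?thesis using assms by (simp add: smult_l_minus)
qed

lemma lincomb_diff:
  assumes "finite I" "c \<in> I \<rightarrow> carrier R" "d \<in> I \<rightarrow> carrier R" "v \<in> I \<rightarrow> carrier M"
  shows "lincomb I (\<lambda>i. c i \<ominus> d i) v = lincomb I c v \<ominus>\<^bsub>M\<^esub> lincomb I d v"
  using assms lincomb_add[of c I "\<lambda>i. \<ominus> d i" v] lincomb_minus[of I d v]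
  by (simp add: a_minus_def Pi_iff)

lemma lincomb_zero [simp]: "v \<in> I \<rightarrow> carrier M \<Longrightarrow> lincomb I (\<lambda>i. \<zero>) v = \<zero>\<^bsub>M\<^esub>"
  unfolding lincomb_def by (intro M.add.finprod_one_eqI) auto

lemma lincomb_empty [simp]: "lincomb {} c v = \<zero>\<^bsub>M\<^esub>"
  by (simp add: lincomb_def)

lemma lincomb_insert:
  assumes "finite I" "i \<notin> I" "c \<in> insert i I \<rightarrow> carrier R" "v \<in> insert i I \<rightarrow> carrier M"
  shows "lincomb (insert i I) c v = c i \<odot>\<^bsub>M\<^esub> v i \<oplus>\<^bsub>M\<^esub> lincomb I c v"
  unfolding lincomb_def using assms by (subst M.finsum_insert) auto

lemma lincomb_Un:
  assumes "finite I" "finite J" "I \<inter> J = {}" "c \<in> I \<union> J \<rightarrow> carrier R" "v \<in> I \<union> J \<rightarrow> carrier M"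
  shows "lincomb (I \<union> J) c v = lincomb I c v \<oplus>\<^bsub>M\<^esub> lincomb J c v"
  unfolding lincomb_def using assms by (subst M.finsum_Un_disjoint) (auto simp: Pi_iff)

lemma lincomb_reindex:
  assumes "inj_on h I" "c \<in> h ` I \<rightarrow> carrier R" "v \<in> h ` I \<rightarrow> carrier M"
  shows "lincomb (h ` I) c v = lincomb I (\<lambda>i. c (h i)) (\<lambda>i. v (h i))"
  unfolding lincomb_def using assms by (subst M.finsum_reindex) (auto simp: Pi_iff)

lemma lincomb_neutral:
  assumes "finite I" "J \<subseteq> I" "\<And>i. i \<in> I - J \<Longrightarrow> c i = \<zero> \<or> v i = \<zero>\<^bsub>M\<^esub>"
    "c \<in> I \<rightarrow> carrier R" "v \<in> I \<rightarrow> carrier M"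
  shows "lincomb I c v = lincomb J c v"
  unfolding lincomb_def using assms
  by (intro M.add.finprod_mono_neutral_cong_right) (auto simp: Pi_iff, force)

lemma lincomb_delta:
  assumes "finite I" "k \<in> I" "v \<in> I \<rightarrow> carrier M"
  shows "lincomb I (\<lambda>i. if i = k then \<one> else \<zero>) v = v k"
proof -
  have "lincomb I (\<lambda>i. if i = k then \<one> else \<zero>) v = lincomb {k} (\<lambda>i. if i = k then \<one> else \<zero>) v"
    using assms by (intro lincomb_neutral) auto
  also have "\<dots> = v k" using assms by (subst lincomb_insert) (auto simp: Pi_iff)
  finally show ?thesis .
qed

lemma independent_familyD:
  assumes "independent_family I v" "finite I" "c \<in> I \<rightarrow> carrier R" "d \<in> I \<rightarrow> carrier R" "v \<in> I \<rightarrow> carrier M"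
    "lincomb I c v = lincomb I d v" "i \<in> I"
  shows "c i = d i"
proof -
  have "lincomb I (\<lambda>i. c i \<ominus> d i) v = \<zero>\<^bsub>M\<^esub>"
    using assms by (subst lincomb_diff) (auto simp: M.minus_eq M.r_neg)
  then have "c i \<ominus> d i = \<zero>"
    using assms(1)[unfolded independent_family_def, rule_format, of "\<lambda>i. c i \<ominus> d i" i] assms by (auto simp: Pi_iff)
  then show ?thesis using assms by (simp add: Pi_iff R.r_right_minus_eq)
qed

lemma is_basis_familyI:
  assumes "finite I" "v \<in> I \<rightarrow> carrier M" "independent_family I v"
    "\<And>w. w \<in> carrier M \<Longrightarrow> \<exists>c\<in>I \<rightarrow> carrier R. w = lincomb I c v"
  shows "is_basis_family R M I v"
  unfolding is_basis_family_def
proof (intro conjI ballI)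
  show "v ` I \<subseteq> carrier M" using assms by auto
  fix w assume "w \<in> carrier M"
  then obtain c where c: "c \<in> I \<rightarrow> carrier R" "w = lincomb I c v" using assms by blast
  show "\<exists>!c. c \<in> I \<rightarrow>\<^sub>E carrier R \<and> w = (\<Oplus>\<^bsub>M\<^esub>i\<in>I. c i \<odot>\<^bsub>M\<^esub> v i)"
    unfolding lincomb_def[symmetric]
  proof (rule ex1I[of _ "restrict c I"])
    show "restrict c I \<in> I \<rightarrow>\<^sub>E carrier R \<and> w = lincomb I (restrict c I) v"
      using c assms by (auto intro!: lincomb_cong)
    fix d assume d: "d \<in> I \<rightarrow>\<^sub>E carrier R \<and> w = lincomb I d v"
    show "d = restrict c I"
    proof
      fix i
      show "d i = restrict c I i"
        using independent_familyD[OF assms(3), of d c i] d c assms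
        by (cases "i \<in> I") (auto simp: PiE_def extensional_def)
    qed
  qed
qed

lemma is_basis_familyD:
  assumes "is_basis_family R M I v" "finite I"
  shows "v \<in> I \<rightarrow> carrier M" "independent_family I v"
    "\<And>w. w \<in> carrier M \<Longrightarrow> \<exists>c\<in>I \<rightarrow> carrier R. w = lincomb I c v"
proof -
  show v: "v \<in> I \<rightarrow> carrier M" using assms by (auto simp: is_basis_family_def)
  have ex: "\<exists>!c. c \<in> (I \<rightarrow>\<^sub>E carrier R) \<and> w = lincomb I c v" if "w \<in> carrier M" for w
    using assms that unfolding is_basis_family_def lincomb_def by blast
  show "\<exists>c\<in>I \<rightarrow> carrier R. w = lincomb I c v" if "w \<in> carrier M" for w
    using ex[OF that] by (auto simp: PiE_def)
  show "independent_family I v" unfolding independent_family_def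
  proof (intro ballI impI)
    fix c i assume c: "c \<in> I \<rightarrow> carrier R" "lincomb I c v = \<zero>\<^bsub>M\<^esub>" "i \<in> I"
    have "lincomb I (restrict c I) v = lincomb I c v" using c v by (intro lincomb_cong) auto
    moreover have "lincomb I (\<lambda>i\<in>I. \<zero>) v = lincomb I (\<lambda>i. \<zero>) v" using v by (intro lincomb_cong) auto
    ultimately have "restrict c I = (\<lambda>i\<in>I. \<zero>)"
      using ex[OF M.zero_closed] c v
      by (elim ex1E) (smt (verit, best) Pi_iff R.zero_closed lincomb_zero restrict_PiE_iff)
    then show "c i = \<zero>" using c(3) by (metis restrict_apply')
  qed
qed

lemma is_basis_family_reindex:
  assumes "finite J" "bij_betw h J I" "is_basis_family R M I v" "\<And>j. j \<in> J \<Longrightarrow> w j = v (h j)"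
  shows "is_basis_family R M J w"
proof -
  have I: "I = h ` J" "inj_on h J" "finite I" using assms by (auto simp: bij_betw_def)
  note v = is_basis_familyD[OF assms(3) I(3)]
  have eq: "lincomb J (\<lambda>j. c (h j)) w = lincomb I c v" if "c \<in> I \<rightarrow> carrier R" for c
    unfolding I using that v assms I
    by (subst lincomb_reindex) (auto intro!: lincomb_cong simp: Pi_iff)
  show ?thesis
  proof (rule is_basis_familyI[OF assms(1)])
    show "w \<in> J \<rightarrow> carrier M" using v I assms by auto
    show "\<exists>c\<in>J \<rightarrow> carrier R. x = lincomb J c w" if x: "x \<in> carrier M" for x
    proof -
      obtain c where c: "c \<in> I \<rightarrow> carrier R" "x = lincomb I c v" using v(3)[OF x] by blast
      then have "x = lincomb J (\<lambda>j. c (h j)) w" using eq[of c] by simp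
      then show ?thesis using c(1) I(1) by (intro bexI[of _ "\<lambda>j. c (h j)"]) auto
    qed
    show "independent_family J w" unfolding independent_family_def
    proof (intro ballI impI)
      fix c j assume c: "c \<in> J \<rightarrow> carrier R" "lincomb J c w = \<zero>\<^bsub>M\<^esub>" "j \<in> J"
      define d where "d = (\<lambda>i. c (inv_into J h i))"
      have dh: "d (h j) = c j" if "j \<in> J" for j using that I by (simp add: d_def)
      have d: "d \<in> I \<rightarrow> carrier R" using c dh I by auto
      have "lincomb J (\<lambda>j. d (h j)) w = lincomb J c w"
        using c assms(4) v I by (intro lincomb_cong) (auto simp: dh)
      then have "lincomb I d v = \<zero>\<^bsub>M\<^esub>" using eq[OF d] c by simp
      then have "d (h j) = \<zero>" using v(2) d I c unfolding independent_family_def by blast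
      then show "c j = \<zero>" using dh c by simp
    qed
  qed
qed

text \<open>
  The Steinitz exchange step, over an arbitrary ring: a basis vector may be replaced by any vector
  in which it occurs with an invertible coefficient.
\<close>

lemma basis_exchange:
  assumes I: "finite I" and w: "is_basis_family R M I w" and k: "k \<in> I"
    and c: "c \<in> I \<rightarrow> carrier R" and u: "c k \<in> Units R" and y: "y = lincomb I c w"
  shows "is_basis_family R M I (w(k := y))"
proof (rule is_basis_familyI[OF I])
  note w = is_basis_familyD[OF w I]
  define t where "t = inv (c k)"
  have t: "t \<in> carrier R" "t \<otimes> c k = \<one>" "c k \<otimes> t = \<one>"
    using u by (auto simp: t_def R.Units_l_inv R.Units_r_inv)
  let ?J = "I - {k}"
  have IJ: "I = insert k ?J" "finite ?J" "k \<notin> ?J" using I k by auto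
  have yM: "y \<in> carrier M" using w c y by auto
  show w': "w(k := y) \<in> I \<rightarrow> carrier M" using yM w by auto
  have rest: "lincomb I d (w(k := y)) = lincomb I (\<lambda>i. if i = k then d k \<otimes> c k else d k \<otimes> c i \<oplus> d i) w"
    if d: "d \<in> I \<rightarrow> carrier R" for d
  proof -
    have "lincomb I d (w(k := y)) = d k \<odot>\<^bsub>M\<^esub> y \<oplus>\<^bsub>M\<^esub> lincomb ?J d w"
    proof -
      have "lincomb I d (w(k := y)) = lincomb (insert k ?J) d (w(k := y))"
        using k by (simp add: insert_absorb)
      also have "\<dots> = d k \<odot>\<^bsub>M\<^esub> y \<oplus>\<^bsub>M\<^esub> lincomb ?J d (w(k := y))"
        using d w' IJ(2,3) k yM by (subst lincomb_insert) auto
      also have "lincomb ?J d (w(k := y)) = lincomb ?J d w"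
        using d w(1) by (intro lincomb_cong) auto
      finally show ?thesis .
    qed
    also have "lincomb ?J d w = lincomb I (\<lambda>i. if i = k then \<zero> else d i) w"
      using d w I by (subst lincomb_neutral[of I ?J]) (auto intro!: lincomb_cong split: if_splits)
    also have "d k \<odot>\<^bsub>M\<^esub> y = lincomb I (\<lambda>i. d k \<otimes> c i) w"
      using d c k w I y by (subst lincomb_smult) auto
    also have "lincomb I (\<lambda>i. d k \<otimes> c i) w \<oplus>\<^bsub>M\<^esub> lincomb I (\<lambda>i. if i = k then \<zero> else d i) w
      = lincomb I (\<lambda>i. d k \<otimes> c i \<oplus> (if i = k then \<zero> else d i)) w"
      using d c k w I by (subst lincomb_add) auto
    also have "\<dots> = lincomb I (\<lambda>i. if i = k then d k \<otimes> c k else d k \<otimes> c i \<oplus> d i) w"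
      using d c k w I by (intro lincomb_cong) (auto simp: Pi_iff)
    finally show ?thesis .
  qed
  show "independent_family I (w(k := y))" unfolding independent_family_def
  proof (intro ballI impI)
    fix d i assume d: "d \<in> I \<rightarrow> carrier R" "lincomb I d (w(k := y)) = \<zero>\<^bsub>M\<^esub>" "i \<in> I"
    have *: "(if i = k then d k \<otimes> c k else d k \<otimes> c i \<oplus> d i) = \<zero>" if "i \<in> I" for i
    proof -
      let ?e = "\<lambda>i. if i = k then d k \<otimes> c k else d k \<otimes> c i \<oplus> d i"
      have "?e \<in> I \<rightarrow> carrier R" using d(1) c k by (auto simp: Pi_iff)
      moreover have "lincomb I ?e w = \<zero>\<^bsub>M\<^esub>" using rest[OF d(1)] d(2) by simp
      ultimately show ?thesis
        using w(2)[unfolded independent_family_def, rule_format, of ?e i] that by blast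
    qed
    from *[OF k] have "d k \<otimes> c k = \<zero>" by simp
    then have "d k \<otimes> (c k \<otimes> t) = \<zero>"
      using d(1) c k t(1) by (subst R.m_assoc[symmetric]) (auto simp: Pi_iff)
    then have dk: "d k = \<zero>" using t d(1) k by (auto simp: Pi_iff)
    show "d i = \<zero>" using *[OF d(3)] dk d c by (cases "i = k") (auto simp: Pi_iff)
  qed
  fix x assume "x \<in> carrier M"
  then obtain a where a: "a \<in> I \<rightarrow> carrier R" "x = lincomb I a w" using w(3) by blast
  define d where "d = (\<lambda>i. if i = k then a k \<otimes> t else a i \<ominus> a k \<otimes> t \<otimes> c i)"
  have d: "d \<in> I \<rightarrow> carrier R" using a c t k by (auto simp: d_def Pi_iff)
  have "lincomb I d (w(k := y)) = lincomb I a w"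
    unfolding rest[OF d] using a c t k w
    by (intro lincomb_cong)
      (auto simp: d_def Pi_iff R.m_assoc R.minus_eq R.a_lcomm[of _ "a _"] R.r_neg)
  then show "\<exists>c\<in>I \<rightarrow> carrier R. x = lincomb I c (w(k := y))" using d a by metis
qed

lemma lincomb_Plus:
  assumes "finite J" "finite K" "c \<in> J <+> K \<rightarrow> carrier R" "v \<in> J \<rightarrow> carrier M" "e \<in> K \<rightarrow> carrier M"
  shows "lincomb (J <+> K) c (case_sum v e) =
    lincomb J (\<lambda>j. c (Inl j)) v \<oplus>\<^bsub>M\<^esub> lincomb K (\<lambda>k. c (Inr k)) e"
proof -
  have "lincomb (J <+> K) c (case_sum v e) =
    lincomb (Inl ` J) c (case_sum v e) \<oplus>\<^bsub>M\<^esub> lincomb (Inr ` K) c (case_sum v e)"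
    unfolding Plus_def using assms by (intro lincomb_Un) auto
  also have "lincomb (Inl ` J) c (case_sum v e) = lincomb J (\<lambda>j. c (Inl j)) v"
    using assms by (subst lincomb_reindex) auto
  also have "lincomb (Inr ` K) c (case_sum v e) = lincomb K (\<lambda>k. c (Inr k)) e"
    using assms by (subst lincomb_reindex) auto
  finally show ?thesis .
qed

text \<open>
  The exchange theorem for a local ring with maximal ideal \<open>m\<close>: vectors that are independent modulo
  \<open>m\<close> can be exchanged into any basis.  A field is the case where \<open>m\<close> contains only zero.
\<close>

theorem exchange_independent_mod:
  assumes m: "\<zero> \<in> m" "\<one> \<notin> m" "m \<subseteq> carrier R" "\<And>a. a \<in> carrier R \<Longrightarrow> a \<notin> m \<Longrightarrow> a \<in> Units R"
    and B: "finite B" and e: "is_basis_family R M B e"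
    and J: "finite J" and v: "v \<in> J \<rightarrow> carrier M"
    and ind: "\<And>c \<mu>. c \<in> J \<rightarrow> carrier R \<Longrightarrow> \<mu> \<in> B \<rightarrow> m \<Longrightarrow>
      lincomb J c v = lincomb B \<mu> e \<Longrightarrow> \<forall>j\<in>J. c j \<in> m"
  shows "\<exists>K\<subseteq>B. card K + card J = card B \<and> is_basis_family R M (J <+> K) (case_sum v e)"
proof -
  have "\<exists>K\<subseteq>B. card K + card J' = card B \<and> is_basis_family R M (J' <+> K) (case_sum v e)"
    if "J' \<subseteq> J" for J'
    using finite_subset[OF that J] that
  proof (induction J' rule: finite_induct)
    case empty
    have "is_basis_family R M ({} <+> B) (case_sum v e)"
      using B by (intro is_basis_family_reindex[OF _ _ e, where h = "case_sum (\<lambda>_. undefined) id"])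
        (auto simp: bij_betw_def inj_on_def image_iff Plus_def)
    then show ?case by auto
  next
    case (insert i J')
    then obtain K where K: "K \<subseteq> B" "card K + card J' = card B"
      "is_basis_family R M (J' <+> K) (case_sum v e)" by auto
    have fin: "finite K" "finite J'" "finite (J' <+> K)" using K insert B by (auto intro: finite_subset)
    have iJ: "i \<in> J" "i \<notin> J'" "J' \<subseteq> J" and vi: "v i \<in> carrier M" using insert v by auto
    note eM = is_basis_familyD(1)[OF e B]
    obtain c where c: "c \<in> J' <+> K \<rightarrow> carrier R" "v i = lincomb (J' <+> K) c (case_sum v e)"
      using is_basis_familyD(3)[OF K(3) fin(3) vi] by blast
    have cJ: "c (Inl j) \<in> carrier R" if "j \<in> J'" for j using c(1) that by auto
    \<comment> \<open>Otherwise the expansion of \<open>v i\<close> would be a relation modulo \<open>m\<close> among the \<open>v\<close> with coefficient \<open>1\<close> at \<open>i\<close>.\<close>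
    have "\<exists>k\<in>K. c (Inr k) \<notin> m"
    proof (rule ccontr)
      assume "\<not> (\<exists>k\<in>K. c (Inr k) \<notin> m)"
      then have cm: "c (Inr k) \<in> m" if "k \<in> K" for k using that by auto
      define c' where "c' = (\<lambda>j. if j = i then \<one> else if j \<in> J' then \<ominus> c (Inl j) else \<zero>)"
      define \<mu> where "\<mu> = (\<lambda>b. if b \<in> K then c (Inr b) else \<zero>)"
      have c': "c' \<in> J \<rightarrow> carrier R" using c by (auto simp: c'_def)
      have c'i: "c' i = \<one>" by (simp add: c'_def)
      have \<mu>: "\<mu> \<in> B \<rightarrow> m" "\<mu> \<in> B \<rightarrow> carrier R" using cm m K by (auto simp: \<mu>_def)
      let ?L = "lincomb J' (\<lambda>j. c (Inl j)) v" and ?E = "lincomb K (\<lambda>k. c (Inr k)) e"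
      have L: "?L \<in> carrier M" and E: "?E \<in> carrier M" using c v eM iJ K by (auto intro!: lincomb_closed)
      have "lincomb J c' v = lincomb (insert i J') c' v"
        using c' v iJ J by (intro lincomb_neutral) (auto simp: c'_def)
      also have "\<dots> = \<one> \<odot>\<^bsub>M\<^esub> v i \<oplus>\<^bsub>M\<^esub> lincomb J' c' v"
        using c' v iJ fin c'i by (subst lincomb_insert) auto
      also have "lincomb J' c' v = \<ominus>\<^bsub>M\<^esub> ?L"
      proof -
        have "lincomb J' c' v = lincomb J' (\<lambda>j. \<ominus> c (Inl j)) v"
          using cJ v iJ by (intro lincomb_cong) (auto simp: c'_def)
        then show ?thesis using cJ v iJ fin by (subst (asm) lincomb_minus) auto
      qed
      also have "v i = ?L \<oplus>\<^bsub>M\<^esub> ?E"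
        unfolding c(2) using c v eM iJ K fin by (subst lincomb_Plus) auto
      also have "\<one> \<odot>\<^bsub>M\<^esub> (?L \<oplus>\<^bsub>M\<^esub> ?E) \<oplus>\<^bsub>M\<^esub> \<ominus>\<^bsub>M\<^esub> ?L = ?E"
        using L E by (simp add: M.a_ac M.r_neg)
      also have "\<dots> = lincomb K \<mu> e" using \<mu> K eM cm m(3) by (intro lincomb_cong) (auto simp: \<mu>_def)
      also have "\<dots> = lincomb B \<mu> e" using \<mu> K eM B by (intro lincomb_neutral[symmetric]) (auto simp: \<mu>_def)
      finally have "c' i \<in> m" using ind[OF c' \<mu>(1)] iJ by blast
      then show False using m by (simp add: c'_def)
    qed
    then obtain k where k: "k \<in> K" "c (Inr k) \<notin> m" by blast
    have u: "c (Inr k) \<in> Units R" using c k m(4) by auto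
    have nb: "is_basis_family R M (J' <+> K) ((case_sum v e)(Inr k := v i))"
      using k by (intro basis_exchange[OF fin(3) K(3) _ c(1) u c(2)]) auto
    have "is_basis_family R M (insert i J' <+> (K - {k})) (case_sum v e)"
      using fin k iJ
      by (intro is_basis_family_reindex[OF _ _ nb, where h = "\<lambda>s. if s = Inl i then Inr k else s"])
        (auto simp: bij_betw_def inj_on_def image_iff Plus_def split: if_splits)
    moreover have "card (K - {k}) + card (insert i J') = card B"
    proof -
      have "card K > 0" using k fin by (auto simp: card_gt_0_iff)
      then show ?thesis using K(2) k fin iJ by (simp add: card_Diff_singleton)
    qed
    ultimately show ?case using K(1) by blast
  qed
  then show ?thesis by simp
qed

lemma basis_of_exchange_all:
  assumes "finite J" "is_basis_family R M (J <+> {}) (case_sum v e)"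
  shows "is_basis_family R M J v"
  using assms(1) by (intro is_basis_family_reindex[OF _ _ assms(2), where h = Inl])
    (auto simp: bij_betw_def image_iff Plus_def)

text \<open>Over a field an independent family is at most as large as a basis, and a basis if equally large.\<close>

lemma independent_family_card:
  assumes field: "field R" and B: "finite B" "is_basis_family R M B e"
    and J: "finite J" "v \<in> J \<rightarrow> carrier M" "independent_family J v"
  shows "card J \<le> card B" "card J = card B \<Longrightarrow> is_basis_family R M J v"
proof -
  interpret F: field R by (fact field)
  have "\<exists>K\<subseteq>B. card K + card J = card B \<and> is_basis_family R M (J <+> K) (case_sum v e)"
  proof (rule exchange_independent_mod[where m = "{\<zero>}"])
    show "a \<in> Units R" if "a \<in> carrier R" "a \<notin> {\<zero>}" for a using that by (simp add: F.field_Units)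
    fix c \<mu> assume c: "c \<in> J \<rightarrow> carrier R" "\<mu> \<in> B \<rightarrow> {\<zero>}" "lincomb J c v = lincomb B \<mu> e"
    have "lincomb B \<mu> e = lincomb B (\<lambda>b. \<zero>) e"
      using c is_basis_familyD(1)[OF B(2,1)] by (intro lincomb_cong) auto
    then have "lincomb J c v = \<zero>\<^bsub>M\<^esub>" using c is_basis_familyD(1)[OF B(2,1)] by simp
    then show "\<forall>j\<in>J. c j \<in> {\<zero>}" using J(3) c unfolding independent_family_def by auto
  qed (use B J in auto)
  then obtain K where K: "K \<subseteq> B" "card K + card J = card B"
    "is_basis_family R M (J <+> K) (case_sum v e)" by blast
  then show "card J \<le> card B" by simp
  assume "card J = card B"
  then have "K = {}" using K B by (auto dest: finite_subset)
  then show "is_basis_family R M J v" using basis_of_exchange_all[OF J(1)] K by simp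
qed

section \<open>Jordan chains\<close>

definition linear_op :: "('m \<Rightarrow> 'm) \<Rightarrow> bool" where
  "linear_op \<theta> \<longleftrightarrow> (\<forall>x\<in>carrier M. \<theta> x \<in> carrier M) \<and>
    (\<forall>x\<in>carrier M. \<forall>y\<in>carrier M. \<theta> (x \<oplus>\<^bsub>M\<^esub> y) = \<theta> x \<oplus>\<^bsub>M\<^esub> \<theta> y) \<and>
    (\<forall>s\<in>carrier R. \<forall>x\<in>carrier M. \<theta> (s \<odot>\<^bsub>M\<^esub> x) = s \<odot>\<^bsub>M\<^esub> \<theta> x)"

lemma linear_op_zero: "linear_op \<theta> \<Longrightarrow> \<theta> \<zero>\<^bsub>M\<^esub> = \<zero>\<^bsub>M\<^esub>"
  unfolding linear_op_def by (metis M.zero_closed R.zero_closed smult_l_null)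

lemma linear_op_minus:
  assumes "linear_op \<theta>" "x \<in> carrier M"
  shows "\<theta> (\<ominus>\<^bsub>M\<^esub> x) = \<ominus>\<^bsub>M\<^esub> \<theta> x"
proof -
  have "\<ominus>\<^bsub>M\<^esub> y = (\<ominus> \<one>) \<odot>\<^bsub>M\<^esub> y" if "y \<in> carrier M" for y using that by (simp add: smult_l_minus)
  moreover have "\<theta> ((\<ominus> \<one>) \<odot>\<^bsub>M\<^esub> x) = (\<ominus> \<one>) \<odot>\<^bsub>M\<^esub> \<theta> x" "\<theta> x \<in> carrier M"
    using assms by (auto simp: linear_op_def)
  ultimately show ?thesis using assms(2) by simp
qed

lemma linear_op_funpow: "linear_op \<theta> \<Longrightarrow> linear_op (\<theta> ^^ n)"
  by (induction n) (auto simp: linear_op_def)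

lemma linear_op_closed: "linear_op \<theta> \<Longrightarrow> x \<in> carrier M \<Longrightarrow> \<theta> x \<in> carrier M"
  by (auto simp: linear_op_def)

lemma linear_op_lincomb:
  assumes "linear_op \<theta>" "finite I" "c \<in> I \<rightarrow> carrier R" "v \<in> I \<rightarrow> carrier M"
  shows "\<theta> (lincomb I c v) = lincomb I c (\<lambda>i. \<theta> (v i))"
  using assms(2-)
proof (induction I rule: finite_induct)
  case empty
  then show ?case using linear_op_zero[OF assms(1)] by simp
next
  case (insert i I)
  then show ?case using assms(1)
    by (simp add: lincomb_insert linear_op_def)
qed

end

text \<open>
  The index \<open>(i, c, j)\<close> stands for the \<open>j\<close>-th member of the \<open>c\<close>-th chain of length \<open>i\<close>.
\<close>

definition jordan_index :: "nat \<Rightarrow> (nat \<Rightarrow> nat) \<Rightarrow> (nat \<times> nat \<times> nat) set" where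
  "jordan_index p a = {(i, c, j). i \<in> {1..p} \<and> c < a i \<and> j < i}"

lemma finite_jordan_index [simp]: "finite (jordan_index p a)"
proof (rule finite_subset)
  show "jordan_index p a \<subseteq> {..p} \<times> {..<(\<Sum>i\<in>{1..p}. a i)} \<times> {..p}"
  proof
    fix z assume "z \<in> jordan_index p a"
    then obtain i c j where z: "z = (i, c, j)" "i \<in> {1..p}" "c < a i" "j < i"
      by (auto simp: jordan_index_def)
    have "a i \<le> (\<Sum>i\<in>{1..p}. a i)" using z by (intro member_le_sum) auto
    then show "z \<in> {..p} \<times> {..<(\<Sum>i\<in>{1..p}. a i)} \<times> {..p}" using z by auto
  qed
qed simp

definition chain_family :: "('m \<Rightarrow> 'm) \<Rightarrow> (nat \<Rightarrow> nat \<Rightarrow> 'm) \<Rightarrow> nat \<times> nat \<times> nat \<Rightarrow> 'm" where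
  "chain_family \<theta> x = (\<lambda>(i, c, j). (\<theta> ^^ j) (x i c))"

locale chain_tops = plain_module R M for R (structure) and M :: "('r, 'm) module" (structure) +
  fixes \<theta> :: "'m \<Rightarrow> 'm" and p :: nat and a :: "nat \<Rightarrow> nat" and x :: "nat \<Rightarrow> nat \<Rightarrow> 'm"
  assumes lin: "linear_op \<theta>"
    and x_closed: "i \<in> {1..p} \<Longrightarrow> c < a i \<Longrightarrow> x i c \<in> carrier M"
begin

abbreviation "J \<equiv> jordan_index p a"
abbreviation "v \<equiv> chain_family \<theta> x"

lemma pow_closed [simp]: "y \<in> carrier M \<Longrightarrow> (\<theta> ^^ n) y \<in> carrier M"
  using linear_op_closed[OF linear_op_funpow[OF lin]] .

lemma pow_zero [simp]: "(\<theta> ^^ n) \<zero>\<^bsub>M\<^esub> = \<zero>\<^bsub>M\<^esub>"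
  using linear_op_zero[OF linear_op_funpow[OF lin]] .

lemma v_closed: "v \<in> J \<rightarrow> carrier M"
  using x_closed by (auto simp: chain_family_def jordan_index_def)

lemma v_closed' [simp]: "z \<in> J \<Longrightarrow> v z \<in> carrier M"
  using v_closed by auto

text \<open>
  The effect of \<open>\<theta>\<^sup>m\<close> on coordinates with respect to Jordan chains.
\<close>

definition shift :: "nat \<Rightarrow> (nat \<times> nat \<times> nat \<Rightarrow> 'r) \<Rightarrow> nat \<times> nat \<times> nat \<Rightarrow> 'r" where
  "shift m w = (\<lambda>(i, c, j). if m \<le> j then w (i, c, j - m) else \<zero>)"

lemma shift_closed: "w \<in> J \<rightarrow> carrier R \<Longrightarrow> shift m w \<in> J \<rightarrow> carrier R"
  by (fastforce simp: shift_def jordan_index_def)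

text \<open>
  The hypothesis \<open>beyond\<close> asks that no nonzero coefficient is moved past the end of its chain to a
  nonzero vector.  For Jordan chains this is automatic; for truncated chains it is a condition on
  the coefficients.
\<close>

lemma pow_lincomb_gen:
  assumes w: "w \<in> J \<rightarrow> carrier R"
    and beyond: "\<And>i c j. (i, c, j) \<in> J \<Longrightarrow> i \<le> j + m \<Longrightarrow>
      w (i, c, j) = \<zero> \<or> (\<theta> ^^ (j + m)) (x i c) = \<zero>\<^bsub>M\<^esub>"
  shows "(\<theta> ^^ m) (lincomb J w v) = lincomb J (shift m w) v"
proof -
  let ?u = "\<lambda>(i, c, j). (\<theta> ^^ (j + m)) (x i c)"
  let ?J = "{(i, c, j) \<in> J. j + m < i}"
  let ?h = "\<lambda>(i, c, j). (i, c, j + m)"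
  have u: "?u \<in> J \<rightarrow> carrier M" using x_closed by (auto simp: jordan_index_def)
  have hJ: "?h ` ?J \<subseteq> J" by (auto simp: jordan_index_def)
  have inj: "inj_on ?h ?J" by (auto simp: inj_on_def)
  have "(\<theta> ^^ m) (lincomb J w v) = lincomb J w (\<lambda>z. (\<theta> ^^ m) (v z))"
    using w by (intro linear_op_lincomb linear_op_funpow lin) auto
  also have "\<dots> = lincomb J w ?u"
    using w u by (intro lincomb_cong) (auto simp: chain_family_def funpow_add add.commute[of _ m])
  also have "\<dots> = lincomb ?J w ?u"
  proof (rule lincomb_neutral)
    fix z assume "z \<in> J - ?J"
    moreover obtain i c j where zz: "z = (i, c, j)" by (cases z)
    ultimately have z: "(i, c, j) \<in> J" "\<not> j + m < i" by auto
    then have "i \<le> j + m" by simp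
    then show "w z = \<zero> \<or> ?u z = \<zero>\<^bsub>M\<^esub>" using beyond[OF z(1)] zz by simp
  qed (use w u in auto)
  also have "\<dots> = lincomb ?J (\<lambda>z. shift m w (?h z)) (\<lambda>z. v (?h z))"
    using w x_closed by (intro lincomb_cong) (auto simp: chain_family_def shift_def jordan_index_def)
  also have "\<dots> = lincomb (?h ` ?J) (shift m w) v"
    using shift_closed[OF w, of m] v_closed hJ
    by (intro lincomb_reindex[symmetric] inj) blast+
  also have "\<dots> = lincomb J (shift m w) v"
  proof (rule lincomb_neutral[symmetric])
    fix z assume z: "z \<in> J - ?h ` ?J"
    obtain i c j where zz: "z = (i, c, j)" by (cases z)
    have "\<not> m \<le> j"
    proof
      assume "m \<le> j"
      then have "z = ?h (i, c, j - m)" "(i, c, j - m) \<in> ?J" using z zz by (auto simp: jordan_index_def)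
      then show False using z by blast
    qed
    then show "shift m w z = \<zero> \<or> v z = \<zero>\<^bsub>M\<^esub>" using zz by (simp add: shift_def)
  qed (use hJ shift_closed[OF w] v_closed in auto)
  finally show ?thesis .
qed

text \<open>
  The preimage has the same coefficients, moved to earlier positions; in particular they stay in any
  ideal that contains the given ones.
\<close>

lemma lincomb_in_image:
  assumes w: "w \<in> J \<rightarrow> carrier R" and 0: "\<And>i c j. (i, c, j) \<in> J \<Longrightarrow> j < m \<Longrightarrow> w (i, c, j) = \<zero>"
  shows "\<exists>u\<in>J \<rightarrow> insert \<zero> (w ` J). lincomb J w v = (\<theta> ^^ m) (lincomb J u v)"
proof
  let ?u = "\<lambda>(i, c, j). if j + m < i then w (i, c, j + m) else \<zero>"
  show "?u \<in> J \<rightarrow> insert \<zero> (w ` J)" by (auto simp: jordan_index_def)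
  have u: "?u \<in> J \<rightarrow> carrier R" using w by (auto simp: jordan_index_def)
  have "lincomb J w v = lincomb J (shift m ?u) v"
    using w 0 shift_closed[OF u] by (intro lincomb_cong) (auto simp: shift_def jordan_index_def)
  then show "lincomb J w v = (\<theta> ^^ m) (lincomb J ?u v)" using pow_lincomb_gen[OF u, of m] by simp
qed

end

locale chains = chain_tops R M \<theta> p a x for R (structure) and M :: "('r, 'm) module" (structure) and \<theta> p a x +
  assumes chain_end: "i \<in> {1..p} \<Longrightarrow> c < a i \<Longrightarrow> (\<theta> ^^ i) (x i c) = \<zero>\<^bsub>M\<^esub>"
begin

lemma pow_beyond: "i \<in> {1..p} \<Longrightarrow> c < a i \<Longrightarrow> i \<le> n \<Longrightarrow> (\<theta> ^^ n) (x i c) = \<zero>\<^bsub>M\<^esub>"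
  using chain_end[of i c] by (metis le_add_diff_inverse2 funpow_add comp_apply pow_zero)

lemma pow_lincomb:
  assumes w: "w \<in> J \<rightarrow> carrier R"
  shows "(\<theta> ^^ m) (lincomb J w v) = lincomb J (shift m w) v"
  using pow_beyond by (intro pow_lincomb_gen w) (auto simp: jordan_index_def)

lemma lincomb_in_image':
  assumes w: "w \<in> J \<rightarrow> carrier R" and 0: "\<And>i c j. (i, c, j) \<in> J \<Longrightarrow> j < m \<Longrightarrow> w (i, c, j) = \<zero>"
  shows "\<exists>u\<in>J \<rightarrow> carrier R. lincomb J w v = (\<theta> ^^ m) (lincomb J u v)"
proof -
  have "J \<rightarrow> insert \<zero> (w ` J) \<subseteq> J \<rightarrow> carrier R" using w by fastforce
  then show ?thesis using lincomb_in_image[OF w 0] by blast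
qed

text \<open>
  The coordinates of the elements that represent the quotient of \<open>ker \<theta> \<inter> im \<theta>\<^bsup>i-1\<^esup>\<close> by \<open>ker \<theta> \<inter> im \<theta>\<^sup>i\<close>.
\<close>

definition top :: "nat \<Rightarrow> (nat \<Rightarrow> 'r) \<Rightarrow> nat \<times> nat \<times> nat \<Rightarrow> 'r" where
  "top i \<alpha> = (\<lambda>(i', c, j). if i' = i \<and> j = i - 1 then \<alpha> c else \<zero>)"

lemma top_closed: "\<alpha> \<in> {..<a i} \<rightarrow> carrier R \<Longrightarrow> top i \<alpha> \<in> J \<rightarrow> carrier R"
  by (auto simp: top_def jordan_index_def)

lemma lincomb_top:
  assumes i: "i \<in> {1..p}" and \<alpha>: "\<alpha> \<in> {..<a i} \<rightarrow> carrier R"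
  shows "lincomb {..<a i} \<alpha> (\<lambda>c. (\<theta> ^^ (i - 1)) (x i c)) = lincomb J (top i \<alpha>) v"
proof -
  let ?h = "\<lambda>c. (i, c, i - 1)"
  have hJ: "?h ` {..<a i} \<subseteq> J" using i by (auto simp: jordan_index_def)
  have "lincomb J (top i \<alpha>) v = lincomb (?h ` {..<a i}) (top i \<alpha>) v"
    using top_closed[OF \<alpha>] v_closed
    by (intro lincomb_neutral[OF finite_jordan_index hJ]) (auto simp: top_def jordan_index_def image_iff)
  also have "\<dots> = lincomb {..<a i} (\<lambda>c. top i \<alpha> (?h c)) (\<lambda>c. v (?h c))"
    using hJ top_closed[OF \<alpha>] v_closed by (intro lincomb_reindex) (auto simp: inj_on_def)
  also have "\<dots> = lincomb {..<a i} \<alpha> (\<lambda>c. (\<theta> ^^ (i - 1)) (x i c))"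
    using \<alpha> x_closed i by (intro lincomb_cong) (auto simp: top_def chain_family_def)
  finally show ?thesis ..
qed

text \<open>
  With respect to a basis of chains, \<open>\<theta>\<^sup>m\<close> moves coordinates by \<open>m\<close> places, so its kernel and its image
  are spanned by members of the basis.
\<close>

lemma image_iff_coords:
  assumes b: "is_basis_family R M J v" and w: "w \<in> J \<rightarrow> carrier R"
  shows "(\<exists>y\<in>carrier M. lincomb J w v = (\<theta> ^^ m) y) \<longleftrightarrow>
    (\<forall>i c j. (i, c, j) \<in> J \<longrightarrow> j < m \<longrightarrow> w (i, c, j) = \<zero>)"
proof
  note b = is_basis_familyD[OF b finite_jordan_index]
  assume "\<exists>y\<in>carrier M. lincomb J w v = (\<theta> ^^ m) y"
  then obtain u where u: "u \<in> J \<rightarrow> carrier R" "lincomb J w v = (\<theta> ^^ m) (lincomb J u v)"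
    using b(3) by metis
  then have "lincomb J w v = lincomb J (shift m u) v" using pow_lincomb by simp
  then have "w z = shift m u z" if "z \<in> J" for z
    using independent_familyD[OF b(2) finite_jordan_index w shift_closed[OF u(1)] v_closed] that by blast
  then show "\<forall>i c j. (i, c, j) \<in> J \<longrightarrow> j < m \<longrightarrow> w (i, c, j) = \<zero>" by (auto simp: shift_def)
next
  assume "\<forall>i c j. (i, c, j) \<in> J \<longrightarrow> j < m \<longrightarrow> w (i, c, j) = \<zero>"
  then obtain u where "u \<in> J \<rightarrow> carrier R" "lincomb J w v = (\<theta> ^^ m) (lincomb J u v)"
    using lincomb_in_image'[OF w] by blast
  then show "\<exists>y\<in>carrier M. lincomb J w v = (\<theta> ^^ m) y" using v_closed by blast
qed

lemma kernel_iff_coords: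
  assumes b: "is_basis_family R M J v" and w: "w \<in> J \<rightarrow> carrier R"
  shows "\<theta> (lincomb J w v) = \<zero>\<^bsub>M\<^esub> \<longleftrightarrow> (\<forall>i c j. (i, c, j) \<in> J \<longrightarrow> j + 1 < i \<longrightarrow> w (i, c, j) = \<zero>)"
proof -
  note b = is_basis_familyD[OF b finite_jordan_index]
  have eq: "\<theta> (lincomb J w v) = lincomb J (shift 1 w) v" using pow_lincomb[OF w, of 1] by simp
  have "lincomb J (shift 1 w) v = \<zero>\<^bsub>M\<^esub> \<longleftrightarrow> (\<forall>z\<in>J. shift 1 w z = \<zero>)"
  proof
    assume "lincomb J (shift 1 w) v = \<zero>\<^bsub>M\<^esub>"
    then show "\<forall>z\<in>J. shift 1 w z = \<zero>"
      using b(2) shift_closed[OF w] unfolding independent_family_def by blast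
  next
    assume "\<forall>z\<in>J. shift 1 w z = \<zero>"
    then have "lincomb J (shift 1 w) v = lincomb J (\<lambda>_. \<zero>) v" using v_closed by (intro lincomb_cong) auto
    then show "lincomb J (shift 1 w) v = \<zero>\<^bsub>M\<^esub>" using v_closed by simp
  qed
  also have "\<dots> \<longleftrightarrow> (\<forall>i c j. (i, c, j) \<in> J \<longrightarrow> j + 1 < i \<longrightarrow> w (i, c, j) = \<zero>)"
  proof (intro iffI allI impI ballI)
    fix i c j assume *: "\<forall>z\<in>J. shift 1 w z = \<zero>" "(i, c, j) \<in> J" "j + 1 < i"
    then have "(i, c, j + 1) \<in> J" by (auto simp: jordan_index_def)
    then have "shift 1 w (i, c, j + 1) = \<zero>" using * by blast
    then show "w (i, c, j) = \<zero>" by (simp add: shift_def)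
  next
    fix z assume *: "\<forall>i c j. (i, c, j) \<in> J \<longrightarrow> j + 1 < i \<longrightarrow> w (i, c, j) = \<zero>" "z \<in> J"
    obtain i c j where z: "z = (i, c, j)" by (cases z)
    then show "shift 1 w z = \<zero>" using * by (auto simp: shift_def jordan_index_def)
  qed
  finally show ?thesis using eq by simp
qed

definition ker_im :: "nat \<Rightarrow> 'm set" where
  "ker_im m = {y \<in> carrier M. \<theta> y = \<zero>\<^bsub>M\<^esub> \<and> (\<exists>u\<in>carrier M. y = (\<theta> ^^ m) u)}"

lemma ker_im_coords:
  assumes b: "is_basis_family R M J v" and w: "w \<in> J \<rightarrow> carrier R"
  shows "lincomb J w v \<in> ker_im m \<longleftrightarrow> (\<forall>i c j. (i, c, j) \<in> J \<longrightarrow> j < m \<or> j + 1 < i \<longrightarrow> w (i, c, j) = \<zero>)"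
  unfolding ker_im_def using image_iff_coords[OF b w, of m] kernel_iff_coords[OF b w] w v_closed
  by blast

text \<open>
  Conversely, chains whose ends give bases of the successive quotients of the filtration
  \<open>ker \<theta> \<inter> im \<theta>\<^sup>m\<close> form a basis of the module, over any ring, provided that \<open>\<theta>\<close> is nilpotent.
\<close>

theorem chains_basis:
  assumes nil: "\<And>y. y \<in> carrier M \<Longrightarrow> (\<theta> ^^ p) y = \<zero>\<^bsub>M\<^esub>"
    and span: "\<And>i y. i \<in> {1..p} \<Longrightarrow> y \<in> ker_im (i - 1) \<Longrightarrow>
      \<exists>\<alpha>\<in>{..<a i} \<rightarrow> carrier R. \<exists>z\<in>ker_im i.
        y = lincomb {..<a i} \<alpha> (\<lambda>c. (\<theta> ^^ (i - 1)) (x i c)) \<oplus>\<^bsub>M\<^esub> z"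
    and ind: "\<And>i \<alpha> c. i \<in> {1..p} \<Longrightarrow> \<alpha> \<in> {..<a i} \<rightarrow> carrier R \<Longrightarrow>
      lincomb {..<a i} \<alpha> (\<lambda>c. (\<theta> ^^ (i - 1)) (x i c)) \<in> ker_im i \<Longrightarrow> c < a i \<Longrightarrow> \<alpha> c = \<zero>"
  shows "is_basis_family R M J v"
proof (rule is_basis_familyI[OF finite_jordan_index v_closed])
  define Sp where "Sp = {lincomb J w v | w. w \<in> J \<rightarrow> carrier R}"
  have Sp_M: "Sp \<subseteq> carrier M" using v_closed by (auto simp: Sp_def simp del: Pi_iff)
  have Sp_add: "y \<oplus>\<^bsub>M\<^esub> z \<in> Sp" if yz: "y \<in> Sp" "z \<in> Sp" for y z
  proof -
    obtain w w' where w: "w \<in> J \<rightarrow> carrier R" "w' \<in> J \<rightarrow> carrier R" "y = lincomb J w v" "z = lincomb J w' v"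
      using yz unfolding Sp_def by blast
    then show ?thesis unfolding Sp_def using lincomb_add[OF w(1,2) v_closed]
      by (intro CollectI exI[of _ "\<lambda>i. w i \<oplus> w' i"]) auto
  qed
  have Sp_pow: "(\<theta> ^^ m) y \<in> Sp" if y: "y \<in> Sp" for y m
    using y pow_lincomb shift_closed unfolding Sp_def by blast
  have Sp_top: "\<exists>u\<in>Sp. lincomb {..<a i} \<alpha> (\<lambda>c. (\<theta> ^^ (i - 1)) (x i c)) = (\<theta> ^^ (i - 1)) u"
    if i: "i \<in> {1..p}" and \<alpha>: "\<alpha> \<in> {..<a i} \<rightarrow> carrier R" for i \<alpha>
  proof -
    have "\<exists>u\<in>J \<rightarrow> carrier R. lincomb J (top i \<alpha>) v = (\<theta> ^^ (i - 1)) (lincomb J u v)"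
      by (rule lincomb_in_image'[OF top_closed[OF \<alpha>]]) (auto simp: top_def)
    then show ?thesis unfolding lincomb_top[OF i \<alpha>] Sp_def by blast
  qed
  \<comment> \<open>Downward induction on the exponent \<open>i = p - n\<close>: modulo \<open>im \<theta>\<^sup>i\<close>, where the induction hypothesis
    applies, an element of the kernel in \<open>im \<theta>\<^bsup>i-1\<^esup>\<close> is a combination of ends of chains.\<close>
  have lift: "\<exists>u\<in>Sp. y = (\<theta> ^^ (p - n)) u" if "n \<le> p" "y \<in> ker_im (p - n)" for n y
    using that
  proof (induction n arbitrary: y)
    case 0
    then have "y = \<zero>\<^bsub>M\<^esub>" using nil by (auto simp: ker_im_def)
    moreover have "\<zero>\<^bsub>M\<^esub> \<in> Sp"
      using lincomb_zero[OF v_closed] unfolding Sp_def by (intro CollectI exI[of _ "\<lambda>_. \<zero>"]) auto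
    ultimately show ?case by (intro bexI[of _ "\<zero>\<^bsub>M\<^esub>"]) auto
  next
    case (Suc n)
    define i where "i = p - n"
    have i: "i \<in> {1..p}" "p - Suc n = i - 1" using Suc.prems by (auto simp: i_def)
    obtain \<alpha> z where \<alpha>: "\<alpha> \<in> {..<a i} \<rightarrow> carrier R" "z \<in> ker_im i"
      "y = lincomb {..<a i} \<alpha> (\<lambda>c. (\<theta> ^^ (i - 1)) (x i c)) \<oplus>\<^bsub>M\<^esub> z"
      using span[OF i(1)] Suc.prems(2) unfolding i(2) by blast
    obtain u where u: "u \<in> Sp" "lincomb {..<a i} \<alpha> (\<lambda>c. (\<theta> ^^ (i - 1)) (x i c)) = (\<theta> ^^ (i - 1)) u"
      using Sp_top[OF i(1) \<alpha>(1)] by blast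
    obtain u' where u': "u' \<in> Sp" "z = (\<theta> ^^ i) u'" using Suc.IH[of z] \<alpha> Suc.prems by (auto simp: i_def)
    have "(\<theta> ^^ i) u' = (\<theta> ^^ (i - 1)) (\<theta> u')"
      using i(1) by (cases i) (auto simp: funpow_Suc_right simp del: funpow.simps)
    then have "y = (\<theta> ^^ (i - 1)) (u \<oplus>\<^bsub>M\<^esub> \<theta> u')"
      using \<alpha>(3) u u' Sp_M linear_op_funpow[OF lin, of "i - 1"] lin
      by (auto simp: linear_op_def subset_iff)
    moreover have "u \<oplus>\<^bsub>M\<^esub> \<theta> u' \<in> Sp" using Sp_add[OF u(1)] Sp_pow[OF u'(1), of 1] by simp
    ultimately show ?case unfolding i(2) by blast
  qed
  \<comment> \<open>If \<open>\<theta>\<^bsup>k+1\<^esup> y = 0\<close>, then \<open>\<theta>\<^sup>k y\<close> lies in the kernel and in the image of \<open>\<theta>\<^sup>k\<close>, so by \<open>lift\<close> it is also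
    \<open>\<theta>\<^sup>k u\<close> for some \<open>u\<close> in the span, and the induction hypothesis applies to \<open>y - u\<close>.\<close>
  have ker_Sp: "y \<in> Sp" if "k \<le> p" "y \<in> carrier M" "(\<theta> ^^ k) y = \<zero>\<^bsub>M\<^esub>" for k y
    using that
  proof (induction k arbitrary: y)
    case 0
    then have "y = \<zero>\<^bsub>M\<^esub>" by simp
    then show ?case
      using lincomb_zero[OF v_closed] unfolding Sp_def by (intro CollectI exI[of _ "\<lambda>_. \<zero>"]) auto
  next
    case (Suc k)
    have "(\<theta> ^^ k) y \<in> ker_im (p - (p - k))"
      using Suc.prems by (auto simp: ker_im_def)
    then obtain u where u: "u \<in> Sp" "(\<theta> ^^ k) y = (\<theta> ^^ k) u"
      using lift[of "p - k" "(\<theta> ^^ k) y"] Suc.prems by auto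
    have uM: "u \<in> carrier M" using u Sp_M by auto
    have "(\<theta> ^^ k) (y \<oplus>\<^bsub>M\<^esub> \<ominus>\<^bsub>M\<^esub> u) = (\<theta> ^^ k) y \<oplus>\<^bsub>M\<^esub> \<ominus>\<^bsub>M\<^esub> (\<theta> ^^ k) u"
      using linear_op_funpow[OF lin, of k] linear_op_minus[OF linear_op_funpow[OF lin], of u k] uM Suc.prems
      by (simp add: linear_op_def)
    also have "\<dots> = \<zero>\<^bsub>M\<^esub>" using u uM by (simp add: M.r_neg)
    finally have "y \<oplus>\<^bsub>M\<^esub> \<ominus>\<^bsub>M\<^esub> u \<in> Sp" using Suc.IH Suc.prems uM by auto
    from Sp_add[OF this u(1)] show ?case using uM Suc.prems by (simp add: M.a_assoc M.l_neg)
  qed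
  show "\<exists>c\<in>J \<rightarrow> carrier R. y = lincomb J c v" if "y \<in> carrier M" for y
    using ker_Sp[OF order.refl that nil[OF that]] by (auto simp: Sp_def simp del: Pi_iff)
  \<comment> \<open>A relation between ends of chains is trivial, by induction on the length: the ends of chains longer
    than \<open>i\<close> lie in \<open>im \<theta>\<^sup>i\<close>, so the relation puts a combination of those of length \<open>i\<close> into \<open>im \<theta>\<^sup>i\<close>.\<close>
  have ends_vanish: "\<gamma> (i, c, i - 1) = \<zero>"
    if \<gamma>: "\<gamma> \<in> J \<rightarrow> carrier R" "\<And>i c j. (i, c, j) \<in> J \<Longrightarrow> j \<noteq> i - 1 \<Longrightarrow> \<gamma> (i, c, j) = \<zero>"
      "lincomb J \<gamma> v = \<zero>\<^bsub>M\<^esub>" and ic: "i \<in> {1..p}" "c < a i" for \<gamma> i c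
    using ic
  proof (induction i arbitrary: c rule: less_induct)
    case (less i)
    define \<alpha> where "\<alpha> = (\<lambda>c. \<gamma> (i, c, i - 1))"
    define \<gamma>' where "\<gamma>' = (\<lambda>(i', c, j). if i' \<le> i then \<zero> else \<gamma> (i', c, j))"
    have \<alpha>: "\<alpha> \<in> {..<a i} \<rightarrow> carrier R" using \<gamma>(1) less.prems by (auto simp: \<alpha>_def jordan_index_def)
    have \<gamma>': "\<gamma>' \<in> J \<rightarrow> carrier R" using \<gamma>(1) by (auto simp: \<gamma>'_def)
    have split: "\<gamma> z = top i \<alpha> z \<oplus> \<gamma>' z" if z: "z \<in> J" for z
    proof -
      obtain i' c j where zz: "z = (i', c, j)" by (cases z)
      have zc: "\<gamma> z \<in> carrier R" using z \<gamma>(1) by auto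
      consider "j \<noteq> i' - 1" | "j = i' - 1" "i' < i" | "j = i' - 1" "i' = i" | "j = i' - 1" "i' > i"
        by linarith
      then show ?thesis
      proof cases
        case 1 then show ?thesis using \<gamma>(2)[of i' c j] z zz by (auto simp: top_def \<gamma>'_def)
      next
        case 2
        then have "\<gamma> z = \<zero>" using less.IH[of i' c] z zz by (auto simp: jordan_index_def)
        then show ?thesis using 2 zz by (auto simp: top_def \<gamma>'_def)
      qed (use zz zc in \<open>auto simp: top_def \<gamma>'_def \<alpha>_def\<close>)
    qed
    obtain u where u: "u \<in> J \<rightarrow> carrier R" "lincomb J \<gamma>' v = (\<theta> ^^ i) (lincomb J u v)"
    proof -
      have "\<exists>u\<in>J \<rightarrow> carrier R. lincomb J \<gamma>' v = (\<theta> ^^ i) (lincomb J u v)"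
      proof (rule lincomb_in_image'[OF \<gamma>'])
        fix i' c j assume "(i', c, j) \<in> J" "j < i"
        then show "\<gamma>' (i', c, j) = \<zero>" using \<gamma>(2)[of i' c j] by (cases "i' \<le> i") (auto simp: \<gamma>'_def)
      qed
      then show ?thesis using that by blast
    qed
    let ?t = "lincomb {..<a i} \<alpha> (\<lambda>c. (\<theta> ^^ (i - 1)) (x i c))"
    let ?u = "lincomb J u v"
    have uM: "?u \<in> carrier M" using lincomb_closed[OF u(1) v_closed] .
    have tM: "?t \<in> carrier M" unfolding lincomb_top[OF less.prems(1) \<alpha>]
      using lincomb_closed[OF top_closed[OF \<alpha>] v_closed] .
    have "\<zero>\<^bsub>M\<^esub> = lincomb J (\<lambda>z. top i \<alpha> z \<oplus> \<gamma>' z) v"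
      unfolding \<gamma>(3)[symmetric] using split \<gamma>(1) v_closed by (intro lincomb_cong) auto
    also have "\<dots> = ?t \<oplus>\<^bsub>M\<^esub> (\<theta> ^^ i) ?u"
      using lincomb_add[OF top_closed[OF \<alpha>] \<gamma>' v_closed] u(2) lincomb_top[OF less.prems(1) \<alpha>] by simp
    finally have "?t = \<ominus>\<^bsub>M\<^esub> (\<theta> ^^ i) ?u"
      using tM uM by (metis M.minus_equality pow_closed)
    also have "\<dots> = (\<theta> ^^ i) (\<ominus>\<^bsub>M\<^esub> ?u)"
      using linear_op_minus[OF linear_op_funpow[OF lin] uM] by simp
    finally have im: "\<exists>y\<in>carrier M. ?t = (\<theta> ^^ i) y" using uM by auto
    have "\<theta> ?t = lincomb {..<a i} \<alpha> (\<lambda>c. \<theta> ((\<theta> ^^ (i - 1)) (x i c)))"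
      using \<alpha> x_closed less.prems by (intro linear_op_lincomb lin) auto
    also have "\<dots> = lincomb {..<a i} \<alpha> (\<lambda>c. (\<theta> ^^ i) (x i c))"
    proof -
      have "\<theta> ((\<theta> ^^ (i - 1)) z) = (\<theta> ^^ i) z" for z using less.prems by (cases i) auto
      then show ?thesis by simp
    qed
    also have "\<dots> = lincomb {..<a i} (\<lambda>_. \<zero>) (\<lambda>c. x i c)"
      unfolding lincomb_def using \<alpha> x_closed chain_end less.prems
      by (intro M.finsum_cong') auto
    also have "\<dots> = \<zero>\<^bsub>M\<^esub>" using x_closed less.prems by (intro lincomb_zero) auto
    finally have "?t \<in> ker_im i" using im tM by (simp add: ker_im_def)
    then show ?case using ind[OF less.prems(1) \<alpha>] less.prems(2) by (auto simp: \<alpha>_def)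
  qed
  show "independent_family J v" unfolding independent_family_def
  proof (intro ballI impI)
    fix w z assume w: "w \<in> J \<rightarrow> carrier R" "lincomb J w v = \<zero>\<^bsub>M\<^esub>" "z \<in> J"
    \<comment> \<open>The members at distance \<open>l\<close> from the end of their chain are treated for decreasing \<open>l\<close>: once those at
      larger distance have coefficient zero, \<open>\<theta>\<^sup>l\<close> turns the relation into one between ends of chains.\<close>
    have levels: "w (i, c, j) = \<zero>" if "(i, c, j) \<in> J" "p - n \<le> i - 1 - j" "n \<le> p" for n i c j
      using that
    proof (induction n arbitrary: i c j)
      case 0
      then show ?case by (auto simp: jordan_index_def)
    next
      case (Suc n)
      define l where "l = p - Suc n"
      show ?case
      proof (cases "i - 1 - j = l")
        case False
        then show ?thesis using Suc l_def by auto
      next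
        case True
        have "shift l w (i, c, i - 1) = \<zero>"
        proof (rule ends_vanish)
          show "shift l w \<in> J \<rightarrow> carrier R" by (rule shift_closed[OF w(1)])
          show "lincomb J (shift l w) v = \<zero>\<^bsub>M\<^esub>" using pow_lincomb[OF w(1), of l] w(2) by simp
          show "i \<in> {1..p}" "c < a i" using Suc.prems by (auto simp: jordan_index_def)
          fix i c j assume ij: "(i, c, j) \<in> J" "j \<noteq> i - 1"
          show "shift l w (i, c, j) = \<zero>"
          proof (cases "l \<le> j")
            case True
            have "w (i, c, j - l) = \<zero>" using ij True Suc.prems(3)
              by (intro Suc.IH) (auto simp: jordan_index_def l_def)
            then show ?thesis by (simp add: shift_def)
          qed (simp add: shift_def)
        qed
        moreover have "l \<le> i - 1" "i - 1 - l = j" using True Suc.prems by (auto simp: jordan_index_def)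
        ultimately show ?thesis by (simp add: shift_def)
      qed
    qed
    obtain i c j where "z = (i, c, j)" by (cases z)
    then show "w z = \<zero>" using levels[of i c j p] w(3) by simp
  qed
qed

end

section \<open>Chains over a field\<close>

context plain_module begin

lemma linear_op_image_submodule:
  assumes "linear_op \<theta>"
  shows "submodule (\<theta> ` carrier M) R M"
proof (rule submoduleI)
  show "\<zero>\<^bsub>M\<^esub> \<in> \<theta> ` carrier M" using linear_op_zero[OF assms] by (metis M.zero_closed imageI)
  show "\<ominus>\<^bsub>M\<^esub> y \<in> \<theta> ` carrier M" if "y \<in> \<theta> ` carrier M" for y
    using that linear_op_minus[OF assms] by (metis (no_types, lifting) M.a_inv_closed imageE imageI)
  show "y \<oplus>\<^bsub>M\<^esub> z \<in> \<theta> ` carrier M" if yz: "y \<in> \<theta> ` carrier M" "z \<in> \<theta> ` carrier M" for y z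
  proof -
    obtain y' z' where "y = \<theta> y'" "z = \<theta> z'" "y' \<in> carrier M" "z' \<in> carrier M" using yz by blast
    then show ?thesis using assms by (intro image_eqI[of _ _ "y' \<oplus>\<^bsub>M\<^esub> z'"]) (auto simp: linear_op_def)
  qed
  show "s \<odot>\<^bsub>M\<^esub> y \<in> \<theta> ` carrier M" if y: "s \<in> carrier R" "y \<in> \<theta> ` carrier M" for s y
  proof -
    obtain y' where "y = \<theta> y'" "y' \<in> carrier M" using y by blast
    then show ?thesis using y assms by (intro image_eqI[of _ _ "s \<odot>\<^bsub>M\<^esub> y'"]) (auto simp: linear_op_def)
  qed
qed (use assms linear_op_closed in auto)

lemma submodule_plain_module: "submodule H R M \<Longrightarrow> plain_module R (M\<lparr>carrier := H\<rparr>)"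
  unfolding plain_module_def using submodule.submodule_is_module module_axioms by blast

lemma lincomb_submodule:
  assumes H: "submodule H R M" and "finite I" "c \<in> I \<rightarrow> carrier R" "v \<in> I \<rightarrow> H"
  shows "plain_module.lincomb (M\<lparr>carrier := H\<rparr>) I c v = lincomb I c v"
proof -
  interpret H: plain_module R "M\<lparr>carrier := H\<rparr>" using H by (rule submodule_plain_module)
  have HM: "H \<subseteq> carrier M" using submoduleE(1)[OF H] .
  show ?thesis using assms(2-)
  proof (induction I rule: finite_induct)
    case (insert i I)
    then have "v \<in> insert i I \<rightarrow> carrier M" using HM by auto
    then show ?case using insert by (simp add: H.lincomb_insert lincomb_insert)
  qed simp
qed

text \<open>
  Let \<open>\<theta>\<close> be an operator over a field whose powers have images no larger than those of an operator
  \<open>\<theta>'\<close> of Jordan type \<open>a\<close>.  If the truncated \<open>\<theta>\<close>-chains on some vectors, with the lengths that \<open>a\<close>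
  prescribes, form a basis, then by counting the image of \<open>\<theta>\<^sup>m\<close> is spanned by the members of these
  chains from the \<open>m\<close>-th on.
\<close>

lemma chain_coords_vanish:
  assumes field: "field R"
    and \<theta>: "linear_op \<theta>" and im: "\<And>m w. w \<in> carrier M \<Longrightarrow> (\<theta> ^^ m) w \<in> (\<theta>' ^^ m) ` carrier M"
    and jordan: "chains R M \<theta>' p a \<xi>" "is_basis_family R M (jordan_index p a) (chain_family \<theta>' \<xi>)"
    and y: "is_basis_family R M (jordan_index p a) (chain_family \<theta> y)"
    and w: "w \<in> carrier M" and c: "c \<in> jordan_index p a \<rightarrow> carrier R"
    and eq: "(\<theta> ^^ m) w = lincomb (jordan_index p a) c (chain_family \<theta> y)"
    and z: "(i, k, j) \<in> jordan_index p a" "j < m"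
  shows "c (i, k, j) = \<zero>"
proof -
  interpret C: chains R M \<theta>' p a \<xi> by (rule jordan)
  define J where "J = jordan_index p a"
  define H where "H = (\<theta>' ^^ m) ` carrier M"
  define Jm where "Jm = {(i, c, j) \<in> J. m \<le> j}"
  note fJ = finite_jordan_index[of p a, folded J_def]
  have Jm: "Jm \<subseteq> J" "finite Jm" using fJ by (auto simp: Jm_def intro: finite_subset[of _ J])
  let ?\<xi> = "chain_family \<theta>' \<xi>" and ?y = "chain_family \<theta> y"
  note b\<xi> = is_basis_familyD[OF jordan(2)[folded J_def] fJ]
  note yB = is_basis_familyD[OF y[folded J_def] fJ]
  have H: "submodule H R M" unfolding H_def
    by (intro linear_op_image_submodule linear_op_funpow C.lin)
  interpret H: plain_module R "M\<lparr>carrier := H\<rparr>" using H by (rule submodule_plain_module)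
  have HM: "H \<subseteq> carrier M" using submoduleE(1)[OF H] .
  have \<xi>H: "?\<xi> \<in> Jm \<rightarrow> H"
  proof
    fix z assume z: "z \<in> Jm"
    then obtain i c j where ij: "z = (i, c, j)" "m \<le> j" "z \<in> J" by (auto simp: Jm_def)
    have "?\<xi> z = (\<theta>' ^^ m) ((\<theta>' ^^ (j - m)) (\<xi> i c))"
      using ij(2) by (simp add: chain_family_def ij(1) flip: funpow_add comp_apply[of "\<theta>' ^^ m" "\<theta>' ^^ (j - m)"])
    moreover have "(\<theta>' ^^ (j - m)) (\<xi> i c) \<in> carrier M"
      using ij C.x_closed by (auto simp: J_def jordan_index_def)
    ultimately show "?\<xi> z \<in> H" unfolding H_def by simp
  qed
  have x: "y i c \<in> carrier M" if "(i, c, 0) \<in> J" for i c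
    using yB(1) that by (auto simp: chain_family_def)
  have yH: "?y \<in> Jm \<rightarrow> H"
  proof
    fix z assume z: "z \<in> Jm"
    then obtain i c j where ij: "z = (i, c, j)" "m \<le> j" "z \<in> J" by (auto simp: Jm_def)
    have "?y z = (\<theta> ^^ m) ((\<theta> ^^ (j - m)) (y i c))"
      using ij(2) by (simp add: chain_family_def ij(1) flip: funpow_add comp_apply[of "\<theta> ^^ m" "\<theta> ^^ (j - m)"])
    moreover have "y i c \<in> carrier M" using ij x by (auto simp: J_def jordan_index_def)
    then have "(\<theta> ^^ (j - m)) (y i c) \<in> carrier M" by (intro linear_op_closed[OF linear_op_funpow[OF \<theta>]])
    ultimately show "?y z \<in> H" unfolding H_def using im by simp
  qed
  have sub: "H.independent_family Jm f" if f: "independent_family J f" "f \<in> J \<rightarrow> carrier M" "f \<in> Jm \<rightarrow> H" for f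
    unfolding H.independent_family_def
  proof (intro ballI impI)
    fix c z assume c: "c \<in> Jm \<rightarrow> carrier R" "H.lincomb Jm c f = \<zero>\<^bsub>M\<lparr>carrier := H\<rparr>\<^esub>" "z \<in> Jm"
    let ?d = "\<lambda>z. if z \<in> Jm then c z else \<zero>"
    have d: "?d \<in> J \<rightarrow> carrier R" using c by auto
    have "lincomb J ?d f = lincomb Jm ?d f" using d f(2) by (intro lincomb_neutral[OF fJ Jm(1)]) auto
    also have "\<dots> = lincomb Jm c f" using c f(2) Jm(1) by (intro lincomb_cong) auto
    also have "\<dots> = \<zero>\<^bsub>M\<^esub>" using c(2) lincomb_submodule[OF H Jm(2) c(1) f(3)] by simp
    finally have "?d z = \<zero>" using f(1) d c(3) Jm(1) unfolding independent_family_def by blast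
    then show "c z = \<zero>" using c(3) by simp
  qed
  have bH: "is_basis_family R (M\<lparr>carrier := H\<rparr>) Jm ?\<xi>"
  proof (rule H.is_basis_familyI[OF Jm(2)])
    show "H.independent_family Jm ?\<xi>" using sub b\<xi> \<xi>H by blast
    fix u assume "u \<in> carrier (M\<lparr>carrier := H\<rparr>)"
    then have u: "u \<in> H" by simp
    then obtain d where d: "d \<in> J \<rightarrow> carrier R" "u = lincomb J d ?\<xi>" using b\<xi>(3) HM by blast
    have d0: "\<forall>i c j. (i, c, j) \<in> J \<longrightarrow> j < m \<longrightarrow> d (i, c, j) = \<zero>"
      using C.image_iff_coords[OF jordan(2), of d m] d u unfolding J_def H_def by blast
    have "lincomb J d ?\<xi> = lincomb Jm d ?\<xi>"
    proof (rule lincomb_neutral[OF fJ Jm(1)])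
      fix z assume z: "z \<in> J - Jm"
      obtain i c j where ij: "z = (i, c, j)" by (cases z)
      then have "(i, c, j) \<in> J" "j < m" using z by (auto simp: Jm_def)
      then show "d z = \<zero> \<or> ?\<xi> z = \<zero>\<^bsub>M\<^esub>" using d0 ij by blast
    qed (use d(1) b\<xi>(1) in auto)
    moreover have dm: "d \<in> Jm \<rightarrow> carrier R" using d(1) Jm by auto
    ultimately show "\<exists>c\<in>Jm \<rightarrow> carrier R. u = H.lincomb Jm c ?\<xi>"
      using lincomb_submodule[OF H Jm(2) dm \<xi>H] d(2) by (intro bexI[of _ d]) auto
  qed (use \<xi>H in auto)
  \<comment> \<open>Both families on \<open>Jm\<close> have the same number of members and the first one is a basis of \<open>H\<close>, so the
    second one, being independent and contained in \<open>H\<close>, is a basis as well.\<close>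
  have yb: "is_basis_family R (M\<lparr>carrier := H\<rparr>) Jm ?y"
    using yH by (intro H.independent_family_card(2)[OF field Jm(2) bH Jm(2) _ sub[OF yB(2,1)]]) auto
  have "(\<theta> ^^ m) w \<in> carrier (M\<lparr>carrier := H\<rparr>)" using im[OF w] by (simp add: H_def)
  from H.is_basis_familyD(3)[OF yb Jm(2) this] obtain d where
    d: "d \<in> Jm \<rightarrow> carrier R" "(\<theta> ^^ m) w = H.lincomb Jm d ?y" by blast
  let ?d = "\<lambda>z. if z \<in> Jm then d z else \<zero>"
  have d': "?d \<in> J \<rightarrow> carrier R" using d by auto
  have "lincomb J ?d ?y = lincomb Jm ?d ?y" using d' yB(1) by (intro lincomb_neutral[OF fJ Jm(1)]) auto
  also have "\<dots> = lincomb Jm d ?y" using d(1) yB(1) Jm(1) by (intro lincomb_cong) auto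
  also have "\<dots> = (\<theta> ^^ m) w" using d(2) lincomb_submodule[OF H Jm(2) d(1) yH] by simp
  finally have "lincomb J c ?y = lincomb J ?d ?y" using eq by (simp add: J_def)
  then have "c (i, k, j) = ?d (i, k, j)"
    using independent_familyD[OF yB(2) fJ _ d' yB(1), of c "(i, k, j)"] c z by (simp add: J_def)
  then show ?thesis using z by (simp add: Jm_def)
qed

end

section \<open>Free modules and matrices\<close>

lemma free_module_simps:
  "carrier (free_module K B) = B \<rightarrow>\<^sub>E carrier K"
  "\<zero>\<^bsub>free_module K B\<^esub> = (\<lambda>b\<in>B. \<zero>\<^bsub>K\<^esub>)"
  "x \<oplus>\<^bsub>free_module K B\<^esub> y = (\<lambda>b\<in>B. x b \<oplus>\<^bsub>K\<^esub> y b)"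
  "c \<odot>\<^bsub>free_module K B\<^esub> x = (\<lambda>b\<in>B. c \<otimes>\<^bsub>K\<^esub> x b)"
  by (simp_all add: free_module_def)

lemma restrict_eqI: "(\<And>b. b \<in> B \<Longrightarrow> f b = g b) \<Longrightarrow> restrict f B = restrict g B"
  by auto

lemma PiE_eq_restrictI: "x \<in> B \<rightarrow>\<^sub>E A \<Longrightarrow> (\<And>b. b \<in> B \<Longrightarrow> x b = f b) \<Longrightarrow> x = restrict f B"
  by (auto simp: fun_eq_iff PiE_def extensional_def)

definition mat_op :: "('r, 'x) ring_scheme \<Rightarrow> 'i set \<Rightarrow> ('i \<Rightarrow> 'i \<Rightarrow> 'r) \<Rightarrow> ('i \<Rightarrow> 'r) \<Rightarrow> 'i \<Rightarrow> 'r" where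
  "mat_op K B A x = (\<lambda>b'\<in>B. \<Oplus>\<^bsub>K\<^esub> b\<in>B. A b' b \<otimes>\<^bsub>K\<^esub> x b)"

text \<open>
  The matrix with rows \<open>v i\<close> has the inverse \<open>g\<close>.  Bases of free modules are carried around together
  with such an inverse because, unlike the property of being a basis, it consists of finitely many
  identities, which spread from a point to a neighbourhood.
\<close>

definition dual_matrix ::
  "('r, 'x) ring_scheme \<Rightarrow> 'i set \<Rightarrow> 'j set \<Rightarrow> ('j \<Rightarrow> 'i \<Rightarrow> 'r) \<Rightarrow> ('i \<Rightarrow> 'j \<Rightarrow> 'r) \<Rightarrow> bool" where
  "dual_matrix K B I v g \<longleftrightarrow>
    (\<forall>b\<in>B. \<forall>i\<in>I. g b i \<in> carrier K) \<and>
    (\<forall>b\<in>B. \<forall>b'\<in>B. (\<Oplus>\<^bsub>K\<^esub> i\<in>I. g b i \<otimes>\<^bsub>K\<^esub> v i b') = (if b = b' then \<one>\<^bsub>K\<^esub> else \<zero>\<^bsub>K\<^esub>)) \<and>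
    (\<forall>i\<in>I. \<forall>i'\<in>I. (\<Oplus>\<^bsub>K\<^esub> b\<in>B. v i b \<otimes>\<^bsub>K\<^esub> g b i') = (if i = i' then \<one>\<^bsub>K\<^esub> else \<zero>\<^bsub>K\<^esub>))"

context cring begin

declare Pi_iff [simp]

lemma free_module_plain_module: "plain_module R (free_module R B)"
proof (rule plain_module.intro, rule moduleI)
  show "cring R" by (rule is_cring)
  show "abelian_group (free_module R B)"
  proof (rule abelian_groupI)
    show "\<exists>y\<in>carrier (free_module R B). y \<oplus>\<^bsub>free_module R B\<^esub> x = \<zero>\<^bsub>free_module R B\<^esub>"
      if "x \<in> carrier (free_module R B)" for x
      using that by (intro bexI[of _ "\<lambda>b\<in>B. \<ominus> x b"]) (auto simp: free_module_simps l_neg PiE_iff intro!: restrict_eqI)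
  qed (auto simp: free_module_simps a_ac PiE_iff extensional_def fun_eq_iff)
qed (auto simp: free_module_simps l_distr r_distr m_assoc PiE_iff extensional_def fun_eq_iff)

abbreviation "flc B \<equiv> plain_module.lincomb (free_module R B)"

lemma lincomb_free:
  assumes "finite I" "c \<in> I \<rightarrow> carrier R" "v \<in> I \<rightarrow> (B \<rightarrow>\<^sub>E carrier R)"
  shows "flc B I c v = (\<lambda>b\<in>B. \<Oplus>i\<in>I. c i \<otimes> v i b)"
proof -
  interpret F: plain_module R "free_module R B" by (rule free_module_plain_module)
  show ?thesis using assms
  proof (induction I rule: finite_induct)
    case empty
    then show ?case by (simp add: free_module_simps)
  next
    case (insert i I)
    have v: "v i b \<in> carrier R" "\<And>j. j \<in> I \<Longrightarrow> v j b \<in> carrier R" if "b \<in> B" for b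
      using insert.prems that by (auto simp: PiE_iff)
    show ?case using insert v
      by (simp add: F.lincomb_insert free_module_simps) (auto intro!: restrict_eqI)
  qed
qed

lemma mat_op_linear:
  assumes "finite B" "\<And>b b'. b \<in> B \<Longrightarrow> b' \<in> B \<Longrightarrow> A b b' \<in> carrier R"
  shows "plain_module.linear_op R (free_module R B) (mat_op R B A)"
proof -
  interpret F: plain_module R "free_module R B" by (rule free_module_plain_module)
  show ?thesis unfolding F.linear_op_def
  proof (intro conjI ballI)
    fix x assume x: "x \<in> carrier (free_module R B)"
    then have xc: "x b \<in> carrier R" if "b \<in> B" for b using that by (auto simp: free_module_simps PiE_iff)
    show "mat_op R B A x \<in> carrier (free_module R B)"
      using xc assms by (auto simp: mat_op_def free_module_simps PiE_iff intro!: finsum_closed)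
    show "mat_op R B A (s \<odot>\<^bsub>free_module R B\<^esub> x) = s \<odot>\<^bsub>free_module R B\<^esub> mat_op R B A x"
      if s: "s \<in> carrier R" for s
      unfolding mat_op_def free_module_simps
    proof (rule restrict_eqI)
      fix b' assume b': "b' \<in> B"
      have "(\<Oplus>b\<in>B. A b' b \<otimes> (\<lambda>b\<in>B. s \<otimes> x b) b) = (\<Oplus>b\<in>B. s \<otimes> (A b' b \<otimes> x b))"
        using xc s assms(2) b' by (intro finsum_cong') (auto simp: m_lcomm)
      also have "\<dots> = s \<otimes> (\<Oplus>b\<in>B. A b' b \<otimes> x b)"
        using xc s assms b' by (intro finsum_rdistr[symmetric]) auto
      finally show "(\<Oplus>b\<in>B. A b' b \<otimes> (\<lambda>b\<in>B. s \<otimes> x b) b) = s \<otimes> (\<lambda>b'\<in>B. \<Oplus>b\<in>B. A b' b \<otimes> x b) b'"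
        using b' by simp
    qed
    fix y assume y: "y \<in> carrier (free_module R B)"
    then have yc: "y b \<in> carrier R" if "b \<in> B" for b using that by (auto simp: free_module_simps PiE_iff)
    show "mat_op R B A (x \<oplus>\<^bsub>free_module R B\<^esub> y) = mat_op R B A x \<oplus>\<^bsub>free_module R B\<^esub> mat_op R B A y"
      unfolding mat_op_def free_module_simps
    proof (rule restrict_eqI)
      fix b' assume b': "b' \<in> B"
      have "(\<Oplus>b\<in>B. A b' b \<otimes> (\<lambda>b\<in>B. x b \<oplus> y b) b) = (\<Oplus>b\<in>B. A b' b \<otimes> x b \<oplus> A b' b \<otimes> y b)"
        using xc yc assms(2) b' by (intro finsum_cong') (auto simp: r_distr)
      also have "\<dots> = (\<Oplus>b\<in>B. A b' b \<otimes> x b) \<oplus> (\<Oplus>b\<in>B. A b' b \<otimes> y b)"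
        using xc yc assms(2) b' by (intro finsum_addf) auto
      finally show "(\<Oplus>b\<in>B. A b' b \<otimes> (\<lambda>b\<in>B. x b \<oplus> y b) b)
        = (\<lambda>b'\<in>B. \<Oplus>b\<in>B. A b' b \<otimes> x b) b' \<oplus> (\<lambda>b'\<in>B. \<Oplus>b\<in>B. A b' b \<otimes> y b) b'"
        using b' by simp
    qed
  qed
qed

lemma finsum_delta:
  assumes "finite I" "k \<in> I" "f \<in> I \<rightarrow> carrier R"
  shows "(\<Oplus>i\<in>I. f i \<otimes> (if i = k then \<one> else \<zero>)) = f k"
    "(\<Oplus>i\<in>I. f i \<otimes> (if k = i then \<one> else \<zero>)) = f k"
proof -
  have "(\<Oplus>i\<in>I. f i \<otimes> (if i = k then \<one> else \<zero>)) = (\<Oplus>i\<in>I. if k = i then f i else \<zero>)"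
    using assms by (intro finsum_cong') auto
  also have "\<dots> = f k" using assms by (intro finsum_singleton) auto
  finally show "(\<Oplus>i\<in>I. f i \<otimes> (if i = k then \<one> else \<zero>)) = f k" .
  then show "(\<Oplus>i\<in>I. f i \<otimes> (if k = i then \<one> else \<zero>)) = f k" by (simp add: eq_commute[of k] cong: if_cong)
qed

lemma finsum_swap:
  assumes "finite I" "finite B" "\<And>i b. i \<in> I \<Longrightarrow> b \<in> B \<Longrightarrow> f i b \<in> carrier R"
  shows "(\<Oplus>i\<in>I. \<Oplus>b\<in>B. f i b) = (\<Oplus>b\<in>B. \<Oplus>i\<in>I. f i b)"
  using assms(1,3)
proof (induction I rule: finite_induct)
  case (insert i I)
  have "(\<Oplus>b\<in>B. \<Oplus>i\<in>insert i I. f i b) = (\<Oplus>b\<in>B. f i b \<oplus> (\<Oplus>i\<in>I. f i b))"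
    using insert by (intro finsum_cong') (auto intro!: finsum_closed)
  also have "\<dots> = (\<Oplus>b\<in>B. f i b) \<oplus> (\<Oplus>b\<in>B. \<Oplus>i\<in>I. f i b)"
    using insert by (intro finsum_addf) (auto intro!: finsum_closed)
  finally show ?case using insert assms(2) by (simp add: finsum_closed)
qed simp

text \<open>Matrix associativity: \<open>\<Sum>\<^sub>i (\<Sum>\<^sub>b w\<^sub>b g\<^sub>b\<^sub>i) v\<^sub>i = \<Sum>\<^sub>b w\<^sub>b (\<Sum>\<^sub>i g\<^sub>b\<^sub>i v\<^sub>i)\<close>.\<close>

lemma finsum_assoc:
  assumes "finite I" "finite B" "w \<in> B \<rightarrow> carrier R" "u \<in> I \<rightarrow> carrier R"
    "\<And>i b. i \<in> I \<Longrightarrow> b \<in> B \<Longrightarrow> g b i \<in> carrier R"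
  shows "(\<Oplus>i\<in>I. (\<Oplus>b\<in>B. w b \<otimes> g b i) \<otimes> u i) = (\<Oplus>b\<in>B. w b \<otimes> (\<Oplus>i\<in>I. g b i \<otimes> u i))"
proof -
  have "(\<Oplus>i\<in>I. (\<Oplus>b\<in>B. w b \<otimes> g b i) \<otimes> u i) = (\<Oplus>i\<in>I. \<Oplus>b\<in>B. w b \<otimes> g b i \<otimes> u i)"
    using assms by (intro finsum_cong' finsum_ldistr) auto
  also have "\<dots> = (\<Oplus>b\<in>B. \<Oplus>i\<in>I. w b \<otimes> g b i \<otimes> u i)"
    using assms by (intro finsum_swap) auto
  also have "\<dots> = (\<Oplus>b\<in>B. w b \<otimes> (\<Oplus>i\<in>I. g b i \<otimes> u i))"
    using assms by (intro finsum_cong') (auto simp: finsum_rdistr m_assoc intro!: finsum_cong')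
  finally show ?thesis .
qed

lemma dual_matrix_coords:
  assumes "finite I" "finite B" "v \<in> I \<rightarrow> (B \<rightarrow>\<^sub>E carrier R)" "dual_matrix R B I v g" "c \<in> I \<rightarrow> carrier R" "i \<in> I"
  shows "(\<Oplus>b\<in>B. flc B I c v b \<otimes> g b i) = c i"
proof -
  have vc: "v i b \<in> carrier R" if "i \<in> I" "b \<in> B" for i b using assms(3) that by (auto simp: PiE_iff)
  have g: "g b i \<in> carrier R" if "i \<in> I" "b \<in> B" for i b using assms(4) that by (auto simp: dual_matrix_def)
  have "(\<Oplus>b\<in>B. flc B I c v b \<otimes> g b i) = (\<Oplus>b\<in>B. (\<Oplus>k\<in>I. c k \<otimes> v k b) \<otimes> g b i)"
    using assms g vc by (intro finsum_cong') (auto simp: lincomb_free intro!: finsum_closed)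
  also have "\<dots> = (\<Oplus>k\<in>I. c k \<otimes> (\<Oplus>b\<in>B. v k b \<otimes> g b i))"
    using assms vc g by (intro finsum_assoc) auto
  also have "\<dots> = (\<Oplus>k\<in>I. c k \<otimes> (if k = i then \<one> else \<zero>))"
    using assms by (intro finsum_cong') (auto simp: dual_matrix_def)
  also have "\<dots> = c i" using assms by (intro finsum_delta) auto
  finally show ?thesis .
qed

lemma dual_matrix_expand:
  assumes "finite I" "finite B" "v \<in> I \<rightarrow> (B \<rightarrow>\<^sub>E carrier R)" "dual_matrix R B I v g" "w \<in> B \<rightarrow>\<^sub>E carrier R"
  shows "flc B I (\<lambda>i. \<Oplus>b\<in>B. w b \<otimes> g b i) v = w"
proof -
  have vc: "v i b \<in> carrier R" if "i \<in> I" "b \<in> B" for i b using assms(3) that by (auto simp: PiE_iff)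
  have wc: "w b \<in> carrier R" if "b \<in> B" for b using assms(5) that by (auto simp: PiE_iff)
  have g: "g b i \<in> carrier R" if "i \<in> I" "b \<in> B" for i b using assms(4) that by (auto simp: dual_matrix_def)
  have "flc B I (\<lambda>i. \<Oplus>b\<in>B. w b \<otimes> g b i) v = (\<lambda>b'\<in>B. \<Oplus>i\<in>I. (\<Oplus>b\<in>B. w b \<otimes> g b i) \<otimes> v i b')"
    using assms g wc by (intro lincomb_free) (auto intro!: finsum_closed)
  also have "\<dots> = (\<lambda>b'\<in>B. w b')"
  proof (rule restrict_eqI)
    fix b' assume b': "b' \<in> B"
    have "(\<Oplus>i\<in>I. (\<Oplus>b\<in>B. w b \<otimes> g b i) \<otimes> v i b') = (\<Oplus>b\<in>B. w b \<otimes> (\<Oplus>i\<in>I. g b i \<otimes> v i b'))"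
      using assms vc g wc b' by (intro finsum_assoc) auto
    also have "\<dots> = (\<Oplus>b\<in>B. w b \<otimes> (if b = b' then \<one> else \<zero>))"
      using assms wc b' by (intro finsum_cong') (auto simp: dual_matrix_def)
    also have "\<dots> = w b'" using assms wc b' by (intro finsum_delta) auto
    finally show "(\<Oplus>i\<in>I. (\<Oplus>b\<in>B. w b \<otimes> g b i) \<otimes> v i b') = w b'" .
  qed
  also have "\<dots> = w" using assms(5) by (auto simp: fun_eq_iff PiE_iff extensional_def)
  finally show ?thesis .
qed

lemma dual_matrix_basis:
  assumes "finite I" "finite B" "v \<in> I \<rightarrow> (B \<rightarrow>\<^sub>E carrier R)" "dual_matrix R B I v g"
  shows "is_basis_family R (free_module R B) I v"
proof -
  interpret F: plain_module R "free_module R B" by (rule free_module_plain_module)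
  have g: "g b i \<in> carrier R" if "i \<in> I" "b \<in> B" for i b using assms(4) that by (auto simp: dual_matrix_def)
  show ?thesis
  proof (rule F.is_basis_familyI[OF assms(1)])
    show "v \<in> I \<rightarrow> carrier (free_module R B)" using assms(3) by (simp add: free_module_simps)
    show "\<exists>c\<in>I \<rightarrow> carrier R. w = flc B I c v" if w: "w \<in> carrier (free_module R B)" for w
      using dual_matrix_expand[OF assms, of w] w g assms(2)
      by (intro bexI[of _ "\<lambda>i. \<Oplus>b\<in>B. w b \<otimes> g b i"])
        (auto simp: free_module_simps PiE_iff intro!: finsum_closed)
    show "F.independent_family I v" unfolding F.independent_family_def
    proof (intro ballI impI)
      fix c i assume c: "c \<in> I \<rightarrow> carrier R" "flc B I c v = \<zero>\<^bsub>free_module R B\<^esub>" "i \<in> I"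
      have "c i = (\<Oplus>b\<in>B. flc B I c v b \<otimes> g b i)" using dual_matrix_coords[OF assms c(1,3)] by simp
      also have "\<dots> = (\<Oplus>b\<in>B. \<zero>)"
        using c g by (intro finsum_cong') (auto simp: free_module_simps)
      finally show "c i = \<zero>" by simp
    qed
  qed
qed

lemma basis_dual_matrix:
  assumes I: "finite I" and B: "finite B" and v: "is_basis_family R (free_module R B) I v"
  shows "\<exists>g. dual_matrix R B I v g"
proof -
  interpret F: plain_module R "free_module R B" by (rule free_module_plain_module)
  note v = F.is_basis_familyD[OF v I]
  define e where "e = (\<lambda>b. \<lambda>b'\<in>B. if b = b' then \<one> else \<zero>)"
  have e: "e b \<in> carrier (free_module R B)" for b by (simp add: e_def free_module_simps PiE_iff)
  have "\<forall>b. \<exists>c. c \<in> I \<rightarrow> carrier R \<and> e b = flc B I c v" using v(3)[OF e] by blast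
  then obtain g where g: "\<And>b. g b \<in> I \<rightarrow> carrier R" "\<And>b. e b = flc B I (g b) v" by metis
  have vM: "v \<in> I \<rightarrow> (B \<rightarrow>\<^sub>E carrier R)" using v(1) by (simp add: free_module_simps)
  then have vc: "v i b \<in> carrier R" if "i \<in> I" "b \<in> B" for i b using that by (auto simp: PiE_iff)
  have 1: "(\<Oplus>i\<in>I. g b i \<otimes> v i b') = (if b = b' then \<one> else \<zero>)" if "b' \<in> B" for b b'
    using fun_cong[OF g(2)[of b], of b'] that lincomb_free[OF I g(1) vM, of b] by (simp add: e_def)
  have 2: "(\<Oplus>b\<in>B. v i b \<otimes> g b i') = (if i = i' then \<one> else \<zero>)" if i: "i \<in> I" "i' \<in> I" for i i'
  proof -
    let ?c = "\<lambda>k. \<Oplus>b\<in>B. v i b \<otimes> g b k"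
    have c: "?c \<in> I \<rightarrow> carrier R" using i vc g(1) B by (auto intro!: finsum_closed)
    have "flc B I ?c v = (\<lambda>b'\<in>B. \<Oplus>k\<in>I. (\<Oplus>b\<in>B. v i b \<otimes> g b k) \<otimes> v k b')"
      by (rule lincomb_free[OF I c vM])
    also have "\<dots> = v i"
    proof (rule PiE_eq_restrictI[symmetric])
      show "v i \<in> B \<rightarrow>\<^sub>E carrier R" using vM i by simp
      fix b' assume b': "b' \<in> B"
      have "(\<Oplus>k\<in>I. (\<Oplus>b\<in>B. v i b \<otimes> g b k) \<otimes> v k b') = (\<Oplus>b\<in>B. v i b \<otimes> (\<Oplus>k\<in>I. g b k \<otimes> v k b'))"
        using I B i b' vc g(1) by (intro finsum_assoc) auto
      also have "\<dots> = (\<Oplus>b\<in>B. v i b \<otimes> (if b = b' then \<one> else \<zero>))"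
        using vc i b' 1 by (intro finsum_cong') auto
      also have "\<dots> = v i b'" using B b' vc i by (intro finsum_delta) auto
      finally show "v i b' = (\<Oplus>k\<in>I. (\<Oplus>b\<in>B. v i b \<otimes> g b k) \<otimes> v k b')" ..
    qed
    also have "v i = flc B I (\<lambda>k. if k = i then \<one> else \<zero>) v"
      using F.lincomb_delta[OF I i(1) v(1)] by simp
    finally have "?c i' = (if i' = i then \<one> else \<zero>)"
      by (intro F.independent_familyD[OF v(2) I c _ v(1) _ i(2)]) auto
    then show ?thesis by auto
  qed
  have "dual_matrix R B I v g" unfolding dual_matrix_def using 1 2 g(1) by auto
  then show ?thesis by blast
qed

lemma std_basis:
  assumes "finite B"
  shows "is_basis_family R (free_module R B) B (\<lambda>b. \<lambda>b'\<in>B. if b = b' then \<one> else \<zero>)"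
proof (rule dual_matrix_basis[OF assms assms])
  show "dual_matrix R B B (\<lambda>b. \<lambda>b'\<in>B. if b = b' then \<one> else \<zero>) (\<lambda>b b'. if b = b' then \<one> else \<zero>)"
    unfolding dual_matrix_def
  proof (intro conjI ballI)
    fix b b' assume b: "b \<in> B" "b' \<in> B"
    have "(\<Oplus>i\<in>B. (if b = i then \<one> else \<zero>) \<otimes> (\<lambda>b'\<in>B. if i = b' then \<one> else \<zero>) b')
      = (\<Oplus>i\<in>B. (if b = i then \<one> else \<zero>) \<otimes> (if i = b' then \<one> else \<zero>))"
      using b by (intro finsum_cong') auto
    also have "\<dots> = (if b = b' then \<one> else \<zero>)" using assms b by (intro finsum_delta) auto
    finally show "(\<Oplus>i\<in>B. (if b = i then \<one> else \<zero>) \<otimes> (\<lambda>b'\<in>B. if i = b' then \<one> else \<zero>) b')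
      = (if b = b' then \<one> else \<zero>)" .
    have "(\<Oplus>i\<in>B. (\<lambda>b'\<in>B. if b = b' then \<one> else \<zero>) i \<otimes> (if i = b' then \<one> else \<zero>))
      = (\<Oplus>i\<in>B. (if b = i then \<one> else \<zero>) \<otimes> (if i = b' then \<one> else \<zero>))"
      using b by (intro finsum_cong') auto
    also have "\<dots> = (if b = b' then \<one> else \<zero>)" using assms b by (intro finsum_delta) auto
    finally show "(\<Oplus>i\<in>B. (\<lambda>b'\<in>B. if b = b' then \<one> else \<zero>) i \<otimes> (if i = b' then \<one> else \<zero>))
      = (if b = b' then \<one> else \<zero>)" .
  qed auto
qed auto

end

section \<open>Reduction modulo the maximal ideal\<close>

locale reduction = ring_hom_cring R S h for R (structure) and S (structure) and h
begin

declare Pi_iff [simp]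

definition vmap :: "'i set \<Rightarrow> ('i \<Rightarrow> 'a) \<Rightarrow> 'i \<Rightarrow> 'c" where
  "vmap B x = (\<lambda>b\<in>B. h (x b))"

lemma vmap_closed: "x \<in> B \<rightarrow>\<^sub>E carrier R \<Longrightarrow> vmap B x \<in> B \<rightarrow>\<^sub>E carrier S"
  by (auto simp: vmap_def PiE_iff)

lemma vmap_lincomb:
  assumes "finite I" "c \<in> I \<rightarrow> carrier R" "v \<in> I \<rightarrow> (B \<rightarrow>\<^sub>E carrier R)"
  shows "vmap B (R.flc B I c v) = S.flc B I (\<lambda>i. h (c i)) (\<lambda>i. vmap B (v i))"
proof -
  have vc: "v i b \<in> carrier R" if "i \<in> I" "b \<in> B" for i b using assms(3) that by (auto simp: PiE_iff)
  have "vmap B (R.flc B I c v) = (\<lambda>b\<in>B. h (\<Oplus>i\<in>I. c i \<otimes> v i b))"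
    unfolding R.lincomb_free[OF assms] vmap_def by (auto intro!: restrict_eqI)
  also have "\<dots> = (\<lambda>b\<in>B. \<Oplus>\<^bsub>S\<^esub>i\<in>I. h (c i) \<otimes>\<^bsub>S\<^esub> vmap B (v i) b)"
  proof (rule restrict_eqI)
    fix b assume b: "b \<in> B"
    have "h (\<Oplus>i\<in>I. c i \<otimes> v i b) = (\<Oplus>\<^bsub>S\<^esub>i\<in>I. h (c i \<otimes> v i b))"
      using assms(2) vc b by (subst hom_finsum) (auto simp: o_def)
    also have "\<dots> = (\<Oplus>\<^bsub>S\<^esub>i\<in>I. h (c i) \<otimes>\<^bsub>S\<^esub> vmap B (v i) b)"
      using assms(2) vc b by (intro S.finsum_cong') (auto simp: vmap_def)
    finally show "h (\<Oplus>i\<in>I. c i \<otimes> v i b) = (\<Oplus>\<^bsub>S\<^esub>i\<in>I. h (c i) \<otimes>\<^bsub>S\<^esub> vmap B (v i) b)" .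
  qed
  also have "\<dots> = S.flc B I (\<lambda>i. h (c i)) (\<lambda>i. vmap B (v i))"
    using assms by (intro S.lincomb_free[symmetric]) (simp_all add: vmap_closed)
  finally show ?thesis .
qed

lemma vmap_mat_op:
  assumes "\<And>b b'. b \<in> B \<Longrightarrow> b' \<in> B \<Longrightarrow> A b b' \<in> carrier R" "x \<in> B \<rightarrow>\<^sub>E carrier R"
  shows "vmap B (mat_op R B A x) = mat_op S B (\<lambda>b b'. h (A b b')) (vmap B x)"
  unfolding mat_op_def vmap_def
proof (rule restrict_eqI)
  fix b' assume b': "b' \<in> B"
  have xc: "x b \<in> carrier R" if "b \<in> B" for b using assms(2) that by (auto simp: PiE_iff)
  have "h (\<Oplus>b\<in>B. A b' b \<otimes> x b) = (\<Oplus>\<^bsub>S\<^esub>b\<in>B. h (A b' b \<otimes> x b))"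
    using assms(1) xc b' by (subst hom_finsum) (auto simp: o_def)
  also have "\<dots> = (\<Oplus>\<^bsub>S\<^esub>b\<in>B. h (A b' b) \<otimes>\<^bsub>S\<^esub> (\<lambda>b\<in>B. h (x b)) b)"
    using assms(1) xc b' by (intro S.finsum_cong') auto
  finally show "h ((\<lambda>b'\<in>B. \<Oplus>b\<in>B. A b' b \<otimes> x b) b') = (\<Oplus>\<^bsub>S\<^esub>b\<in>B. h (A b' b) \<otimes>\<^bsub>S\<^esub> (\<lambda>b\<in>B. h (x b)) b)"
    using b' by simp
qed

lemma vmap_mat_op_pow:
  assumes "finite B" "\<And>b b'. b \<in> B \<Longrightarrow> b' \<in> B \<Longrightarrow> A b b' \<in> carrier R" "x \<in> B \<rightarrow>\<^sub>E carrier R"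
  shows "vmap B ((mat_op R B A ^^ n) x) = (mat_op S B (\<lambda>b b'. h (A b b')) ^^ n) (vmap B x)"
proof (induction n)
  case (Suc n)
  interpret F: plain_module R "free_module R B" by (rule R.free_module_plain_module)
  have "(mat_op R B A ^^ n) x \<in> B \<rightarrow>\<^sub>E carrier R"
  proof -
    have "(mat_op R B A ^^ n) x \<in> carrier (free_module R B)"
      by (intro F.linear_op_closed[OF F.linear_op_funpow[OF R.mat_op_linear]])
        (use assms in \<open>auto simp: free_module_simps simp del: PiE_iff\<close>)
    then show ?thesis by (simp add: free_module_simps)
  qed
  then show ?case using Suc vmap_mat_op[of B A "(mat_op R B A ^^ n) x"] assms(2) by simp
qed simp

lemma dual_matrix_map:
  assumes "dual_matrix R B I v g" "v \<in> I \<rightarrow> (B \<rightarrow>\<^sub>E carrier R)" "finite B" "finite I"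
  shows "dual_matrix S B I (\<lambda>i. vmap B (v i)) (\<lambda>b i. h (g b i))"
proof -
  have vc: "v i b \<in> carrier R" if "i \<in> I" "b \<in> B" for i b using assms(2) that by (auto simp: PiE_iff)
  have g: "g b i \<in> carrier R" if "i \<in> I" "b \<in> B" for i b using assms(1) that by (auto simp: dual_matrix_def)
  show ?thesis unfolding dual_matrix_def
  proof (intro conjI ballI)
    show "h (g b i) \<in> carrier S" if "b \<in> B" "i \<in> I" for b i using g that by auto
    fix b b' assume b: "b \<in> B" "b' \<in> B"
    have "(\<Oplus>\<^bsub>S\<^esub>i\<in>I. h (g b i) \<otimes>\<^bsub>S\<^esub> vmap B (v i) b') = (\<Oplus>\<^bsub>S\<^esub>i\<in>I. h (g b i \<otimes> v i b'))"
      using g vc b by (intro S.finsum_cong') (auto simp: vmap_def)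
    also have "\<dots> = h (\<Oplus>i\<in>I. g b i \<otimes> v i b')"
      using g vc b by (subst hom_finsum) (auto simp: o_def)
    also have "\<dots> = (if b = b' then \<one>\<^bsub>S\<^esub> else \<zero>\<^bsub>S\<^esub>)"
      using assms(1) b by (auto simp: dual_matrix_def)
    finally show "(\<Oplus>\<^bsub>S\<^esub>i\<in>I. h (g b i) \<otimes>\<^bsub>S\<^esub> vmap B (v i) b') = (if b = b' then \<one>\<^bsub>S\<^esub> else \<zero>\<^bsub>S\<^esub>)" .
  next
    fix i i' assume i: "i \<in> I" "i' \<in> I"
    have "(\<Oplus>\<^bsub>S\<^esub>b\<in>B. vmap B (v i) b \<otimes>\<^bsub>S\<^esub> h (g b i')) = (\<Oplus>\<^bsub>S\<^esub>b\<in>B. h (v i b \<otimes> g b i'))"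
      using g vc i by (intro S.finsum_cong') (auto simp: vmap_def)
    also have "\<dots> = h (\<Oplus>b\<in>B. v i b \<otimes> g b i')"
      using g vc i by (subst hom_finsum) (auto simp: o_def)
    also have "\<dots> = (if i = i' then \<one>\<^bsub>S\<^esub> else \<zero>\<^bsub>S\<^esub>)"
      using assms(1) i by (auto simp: dual_matrix_def)
    finally show "(\<Oplus>\<^bsub>S\<^esub>b\<in>B. vmap B (v i) b \<otimes>\<^bsub>S\<^esub> h (g b i')) = (if i = i' then \<one>\<^bsub>S\<^esub> else \<zero>\<^bsub>S\<^esub>)" .
  qed
qed

lemma basis_map:
  assumes "is_basis_family R (free_module R B) I v" "v \<in> I \<rightarrow> (B \<rightarrow>\<^sub>E carrier R)" "finite B" "finite I"
  shows "is_basis_family S (free_module S B) I (\<lambda>i. vmap B (v i))"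
proof -
  obtain g where "dual_matrix R B I v g" using R.basis_dual_matrix[OF assms(4,3,1)] by blast
  from dual_matrix_map[OF this assms(2,3,4)] show ?thesis
    using assms by (intro S.dual_matrix_basis) (simp_all add: vmap_closed)
qed

end

locale local_reduction = reduction R S h for R (structure) and S (structure) and h +
  assumes S_field: "field S"
    and surj: "s \<in> carrier S \<Longrightarrow> \<exists>r\<in>carrier R. h r = s"
    and local: "r \<in> carrier R \<Longrightarrow> h r \<noteq> \<zero>\<^bsub>S\<^esub> \<Longrightarrow> r \<in> Units R"
begin

text \<open>
  Nakayama's lemma for free modules, in the form that a family is a basis if its reduction is one:
  such a family is independent modulo the maximal ideal, so it can be exchanged into the standard
  basis, and comparing numbers over the residue field it replaces all of it.
\<close>

lemma lift_basis:
  assumes I: "finite I" and B: "finite B" and v: "v \<in> I \<rightarrow> (B \<rightarrow>\<^sub>E carrier R)"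
    and b: "is_basis_family S (free_module S B) I (\<lambda>i. vmap B (v i))"
  shows "is_basis_family R (free_module R B) I v"
proof -
  interpret F: plain_module R "free_module R B" by (rule R.free_module_plain_module)
  interpret G: plain_module S "free_module S B" by (rule S.free_module_plain_module)
  interpret S: field S by (rule S_field)
  let ?e = "\<lambda>b. \<lambda>b'\<in>B. if b = b' then \<one> else \<zero>"
  have e: "?e \<in> B \<rightarrow> (B \<rightarrow>\<^sub>E carrier R)" by auto
  have sb: "is_basis_family S (free_module S B) B (\<lambda>b. \<lambda>b'\<in>B. if b = b' then \<one>\<^bsub>S\<^esub> else \<zero>\<^bsub>S\<^esub>)"
    using B by (rule S.std_basis)
  have "card I \<le> card B"
    by (rule G.independent_family_card(1)[OF S_field B sb I G.is_basis_familyD(1,2)[OF b I]])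
  moreover have "card B \<le> card I"
    by (rule G.independent_family_card(1)[OF S_field I b B G.is_basis_familyD(1,2)[OF sb B]])
  ultimately have card: "card I = card B" by simp
  let ?m = "{r \<in> carrier R. h r = \<zero>\<^bsub>S\<^esub>}"
  have "\<exists>K\<subseteq>B. card K + card I = card B \<and> is_basis_family R (free_module R B) (I <+> K) (case_sum v ?e)"
  proof (rule F.exchange_independent_mod[where m = ?m])
    show "is_basis_family R (free_module R B) B ?e" using B by (rule R.std_basis)
    fix c \<mu> assume c: "c \<in> I \<rightarrow> carrier R" and \<mu>: "\<mu> \<in> B \<rightarrow> ?m"
      and eq: "R.flc B I c v = R.flc B B \<mu> ?e"
    have "S.flc B I (\<lambda>i. h (c i)) (\<lambda>i. vmap B (v i)) = vmap B (R.flc B B \<mu> ?e)"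
      unfolding eq[symmetric] using vmap_lincomb[OF I c v] by simp
    also have "\<dots> = S.flc B B (\<lambda>b. h (\<mu> b)) (\<lambda>b. vmap B (?e b))"
      using \<mu> B e by (intro vmap_lincomb) auto
    also have "\<dots> = S.flc B B (\<lambda>b. \<zero>\<^bsub>S\<^esub>) (\<lambda>b. vmap B (?e b))"
      using \<mu> e vmap_closed[of "?e _" B] by (intro G.lincomb_cong) (auto simp: free_module_simps)
    also have "\<dots> = \<zero>\<^bsub>free_module S B\<^esub>"
      using vmap_closed[of "?e _" B] by (intro G.lincomb_zero) (auto simp: free_module_simps)
    finally show "\<forall>i\<in>I. c i \<in> ?m"
      using G.is_basis_familyD(2)[OF b I] c unfolding G.independent_family_def by auto
  qed (use I B v local in \<open>auto simp: free_module_simps\<close>)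
  then obtain K where K: "K \<subseteq> B" "card K + card I = card B"
    "is_basis_family R (free_module R B) (I <+> K) (case_sum v ?e)" by blast
  then have "K = {}" using card B by (auto dest: finite_subset)
  then show ?thesis using F.basis_of_exchange_all[OF I] K by simp
qed

text \<open>
  The vector \<open>\<theta>\<^sup>i x\<close> beyond the end of a lifted chain reduces to zero.  The hypothesis \<open>rank\<close> expresses
  that the image of \<open>\<theta>\<^sup>m\<close> is spanned by the members of the lifted chains from the \<open>m\<close>-th on; it makes
  \<open>- \<theta>\<^sup>i x\<close> the image under \<open>\<theta>\<^sup>i\<close> of a vector \<open>z\<close> whose coordinates lie in the maximal ideal, and
  \<open>x + z\<close> is the corrected lift of the same vector.
\<close>

lemma lift_chains:
  assumes B: "finite B" and A: "\<And>b b'. b \<in> B \<Longrightarrow> b' \<in> B \<Longrightarrow> A b b' \<in> carrier R"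
    and x: "\<And>i c. i \<in> {1..p} \<Longrightarrow> c < a i \<Longrightarrow> x i c \<in> B \<rightarrow>\<^sub>E carrier R"
    and red_end: "\<And>i c. i \<in> {1..p} \<Longrightarrow> c < a i \<Longrightarrow>
      (mat_op S B (\<lambda>b b'. h (A b b')) ^^ i) (vmap B (x i c)) = (\<lambda>b\<in>B. \<zero>\<^bsub>S\<^esub>)"
    and red_basis: "is_basis_family S (free_module S B) (jordan_index p a)
      (chain_family (mat_op S B (\<lambda>b b'. h (A b b'))) (\<lambda>i c. vmap B (x i c)))"
    and rank: "\<And>w d m i c j. w \<in> B \<rightarrow>\<^sub>E carrier R \<Longrightarrow> d \<in> jordan_index p a \<rightarrow> carrier R \<Longrightarrow>
      (mat_op R B A ^^ m) w = R.flc B (jordan_index p a) d (chain_family (mat_op R B A) x) \<Longrightarrow>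
      (i, c, j) \<in> jordan_index p a \<Longrightarrow> j < m \<Longrightarrow> d (i, c, j) = \<zero>"
  shows "\<exists>x'. chains R (free_module R B) (mat_op R B A) p a x' \<and>
    is_basis_family R (free_module R B) (jordan_index p a) (chain_family (mat_op R B A) x')"
proof -
  interpret F: plain_module R "free_module R B" by (rule R.free_module_plain_module)
  interpret G: plain_module S "free_module S B" by (rule S.free_module_plain_module)
  define J where "J = jordan_index p a"
  note fJ = finite_jordan_index[of p a, folded J_def]
  let ?\<theta> = "mat_op R B A" and ?\<theta>' = "mat_op S B (\<lambda>b b'. h (A b b'))"
  have lin: "F.linear_op ?\<theta>" using B A by (rule R.mat_op_linear)
  have pow_closed: "(?\<theta> ^^ n) w \<in> B \<rightarrow>\<^sub>E carrier R" if "w \<in> B \<rightarrow>\<^sub>E carrier R" for n w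
    using F.linear_op_closed[OF F.linear_op_funpow[OF lin], of w] that by (simp add: free_module_simps)
  have xM: "chain_tops R (free_module R B) ?\<theta> p a x"
    by unfold_locales (use lin x in \<open>auto simp: free_module_simps\<close>)
  interpret T: chain_tops R "free_module R B" ?\<theta> p a x by (rule xM)
  have lift: "is_basis_family R (free_module R B) J (chain_family ?\<theta> y)"
    if y: "\<And>i c. i \<in> {1..p} \<Longrightarrow> c < a i \<Longrightarrow> y i c \<in> B \<rightarrow>\<^sub>E carrier R"
      and eq: "\<And>i c. i \<in> {1..p} \<Longrightarrow> c < a i \<Longrightarrow> vmap B (y i c) = vmap B (x i c)" for y
  proof (rule lift_basis[OF fJ B])
    show "chain_family ?\<theta> y \<in> J \<rightarrow> (B \<rightarrow>\<^sub>E carrier R)"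
      using y pow_closed by (auto simp: chain_family_def J_def jordan_index_def simp del: PiE_iff)
    show "is_basis_family S (free_module S B) J (\<lambda>i. vmap B (chain_family ?\<theta> y i))"
    proof (rule G.is_basis_family_reindex[OF fJ bij_betw_id red_basis[folded J_def]])
      fix z assume z: "z \<in> J"
      show "vmap B (chain_family ?\<theta> y z) = chain_family ?\<theta>' (\<lambda>i c. vmap B (x i c)) (id z)"
        proof -
        obtain i c j where ij: "z = (i, c, j)" "i \<in> {1..p}" "c < a i"
          using z by (cases z) (auto simp: J_def jordan_index_def)
        have "vmap B (chain_family ?\<theta> y z) = (?\<theta>' ^^ j) (vmap B (y i c))"
          using vmap_mat_op_pow[OF B A y[OF ij(2,3)]] by (simp add: chain_family_def ij(1))
        then show ?thesis by (simp add: chain_family_def ij(1) eq[OF ij(2,3)])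
      qed
    qed
  qed
  have bx: "is_basis_family R (free_module R B) J (chain_family ?\<theta> x)" using lift x by blast
  note bx' = F.is_basis_familyD[OF bx fJ]
  have bx_red: "G.independent_family J (\<lambda>z. vmap B (chain_family ?\<theta> x z))"
    using G.is_basis_familyD(2)[OF basis_map[OF bx _ B fJ] fJ] bx'(1) by (simp add: free_module_simps)
  have red0: "vmap B (R.flc B J d (chain_family ?\<theta> x)) = (\<lambda>b\<in>B. \<zero>\<^bsub>S\<^esub>) \<longleftrightarrow> (\<forall>z\<in>J. h (d z) = \<zero>\<^bsub>S\<^esub>)"
    if d: "d \<in> J \<rightarrow> carrier R" for d
  proof -
    have vM: "(\<lambda>z. vmap B (chain_family ?\<theta> x z)) \<in> J \<rightarrow> carrier (free_module S B)"
      using bx'(1) by (simp add: free_module_simps vmap_closed del: PiE_iff)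
    have e: "vmap B (R.flc B J d (chain_family ?\<theta> x))
      = S.flc B J (\<lambda>z. h (d z)) (\<lambda>z. vmap B (chain_family ?\<theta> x z))"
      using d bx'(1) by (intro vmap_lincomb fJ) (auto simp: free_module_simps simp del: PiE_iff)
    show ?thesis
    proof
      assume "vmap B (R.flc B J d (chain_family ?\<theta> x)) = (\<lambda>b\<in>B. \<zero>\<^bsub>S\<^esub>)"
      then have "S.flc B J (\<lambda>z. h (d z)) (\<lambda>z. vmap B (chain_family ?\<theta> x z)) = \<zero>\<^bsub>free_module S B\<^esub>"
        unfolding e by (simp only: free_module_simps)
      moreover have "(\<lambda>z. h (d z)) \<in> J \<rightarrow> carrier S" using d by simp
      ultimately show "\<forall>z\<in>J. h (d z) = \<zero>\<^bsub>S\<^esub>"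
        using bx_red unfolding G.independent_family_def by blast
    next
      assume "\<forall>z\<in>J. h (d z) = \<zero>\<^bsub>S\<^esub>"
      then have "S.flc B J (\<lambda>z. h (d z)) (\<lambda>z. vmap B (chain_family ?\<theta> x z))
        = S.flc B J (\<lambda>z. \<zero>\<^bsub>S\<^esub>) (\<lambda>z. vmap B (chain_family ?\<theta> x z))"
        using vM by (intro G.lincomb_cong) auto
      then show "vmap B (R.flc B J d (chain_family ?\<theta> x)) = (\<lambda>b\<in>B. \<zero>\<^bsub>S\<^esub>)"
        unfolding e using G.lincomb_zero[OF vM] by (simp add: free_module_simps)
    qed
  qed
  have "\<exists>y. y \<in> B \<rightarrow>\<^sub>E carrier R \<and> vmap B y = vmap B (x i c) \<and> (?\<theta> ^^ i) y = (\<lambda>b\<in>B. \<zero>)"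
    if ic: "i \<in> {1..p}" "c < a i" for i c
  proof -
    let ?e = "\<ominus>\<^bsub>free_module R B\<^esub> (?\<theta> ^^ i) (x i c)"
    have xi: "x i c \<in> carrier (free_module R B)" using x ic by (simp add: free_module_simps)
    have e: "?e = (?\<theta> ^^ i) (\<ominus>\<^bsub>free_module R B\<^esub> x i c)"
      using F.linear_op_minus[OF F.linear_op_funpow[OF lin] xi] by simp
    have eM: "?e \<in> carrier (free_module R B)"
      by (rule F.M.a_inv_closed) (use pow_closed x ic in \<open>simp add: free_module_simps\<close>)
    obtain d where d: "d \<in> J \<rightarrow> carrier R" "?e = R.flc B J d (chain_family ?\<theta> x)"
      using bx'(3)[OF eM] by blast
    have "vmap B ?e = (\<lambda>b\<in>B. \<zero>\<^bsub>S\<^esub>)"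
    proof -
      have mx: "\<ominus>\<^bsub>free_module R B\<^esub> x i c \<in> B \<rightarrow>\<^sub>E carrier R"
        using F.M.a_inv_closed[OF xi] by (simp add: free_module_simps)
      have sum0: "x i c \<oplus>\<^bsub>free_module R B\<^esub> (\<ominus>\<^bsub>free_module R B\<^esub> x i c) = \<zero>\<^bsub>free_module R B\<^esub>"
        using xi by (rule F.M.r_neg)
      have p0: "(?\<theta> ^^ i) (x i c) \<oplus>\<^bsub>free_module R B\<^esub> ?e = \<zero>\<^bsub>free_module R B\<^esub>"
        using pow_closed x ic by (intro F.M.r_neg) (simp add: free_module_simps)
      have vx: "vmap B ((?\<theta> ^^ i) (x i c)) = (\<lambda>b\<in>B. \<zero>\<^bsub>S\<^esub>)"
        using vmap_mat_op_pow[OF B A x[OF ic]] red_end[OF ic] by simp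
      show ?thesis unfolding vmap_def
      proof (rule restrict_eqI)
        fix b assume b: "b \<in> B"
        have c1: "(?\<theta> ^^ i) (x i c) b \<in> carrier R" "?e b \<in> carrier R"
          using pow_closed[OF x[OF ic], of i] eM b by (auto simp: free_module_simps PiE_iff)
        have "h ((?\<theta> ^^ i) (x i c) b \<oplus> ?e b) = \<zero>\<^bsub>S\<^esub>"
          using fun_cong[OF p0, of b] b by (simp add: free_module_simps)
        moreover have "h ((?\<theta> ^^ i) (x i c) b) = \<zero>\<^bsub>S\<^esub>"
          using fun_cong[OF vx, of b] b by (simp add: vmap_def)
        ultimately show "h (?e b) = \<zero>\<^bsub>S\<^esub>" using c1 by simp
      qed
    qed
    then have dm: "\<forall>z\<in>J. h (d z) = \<zero>\<^bsub>S\<^esub>" using red0[OF d(1)] d(2) by simp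
    have "d (i', c', j) = \<zero>" if "(i', c', j) \<in> J" "j < i" for i' c' j
      using rank[of "\<ominus>\<^bsub>free_module R B\<^esub> x i c" d i i' c' j] that d e F.M.a_inv_closed[OF xi]
      by (auto simp: J_def free_module_simps simp del: PiE_iff)
    then obtain u where u: "u \<in> J \<rightarrow> insert \<zero> (d ` J)"
      "?e = (?\<theta> ^^ i) (R.flc B J u (chain_family ?\<theta> x))"
      using T.lincomb_in_image[OF d(1)[unfolded J_def], of i] d(2) unfolding J_def by metis
    let ?z = "R.flc B J u (chain_family ?\<theta> x)"
    have uR: "u \<in> J \<rightarrow> carrier R" and um: "\<forall>z\<in>J. h (u z) = \<zero>\<^bsub>S\<^esub>" using u(1) d(1) dm by fastforce+
    have zM: "?z \<in> carrier (free_module R B)" using F.lincomb_closed[OF uR bx'(1)] .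
    have z0: "vmap B ?z = (\<lambda>b\<in>B. \<zero>\<^bsub>S\<^esub>)" using red0[OF uR] um by simp
    let ?y = "x i c \<oplus>\<^bsub>free_module R B\<^esub> ?z"
    have "?y \<in> B \<rightarrow>\<^sub>E carrier R" using F.M.a_closed[OF xi zM] by (simp add: free_module_simps)
    moreover have "vmap B ?y = vmap B (x i c)" unfolding vmap_def free_module_simps
    proof (rule restrict_eqI)
      fix b assume b: "b \<in> B"
      have "x i c b \<in> carrier R" "?z b \<in> carrier R" using xi zM b by (auto simp: free_module_simps PiE_iff)
      moreover have "h (?z b) = \<zero>\<^bsub>S\<^esub>" using fun_cong[OF z0, of b] b by (simp add: vmap_def)
      ultimately show "h ((\<lambda>b\<in>B. x i c b \<oplus> ?z b) b) = h (x i c b)" using b by simp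
    qed
    moreover have "(?\<theta> ^^ i) ?y = (\<lambda>b\<in>B. \<zero>)"
    proof -
      have "(?\<theta> ^^ i) ?y = (?\<theta> ^^ i) (x i c) \<oplus>\<^bsub>free_module R B\<^esub> ?e"
        using F.linear_op_funpow[OF lin, of i] xi zM u(2) by (simp add: F.linear_op_def)
      also have "\<dots> = \<zero>\<^bsub>free_module R B\<^esub>"
        using pow_closed x ic by (intro F.M.r_neg) (simp add: free_module_simps)
      finally show ?thesis by (simp add: free_module_simps)
    qed
    ultimately show ?thesis by blast
  qed
  then obtain x' where x': "\<And>i c. i \<in> {1..p} \<Longrightarrow> c < a i \<Longrightarrow> x' i c \<in> B \<rightarrow>\<^sub>E carrier R"
    "\<And>i c. i \<in> {1..p} \<Longrightarrow> c < a i \<Longrightarrow> vmap B (x' i c) = vmap B (x i c)"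
    "\<And>i c. i \<in> {1..p} \<Longrightarrow> c < a i \<Longrightarrow> (?\<theta> ^^ i) (x' i c) = (\<lambda>b\<in>B. \<zero>)"
    by metis
  have "chains R (free_module R B) ?\<theta> p a x'"
    by unfold_locales (use lin x' in \<open>auto simp: free_module_simps simp del: PiE_iff\<close>)
  with lift[OF x'(1,2)] show ?thesis unfolding J_def by blast
qed

end

section \<open>Fractions and sections on Proj\<close>

text \<open>
  The graded ring is presented as a quotient \<open>\<pi>\<close> of a ring that is a type, with \<open>H n\<close> mapping onto
  the component \<open>D n\<close>; this lets the identities between fractions be verified by simplification in
  the type.
\<close>

locale graded_presentation = cring R for R :: "('a, 'b) ring_scheme" (structure) +
  fixes D :: "nat \<Rightarrow> 'a set" and \<pi> :: "'p::comm_ring_1 \<Rightarrow> 'a" and H :: "nat \<Rightarrow> 'p set"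
  assumes carrier_range: "carrier R = range \<pi>"
    and \<pi>_add: "\<pi> (x + y) = \<pi> x \<oplus> \<pi> y"
    and \<pi>_mult: "\<pi> (x * y) = \<pi> x \<otimes> \<pi> y"
    and \<pi>_one: "\<pi> 1 = \<one>"
    and D_eq: "D n = \<pi> ` H n"
    and H_zero: "0 \<in> H n"
    and H_add: "x \<in> H n \<Longrightarrow> y \<in> H n \<Longrightarrow> x + y \<in> H n"
    and H_uminus: "x \<in> H n \<Longrightarrow> - x \<in> H n"
    and H_mult: "x \<in> H m \<Longrightarrow> y \<in> H n \<Longrightarrow> x * y \<in> H (m + n)"
    and H_one: "1 \<in> H 0"
begin

lemma \<pi>_closed [simp]: "\<pi> x \<in> carrier R" by (simp add: carrier_range)

lemma \<pi>_zero: "\<pi> 0 = \<zero>"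
  using \<pi>_add[of 0 0] by (metis \<pi>_closed add.r_cancel_one' add_0)

abbreviation "PR \<equiv> Proj R D"
abbreviation "is_open \<equiv> proj_open R D"
abbreviation "LOC P \<equiv> homog_loc R D P"
abbreviation "ST P \<equiv> stalk_ring R D P"

text \<open>
  The representatives of the homogeneous elements outside \<open>P\<close>, which are the admissible denominators at \<open>P\<close>.
\<close>

definition away :: "'a set \<Rightarrow> 'p set" where
  "away P = {f. (\<exists>n. f \<in> H n) \<and> \<pi> f \<notin> P}"

definition fr :: "'a set \<Rightarrow> 'p \<Rightarrow> 'p \<Rightarrow> ('a \<times> 'a) set" where
  "fr P x f = fraction R (homog_away D P) (\<pi> x) (\<pi> f)"

text \<open>
  The fraction \<open>x / f\<close> is homogeneous of degree \<open>n\<close>.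
\<close>

definition hfr :: "int \<Rightarrow> 'p \<Rightarrow> 'p \<Rightarrow> bool" where
  "hfr n x f \<longleftrightarrow> (\<exists>e m. f \<in> H e \<and> x \<in> H m \<and> int m = int e + n)"

lemma homog_away_eq: "homog_away D P = \<pi> ` away P"
  by (auto simp: homog_away_def away_def D_eq)

lemma PR_prime: "P \<in> PR \<Longrightarrow> primeideal P R" by (simp add: Proj_def)

lemma away_one [simp]: "P \<in> PR \<Longrightarrow> 1 \<in> away P"
  using H_one ideal.one_imp_carrier[OF primeideal.axioms(1)[OF PR_prime]] primeideal.I_notcarr[OF PR_prime]
  by (auto simp: away_def \<pi>_one)

lemma prime_mult: "P \<in> PR \<Longrightarrow> \<pi> (x * y) \<in> P \<longleftrightarrow> \<pi> x \<in> P \<or> \<pi> y \<in> P"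
  using primeideal.I_prime[OF PR_prime, of P "\<pi> x" "\<pi> y"]
    ideal.I_l_closed[OF primeideal.axioms(1)[OF PR_prime], of P "\<pi> y" "\<pi> x"]
    ideal.I_r_closed[OF primeideal.axioms(1)[OF PR_prime], of P "\<pi> x" "\<pi> y"]
  by (auto simp: \<pi>_mult)

lemma prime_add: "P \<in> PR \<Longrightarrow> \<pi> x \<in> P \<Longrightarrow> \<pi> y \<in> P \<Longrightarrow> \<pi> (x + y) \<in> P"
  using additive_subgroup.a_closed[OF ideal.axioms(1)[OF primeideal.axioms(1)[OF PR_prime]]]
  by (simp add: \<pi>_add)

lemma prime_zero: "P \<in> PR \<Longrightarrow> \<pi> 0 \<in> P"
  using additive_subgroup.zero_closed[OF ideal.axioms(1)[OF primeideal.axioms(1)[OF PR_prime]]]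
  by (simp add: \<pi>_zero)

lemma away_mult [simp]: "P \<in> PR \<Longrightarrow> f \<in> away P \<Longrightarrow> g \<in> away P \<Longrightarrow> f * g \<in> away P"
  unfolding away_def using H_mult prime_mult by blast

lemma fr_eq_iff:
  assumes P: "P \<in> PR" and f: "f \<in> away P" and g: "g \<in> away P"
  shows "fr P x f = fr P y g \<longleftrightarrow> (\<exists>h\<in>away P. \<pi> (h * (g * x)) = \<pi> (h * (f * y)))"
proof
  assume eq: "fr P x f = fr P y g"
  have "(\<pi> y, \<pi> g) \<in> fr P y g"
    unfolding fr_def fraction_def homog_away_eq using g away_one[OF P] by auto
  then have "(\<pi> y, \<pi> g) \<in> fr P x f" using eq by simp
  then show "\<exists>h\<in>away P. \<pi> (h * (g * x)) = \<pi> (h * (f * y))"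
    unfolding fr_def fraction_def homog_away_eq by (auto simp: \<pi>_mult)
next
  assume "\<exists>h\<in>away P. \<pi> (h * (g * x)) = \<pi> (h * (f * y))"
  then obtain h where h: "h \<in> away P" "\<pi> (h * (g * x)) = \<pi> (h * (f * y))" by blast
  have sub: "fr P x f \<subseteq> fr P y g"
    if f: "f \<in> away P" and g: "g \<in> away P" and h: "h \<in> away P" "\<pi> (h * (g * x)) = \<pi> (h * (f * y))"
    for x y f g h
  proof
    fix z assume "z \<in> fr P x f"
    then obtain w k l where z: "z = (\<pi> w, \<pi> k)" "k \<in> away P" "l \<in> away P" "\<pi> (l * (k * x)) = \<pi> (l * (f * w))"
      unfolding fr_def fraction_def homog_away_eq carrier_range by (auto simp: \<pi>_mult)
    have "\<pi> (h * l * f * (k * y)) = \<pi> (h * (f * y)) \<otimes> \<pi> (l * k)"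
      by (simp add: \<pi>_mult[symmetric] mult_ac)
    also have "\<dots> = \<pi> (h * (g * x)) \<otimes> \<pi> (l * k)" by (simp add: h)
    also have "\<dots> = \<pi> (l * (k * x)) \<otimes> \<pi> (h * g)" by (simp add: \<pi>_mult[symmetric] mult_ac)
    also have "\<dots> = \<pi> (h * l * f * (g * w))" unfolding z(4) by (simp add: \<pi>_mult[symmetric] mult_ac)
    finally have "\<pi> (h * l * f * (k * y)) = \<pi> (h * l * f * (g * w))" .
    moreover have "h * l * f \<in> away P" using P f h z by simp
    ultimately show "z \<in> fr P y g"
      unfolding fr_def fraction_def homog_away_eq z(1) using z(2)
      by (auto simp: \<pi>_mult intro!: bexI[of _ "h * l * f"])
  qed
  show "fr P x f = fr P y g" using sub[OF f g h] sub[OF g f h(1) h(2)[symmetric]] by blast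
qed

lemma fr_eqI:
  "P \<in> PR \<Longrightarrow> f \<in> away P \<Longrightarrow> g \<in> away P \<Longrightarrow> g * x = f * y \<Longrightarrow> fr P x f = fr P y g"
  by (subst fr_eq_iff) (auto intro!: bexI[of _ 1])

text \<open>
  The operations on a localization are unions over all representatives; this lemma reduces them to
  representatives of the form \<open>(\<pi> y, \<pi> g)\<close>.
\<close>

lemma fr_rep:
  assumes P: "P \<in> PR" and f: "f \<in> away P" and z: "(u, v) \<in> fr P x f"
  shows "\<exists>y g. u = \<pi> y \<and> v = \<pi> g \<and> g \<in> away P \<and> fr P y g = fr P x f"
proof -
  obtain y g h where "u = \<pi> y" "v = \<pi> g" "g \<in> away P" "h \<in> away P" "\<pi> (h * (g * x)) = \<pi> (h * (f * y))"
    using z unfolding fr_def fraction_def homog_away_eq carrier_range by (auto simp: \<pi>_mult)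
  then show ?thesis using fr_eq_iff[OF P f, of g x y] by auto
qed

lemma fr_self: "P \<in> PR \<Longrightarrow> f \<in> away P \<Longrightarrow> (\<pi> x, \<pi> f) \<in> fr P x f"
  unfolding fr_def fraction_def homog_away_eq using away_one by auto

lemma LOC_carrier: "carrier (LOC P) = {fr P x f | x f. f \<in> away P}"
  unfolding localization_def fr_def homog_away_eq carrier_range by auto

lemma fr_carrier: "f \<in> away P \<Longrightarrow> fr P x f \<in> carrier (LOC P)"
  unfolding LOC_carrier by blast

lemma LOC_one: "\<one>\<^bsub>LOC P\<^esub> = fr P 1 1" and LOC_zero: "\<zero>\<^bsub>LOC P\<^esub> = fr P 0 1"
  by (simp_all add: localization_def fr_def \<pi>_one \<pi>_zero)

lemma fr_mult:
  assumes P: "P \<in> PR" and f: "f \<in> away P" and g: "g \<in> away P"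
  shows "fr P x f \<otimes>\<^bsub>LOC P\<^esub> fr P y g = fr P (x * y) (f * g)"
proof -
  have "fraction R (homog_away D P) (a \<otimes> b) (c \<otimes> d) = fr P (x * y) (f * g)"
    if ac: "(a, c) \<in> fr P x f" and bd: "(b, d) \<in> fr P y g" for a b c d
  proof -
    obtain a' c' where a: "a = \<pi> a'" "c = \<pi> c'" "c' \<in> away P" "fr P a' c' = fr P x f"
      using fr_rep[OF P f ac] by blast
    obtain b' d' where b: "b = \<pi> b'" "d = \<pi> d'" "d' \<in> away P" "fr P b' d' = fr P y g"
      using fr_rep[OF P g bd] by blast
    obtain h where h: "h \<in> away P" "\<pi> (h * (f * a')) = \<pi> (h * (c' * x))"
      using fr_eq_iff[OF P a(3) f] a(4) by blast
    obtain k where k: "k \<in> away P" "\<pi> (k * (g * b')) = \<pi> (k * (d' * y))"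
      using fr_eq_iff[OF P b(3) g] b(4) by blast
    have "\<pi> (h * k * (f * g * (a' * b'))) = \<pi> (h * (f * a')) \<otimes> \<pi> (k * (g * b'))"
      by (simp add: \<pi>_mult[symmetric] mult_ac)
    also have "\<dots> = \<pi> (h * k * (c' * d' * (x * y)))"
      unfolding h k by (simp add: \<pi>_mult[symmetric] mult_ac)
    finally have "fr P (a' * b') (c' * d') = fr P (x * y) (f * g)"
      using P f g a b h k by (subst fr_eq_iff) (auto intro!: bexI[of _ "h * k"])
    then show ?thesis by (simp add: fr_def \<pi>_mult a b)
  qed
  then have *: "(\<Union>(x, f)\<in>fr P x f. \<Union>(y, g)\<in>fr P y g. fraction R (homog_away D P) (x \<otimes> y) (f \<otimes> g))
    = (\<Union>(x', f')\<in>fr P x f. \<Union>(y', g')\<in>fr P y g. fr P (x * y) (f * g))"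
    by (intro SUP_cong refl) (auto split: prod.splits)
  show ?thesis
    using fr_self[OF P f, of x] fr_self[OF P g, of y] unfolding localization_def monoid.simps ring.simps *
    by auto
qed

lemma fr_add:
  assumes P: "P \<in> PR" and f: "f \<in> away P" and g: "g \<in> away P"
  shows "fr P x f \<oplus>\<^bsub>LOC P\<^esub> fr P y g = fr P (g * x + f * y) (f * g)"
proof -
  have "fraction R (homog_away D P) ((d \<otimes> a) \<oplus> (c \<otimes> b)) (c \<otimes> d) = fr P (g * x + f * y) (f * g)"
    if ac: "(a, c) \<in> fr P x f" and bd: "(b, d) \<in> fr P y g" for a b c d
  proof -
    obtain a' c' where a: "a = \<pi> a'" "c = \<pi> c'" "c' \<in> away P" "fr P a' c' = fr P x f"
      using fr_rep[OF P f ac] by blast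
    obtain b' d' where b: "b = \<pi> b'" "d = \<pi> d'" "d' \<in> away P" "fr P b' d' = fr P y g"
      using fr_rep[OF P g bd] by blast
    obtain h where h: "h \<in> away P" "\<pi> (h * (f * a')) = \<pi> (h * (c' * x))"
      using fr_eq_iff[OF P a(3) f] a(4) by blast
    obtain k where k: "k \<in> away P" "\<pi> (k * (g * b')) = \<pi> (k * (d' * y))"
      using fr_eq_iff[OF P b(3) g] b(4) by blast
    have "\<pi> (h * k * (f * g * (d' * a' + c' * b')))
      = \<pi> (h * (f * a')) \<otimes> \<pi> (k * g * d') \<oplus> \<pi> (k * (g * b')) \<otimes> \<pi> (h * f * c')"
      by (simp add: \<pi>_mult[symmetric] \<pi>_add[symmetric] algebra_simps)
    also have "\<dots> = \<pi> (h * k * (c' * d' * (g * x + f * y)))"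
      unfolding h k by (simp add: \<pi>_mult[symmetric] \<pi>_add[symmetric] algebra_simps)
    finally have "fr P (d' * a' + c' * b') (c' * d') = fr P (g * x + f * y) (f * g)"
      using P f g a b h k by (subst fr_eq_iff) (auto intro!: bexI[of _ "h * k"])
    then show ?thesis by (simp add: fr_def \<pi>_mult \<pi>_add a b)
  qed
  then have *: "(\<Union>(x, f)\<in>fr P x f. \<Union>(y, g)\<in>fr P y g. fraction R (homog_away D P) ((g \<otimes> x) \<oplus> (f \<otimes> y)) (f \<otimes> g))
    = (\<Union>(x', f')\<in>fr P x f. \<Union>(y', g')\<in>fr P y g. fr P (g * x + f * y) (f * g))"
    by (intro SUP_cong refl) (auto split: prod.splits)
  show ?thesis
    using fr_self[OF P f, of x] fr_self[OF P g, of y] unfolding localization_def monoid.simps ring.simps *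
    by auto
qed

lemma LOC_cases:
  assumes "s \<in> carrier (LOC P)"
  obtains x f where "f \<in> away P" "s = fr P x f"
  using assms unfolding LOC_carrier by blast

lemma LOC_cring:
  assumes P: "P \<in> PR"
  shows "cring (LOC P)"
proof (rule cringI)
  show "abelian_group (LOC P)"
  proof (rule abelian_groupI)
    fix s t u assume s: "s \<in> carrier (LOC P)" and t: "t \<in> carrier (LOC P)" and u: "u \<in> carrier (LOC P)"
    then obtain x f y g z k where e: "f \<in> away P" "s = fr P x f" "g \<in> away P" "t = fr P y g"
      "k \<in> away P" "u = fr P z k" by (metis LOC_cases)
    show "s \<oplus>\<^bsub>LOC P\<^esub> t \<oplus>\<^bsub>LOC P\<^esub> u = s \<oplus>\<^bsub>LOC P\<^esub> (t \<oplus>\<^bsub>LOC P\<^esub> u)"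
      using P e by (auto simp: fr_add algebra_simps intro!: fr_eqI)
  next
    fix s t assume s: "s \<in> carrier (LOC P)" and t: "t \<in> carrier (LOC P)"
    then obtain x f y g where e: "f \<in> away P" "s = fr P x f" "g \<in> away P" "t = fr P y g"
      by (metis LOC_cases)
    show "s \<oplus>\<^bsub>LOC P\<^esub> t \<in> carrier (LOC P)" using P e by (simp add: fr_add fr_carrier)
    show "s \<oplus>\<^bsub>LOC P\<^esub> t = t \<oplus>\<^bsub>LOC P\<^esub> s" using P e by (auto simp: fr_add algebra_simps intro!: fr_eqI)
  next
    fix s assume s: "s \<in> carrier (LOC P)"
    then obtain x f where e: "f \<in> away P" "s = fr P x f" by (metis LOC_cases)
    show "\<zero>\<^bsub>LOC P\<^esub> \<oplus>\<^bsub>LOC P\<^esub> s = s" using P e by (auto simp: fr_add LOC_zero algebra_simps intro!: fr_eqI)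
    show "\<exists>t\<in>carrier (LOC P). t \<oplus>\<^bsub>LOC P\<^esub> s = \<zero>\<^bsub>LOC P\<^esub>"
    proof (rule bexI)
      show "fr P (- x) f \<oplus>\<^bsub>LOC P\<^esub> s = \<zero>\<^bsub>LOC P\<^esub>"
        using P e by (simp add: fr_add LOC_zero) (rule fr_eqI, auto)
      show "fr P (- x) f \<in> carrier (LOC P)" using e by (simp add: fr_carrier)
    qed
  qed (use P in \<open>auto simp: fr_carrier LOC_zero\<close>)
  show "Group.comm_monoid (LOC P)"
  proof (rule comm_monoidI)
    fix s t u assume s: "s \<in> carrier (LOC P)" and t: "t \<in> carrier (LOC P)" and u: "u \<in> carrier (LOC P)"
    then obtain x f y g z k where e: "f \<in> away P" "s = fr P x f" "g \<in> away P" "t = fr P y g"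
      "k \<in> away P" "u = fr P z k" by (metis LOC_cases)
    show "s \<otimes>\<^bsub>LOC P\<^esub> t \<otimes>\<^bsub>LOC P\<^esub> u = s \<otimes>\<^bsub>LOC P\<^esub> (t \<otimes>\<^bsub>LOC P\<^esub> u)"
      using P e by (auto simp: fr_mult algebra_simps intro!: fr_eqI)
  next
    fix s t assume s: "s \<in> carrier (LOC P)" and t: "t \<in> carrier (LOC P)"
    then obtain x f y g where e: "f \<in> away P" "s = fr P x f" "g \<in> away P" "t = fr P y g"
      by (metis LOC_cases)
    show "s \<otimes>\<^bsub>LOC P\<^esub> t \<in> carrier (LOC P)" using P e by (simp add: fr_mult fr_carrier)
    show "s \<otimes>\<^bsub>LOC P\<^esub> t = t \<otimes>\<^bsub>LOC P\<^esub> s" using P e by (auto simp: fr_mult algebra_simps intro!: fr_eqI)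
  next
    fix s assume s: "s \<in> carrier (LOC P)"
    then obtain x f where e: "f \<in> away P" "s = fr P x f" by (metis LOC_cases)
    show "\<one>\<^bsub>LOC P\<^esub> \<otimes>\<^bsub>LOC P\<^esub> s = s" using P e by (auto simp: fr_mult LOC_one algebra_simps intro!: fr_eqI)
  qed (use P in \<open>auto simp: fr_carrier LOC_one\<close>)
  fix s t u assume s: "s \<in> carrier (LOC P)" and t: "t \<in> carrier (LOC P)" and u: "u \<in> carrier (LOC P)"
  then obtain x f y g z k where e: "f \<in> away P" "s = fr P x f" "g \<in> away P" "t = fr P y g"
    "k \<in> away P" "u = fr P z k" by (metis LOC_cases)
  show "(s \<oplus>\<^bsub>LOC P\<^esub> t) \<otimes>\<^bsub>LOC P\<^esub> u = s \<otimes>\<^bsub>LOC P\<^esub> u \<oplus>\<^bsub>LOC P\<^esub> t \<otimes>\<^bsub>LOC P\<^esub> u"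
    using P e by (simp add: fr_mult fr_add) (rule fr_eqI, simp_all add: algebra_simps)
qed

lemma homog_frac_rep: "homog_frac D n u v \<longleftrightarrow> (\<exists>x f. u = \<pi> x \<and> v = \<pi> f \<and> hfr n x f)"
  unfolding homog_frac_def hfr_def D_eq by blast

lemma hfr_away: "hfr n x f \<Longrightarrow> \<pi> f \<notin> P \<Longrightarrow> f \<in> away P"
  unfolding hfr_def away_def by auto

lemma loc_deg_eq: "loc_deg R D P n = {fr P x f | x f. hfr n x f \<and> \<pi> f \<notin> P}"
  unfolding loc_deg_def homog_frac_rep fr_def by blast

lemma fr_in_loc_deg: "hfr n x f \<Longrightarrow> \<pi> f \<notin> P \<Longrightarrow> fr P x f \<in> loc_deg R D P n"
  unfolding loc_deg_eq by blast

lemma hfr_mult: "hfr m x f \<Longrightarrow> hfr n y g \<Longrightarrow> hfr (m + n) (x * y) (f * g)"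
  unfolding hfr_def
proof (elim exE conjE)
  fix e k e' k'
  assume "f \<in> H e" "x \<in> H k" "int k = int e + m" "g \<in> H e'" "y \<in> H k'" "int k' = int e' + n"
  then show "\<exists>e k. f * g \<in> H e \<and> x * y \<in> H k \<and> int k = int e + (m + n)"
    using H_mult by (intro exI[of _ "e + e'"] exI[of _ "k + k'"]) auto
qed

lemma hfr_add: "hfr n x f \<Longrightarrow> hfr n y g \<Longrightarrow> hfr n (g * x + f * y) (f * g)"
  unfolding hfr_def
proof (elim exE conjE)
  fix e k e' k'
  assume *: "f \<in> H e" "x \<in> H k" "int k = int e + n" "g \<in> H e'" "y \<in> H k'" "int k' = int e' + n"
  then have "e' + k = e + k'" by linarith
  then have "g * x + f * y \<in> H (e' + k)" using H_mult[OF *(4,2)] H_mult[OF *(1,5)] by (auto intro: H_add)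
  moreover have "f * g \<in> H (e + e')" by (rule H_mult[OF *(1,4)])
  moreover have "int (e' + k) = int (e + e') + n" using *(3) by simp
  ultimately show "\<exists>e k. f * g \<in> H e \<and> g * x + f * y \<in> H k \<and> int k = int e + n" by blast
qed

lemma hfr_one: "hfr 0 1 1" "hfr 0 0 1"
  using H_one H_zero by (auto simp: hfr_def)

lemma hfr_uminus: "hfr n x f \<Longrightarrow> hfr n (- x) f"
  unfolding hfr_def using H_uminus by blast

lemma ST_simps:
  "carrier (ST P) = loc_deg R D P 0" "monoid.mult (ST P) = monoid.mult (LOC P)"
  "add (ST P) = add (LOC P)" "\<one>\<^bsub>ST P\<^esub> = \<one>\<^bsub>LOC P\<^esub>" "\<zero>\<^bsub>ST P\<^esub> = \<zero>\<^bsub>LOC P\<^esub>"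
  by (simp_all add: stalk_ring_def)

lemma ST_sub: "loc_deg R D P n \<subseteq> carrier (LOC P)"
  unfolding loc_deg_eq LOC_carrier using hfr_away by blast

lemma loc_deg_mult:
  "P \<in> PR \<Longrightarrow> s \<in> loc_deg R D P m \<Longrightarrow> t \<in> loc_deg R D P n \<Longrightarrow> s \<otimes>\<^bsub>LOC P\<^esub> t \<in> loc_deg R D P (m + n)"
  unfolding loc_deg_eq
proof safe
  fix x f y g assume *: "P \<in> PR" "hfr m x f" "\<pi> f \<notin> P" "hfr n y g" "\<pi> g \<notin> P"
  then show "\<exists>xa fa. fr P x f \<otimes>\<^bsub>LOC P\<^esub> fr P y g = fr P xa fa \<and> hfr (m + n) xa fa \<and> \<pi> fa \<notin> P"
    using hfr_mult[OF *(2,4)] by (intro exI[of _ "x * y"] exI[of _ "f * g"]) (auto simp: fr_mult hfr_away prime_mult)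
qed

lemma loc_deg_add:
  "P \<in> PR \<Longrightarrow> s \<in> loc_deg R D P n \<Longrightarrow> t \<in> loc_deg R D P n \<Longrightarrow> s \<oplus>\<^bsub>LOC P\<^esub> t \<in> loc_deg R D P n"
  unfolding loc_deg_eq
proof safe
  fix x f y g assume *: "P \<in> PR" "hfr n x f" "\<pi> f \<notin> P" "hfr n y g" "\<pi> g \<notin> P"
  then show "\<exists>xa fa. fr P x f \<oplus>\<^bsub>LOC P\<^esub> fr P y g = fr P xa fa \<and> hfr n xa fa \<and> \<pi> fa \<notin> P"
    using hfr_add[OF *(2,4)] by (intro exI[of _ "g * x + f * y"] exI[of _ "f * g"]) (auto simp: fr_add hfr_away prime_mult)
qed

lemma loc_deg_one: "P \<in> PR \<Longrightarrow> \<one>\<^bsub>LOC P\<^esub> \<in> loc_deg R D P 0"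
  and loc_deg_zero: "P \<in> PR \<Longrightarrow> \<zero>\<^bsub>LOC P\<^esub> \<in> loc_deg R D P 0"
  unfolding loc_deg_eq LOC_one LOC_zero using hfr_one away_one by (auto simp: away_def)

lemma ST_cring:
  assumes P: "P \<in> PR"
  shows "cring (ST P)"
proof -
  interpret L: cring "LOC P" using P by (rule LOC_cring)
  have sub: "s \<in> loc_deg R D P 0 \<Longrightarrow> s \<in> carrier (LOC P)" for s using ST_sub by blast
  show ?thesis
  proof (rule cringI)
    show "abelian_group (ST P)"
    proof (rule abelian_groupI)
      fix s assume "s \<in> carrier (ST P)"
      then obtain x f where s: "s = fr P x f" "hfr 0 x f" "\<pi> f \<notin> P" by (auto simp: ST_simps loc_deg_eq)
      then have "f \<in> away P" by (simp add: hfr_away)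
      then have "fr P (- x) f \<oplus>\<^bsub>LOC P\<^esub> s = \<zero>\<^bsub>LOC P\<^esub>"
        using P s(1) by (simp add: fr_add LOC_zero) (rule fr_eqI, auto)
      then show "\<exists>t\<in>carrier (ST P). t \<oplus>\<^bsub>ST P\<^esub> s = \<zero>\<^bsub>ST P\<^esub>"
        using s fr_in_loc_deg[OF hfr_uminus[OF s(2)] s(3)]
        by (intro bexI[of _ "fr P (- x) f"]) (auto simp: ST_simps)
    qed (use P in \<open>auto simp: ST_simps loc_deg_add loc_deg_zero sub L.a_ac\<close>)
    show "Group.comm_monoid (ST P)"
      using loc_deg_mult[OF P, of _ 0 _ 0] loc_deg_one[OF P]
      by (intro comm_monoidI) (auto simp: ST_simps sub L.m_ac)
  qed (auto simp: ST_simps sub L.l_distr)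
qed

lemma finsum_ST:
  assumes P: "P \<in> PR" and "f \<in> B \<rightarrow> loc_deg R D P 0"
  shows "finsum (ST P) f B = finsum (LOC P) f B"
proof -
  interpret L: cring "LOC P" using P by (rule LOC_cring)
  interpret S: cring "ST P" using P by (rule ST_cring)
  show ?thesis using assms(2)
  proof (induction B rule: infinite_finite_induct)
    case (insert b B)
    then have "f b \<in> carrier (LOC P)" "f \<in> B \<rightarrow> carrier (LOC P)" using ST_sub by blast+
    then show ?case using insert by (simp add: ST_simps Pi_iff)
  qed (simp_all add: ST_simps)
qed

subsection \<open>The local ring and its residue field\<close>

definition mx :: "'a set \<Rightarrow> ('a \<times> 'a) set set" where
  "mx P = stalk_max_ideal R D P"

lemma mx_eq: "mx P = {fr P x f | x f. hfr 0 x f \<and> \<pi> f \<notin> P \<and> \<pi> x \<in> P}"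
  unfolding mx_def stalk_max_ideal_def homog_frac_rep fr_def by blast

lemma fr_in_mx:
  assumes P: "P \<in> PR" and f: "f \<in> away P" and m: "fr P x f \<in> mx P"
  shows "\<pi> x \<in> P"
proof -
  obtain y g where y: "fr P x f = fr P y g" "hfr 0 y g" "\<pi> g \<notin> P" "\<pi> y \<in> P"
    using m unfolding mx_eq by blast
  then obtain h where h: "h \<in> away P" "\<pi> (h * (g * x)) = \<pi> (h * (f * y))"
    using fr_eq_iff[OF P f hfr_away] by blast
  have "\<pi> (h * (f * y)) \<in> P" using P y by (simp add: prime_mult)
  then have "\<pi> (h * (g * x)) \<in> P" using h by simp
  then show ?thesis using P y(3) h(1) by (auto simp: prime_mult away_def)
qed

lemma mx_iff: "P \<in> PR \<Longrightarrow> hfr 0 x f \<Longrightarrow> \<pi> f \<notin> P \<Longrightarrow> fr P x f \<in> mx P \<longleftrightarrow> \<pi> x \<in> P"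
  using fr_in_mx[OF _ hfr_away] unfolding mx_eq by blast

lemma mx_ideal:
  assumes P: "P \<in> PR"
  shows "ideal (mx P) (ST P)"
proof -
  interpret S: cring "ST P" using P by (rule ST_cring)
  have sub: "mx P \<subseteq> carrier (ST P)" unfolding mx_eq ST_simps loc_deg_eq by blast
  have prod: "s \<otimes>\<^bsub>LOC P\<^esub> t \<in> mx P" if s: "s \<in> mx P" and t: "t \<in> carrier (ST P)" for s t
  proof -
    obtain x f where x: "s = fr P x f" "hfr 0 x f" "\<pi> f \<notin> P" "\<pi> x \<in> P" using s unfolding mx_eq by blast
    obtain y g where y: "t = fr P y g" "hfr 0 y g" "\<pi> g \<notin> P" using t unfolding ST_simps loc_deg_eq by blast
    show ?thesis
      using P x y hfr_mult[OF x(2) y(2)] by (simp add: fr_mult hfr_away mx_iff prime_mult)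
  qed
  have add: "s \<oplus>\<^bsub>LOC P\<^esub> t \<in> mx P" if s: "s \<in> mx P" and t: "t \<in> mx P" for s t
  proof -
    obtain x f where x: "s = fr P x f" "hfr 0 x f" "\<pi> f \<notin> P" "\<pi> x \<in> P" using s unfolding mx_eq by blast
    obtain y g where y: "t = fr P y g" "hfr 0 y g" "\<pi> g \<notin> P" "\<pi> y \<in> P" using t unfolding mx_eq by blast
    show ?thesis
      using P x y hfr_add[OF x(2) y(2)] by (simp add: fr_add hfr_away mx_iff prime_mult prime_add)
  qed
  show ?thesis
  proof (rule idealI)
    show "ring (ST P)" by (rule S.ring_axioms)
    show "subgroup (mx P) (add_monoid (ST P))"
    proof (rule group.subgroupI[OF S.add.is_group])
      show "mx P \<noteq> {}" using P H_one prime_zero[OF P] away_one[OF P] hfr_one unfolding mx_eq away_def by blast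
      show "inv\<^bsub>add_monoid (ST P)\<^esub> s \<in> mx P" if s: "s \<in> mx P" for s
      proof -
        have "\<ominus>\<^bsub>ST P\<^esub> s = (\<ominus>\<^bsub>ST P\<^esub> \<one>\<^bsub>ST P\<^esub>) \<otimes>\<^bsub>ST P\<^esub> s" using s sub by (auto simp: S.l_minus)
        also have "\<dots> = s \<otimes>\<^bsub>ST P\<^esub> (\<ominus>\<^bsub>ST P\<^esub> \<one>\<^bsub>ST P\<^esub>)" using s sub by (intro S.m_comm) auto
        also have "\<dots> \<in> mx P" using prod[OF s, of "\<ominus>\<^bsub>ST P\<^esub> \<one>\<^bsub>ST P\<^esub>"] by (simp add: ST_simps(2))
        finally show ?thesis by (simp add: a_inv_def)
      qed
    qed (use sub add in \<open>auto simp: ST_simps(3)\<close>)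
    show "t \<otimes>\<^bsub>ST P\<^esub> s \<in> mx P" if "s \<in> mx P" "t \<in> carrier (ST P)" for s t
      using prod[OF that] S.m_comm[of s t] that sub by (auto simp: ST_simps(2))
    show "s \<otimes>\<^bsub>ST P\<^esub> t \<in> mx P" if "s \<in> mx P" "t \<in> carrier (ST P)" for s t
      using prod[OF that] by (simp add: ST_simps(2))
  qed
qed

text \<open>
  The inverse of \<open>x / f\<close> is \<open>f / x\<close>, which again has degree zero.
\<close>

lemma ST_unit:
  assumes P: "P \<in> PR" and s: "s \<in> carrier (ST P)" "s \<notin> mx P"
  shows "s \<in> Units (ST P)"
proof -
  obtain x f where x: "s = fr P x f" "hfr 0 x f" "\<pi> f \<notin> P" using s(1) unfolding ST_simps loc_deg_eq by blast
  have xP: "\<pi> x \<notin> P" using s(2) mx_iff[OF P x(2,3)] x(1) by simp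
  have inv: "hfr 0 f x" using x(2) unfolding hfr_def by auto
  have "f \<in> away P" "x \<in> away P" using x xP inv hfr_away by blast+
  then have "fr P f x \<otimes>\<^bsub>ST P\<^esub> s = \<one>\<^bsub>ST P\<^esub>" "s \<otimes>\<^bsub>ST P\<^esub> fr P f x = \<one>\<^bsub>ST P\<^esub>"
    using P unfolding ST_simps x(1) LOC_one by (simp_all add: fr_mult) (rule fr_eqI; simp add: mult.commute)+
  moreover have "fr P f x \<in> carrier (ST P)" unfolding ST_simps by (rule fr_in_loc_deg[OF inv xP])
  ultimately show ?thesis using s(1) unfolding Units_def by blast
qed

abbreviation "RF P \<equiv> residue_field R D P"

definition rho :: "'a set \<Rightarrow> ('a \<times> 'a) set \<Rightarrow> ('a \<times> 'a) set set" where
  "rho P s = mx P +>\<^bsub>ST P\<^esub> s"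

lemma RF_eq: "RF P = ST P Quot mx P"
  by (simp add: residue_field_def mx_def)

lemma rho_zero_iff:
  assumes P: "P \<in> PR" and s: "s \<in> carrier (ST P)"
  shows "rho P s = \<zero>\<^bsub>RF P\<^esub> \<longleftrightarrow> s \<in> mx P"
proof -
  interpret I: ideal "mx P" "ST P" using P by (rule mx_ideal)
  have "\<zero>\<^bsub>RF P\<^esub> = mx P" by (simp add: RF_eq FactRing_def)
  then show ?thesis
    using I.a_rcos_const[of s] I.a_rcos_self[OF s] unfolding rho_def by auto
qed

lemma local_reduction_ST:
  assumes P: "P \<in> PR"
  shows "local_reduction (ST P) (RF P) (rho P)"
proof -
  interpret S: cring "ST P" using P by (rule ST_cring)
  interpret I: ideal "mx P" "ST P" using P by (rule mx_ideal)
  have hom: "rho P \<in> ring_hom (ST P) (RF P)"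
    using I.rcos_ring_hom unfolding rho_def RF_eq by (simp add: rho_def[abs_def])
  have cr: "cring (RF P)" unfolding RF_eq by (rule I.quotient_is_cring[OF S.is_cring])
  interpret K: cring "RF P" by (rule cr)
  interpret h: ring_hom_cring "ST P" "RF P" "rho P"
    by (rule ring_hom_cring.intro[OF S.is_cring cr]) (use hom in \<open>simp add: ring_hom_cring_axioms_def\<close>)
  have surj: "\<exists>r\<in>carrier (ST P). rho P r = s" if "s \<in> carrier (RF P)" for s
    using that unfolding RF_eq FactRing_def A_RCOSETS_def' rho_def by auto
  have unit: "r \<in> Units (ST P)" if "r \<in> carrier (ST P)" "rho P r \<noteq> \<zero>\<^bsub>RF P\<^esub>" for r
    using that rho_zero_iff[OF P] ST_unit[OF P] by blast
  have one: "\<one>\<^bsub>ST P\<^esub> \<notin> mx P"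
  proof
    assume "\<one>\<^bsub>ST P\<^esub> \<in> mx P"
    then have "\<pi> 1 \<in> P" using fr_in_mx[OF P away_one[OF P], of 1] by (simp add: ST_simps LOC_one)
    then show False using away_one[OF P] by (simp add: away_def)
  qed
  have "field (RF P)"
  proof (rule K.cring_fieldI)
    have "\<one>\<^bsub>RF P\<^esub> \<noteq> \<zero>\<^bsub>RF P\<^esub>" using one rho_zero_iff[OF P S.one_closed] h.hom_one by simp
    show "Units (RF P) = carrier (RF P) - {\<zero>\<^bsub>RF P\<^esub>}"
    proof
      show "Units (RF P) \<subseteq> carrier (RF P) - {\<zero>\<^bsub>RF P\<^esub>}"
        using \<open>\<one>\<^bsub>RF P\<^esub> \<noteq> \<zero>\<^bsub>RF P\<^esub>\<close> unfolding Units_def by auto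
      show "carrier (RF P) - {\<zero>\<^bsub>RF P\<^esub>} \<subseteq> Units (RF P)"
      proof
        fix s assume s: "s \<in> carrier (RF P) - {\<zero>\<^bsub>RF P\<^esub>}"
        then obtain r where r: "r \<in> carrier (ST P)" "rho P r = s" using surj by blast
        then have "r \<in> Units (ST P)" using unit s by auto
        then obtain t where t: "t \<in> carrier (ST P)" "t \<otimes>\<^bsub>ST P\<^esub> r = \<one>\<^bsub>ST P\<^esub>" "r \<otimes>\<^bsub>ST P\<^esub> t = \<one>\<^bsub>ST P\<^esub>"
          unfolding Units_def by blast
        then have "rho P t \<otimes>\<^bsub>RF P\<^esub> s = \<one>\<^bsub>RF P\<^esub>" "s \<otimes>\<^bsub>RF P\<^esub> rho P t = \<one>\<^bsub>RF P\<^esub>"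
          using r by (metis h.hom_mult h.hom_one)+
        then show "s \<in> Units (RF P)" using s t(1) unfolding Units_def by auto
      qed
    qed
  qed
  then show ?thesis
    by (intro local_reduction.intro reduction.intro h.ring_hom_cring_axioms local_reduction_axioms.intro)
      (use surj unit in auto)
qed

subsection \<open>Germs of sections\<close>

text \<open>
  Properties that hold on a neighbourhood of \<open>P\<close>.  Sections and identities between them are handled
  through this predicate, so that finitely many neighbourhoods are intersected tacitly.
\<close>

definition near :: "'a set \<Rightarrow> ('a set \<Rightarrow> bool) \<Rightarrow> bool" where
  "near P \<Phi> \<longleftrightarrow> (\<exists>V. is_open V \<and> P \<in> V \<and> (\<forall>Q\<in>V. \<Phi> Q))"

lemma open_sub: "is_open U \<Longrightarrow> U \<subseteq> PR"
  by (auto simp: proj_open_def)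

lemma open_PR: "is_open PR"
  unfolding proj_open_def
proof (intro exI[of _ "{\<one>}"] conjI)
  show "{\<one>} \<subseteq> (\<Union>n. D n)" using H_one by (auto simp: D_eq \<pi>_one[symmetric])
  show "PR = {P \<in> PR. \<not> {\<one>} \<subseteq> P}" using away_one by (auto simp: away_def \<pi>_one)
qed

lemma open_principal: "f \<in> H e \<Longrightarrow> is_open {P \<in> PR. \<pi> f \<notin> P}"
  unfolding proj_open_def by (intro exI[of _ "{\<pi> f}"]) (auto simp: D_eq)

lemma open_Int:
  assumes "is_open U" "is_open V"
  shows "is_open (U \<inter> V)"
proof -
  obtain E where E: "E \<subseteq> (\<Union>n. D n)" "U = {P \<in> PR. \<not> E \<subseteq> P}" using assms(1) by (auto simp: proj_open_def)
  obtain E' where E': "E' \<subseteq> (\<Union>n. D n)" "V = {P \<in> PR. \<not> E' \<subseteq> P}" using assms(2) by (auto simp: proj_open_def)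
  have "U \<inter> V = {P \<in> PR. \<not> {x \<otimes> y | x y. x \<in> E \<and> y \<in> E'} \<subseteq> P}"
  proof (rule subset_antisym; rule subsetI)
    fix P assume P: "P \<in> U \<inter> V"
    then obtain x y where "x \<in> E" "y \<in> E'" "x \<notin> P" "y \<notin> P" using E E' by auto
    moreover have "P \<in> PR" using P E by auto
    moreover obtain x' y' where "x = \<pi> x'" "y = \<pi> y'" using calculation E E' by (auto simp: D_eq) blast
    ultimately show "P \<in> {P \<in> PR. \<not> {x \<otimes> y | x y. x \<in> E \<and> y \<in> E'} \<subseteq> P}"
      using prime_mult[of P x' y'] by (auto simp: \<pi>_mult)
  next
    fix P assume "P \<in> {P \<in> PR. \<not> {x \<otimes> y | x y. x \<in> E \<and> y \<in> E'} \<subseteq> P}"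
    then obtain x y where xy: "P \<in> PR" "x \<in> E" "y \<in> E'" "x \<otimes> y \<notin> P" by auto
    moreover obtain x' y' where "x = \<pi> x'" "y = \<pi> y'" using xy E E' by (auto simp: D_eq) blast
    ultimately have "x \<notin> P" "y \<notin> P" using prime_mult[of P x' y'] by (auto simp: \<pi>_mult)
    then show "P \<in> U \<inter> V" using xy E E' by auto
  qed
  moreover have "{x \<otimes> y | x y. x \<in> E \<and> y \<in> E'} \<subseteq> (\<Union>n. D n)"
  proof clarify
    fix x y assume "x \<in> E" "y \<in> E'"
    then obtain m n x' y' where "x' \<in> H m" "y' \<in> H n" "x = \<pi> x'" "y = \<pi> y'"
      using E E' by (auto simp: D_eq subset_iff) blast
    then show "x \<otimes> y \<in> (\<Union>n. D n)" using H_mult[of x' m y' n] by (auto simp: D_eq \<pi>_mult[symmetric])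
  qed
  ultimately show ?thesis unfolding proj_open_def by blast
qed

lemma near_PR: "near P \<Phi> \<Longrightarrow> P \<in> PR"
  unfolding near_def using open_sub by blast

lemma near_at: "near P \<Phi> \<Longrightarrow> \<Phi> P"
  by (auto simp: near_def)

lemma near_conj: "near P \<Phi> \<Longrightarrow> near P \<Psi> \<Longrightarrow> near P (\<lambda>Q. \<Phi> Q \<and> \<Psi> Q)"
  unfolding near_def using open_Int by (metis (no_types, lifting) IntE IntI)

lemma near_true: "P \<in> PR \<Longrightarrow> near P (\<lambda>Q. Q \<in> PR)"
  unfolding near_def using open_PR by blast

lemma near_open: "is_open V \<Longrightarrow> P \<in> V \<Longrightarrow> near P (\<lambda>Q. Q \<in> V)"
  unfolding near_def by blast

lemma near_mono:
  assumes "near P \<Phi>" "\<And>Q. Q \<in> PR \<Longrightarrow> \<Phi> Q \<Longrightarrow> \<Psi> Q"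
  shows "near P \<Psi>"
  using assms open_sub unfolding near_def by (meson subsetD)

lemma near_mono2:
  assumes "near P \<Phi>" "near P \<Phi>'" "\<And>Q. Q \<in> PR \<Longrightarrow> \<Phi> Q \<Longrightarrow> \<Phi>' Q \<Longrightarrow> \<Psi> Q"
  shows "near P \<Psi>"
  using near_mono[OF near_conj[OF assms(1,2)]] assms(3) by blast

lemma near_ball:
  assumes "finite B" "P \<in> PR" "\<And>b. b \<in> B \<Longrightarrow> near P (\<lambda>Q. \<Phi> Q b)"
  shows "near P (\<lambda>Q. \<forall>b\<in>B. \<Phi> Q b)"
  using assms(1,3)
proof (induction B rule: finite_induct)
  case empty
  then show ?case using near_true[OF assms(2)] by (auto elim: near_mono)
next
  case (insert b B)
  have "near P (\<lambda>Q. \<Phi> Q b)" by (rule insert.prems) simp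
  moreover have "near P (\<lambda>Q. \<forall>b\<in>B. \<Phi> Q b)" by (rule insert.IH) (rule insert.prems, simp)
  ultimately show ?case by (rule near_mono2) simp
qed

lemma near_near: "near P \<Phi> \<Longrightarrow> near P (\<lambda>Q. near Q \<Phi>)"
  unfolding near_def by blast

lemma near_principal:
  assumes "f \<in> away P" "P \<in> PR"
  shows "near P (\<lambda>Q. f \<in> away Q)"
proof -
  obtain e where e: "f \<in> H e" "\<pi> f \<notin> P" using assms(1) unfolding away_def by blast
  have "\<forall>Q\<in>{Q \<in> PR. \<pi> f \<notin> Q}. f \<in> away Q" using e(1) unfolding away_def by blast
  moreover have "P \<in> {Q \<in> PR. \<pi> f \<notin> Q}" using assms(2) e(2) by blast
  ultimately show ?thesis unfolding near_def using open_principal[OF e(1)] by blast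
qed

text \<open>\<open>sec n P s\<close>: near \<open>P\<close>, the function \<open>s\<close> to the stalks is a section of \<open>\<O>(n)\<close>.\<close>

definition sec :: "int \<Rightarrow> 'a set \<Rightarrow> ('a set \<Rightarrow> ('a \<times> 'a) set) \<Rightarrow> bool" where
  "sec n P s \<longleftrightarrow> (\<exists>x f. hfr n x f \<and> near P (\<lambda>Q. \<pi> f \<notin> Q \<and> s Q = fr Q x f))"

lemma sec_PR: "sec n P s \<Longrightarrow> P \<in> PR"
  unfolding sec_def using near_PR by blast

lemma sec_mem: "sec n P s \<Longrightarrow> s P \<in> loc_deg R D P n"
  unfolding sec_def loc_deg_eq using near_at by blast

lemma sec_near: "sec n P s \<Longrightarrow> near P (\<lambda>Q. sec n Q s)"
  unfolding sec_def by (elim exE conjE, drule near_near, erule near_mono) blast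

lemma sec_near_mem: "sec n P s \<Longrightarrow> near P (\<lambda>Q. s Q \<in> loc_deg R D Q n)"
  by (drule sec_near, erule near_mono, erule sec_mem)

lemma sec_cong: "sec n P s \<Longrightarrow> near P (\<lambda>Q. s Q = t Q) \<Longrightarrow> sec n P t"
  unfolding sec_def
proof (elim exE conjE)
  fix x f assume *: "hfr n x f" "near P (\<lambda>Q. \<pi> f \<notin> Q \<and> s Q = fr Q x f)" "near P (\<lambda>Q. s Q = t Q)"
  have "near P (\<lambda>Q. \<pi> f \<notin> Q \<and> t Q = fr Q x f)" by (rule near_mono2[OF *(2,3)]) auto
  then show "\<exists>x f. hfr n x f \<and> near P (\<lambda>Q. \<pi> f \<notin> Q \<and> t Q = fr Q x f)" using * by blast
qed

lemma sec_fr: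
  assumes "hfr n x f" "P \<in> PR" "\<pi> f \<notin> P"
  shows "sec n P (\<lambda>Q. fr Q x f)"
proof -
  have "near P (\<lambda>Q. f \<in> away Q)" using assms hfr_away near_principal by blast
  then have "near P (\<lambda>Q. \<pi> f \<notin> Q \<and> fr Q x f = fr Q x f)" by (rule near_mono) (auto simp: away_def)
  then show ?thesis using assms unfolding sec_def by blast
qed

lemma sec_germ:
  assumes "P \<in> PR" "y \<in> loc_deg R D P n"
  shows "\<exists>s. sec n P s \<and> s P = y"
  using assms sec_fr unfolding loc_deg_eq by blast

lemma sec_mult:
  assumes "sec m P s" "sec n P t"
  shows "sec (m + n) P (\<lambda>Q. s Q \<otimes>\<^bsub>LOC Q\<^esub> t Q)"
proof -
  obtain x f where 1: "hfr m x f" "near P (\<lambda>Q. \<pi> f \<notin> Q \<and> s Q = fr Q x f)" using assms(1) unfolding sec_def by blast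
  obtain y g where 2: "hfr n y g" "near P (\<lambda>Q. \<pi> g \<notin> Q \<and> t Q = fr Q y g)" using assms(2) unfolding sec_def by blast
  have "near P (\<lambda>Q. \<pi> (f * g) \<notin> Q \<and> s Q \<otimes>\<^bsub>LOC Q\<^esub> t Q = fr Q (x * y) (f * g))"
    by (rule near_mono2[OF 1(2) 2(2)]) (use 1 2 in \<open>auto simp: prime_mult fr_mult hfr_away\<close>)
  then show ?thesis using hfr_mult[OF 1(1) 2(1)] unfolding sec_def by blast
qed

lemma sec_add:
  assumes "sec n P s" "sec n P t"
  shows "sec n P (\<lambda>Q. s Q \<oplus>\<^bsub>LOC Q\<^esub> t Q)"
proof -
  obtain x f where 1: "hfr n x f" "near P (\<lambda>Q. \<pi> f \<notin> Q \<and> s Q = fr Q x f)" using assms(1) unfolding sec_def by blast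
  obtain y g where 2: "hfr n y g" "near P (\<lambda>Q. \<pi> g \<notin> Q \<and> t Q = fr Q y g)" using assms(2) unfolding sec_def by blast
  have "near P (\<lambda>Q. \<pi> (f * g) \<notin> Q \<and> s Q \<oplus>\<^bsub>LOC Q\<^esub> t Q = fr Q (g * x + f * y) (f * g))"
    by (rule near_mono2[OF 1(2) 2(2)]) (use 1 2 in \<open>auto simp: prime_mult fr_add hfr_away\<close>)
  then show ?thesis using hfr_add[OF 1(1) 2(1)] unfolding sec_def by blast
qed

lemma sec_zero: "P \<in> PR \<Longrightarrow> sec 0 P (\<lambda>Q. \<zero>\<^bsub>LOC Q\<^esub>)"
  and sec_one: "P \<in> PR \<Longrightarrow> sec 0 P (\<lambda>Q. \<one>\<^bsub>LOC Q\<^esub>)"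
  unfolding LOC_zero LOC_one using sec_fr hfr_one away_one by (auto simp: away_def)

lemma sec_finsum:
  assumes "finite B" "P \<in> PR" "\<And>b. b \<in> B \<Longrightarrow> sec n P (s b)" "sec n P (\<lambda>Q. \<zero>\<^bsub>LOC Q\<^esub>)"
  shows "sec n P (\<lambda>Q. \<Oplus>\<^bsub>LOC Q\<^esub>b\<in>B. s b Q)"
  using assms(1,3)
proof (induction B rule: finite_induct)
  case empty
  have "near P (\<lambda>Q. \<zero>\<^bsub>LOC Q\<^esub> = (\<Oplus>\<^bsub>LOC Q\<^esub>b\<in>{}. s b Q))"
    using near_true[OF assms(2)]
  proof (rule near_mono)
    fix Q assume "Q \<in> PR"
    then interpret L: cring "LOC Q" by (rule LOC_cring)
    show "\<zero>\<^bsub>LOC Q\<^esub> = (\<Oplus>\<^bsub>LOC Q\<^esub>b\<in>{}. s b Q)" by simp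
  qed
  then show ?case by (rule sec_cong[OF assms(4)])
next
  case (insert c B)
  have n: "near P (\<lambda>Q. \<forall>b\<in>insert c B. s b Q \<in> loc_deg R D Q n)"
    using insert by (intro near_ball assms(2) sec_near_mem) auto
  have eq: "near P (\<lambda>Q. s c Q \<oplus>\<^bsub>LOC Q\<^esub> (\<Oplus>\<^bsub>LOC Q\<^esub>b\<in>B. s b Q) = (\<Oplus>\<^bsub>LOC Q\<^esub>b\<in>insert c B. s b Q))"
    using n
  proof (rule near_mono)
    fix Q assume Q: "Q \<in> PR" "\<forall>b\<in>insert c B. s b Q \<in> loc_deg R D Q n"
    interpret L: cring "LOC Q" using Q by (intro LOC_cring)
    have "\<forall>b\<in>insert c B. s b Q \<in> carrier (LOC Q)" using Q(2) ST_sub by blast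
    then show "s c Q \<oplus>\<^bsub>LOC Q\<^esub> (\<Oplus>\<^bsub>LOC Q\<^esub>b\<in>B. s b Q) = (\<Oplus>\<^bsub>LOC Q\<^esub>b\<in>insert c B. s b Q)"
      using insert by (subst L.finsum_insert) auto
  qed
  have "sec n P (s c)" by (rule insert.prems) simp
  moreover have "sec n P (\<lambda>Q. \<Oplus>\<^bsub>LOC Q\<^esub>b\<in>B. s b Q)" by (rule insert.IH) (rule insert.prems, simp)
  ultimately show ?case using eq by (rule sec_cong[OF sec_add])
qed

text \<open>
  An identity between two fractions at \<open>P\<close> holds wherever the multiplier that proves it is admissible.
\<close>

lemma sec_eq:
  assumes "sec n P s" "sec n P t" "s P = t P"
  shows "near P (\<lambda>Q. s Q = t Q)"
proof -
  obtain x f where 1: "hfr n x f" "near P (\<lambda>Q. \<pi> f \<notin> Q \<and> s Q = fr Q x f)" using assms(1) unfolding sec_def by blast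
  obtain y g where 2: "hfr n y g" "near P (\<lambda>Q. \<pi> g \<notin> Q \<and> t Q = fr Q y g)" using assms(2) unfolding sec_def by blast
  have P: "P \<in> PR" using sec_PR[OF assms(1)] .
  have "fr P x f = fr P y g" "\<pi> f \<notin> P" "\<pi> g \<notin> P" using near_at[OF 1(2)] near_at[OF 2(2)] assms(3) by auto
  then obtain h where h: "h \<in> away P" "\<pi> (h * (g * x)) = \<pi> (h * (f * y))"
    using fr_eq_iff[OF P hfr_away[OF 1(1)] hfr_away[OF 2(1)]] by blast
  show ?thesis
  proof (rule near_mono2[OF near_conj[OF 1(2) 2(2)] near_principal[OF h(1) P]])
    fix Q assume "Q \<in> PR" "(\<pi> f \<notin> Q \<and> s Q = fr Q x f) \<and> \<pi> g \<notin> Q \<and> t Q = fr Q y g" "h \<in> away Q"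
    then show "s Q = t Q" using fr_eq_iff[of Q f g x y] hfr_away[OF 1(1)] hfr_away[OF 2(1)] h(2) by auto
  qed
qed

lemma twist_iff:
  assumes W: "is_open W"
  shows "s \<in> twist R D n W \<longleftrightarrow> s \<in> extensional W \<and> (\<forall>P\<in>W. sec n P s)"
proof
  assume s: "s \<in> twist R D n W"
  have "sec n P s" if P: "P \<in> W" for P
  proof -
    obtain V u w where V: "is_open V" "P \<in> V" "homog_frac D n u w"
      "\<forall>Q\<in>V. w \<notin> Q \<and> s Q = fraction R (homog_away D Q) u w"
      using s[unfolded twist_def, THEN CollectD, THEN conjunct2, rule_format, OF P] by blast
    obtain x f where "u = \<pi> x" "w = \<pi> f" "hfr n x f" using V(3) unfolding homog_frac_rep by blast
    then have "hfr n x f" "\<forall>Q\<in>V. \<pi> f \<notin> Q \<and> s Q = fr Q x f" using V(4) by (simp_all add: fr_def)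
    then show ?thesis using V(1,2) unfolding sec_def near_def by blast
  qed
  then show "s \<in> extensional W \<and> (\<forall>P\<in>W. sec n P s)" using s by (auto simp: twist_def PiE_def)
next
  assume s: "s \<in> extensional W \<and> (\<forall>P\<in>W. sec n P s)"
  show "s \<in> twist R D n W" unfolding twist_def
  proof (intro CollectI conjI ballI)
    show "s \<in> (\<Pi>\<^sub>E P\<in>W. loc_deg R D P n)" using s sec_mem by (auto simp: PiE_def)
    fix P assume P: "P \<in> W"
    then obtain x f where 1: "hfr n x f" "near P (\<lambda>Q. \<pi> f \<notin> Q \<and> s Q = fr Q x f)"
      using s unfolding sec_def by blast
    then obtain V where V: "is_open V" "P \<in> V" "\<forall>Q\<in>V. \<pi> f \<notin> Q \<and> s Q = fr Q x f" unfolding near_def by blast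
    have "homog_frac D n (\<pi> x) (\<pi> f)" using 1(1) unfolding homog_frac_rep by blast
    moreover have "\<forall>Q\<in>V \<inter> W. \<pi> f \<notin> Q \<and> s Q = fraction R (homog_away D Q) (\<pi> x) (\<pi> f)"
      using V(3) by (simp add: fr_def)
    moreover have "is_open (V \<inter> W)" "P \<in> V \<inter> W" "V \<inter> W \<subseteq> W" using V P open_Int[OF V(1) W] by blast+
    ultimately show "\<exists>V. is_open V \<and> P \<in> V \<and> V \<subseteq> W \<and>
      (\<exists>x f. homog_frac D n x f \<and> (\<forall>Q\<in>V. f \<notin> Q \<and> s Q = fraction R (homog_away D Q) x f))"
      by blast
  qed
qed

definition vsec :: "int \<Rightarrow> 'i set \<Rightarrow> 'a set \<Rightarrow> ('a set \<Rightarrow> 'i \<Rightarrow> ('a \<times> 'a) set) \<Rightarrow> bool" where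
  "vsec n B P s \<longleftrightarrow> (\<forall>b\<in>B. sec n P (\<lambda>Q. s Q b)) \<and> near P (\<lambda>Q. s Q \<in> extensional B)"

lemma vsec_PR: "vsec n B P s \<Longrightarrow> P \<in> PR"
  unfolding vsec_def using near_PR by blast

lemma vsec_mem: "vsec n B P s \<Longrightarrow> s P \<in> B \<rightarrow>\<^sub>E loc_deg R D P n"
  unfolding vsec_def PiE_def using sec_mem near_at by blast

lemma vsec_near: "finite B \<Longrightarrow> vsec n B P s \<Longrightarrow> near P (\<lambda>Q. vsec n B Q s)"
proof -
  assume B: "finite B" and s: "vsec n B P s"
  have "near P (\<lambda>Q. \<forall>b\<in>B. sec n Q (\<lambda>Q. s Q b))"
    using s B vsec_PR[OF s] by (intro near_ball sec_near) (auto simp: vsec_def)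
  moreover have "near P (\<lambda>Q. near Q (\<lambda>Q. s Q \<in> extensional B))" using s near_near by (auto simp: vsec_def)
  ultimately show ?thesis by (rule near_mono2) (auto simp: vsec_def)
qed

lemma vsec_near_mem: "finite B \<Longrightarrow> vsec n B P s \<Longrightarrow> near P (\<lambda>Q. s Q \<in> B \<rightarrow>\<^sub>E loc_deg R D Q n)"
  by (drule (1) vsec_near, erule near_mono, erule vsec_mem)

lemma vsec_cong: "vsec n B P s \<Longrightarrow> near P (\<lambda>Q. s Q = t Q) \<Longrightarrow> vsec n B P t"
proof -
  assume s: "vsec n B P s" and n: "near P (\<lambda>Q. s Q = t Q)"
  have "sec n P (\<lambda>Q. t Q b)" if "b \<in> B" for b
  proof (rule sec_cong)
    show "sec n P (\<lambda>Q. s Q b)" using s that unfolding vsec_def by blast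
    show "near P (\<lambda>Q. s Q b = t Q b)" by (rule near_mono[OF n]) simp
  qed
  moreover have "near P (\<lambda>Q. t Q \<in> extensional B)"
    by (rule near_mono2[OF s[unfolded vsec_def, THEN conjunct2] n]) simp
  ultimately show ?thesis by (simp add: vsec_def)
qed

lemma vsec_restrict: "P \<in> PR \<Longrightarrow> (\<And>b. b \<in> B \<Longrightarrow> sec n P (s b)) \<Longrightarrow> vsec n B P (\<lambda>Q. \<lambda>b\<in>B. s b Q)"
  unfolding vsec_def using near_mono[OF near_true[of P], of "\<lambda>Q. (\<lambda>b\<in>B. s b Q) \<in> extensional B"] by auto

lemma vsec_germ:
  assumes P: "P \<in> PR" and y: "y \<in> B \<rightarrow>\<^sub>E loc_deg R D P n"
  shows "\<exists>s. vsec n B P s \<and> s P = y"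
proof -
  have "\<forall>b. \<exists>s. b \<in> B \<longrightarrow> sec n P s \<and> s P = y b" using sec_germ[OF P] y by (auto simp: PiE_iff)
  then obtain s where s: "\<And>b. b \<in> B \<Longrightarrow> sec n P (s b) \<and> s b P = y b" by metis
  have "(\<lambda>b\<in>B. s b P) = y" using s y by (auto simp: PiE_iff extensional_def fun_eq_iff)
  then show ?thesis using vsec_restrict[OF P, of B n s] s by (intro exI[of _ "\<lambda>Q. \<lambda>b\<in>B. s b Q"]) auto
qed

lemma vsec_eq:
  assumes "finite B" "vsec n B P s" "vsec n B P t" "s P = t P"
  shows "near P (\<lambda>Q. s Q = t Q)"
proof -
  have "near P (\<lambda>Q. \<forall>b\<in>B. s Q b = t Q b)"
  proof (rule near_ball[OF assms(1) vsec_PR[OF assms(2)]])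
    fix b assume "b \<in> B"
    then show "near P (\<lambda>Q. s Q b = t Q b)"
      using assms(2-4) by (intro sec_eq[of n]) (simp_all add: vsec_def)
  qed
  moreover have "near P (\<lambda>Q. s Q \<in> extensional B \<and> t Q \<in> extensional B)"
    using assms by (intro near_conj) (auto simp: vsec_def)
  ultimately show ?thesis by (rule near_mono2) (auto intro: extensionalityI)
qed

lemma twist_power_iff:
  assumes W: "is_open W"
  shows "s \<in> twist_power R D n B W \<longleftrightarrow> s \<in> extensional W \<and> (\<forall>P\<in>W. vsec n B P s)"
proof -
  have r: "sec n P (\<lambda>P\<in>W. s P b) \<longleftrightarrow> sec n P (\<lambda>P. s P b)" if "P \<in> W" for P b
    using sec_cong[of n P "\<lambda>P\<in>W. s P b" "\<lambda>P. s P b"] sec_cong[of n P "\<lambda>P. s P b" "\<lambda>P\<in>W. s P b"]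
      near_mono[OF near_open[OF W that]] by auto
  show ?thesis
  proof
    assume s: "s \<in> twist_power R D n B W"
    then have e: "s \<in> extensional W" "\<And>P. P \<in> W \<Longrightarrow> s P \<in> extensional B"
      and t: "\<And>b. b \<in> B \<Longrightarrow> (\<lambda>P\<in>W. s P b) \<in> twist R D n W"
      by (auto simp: twist_power_def PiE_def)
    have "vsec n B P s" if P: "P \<in> W" for P unfolding vsec_def
      using t r[OF P] P twist_iff[OF W] e near_mono[OF near_open[OF W P]] by auto
    then show "s \<in> extensional W \<and> (\<forall>P\<in>W. vsec n B P s)" using e by auto
  next
    assume s: "s \<in> extensional W \<and> (\<forall>P\<in>W. vsec n B P s)"
    then have m: "s P \<in> B \<rightarrow>\<^sub>E loc_deg R D P n" if "P \<in> W" for P using vsec_mem that by blast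
    have "(\<lambda>P\<in>W. s P b) \<in> twist R D n W" if "b \<in> B" for b
      unfolding twist_iff[OF W] using s r that by (simp add: vsec_def)
    then show "s \<in> twist_power R D n B W" unfolding twist_power_def
      using m s by (simp add: PiE_def Pi_iff)
  qed
qed

end

section \<open>The sheaves of a homogeneous matrix\<close>

text \<open>
  Two properties of the graded ring are needed.  By \<open>degree\<close> the sheaf \<open>\<O>(d)\<close> is trivialised near each
  point by an element of degree \<open>d\<close>.  By \<open>vanishing\<close> an element that lies in every point of the basic open
  set of \<open>f\<close> is annihilated by \<open>f\<close>; this is where the ring has to be reduced.
\<close>

locale reduced_presentation = graded_presentation R D \<pi> H
  for R :: "('a, 'b) ring_scheme" (structure) and D and \<pi> :: "'p::comm_ring_1 \<Rightarrow> 'a" and H +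
  fixes d :: nat
  assumes degree: "P \<in> Proj R D \<Longrightarrow> \<exists>f\<in>H d. \<pi> f \<notin> P"
    and vanishing: "x \<in> H m \<Longrightarrow> f \<in> H e \<Longrightarrow> 0 < e \<Longrightarrow>
      (\<And>Q. Q \<in> Proj R D \<Longrightarrow> \<pi> f \<notin> Q \<Longrightarrow> \<pi> x \<in> Q) \<Longrightarrow> \<pi> (f * x) = \<zero>"
begin

text \<open>
  A section whose values near \<open>P\<close> all lie in the maximal ideals has germ zero at \<open>P\<close>: its numerator \<open>x\<close>
  lies in every point of a basic open set, so \<open>vanishing\<close> yields an element outside \<open>P\<close> that
  annihilates \<open>x\<close>.
\<close>

lemma sec_reduced:
  assumes s: "sec 0 P s" and m: "near P (\<lambda>Q. s Q \<in> mx Q)"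
  shows "s P = \<zero>\<^bsub>LOC P\<^esub>"
proof -
  have P: "P \<in> PR" using sec_PR[OF s] .
  obtain x f where x: "hfr 0 x f" "near P (\<lambda>Q. \<pi> f \<notin> Q \<and> s Q = fr Q x f)" using s unfolding sec_def by blast
  have "near P (\<lambda>Q. \<pi> x \<in> Q)"
  proof (rule near_mono2[OF x(2) m])
    fix Q assume "Q \<in> PR" "\<pi> f \<notin> Q \<and> s Q = fr Q x f" "s Q \<in> mx Q"
    then show "\<pi> x \<in> Q" using mx_iff[OF _ x(1)] by auto
  qed
  then obtain V where V: "is_open V" "P \<in> V" "\<forall>Q\<in>V. \<pi> x \<in> Q" unfolding near_def by blast
  then obtain E where E: "E \<subseteq> (\<Union>n. D n)" "V = {Q \<in> PR. \<not> E \<subseteq> Q}" unfolding proj_open_def by blast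
  then obtain u where u: "u \<in> E" "u \<notin> P" using V(2) by blast
  then obtain h k where h: "u = \<pi> h" "h \<in> H k" using E(1) unfolding D_eq by blast
  obtain e g where g: "g \<in> H e" "0 < e" "\<pi> g \<notin> P"
    using P unfolding Proj_def D_eq by blast
  obtain m where xm: "x \<in> H m" using x(1) unfolding hfr_def by blast
  have "\<pi> (h * g * x) = \<zero>"
  proof (rule vanishing[OF xm H_mult[OF h(2) g(1)]])
    show "0 < k + e" using g(2) by simp
    fix Q assume Q: "Q \<in> PR" "\<pi> (h * g) \<notin> Q"
    then have "u \<notin> Q" using h prime_mult[OF Q(1)] by blast
    then have "Q \<in> V" using E(2) u(1) Q(1) by blast
    then show "\<pi> x \<in> Q" using V(3) by blast
  qed
  moreover have hg: "h * g \<in> away P"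
    using H_mult[OF h(2) g(1)] prime_mult[OF P, of h g] u(2) h(1) g(3) unfolding away_def by blast
  moreover have fP: "f \<in> away P" using near_at[OF x(2)] hfr_away[OF x(1)] by blast
  ultimately have "fr P x f = fr P 0 1"
    using P by (subst fr_eq_iff) (auto intro!: bexI[of _ "h * g"] simp: \<pi>_zero)
  then show ?thesis using near_at[OF x(2)] by (simp add: LOC_zero)
qed

end

fun mat_pow :: "'i set \<Rightarrow> ('i \<Rightarrow> 'i \<Rightarrow> 'p::comm_ring_1) \<Rightarrow> nat \<Rightarrow> 'i \<Rightarrow> 'i \<Rightarrow> 'p" where
  "mat_pow B A 0 = (\<lambda>b b'. if b = b' then 1 else 0)"
| "mat_pow B A (Suc n) = (\<lambda>b b'. \<Sum>c\<in>B. A b c * mat_pow B A n c b')"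

text \<open>
  The matrix entries are given by representatives in the presenting ring, and the powers are formed
  there, which keeps the nilpotency hypothesis free of sums over the carrier of \<open>R\<close>.
\<close>

locale homogeneous_matrix = reduced_presentation R D \<pi> H d
  for R :: "('a, 'b) ring_scheme" (structure) and D and \<pi> :: "'p::comm_ring_1 \<Rightarrow> 'a" and H and d +
  fixes B :: "'i set" and A :: "'i \<Rightarrow> 'i \<Rightarrow> 'p" and p :: nat
  assumes fB: "finite B"
    and A_degree: "b \<in> B \<Longrightarrow> b' \<in> B \<Longrightarrow> A b b' \<in> H d"
    and nilpotent: "b \<in> B \<Longrightarrow> b' \<in> B \<Longrightarrow> \<pi> (mat_pow B A p b b') = \<zero>"
begin

abbreviation "RA \<equiv> \<lambda>b b'. \<pi> (A b b')"
abbreviation "MO \<equiv> matrix_op R D B RA"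

text \<open>
  The operator \<open>\<Theta>/f\<close> on the free module over the local ring, and the same operator over the full
  homogeneous localization, on which multiplication by \<open>f\<close> is defined.
\<close>

definition th :: "'p \<Rightarrow> 'a set \<Rightarrow> ('i \<Rightarrow> ('a \<times> 'a) set) \<Rightarrow> 'i \<Rightarrow> ('a \<times> 'a) set" where
  "th f Q = mat_op (ST Q) B (\<lambda>b b'. fr Q (A b b') f)"

definition thL :: "'p \<Rightarrow> 'a set \<Rightarrow> ('i \<Rightarrow> ('a \<times> 'a) set) \<Rightarrow> 'i \<Rightarrow> ('a \<times> 'a) set" where
  "thL f Q = mat_op (LOC Q) B (\<lambda>b b'. fr Q (A b b') f)"

text \<open>The element \<open>f\<close> trivialises \<open>\<O>(d)\<close> at \<open>Q\<close>.\<close>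

definition unit_at :: "'p \<Rightarrow> 'a set \<Rightarrow> bool" where
  "unit_at f Q \<longleftrightarrow> Q \<in> PR \<and> f \<in> H d \<and> \<pi> f \<notin> Q"

lemma unit_at_away: "unit_at f Q \<Longrightarrow> f \<in> away Q"
  unfolding unit_at_def away_def by blast

lemma unit_at_PR: "unit_at f Q \<Longrightarrow> Q \<in> PR"
  unfolding unit_at_def by blast

lemma away_pow: "P \<in> PR \<Longrightarrow> f \<in> away P \<Longrightarrow> f ^ n \<in> away P"
  by (induction n) auto

lemma H_pow: "f \<in> H e \<Longrightarrow> f ^ n \<in> H (n * e)"
  by (induction n) (auto simp: H_one H_mult add.commute)

lemma unit_at_ex: "Q \<in> PR \<Longrightarrow> \<exists>f. unit_at f Q"
  using degree unfolding unit_at_def by blast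

lemma unit_at_near: "unit_at f P \<Longrightarrow> near P (unit_at f)"
  using near_principal[OF unit_at_away unit_at_PR, of f P f]
  by (rule near_mono) (simp_all add: unit_at_def away_def)

lemma entry_deg: "unit_at f Q \<Longrightarrow> b \<in> B \<Longrightarrow> b' \<in> B \<Longrightarrow> hfr 0 (A b b') f"
  unfolding unit_at_def hfr_def using A_degree by auto

lemma entry_closed: "unit_at f Q \<Longrightarrow> b \<in> B \<Longrightarrow> b' \<in> B \<Longrightarrow> fr Q (A b b') f \<in> loc_deg R D Q 0"
  using fr_in_loc_deg entry_deg by (auto simp: unit_at_def)

lemma MO_eq: "MO Q = mat_op (LOC Q) B (\<lambda>b b'. fr Q (A b b') 1)"
  unfolding matrix_op_def mat_op_def fr_def \<pi>_one ..

abbreviation "VL Q \<equiv> free_module (LOC Q) B"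
abbreviation "VS Q \<equiv> free_module (ST Q) B"

lemma th_linear:
  assumes f: "unit_at f Q"
  shows "plain_module.linear_op (ST Q) (VS Q) (th f Q)"
proof -
  interpret S: cring "ST Q" using unit_at_PR[OF f] by (rule ST_cring)
  show ?thesis unfolding th_def using fB entry_closed[OF f] by (intro S.mat_op_linear) (auto simp: ST_simps)
qed

lemma thL_linear:
  assumes f: "unit_at f Q"
  shows "plain_module.linear_op (LOC Q) (VL Q) (thL f Q)"
proof -
  interpret L: cring "LOC Q" using unit_at_PR[OF f] by (rule LOC_cring)
  show ?thesis unfolding thL_def using fB fr_carrier[OF unit_at_away[OF f]] by (intro L.mat_op_linear) auto
qed

lemma VS_carrier: "carrier (VS Q) = B \<rightarrow>\<^sub>E loc_deg R D Q 0"
  by (simp add: free_module_simps ST_simps)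

lemma VS_VL: "x \<in> carrier (VS Q) \<Longrightarrow> x \<in> carrier (VL Q)"
  unfolding VS_carrier using ST_sub[of Q 0] by (auto simp: free_module_simps PiE_iff)

lemma th_eq_thL:
  assumes f: "unit_at f Q" and x: "x \<in> carrier (VS Q)"
  shows "th f Q x = thL f Q x"
  unfolding th_def thL_def mat_op_def ST_simps
proof (rule restrict_eqI)
  fix b assume b: "b \<in> B"
  show "(\<Oplus>\<^bsub>ST Q\<^esub>b'\<in>B. fr Q (A b b') f \<otimes>\<^bsub>LOC Q\<^esub> x b') = (\<Oplus>\<^bsub>LOC Q\<^esub>b'\<in>B. fr Q (A b b') f \<otimes>\<^bsub>LOC Q\<^esub> x b')"
    using loc_deg_mult[OF unit_at_PR[OF f], of _ 0 _ 0] entry_closed[OF f b] x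
    by (intro finsum_ST[OF unit_at_PR[OF f]]) (auto simp: VS_carrier PiE_iff)
qed

lemma th_pow_closed:
  assumes f: "unit_at f Q" and x: "x \<in> carrier (VS Q)"
  shows "(th f Q ^^ n) x \<in> carrier (VS Q)"
proof -
  interpret S: cring "ST Q" using unit_at_PR[OF f] by (rule ST_cring)
  interpret F: plain_module "ST Q" "VS Q" by (rule S.free_module_plain_module)
  show ?thesis by (rule F.linear_op_closed[OF F.linear_op_funpow[OF th_linear[OF f]] x])
qed

lemma th_pow_eq_thL:
  assumes f: "unit_at f Q" and x: "x \<in> carrier (VS Q)"
  shows "(th f Q ^^ n) x = (thL f Q ^^ n) x"
proof (induction n)
  case (Suc n)
  then show ?case using th_eq_thL[OF f th_pow_closed[OF f x, of n]] by simp
qed simp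

text \<open>
  Multiplication by \<open>f\<close> commutes with the operator, so \<open>\<Theta>\<^sup>n = (\<Theta>/f)\<^sup>n f\<^sup>n\<close>.
\<close>

lemma MO_pow_thL:
  assumes f: "unit_at f Q" and t: "t \<in> carrier (VL Q)"
  shows "(MO Q ^^ n) t = (thL f Q ^^ n) (fr Q (f ^ n) 1 \<odot>\<^bsub>VL Q\<^esub> t)"
proof -
  have Q: "Q \<in> PR" using unit_at_PR[OF f] .
  interpret L: cring "LOC Q" using Q by (rule LOC_cring)
  interpret F: plain_module "LOC Q" "VL Q" by (rule L.free_module_plain_module)
  note fa = unit_at_away[OF f]
  have frc: "fr Q x 1 \<in> carrier (LOC Q)" for x using Q by (simp add: fr_carrier)
  have one: "MO Q x = thL f Q (fr Q f 1 \<odot>\<^bsub>VL Q\<^esub> x)" if x: "x \<in> carrier (VL Q)" for x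
    unfolding MO_eq thL_def mat_op_def free_module_simps
  proof (rule restrict_eqI, rule L.finsum_cong')
    fix b b' assume b: "b \<in> B" "b' \<in> B"
    have xb: "x b' \<in> carrier (LOC Q)" using x b by (auto simp: free_module_simps PiE_iff)
    have "fr Q (A b b') 1 = fr Q (A b b') f \<otimes>\<^bsub>LOC Q\<^esub> fr Q f 1"
      using Q fa by (simp add: fr_mult) (rule fr_eqI, auto)
    then show "fr Q (A b b') 1 \<otimes>\<^bsub>LOC Q\<^esub> x b' = fr Q (A b b') f \<otimes>\<^bsub>LOC Q\<^esub> (\<lambda>b\<in>B. fr Q f 1 \<otimes>\<^bsub>LOC Q\<^esub> x b) b'"
      using b xb frc fr_carrier[OF fa] by (simp add: L.m_assoc)
  qed (use x frc fr_carrier[OF fa] in \<open>auto simp: free_module_simps PiE_iff\<close>)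
  show ?thesis
  proof (induction n)
    case 0
    have "fr Q 1 1 \<odot>\<^bsub>VL Q\<^esub> t = t" using F.smult_one[OF t] by (simp add: LOC_one)
    then show ?case by simp
  next
    case (Suc n)
    let ?y = "fr Q (f ^ n) 1 \<odot>\<^bsub>VL Q\<^esub> t"
    have y: "?y \<in> carrier (VL Q)" using frc t by (rule F.smult_closed)
    note lin = F.linear_op_funpow[OF thL_linear[OF f]]
    have c: "(thL f Q ^^ n) ?y \<in> carrier (VL Q)" by (rule F.linear_op_closed[OF lin y])
    have "(MO Q ^^ Suc n) t = thL f Q (fr Q f 1 \<odot>\<^bsub>VL Q\<^esub> (thL f Q ^^ n) ?y)"
      using Suc one[OF c] by simp
    also have "fr Q f 1 \<odot>\<^bsub>VL Q\<^esub> (thL f Q ^^ n) ?y = (thL f Q ^^ n) (fr Q f 1 \<odot>\<^bsub>VL Q\<^esub> ?y)"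
      using lin[of n] y frc by (simp add: F.linear_op_def)
    also have "fr Q f 1 \<odot>\<^bsub>VL Q\<^esub> ?y = fr Q (f ^ Suc n) 1 \<odot>\<^bsub>VL Q\<^esub> t"
      using F.smult_assoc1[OF frc frc t, of f "f ^ n"] Q by (simp add: fr_mult)
    finally show ?case by simp
  qed
qed

lemma fr_pow_inverse:
  assumes f: "unit_at f Q" and x: "x \<in> carrier (VL Q)"
  shows "fr Q (f ^ n) 1 \<odot>\<^bsub>VL Q\<^esub> (fr Q 1 (f ^ n) \<odot>\<^bsub>VL Q\<^esub> x) = x"
    "fr Q 1 (f ^ n) \<odot>\<^bsub>VL Q\<^esub> (fr Q (f ^ n) 1 \<odot>\<^bsub>VL Q\<^esub> x) = x"
proof -
  have Q: "Q \<in> PR" using unit_at_PR[OF f] .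
  interpret L: cring "LOC Q" using Q by (rule LOC_cring)
  interpret F: plain_module "LOC Q" "VL Q" by (rule L.free_module_plain_module)
  note fa = away_pow[OF Q unit_at_away[OF f]]
  have c: "fr Q (f ^ n) 1 \<in> carrier (LOC Q)" "fr Q 1 (f ^ n) \<in> carrier (LOC Q)"
    using Q fa by (auto simp: fr_carrier)
  have "fr Q (f ^ n) 1 \<otimes>\<^bsub>LOC Q\<^esub> fr Q 1 (f ^ n) = \<one>\<^bsub>LOC Q\<^esub>"
    using Q fa unfolding LOC_one by (simp add: fr_mult) (rule fr_eqI, auto)
  then show "fr Q (f ^ n) 1 \<odot>\<^bsub>VL Q\<^esub> (fr Q 1 (f ^ n) \<odot>\<^bsub>VL Q\<^esub> x) = x"
    "fr Q 1 (f ^ n) \<odot>\<^bsub>VL Q\<^esub> (fr Q (f ^ n) 1 \<odot>\<^bsub>VL Q\<^esub> x) = x"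
    using F.smult_assoc1[OF c(1,2) x] F.smult_assoc1[OF c(2,1) x] x L.m_comm[OF c] by simp_all
qed

lemma smult_pow_deg:
  assumes f: "unit_at f Q"
  shows "t \<in> B \<rightarrow>\<^sub>E loc_deg R D Q (- int (n * d)) \<Longrightarrow> fr Q (f ^ n) 1 \<odot>\<^bsub>VL Q\<^esub> t \<in> carrier (VS Q)"
    "w \<in> carrier (VS Q) \<Longrightarrow> fr Q 1 (f ^ n) \<odot>\<^bsub>VL Q\<^esub> w \<in> B \<rightarrow>\<^sub>E loc_deg R D Q (- int (n * d))"
proof -
  have Q: "Q \<in> PR" using unit_at_PR[OF f] .
  have fn: "f ^ n \<in> H (n * d)" "\<pi> (f ^ n) \<notin> Q"
    using f H_pow away_pow[OF Q unit_at_away[OF f], of n] by (auto simp: unit_at_def away_def)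
  have 1: "fr Q (f ^ n) 1 \<in> loc_deg R D Q (int (n * d))"
  proof (rule fr_in_loc_deg)
    show "hfr (int (n * d)) (f ^ n) 1" unfolding hfr_def using fn(1) H_one by (intro exI[of _ 0] exI[of _ "n * d"]) simp
    show "\<pi> 1 \<notin> Q" using away_one[OF Q] by (simp add: away_def)
  qed
  have 2: "fr Q 1 (f ^ n) \<in> loc_deg R D Q (- int (n * d))"
    by (rule fr_in_loc_deg) (use fn H_one in \<open>auto simp: hfr_def\<close>)
  show "t \<in> B \<rightarrow>\<^sub>E loc_deg R D Q (- int (n * d)) \<Longrightarrow> fr Q (f ^ n) 1 \<odot>\<^bsub>VL Q\<^esub> t \<in> carrier (VS Q)"
    using loc_deg_mult[OF Q 1, of _ "- int (n * d)"] by (auto simp: ST_simps free_module_simps PiE_iff)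
  show "w \<in> carrier (VS Q) \<Longrightarrow> fr Q 1 (f ^ n) \<odot>\<^bsub>VL Q\<^esub> w \<in> B \<rightarrow>\<^sub>E loc_deg R D Q (- int (n * d))"
    using loc_deg_mult[OF Q 2, of _ 0] by (auto simp: ST_simps free_module_simps PiE_iff)
qed

lemma loc_deg_VL: "t \<in> B \<rightarrow>\<^sub>E loc_deg R D Q n \<Longrightarrow> t \<in> carrier (VL Q)"
  using ST_sub[of Q n] by (auto simp: free_module_simps PiE_iff)

text \<open>The stalk of \<open>ker \<Theta> \<inter> im \<Theta>\<^sup>j\<close>.\<close>

definition Z :: "nat \<Rightarrow> 'a set \<Rightarrow> ('i \<Rightarrow> ('a \<times> 'a) set) set" where
  "Z j Q = {y \<in> carrier (VS Q). MO Q y = (\<lambda>b\<in>B. \<zero>\<^bsub>LOC Q\<^esub>) \<and>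
    (\<exists>t\<in>B \<rightarrow>\<^sub>E loc_deg R D Q (- int (j * d)). y = (MO Q ^^ j) t)}"

text \<open>
  Multiplication by \<open>f\<^sup>j\<close> is a bijection from vectors of degree \<open>- j d\<close> to vectors of degree \<open>0\<close>.
\<close>

lemma MO_image_iff:
  assumes f: "unit_at f Q"
  shows "(\<exists>t\<in>B \<rightarrow>\<^sub>E loc_deg R D Q (- int (j * d)). y = (MO Q ^^ j) t) \<longleftrightarrow>
    (\<exists>w\<in>carrier (VS Q). y = (th f Q ^^ j) w)"
proof
  assume "\<exists>t\<in>B \<rightarrow>\<^sub>E loc_deg R D Q (- int (j * d)). y = (MO Q ^^ j) t"
  then obtain t where t: "t \<in> B \<rightarrow>\<^sub>E loc_deg R D Q (- int (j * d))" "y = (MO Q ^^ j) t" by blast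
  show "\<exists>w\<in>carrier (VS Q). y = (th f Q ^^ j) w"
    using smult_pow_deg(1)[OF f t(1)] MO_pow_thL[OF f loc_deg_VL[OF t(1)]] th_pow_eq_thL[OF f] t(2) by metis
next
  assume "\<exists>w\<in>carrier (VS Q). y = (th f Q ^^ j) w"
  then obtain w where w: "w \<in> carrier (VS Q)" "y = (th f Q ^^ j) w" by blast
  note t = smult_pow_deg(2)[OF f w(1), of j]
  have "y = (MO Q ^^ j) (fr Q 1 (f ^ j) \<odot>\<^bsub>VL Q\<^esub> w)"
    unfolding MO_pow_thL[OF f loc_deg_VL[OF t]] fr_pow_inverse(1)[OF f VS_VL[OF w(1)]]
    using w th_pow_eq_thL[OF f] by simp
  then show "\<exists>t\<in>B \<rightarrow>\<^sub>E loc_deg R D Q (- int (j * d)). y = (MO Q ^^ j) t" using t by blast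
qed

lemma MO_zero_iff:
  assumes f: "unit_at f Q" and y: "y \<in> carrier (VS Q)"
  shows "MO Q y = (\<lambda>b\<in>B. \<zero>\<^bsub>LOC Q\<^esub>) \<longleftrightarrow> th f Q y = (\<lambda>b\<in>B. \<zero>\<^bsub>LOC Q\<^esub>)"
proof -
  have Q: "Q \<in> PR" using unit_at_PR[OF f] .
  interpret L: cring "LOC Q" using Q by (rule LOC_cring)
  interpret F: plain_module "LOC Q" "VL Q" by (rule L.free_module_plain_module)
  let ?c = "fr Q (f ^ 1) 1" and ?i = "fr Q 1 (f ^ 1)"
  have c: "?c \<in> carrier (LOC Q)" "?i \<in> carrier (LOC Q)"
    using Q unit_at_away[OF f] by (auto simp: fr_carrier)
  have yL: "y \<in> carrier (VL Q)" using y by (rule VS_VL)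
  have thc: "thL f Q y \<in> carrier (VL Q)" by (rule F.linear_op_closed[OF thL_linear[OF f] yL])
  have "MO Q y = ?c \<odot>\<^bsub>VL Q\<^esub> thL f Q y"
    using MO_pow_thL[OF f yL, of 1] thL_linear[OF f] c yL by (simp add: F.linear_op_def)
  moreover have "?i \<odot>\<^bsub>VL Q\<^esub> (?c \<odot>\<^bsub>VL Q\<^esub> thL f Q y) = thL f Q y" using fr_pow_inverse(2)[OF f thc] .
  ultimately have "MO Q y = \<zero>\<^bsub>VL Q\<^esub> \<longleftrightarrow> thL f Q y = \<zero>\<^bsub>VL Q\<^esub>"
    using F.smult_r_null[OF c(1)] F.smult_r_null[OF c(2)] by metis
  then show ?thesis using th_eq_thL[OF f y] by (simp add: free_module_simps)
qed

lemma Z_eq: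
  assumes f: "unit_at f Q"
  shows "Z j Q = {y \<in> carrier (VS Q). th f Q y = (\<lambda>b\<in>B. \<zero>\<^bsub>LOC Q\<^esub>) \<and> (\<exists>w\<in>carrier (VS Q). y = (th f Q ^^ j) w)}"
  unfolding Z_def using MO_zero_iff[OF f] MO_image_iff[OF f] by blast

lemma fr_finsum:
  assumes Q: "Q \<in> PR" and "finite C"
  shows "(\<Oplus>\<^bsub>LOC Q\<^esub>c\<in>C. fr Q (x c) 1) = fr Q (\<Sum>c\<in>C. x c) 1"
proof -
  interpret L: cring "LOC Q" using Q by (rule LOC_cring)
  show ?thesis using assms(2)
  proof (induction C rule: finite_induct)
    case (insert c C)
    then show ?case using Q by (simp add: fr_carrier fr_add)
  qed (simp add: LOC_zero)
qed

lemma MO_pow_mat_pow: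
  assumes Q: "Q \<in> PR" and x: "x \<in> carrier (VL Q)"
  shows "(MO Q ^^ n) x = mat_op (LOC Q) B (\<lambda>b b'. fr Q (mat_pow B A n b b') 1) x"
proof -
  interpret L: cring "LOC Q" using Q by (rule LOC_cring)
  have xc: "x b \<in> carrier (LOC Q)" if "b \<in> B" for b using x that by (auto simp: free_module_simps PiE_iff)
  have frc: "fr Q y 1 \<in> carrier (LOC Q)" for y using Q by (simp add: fr_carrier)
  show ?thesis
  proof (induction n)
    case 0
    have "(\<Oplus>\<^bsub>LOC Q\<^esub>b'\<in>B. fr Q (if b = b' then 1 else 0) 1 \<otimes>\<^bsub>LOC Q\<^esub> x b') = x b" if b: "b \<in> B" for b
    proof -
      have "(\<Oplus>\<^bsub>LOC Q\<^esub>b'\<in>B. fr Q (if b = b' then 1 else 0) 1 \<otimes>\<^bsub>LOC Q\<^esub> x b')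
        = (\<Oplus>\<^bsub>LOC Q\<^esub>b'\<in>B. x b' \<otimes>\<^bsub>LOC Q\<^esub> (if b = b' then \<one>\<^bsub>LOC Q\<^esub> else \<zero>\<^bsub>LOC Q\<^esub>))"
        using xc by (intro L.finsum_cong') (auto simp: LOC_one[symmetric] LOC_zero[symmetric])
      also have "\<dots> = x b" using xc b fB by (intro L.finsum_delta) auto
      finally show ?thesis .
    qed
    then have "x = mat_op (LOC Q) B (\<lambda>b b'. fr Q (if b = b' then 1 else 0) 1) x"
      unfolding mat_op_def using x by (intro PiE_eq_restrictI) (simp_all add: free_module_simps)
    then show ?case by simp
  next
    case (Suc n)
    have "(MO Q ^^ Suc n) x = mat_op (LOC Q) B (\<lambda>b b'. fr Q (A b b') 1)
      (mat_op (LOC Q) B (\<lambda>b b'. fr Q (mat_pow B A n b b') 1) x)"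
      using Suc by (simp add: MO_eq)
    also have "\<dots> = mat_op (LOC Q) B (\<lambda>b b'. fr Q (mat_pow B A (Suc n) b b') 1) x"
    proof (subst (1 3) mat_op_def, rule restrict_eqI)
      fix b assume b: "b \<in> B"
      let ?M = "\<lambda>b b'. fr Q (mat_pow B A n b b') 1"
      have "(\<Oplus>\<^bsub>LOC Q\<^esub>c\<in>B. fr Q (A b c) 1 \<otimes>\<^bsub>LOC Q\<^esub> mat_op (LOC Q) B ?M x c)
        = (\<Oplus>\<^bsub>LOC Q\<^esub>c\<in>B. fr Q (A b c) 1 \<otimes>\<^bsub>LOC Q\<^esub> (\<Oplus>\<^bsub>LOC Q\<^esub>b'\<in>B. ?M c b' \<otimes>\<^bsub>LOC Q\<^esub> x b'))"
        using frc xc by (intro L.finsum_cong') (auto simp: mat_op_def intro!: L.finsum_closed)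
      also have "\<dots> = (\<Oplus>\<^bsub>LOC Q\<^esub>b'\<in>B. (\<Oplus>\<^bsub>LOC Q\<^esub>c\<in>B. fr Q (A b c) 1 \<otimes>\<^bsub>LOC Q\<^esub> ?M c b') \<otimes>\<^bsub>LOC Q\<^esub> x b')"
        using frc xc fB by (intro L.finsum_assoc[symmetric]) auto
      also have "\<dots> = (\<Oplus>\<^bsub>LOC Q\<^esub>b'\<in>B. fr Q (mat_pow B A (Suc n) b b') 1 \<otimes>\<^bsub>LOC Q\<^esub> x b')"
        using Q fB frc xc by (intro L.finsum_cong') (auto simp: fr_mult fr_finsum)
      finally show "(\<Oplus>\<^bsub>LOC Q\<^esub>c\<in>B. fr Q (A b c) 1 \<otimes>\<^bsub>LOC Q\<^esub> mat_op (LOC Q) B ?M x c)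
        = (\<Oplus>\<^bsub>LOC Q\<^esub>b'\<in>B. fr Q (mat_pow B A (Suc n) b b') 1 \<otimes>\<^bsub>LOC Q\<^esub> x b')" .
    qed
    finally show ?case .
  qed
qed

lemma th_nilpotent:
  assumes f: "unit_at f Q" and x: "x \<in> carrier (VS Q)"
  shows "(th f Q ^^ p) x = \<zero>\<^bsub>VS Q\<^esub>"
proof -
  have Q: "Q \<in> PR" using unit_at_PR[OF f] .
  interpret L: cring "LOC Q" using Q by (rule LOC_cring)
  note t = loc_deg_VL[OF smult_pow_deg(2)[OF f x, of p]]
  have "(th f Q ^^ p) x = (MO Q ^^ p) (fr Q 1 (f ^ p) \<odot>\<^bsub>VL Q\<^esub> x)"
    unfolding MO_pow_thL[OF f t] fr_pow_inverse(1)[OF f VS_VL[OF x]] using th_pow_eq_thL[OF f x] by simp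
  also have "\<dots> = (\<lambda>b\<in>B. \<zero>\<^bsub>LOC Q\<^esub>)"
    unfolding MO_pow_mat_pow[OF Q t] mat_op_def
  proof (rule restrict_eqI)
    fix b assume b: "b \<in> B"
    let ?t = "fr Q 1 (f ^ p) \<odot>\<^bsub>VL Q\<^esub> x"
    have "fr Q (mat_pow B A p b b') 1 = \<zero>\<^bsub>LOC Q\<^esub>" if "b' \<in> B" for b'
      using nilpotent[OF b that] by (simp add: LOC_zero fr_def \<pi>_zero)
    moreover have "?t b' \<in> carrier (LOC Q)" if "b' \<in> B" for b'
      using t that unfolding free_module_simps by blast
    ultimately have "(\<Oplus>\<^bsub>LOC Q\<^esub>b'\<in>B. fr Q (mat_pow B A p b b') 1 \<otimes>\<^bsub>LOC Q\<^esub> ?t b') = (\<Oplus>\<^bsub>LOC Q\<^esub>b'\<in>B. \<zero>\<^bsub>LOC Q\<^esub>)"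
      by (intro L.finsum_cong') auto
    then show "(\<Oplus>\<^bsub>LOC Q\<^esub>b'\<in>B. fr Q (mat_pow B A p b b') 1 \<otimes>\<^bsub>LOC Q\<^esub> ?t b') = \<zero>\<^bsub>LOC Q\<^esub>" by simp
  qed
  finally show ?thesis by (simp add: free_module_simps ST_simps)
qed

subsection \<open>Sections of kernels and images\<close>

lemma vsec_th:
  assumes w: "vsec 0 B P w" and f: "unit_at f P"
  shows "vsec 0 B P (\<lambda>Q. th f Q (w Q))"
proof (rule vsec_cong)
  have P: "P \<in> PR" using unit_at_PR[OF f] .
  show "vsec 0 B P (\<lambda>Q. \<lambda>b\<in>B. \<Oplus>\<^bsub>LOC Q\<^esub>b'\<in>B. fr Q (A b b') f \<otimes>\<^bsub>LOC Q\<^esub> w Q b')"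
  proof (rule vsec_restrict[OF P], rule sec_finsum[OF fB P])
    fix b b' assume b: "b \<in> B" "b' \<in> B"
    have "sec 0 P (\<lambda>Q. fr Q (A b b') f)"
      using f by (intro sec_fr entry_deg[OF f b] P) (simp add: unit_at_def)
    moreover have "sec 0 P (\<lambda>Q. w Q b')" using w b unfolding vsec_def by blast
    ultimately show "sec 0 P (\<lambda>Q. fr Q (A b b') f \<otimes>\<^bsub>LOC Q\<^esub> w Q b')" using sec_mult[of 0 P _ 0] by fastforce
  qed (rule sec_zero[OF P])
  show "near P (\<lambda>Q. (\<lambda>b\<in>B. \<Oplus>\<^bsub>LOC Q\<^esub>b'\<in>B. fr Q (A b b') f \<otimes>\<^bsub>LOC Q\<^esub> w Q b') = th f Q (w Q))"
  proof (rule near_mono2[OF unit_at_near[OF f] vsec_near_mem[OF fB w]])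
    fix Q assume Q: "unit_at f Q" "w Q \<in> B \<rightarrow>\<^sub>E loc_deg R D Q 0"
    have "th f Q (w Q) = thL f Q (w Q)" using Q by (intro th_eq_thL) (simp_all add: VS_carrier)
    then show "(\<lambda>b\<in>B. \<Oplus>\<^bsub>LOC Q\<^esub>b'\<in>B. fr Q (A b b') f \<otimes>\<^bsub>LOC Q\<^esub> w Q b') = th f Q (w Q)"
      by (simp add: thL_def mat_op_def)
  qed
qed

lemma vsec_th_pow: "vsec 0 B P w \<Longrightarrow> unit_at f P \<Longrightarrow> vsec 0 B P (\<lambda>Q. (th f Q ^^ n) (w Q))"
  by (induction n) (simp_all add: vsec_th)

lemma vsec_zero: "P \<in> PR \<Longrightarrow> vsec 0 B P (\<lambda>Q. \<lambda>b\<in>B. \<zero>\<^bsub>LOC Q\<^esub>)"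
  by (rule vsec_restrict[of P B 0 "\<lambda>b Q. \<zero>\<^bsub>LOC Q\<^esub>"]) (simp_all add: sec_zero)

lemma vsec_VS: "vsec 0 B P s \<Longrightarrow> s P \<in> carrier (VS P)"
  using vsec_mem[of 0 B P s] by (simp add: VS_carrier)

lemma near_VS: "vsec 0 B P s \<Longrightarrow> near P (\<lambda>Q. s Q \<in> carrier (VS Q))"
  using vsec_near_mem[OF fB, of 0 P s] by (simp add: VS_carrier)

text \<open>
  Write the vector as \<open>\<theta>\<^sup>j w\<close> and extend \<open>w\<close> to a section; then \<open>\<theta>\<^sup>j w\<close> stays in the image of \<open>\<theta>\<^sup>j\<close>, and it
  stays in the kernel near \<open>P\<close> because that is an identity between sections.
\<close>

lemma Z_germ:
  assumes P: "P \<in> PR" and y: "y \<in> Z j P"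
  shows "\<exists>s. vsec 0 B P s \<and> s P = y \<and> near P (\<lambda>Q. s Q \<in> Z j Q)"
proof -
  obtain f where f: "unit_at f P" using unit_at_ex[OF P] by blast
  obtain w0 where w0: "w0 \<in> carrier (VS P)" "y = (th f P ^^ j) w0" "th f P y = (\<lambda>b\<in>B. \<zero>\<^bsub>LOC P\<^esub>)"
    using y unfolding Z_eq[OF f] by blast
  obtain w where w: "vsec 0 B P w" "w P = w0" using vsec_germ[OF P] w0(1) unfolding VS_carrier by blast
  let ?s = "\<lambda>Q. (th f Q ^^ j) (w Q)"
  have s: "vsec 0 B P ?s" by (rule vsec_th_pow[OF w(1) f])
  have "near P (\<lambda>Q. th f Q (?s Q) = (\<lambda>b\<in>B. \<zero>\<^bsub>LOC Q\<^esub>))"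
    by (rule vsec_eq[OF fB vsec_th[OF s f] vsec_zero[OF P]]) (use w0 w in simp)
  then have "near P (\<lambda>Q. ?s Q \<in> Z j Q)"
  proof (rule near_mono2[OF near_conj[OF unit_at_near[OF f] near_VS[OF w(1)]]])
    fix Q assume Q: "unit_at f Q \<and> w Q \<in> carrier (VS Q)" "th f Q (?s Q) = (\<lambda>b\<in>B. \<zero>\<^bsub>LOC Q\<^esub>)"
    then show "?s Q \<in> Z j Q" unfolding Z_eq[OF Q(1)[THEN conjunct1]] using th_pow_closed[of f Q "w Q" j] by blast
  qed
  then show ?thesis using s w w0 by (intro exI[of _ ?s]) simp
qed

lemma Z_near:
  assumes s: "vsec 0 B P s" and y: "s P \<in> Z j P"
  shows "near P (\<lambda>Q. s Q \<in> Z j Q)"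
proof -
  obtain s' where s': "vsec 0 B P s'" "s' P = s P" "near P (\<lambda>Q. s' Q \<in> Z j Q)"
    using Z_germ[OF vsec_PR[OF s] y] by blast
  show ?thesis by (rule near_mono2[OF vsec_eq[OF fB s'(1) s s'(2)] s'(3)]) simp
qed

text \<open>
  Membership in the image sheaf is local, so it can be tested on stalks.
\<close>

lemma ker_im_sheaf_iff:
  assumes W: "is_open W"
  shows "s \<in> ker_sheaf R D B RA W \<inter> im_sheaf R D B d RA j W \<longleftrightarrow>
    s \<in> extensional W \<and> (\<forall>P\<in>W. vsec 0 B P s \<and> s P \<in> Z j P)"
proof
  assume s: "s \<in> ker_sheaf R D B RA W \<inter> im_sheaf R D B d RA j W"
  then have s0: "s \<in> extensional W" "\<And>P. P \<in> W \<Longrightarrow> vsec 0 B P s"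
    using twist_power_iff[OF W, of s 0 B] unfolding ker_sheaf_def by blast+
  have "s P \<in> Z j P" if P: "P \<in> W" for P
  proof -
    obtain V t where V: "is_open V" "P \<in> V" "t \<in> twist_power R D (- int (j * d)) B V"
      "\<forall>Q\<in>V. s Q = (MO Q ^^ j) (t Q)"
      using s P unfolding im_sheaf_def by blast
    have "t P \<in> B \<rightarrow>\<^sub>E loc_deg R D P (- int (j * d))"
    proof (rule vsec_mem)
      show "vsec (- int (j * d)) B P t" using V(3)[unfolded twist_power_iff[OF V(1)]] V(2) by blast
    qed
    moreover have "MO P (s P) = (\<lambda>b\<in>B. \<zero>\<^bsub>LOC P\<^esub>)" using s P unfolding ker_sheaf_def by blast
    ultimately show ?thesis unfolding Z_def using V(2,4) vsec_VS[OF s0(2)[OF P]] by blast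
  qed
  then show "s \<in> extensional W \<and> (\<forall>P\<in>W. vsec 0 B P s \<and> s P \<in> Z j P)" using s0 by blast
next
  assume s: "s \<in> extensional W \<and> (\<forall>P\<in>W. vsec 0 B P s \<and> s P \<in> Z j P)"
  then have tp: "s \<in> twist_power R D 0 B W" using twist_power_iff[OF W] by blast
  have "\<exists>V. is_open V \<and> P \<in> V \<and> V \<subseteq> W \<and>
       (\<exists>t\<in>twist_power R D (- int (j * d)) B V. \<forall>Q\<in>V. s Q = (MO Q ^^ j) (t Q))" if P: "P \<in> W" for P
  proof -
    have sP: "vsec 0 B P s" "s P \<in> Z j P" using s P by blast+
    have PR: "P \<in> PR" using vsec_PR[OF sP(1)] .
    obtain f where f: "unit_at f P" using unit_at_ex[OF PR] by blast
    obtain w0 where w0: "w0 \<in> carrier (VS P)" "s P = (th f P ^^ j) w0" using sP(2) unfolding Z_eq[OF f] by blast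
    obtain w where w: "vsec 0 B P w" "w P = w0" using vsec_germ[OF PR] w0(1) unfolding VS_carrier by blast
    let ?t = "\<lambda>Q. fr Q 1 (f ^ j) \<odot>\<^bsub>VL Q\<^esub> w Q"
    have fn: "hfr (- int (j * d)) 1 (f ^ j)" "\<pi> (f ^ j) \<notin> P"
    proof -
      have "f ^ j \<in> H (j * d)" using f H_pow by (simp add: unit_at_def)
      then show "hfr (- int (j * d)) 1 (f ^ j)"
        unfolding hfr_def using H_one by (intro exI[of _ "j * d"] exI[of _ 0]) simp
      show "\<pi> (f ^ j) \<notin> P" using away_pow[OF PR unit_at_away[OF f], of j] by (simp add: away_def)
    qed
    have t: "vsec (- int (j * d)) B P ?t" unfolding free_module_simps
    proof (rule vsec_restrict[OF PR])
      fix b assume "b \<in> B"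
      then have "sec 0 P (\<lambda>Q. w Q b)" using w(1) unfolding vsec_def by blast
      from sec_mult[OF sec_fr[OF fn(1) PR fn(2)] this]
      show "sec (- int (j * d)) P (\<lambda>Q. fr Q 1 (f ^ j) \<otimes>\<^bsub>LOC Q\<^esub> w Q b)" by simp
    qed
    have "near P (\<lambda>Q. s Q = (th f Q ^^ j) (w Q))"
      by (rule vsec_eq[OF fB sP(1) vsec_th_pow[OF w(1) f]]) (use w0 w in simp)
    then have "near P (\<lambda>Q. s Q = (MO Q ^^ j) (?t Q))"
    proof (rule near_mono2[OF near_conj[OF unit_at_near[OF f] near_VS[OF w(1)]]])
      fix Q assume Q: "unit_at f Q \<and> w Q \<in> carrier (VS Q)" "s Q = (th f Q ^^ j) (w Q)"
      then have uf: "unit_at f Q" and wQ: "w Q \<in> carrier (VS Q)" by auto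
      show "s Q = (MO Q ^^ j) (?t Q)"
        unfolding MO_pow_thL[OF uf loc_deg_VL[OF smult_pow_deg(2)[OF uf wQ]]]
          fr_pow_inverse(1)[OF uf VS_VL[OF wQ]] using Q(2) th_pow_eq_thL[OF uf wQ] by simp
    qed
    from near_conj[OF this vsec_near[OF fB t]] obtain V where V: "is_open V" "P \<in> V"
      "\<forall>Q\<in>V. s Q = (MO Q ^^ j) (?t Q) \<and> vsec (- int (j * d)) B Q ?t" unfolding near_def by blast
    let ?V = "V \<inter> W"
    have oV: "is_open ?V" by (rule open_Int[OF V(1) W])
    have "restrict ?t ?V \<in> twist_power R D (- int (j * d)) B ?V" unfolding twist_power_iff[OF oV]
    proof (intro conjI ballI)
      fix Q assume Q: "Q \<in> ?V"
      have "near Q (\<lambda>Q. ?t Q = restrict ?t ?V Q)" by (rule near_mono[OF near_open[OF oV Q]]) simp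
      moreover have "vsec (- int (j * d)) B Q ?t" using V(3) Q by blast
      ultimately show "vsec (- int (j * d)) B Q (restrict ?t ?V)" by (rule vsec_cong[rotated])
    qed simp
    moreover have "\<forall>Q\<in>?V. s Q = (MO Q ^^ j) (restrict ?t ?V Q)" using V(3) by simp
    ultimately show ?thesis using oV V(2) P by blast
  qed
  then have "s \<in> im_sheaf R D B d RA j W" unfolding im_sheaf_def using tp by blast
  moreover have "s \<in> ker_sheaf R D B RA W" unfolding ker_sheaf_def using tp s by (auto simp: Z_def)
  ultimately show "s \<in> ker_sheaf R D B RA W \<inter> im_sheaf R D B d RA j W" by blast
qed

lemma vsec_restrict_open:
  assumes "is_open V" "P \<in> V" "vsec n C P s"
  shows "vsec n C P (restrict s V)"
  by (rule vsec_cong[OF assms(3) near_mono[OF near_open[OF assms(1,2)]]]) simp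

lemma stalk_of_Z:
  assumes P: "P \<in> PR"
  shows "stalk_of R D (\<lambda>W. ker_sheaf R D B RA W \<inter> im_sheaf R D B d RA j W) P = Z j P"
proof
  show "stalk_of R D (\<lambda>W. ker_sheaf R D B RA W \<inter> im_sheaf R D B d RA j W) P \<subseteq> Z j P"
    unfolding stalk_of_def using ker_im_sheaf_iff by blast
  show "Z j P \<subseteq> stalk_of R D (\<lambda>W. ker_sheaf R D B RA W \<inter> im_sheaf R D B d RA j W) P"
  proof
    fix y assume "y \<in> Z j P"
    then obtain s where s: "vsec 0 B P s" "s P = y" "near P (\<lambda>Q. s Q \<in> Z j Q)" using Z_germ[OF P] by blast
    from near_conj[OF vsec_near[OF fB s(1)] s(3)] obtain V where
      V: "is_open V" "P \<in> V" "\<forall>Q\<in>V. vsec 0 B Q s \<and> s Q \<in> Z j Q" unfolding near_def by blast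
    have "restrict s V \<in> ker_sheaf R D B RA V \<inter> im_sheaf R D B d RA j V"
      unfolding ker_im_sheaf_iff[OF V(1)] using V vsec_restrict_open[OF V(1), of _ 0 B s] by simp
    moreover have "restrict s V P = y" using V(2) s(2) by simp
    ultimately show "y \<in> stalk_of R D (\<lambda>W. ker_sheaf R D B RA W \<inter> im_sheaf R D B d RA j W) P"
      unfolding stalk_of_def using V(1,2) by blast
  qed
qed

definition Fsh :: "nat \<Rightarrow> ('a set, ('a \<times> 'a) set, ('i \<Rightarrow> ('a \<times> 'a) set) set) mod_sheaf" where
  "Fsh i = quotient_sheaf R D (stalk (free_sheaf R D B))
    (\<lambda>W. ker_sheaf R D B RA W \<inter> im_sheaf R D B d RA (i - 1) W)
    (\<lambda>W. ker_sheaf R D B RA W \<inter> im_sheaf R D B d RA i W)"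

lemma stalk_Fsh: "P \<in> PR \<Longrightarrow> stalk (Fsh i) P = quotient_module (VS P) (Z (i - 1) P) (Z i P)"
  unfolding Fsh_def quotient_sheaf_def by (simp add: stalk_of_Z free_sheaf_def)

text \<open>
  The condition on germs that characterises sections of the quotient sheaf.
\<close>

definition qsec :: "nat \<Rightarrow> 'a set \<Rightarrow> ('a set \<Rightarrow> ('i \<Rightarrow> ('a \<times> 'a) set) set) \<Rightarrow> bool" where
  "qsec i P t \<longleftrightarrow> (\<exists>s. vsec 0 B P s \<and> near P (\<lambda>Q. s Q \<in> Z (i - 1) Q \<and> t Q = Z i Q +>\<^bsub>VS Q\<^esub> s Q))"

lemma sections_Fsh:
  assumes W: "is_open W"
  shows "t \<in> sections (Fsh i) W \<longleftrightarrow> t \<in> extensional W \<and> (\<forall>P\<in>W. qsec i P t)"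
proof -
  let ?A = "\<lambda>W. ker_sheaf R D B RA W \<inter> im_sheaf R D B d RA (i - 1) W"
  have "(\<exists>V. is_open V \<and> P \<in> V \<and> V \<subseteq> W \<and> (\<exists>s\<in>?A V. \<forall>Q\<in>V. t Q = Z i Q +>\<^bsub>VS Q\<^esub> s Q)) \<longleftrightarrow> qsec i P t"
    if P: "P \<in> W" for P
  proof
    assume "\<exists>V. is_open V \<and> P \<in> V \<and> V \<subseteq> W \<and> (\<exists>s\<in>?A V. \<forall>Q\<in>V. t Q = Z i Q +>\<^bsub>VS Q\<^esub> s Q)"
    then obtain V s where V: "is_open V" "P \<in> V" "s \<in> ?A V" "\<forall>Q\<in>V. t Q = Z i Q +>\<^bsub>VS Q\<^esub> s Q" by blast
    then have sV: "\<forall>Q\<in>V. vsec 0 B Q s \<and> s Q \<in> Z (i - 1) Q" using ker_im_sheaf_iff[OF V(1)] by blast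
    have "near P (\<lambda>Q. s Q \<in> Z (i - 1) Q \<and> t Q = Z i Q +>\<^bsub>VS Q\<^esub> s Q)"
      unfolding near_def using V sV by blast
    then show "qsec i P t" unfolding qsec_def using sV V(2) by blast
  next
    assume "qsec i P t"
    then obtain s where s: "vsec 0 B P s" "near P (\<lambda>Q. s Q \<in> Z (i - 1) Q \<and> t Q = Z i Q +>\<^bsub>VS Q\<^esub> s Q)"
      unfolding qsec_def by blast
    from near_conj[OF vsec_near[OF fB s(1)] s(2)] obtain V where V: "is_open V" "P \<in> V"
      "\<forall>Q\<in>V. vsec 0 B Q s \<and> s Q \<in> Z (i - 1) Q \<and> t Q = Z i Q +>\<^bsub>VS Q\<^esub> s Q" unfolding near_def by blast
    let ?V = "V \<inter> W"
    have oV: "is_open ?V" by (rule open_Int[OF V(1) W])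
    have "restrict s ?V \<in> ?A ?V"
      unfolding ker_im_sheaf_iff[OF oV] using V vsec_restrict_open[OF oV, of _ 0 B s] by simp
    moreover have "\<forall>Q\<in>?V. t Q = Z i Q +>\<^bsub>VS Q\<^esub> restrict s ?V Q" using V(3) by simp
    ultimately show "\<exists>V. is_open V \<and> P \<in> V \<and> V \<subseteq> W \<and> (\<exists>s\<in>?A V. \<forall>Q\<in>V. t Q = Z i Q +>\<^bsub>VS Q\<^esub> s Q)"
      using oV V(2) P by blast
  qed
  moreover have "stalk_of R D (\<lambda>W. ker_sheaf R D B RA W \<inter> im_sheaf R D B d RA i W) Q = Z i Q" if "Q \<in> V" "is_open V" for Q V
    using stalk_of_Z open_sub that by blast
  ultimately show ?thesis
    unfolding Fsh_def quotient_sheaf_def free_sheaf_def mod_sheaf.simps by (auto cong: conj_cong)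
qed

end

section \<open>Quotients by submodules\<close>

context plain_module begin

context
  fixes K assumes K: "submodule K R M"
begin

lemma submodule_abelian: "abelian_subgroup K M"
  using K M.abelian_group_axioms
  by (intro abelian_subgroupI3 additive_subgroup.intro) (auto simp: submodule_def)

lemma coset_mem: "y \<in> K +>\<^bsub>M\<^esub> x \<longleftrightarrow> (\<exists>z\<in>K. y = z \<oplus>\<^bsub>M\<^esub> x)"
  unfolding a_r_coset_def' by auto

lemma coset_self: "x \<in> carrier M \<Longrightarrow> x \<in> K +>\<^bsub>M\<^esub> x"
  using abelian_subgroup.a_rcos_self[OF submodule_abelian] by blast

lemma coset_eqI: "x \<in> carrier M \<Longrightarrow> y \<in> K +>\<^bsub>M\<^esub> x \<Longrightarrow> K +>\<^bsub>M\<^esub> x = K +>\<^bsub>M\<^esub> y"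
  using M.a_repr_independence K by (simp add: submodule_def)

lemma coset_eqD: "y \<in> carrier M \<Longrightarrow> K +>\<^bsub>M\<^esub> x = K +>\<^bsub>M\<^esub> y \<Longrightarrow> \<exists>z\<in>K. y = z \<oplus>\<^bsub>M\<^esub> x"
  using coset_self[of y] coset_mem by blast

lemma coset_zero: "x \<in> K \<Longrightarrow> K +>\<^bsub>M\<^esub> x = K"
  using abelian_subgroup.a_rcos_const[OF submodule_abelian] .

lemma coset_eq_self_iff: "x \<in> carrier M \<Longrightarrow> K +>\<^bsub>M\<^esub> x = K \<longleftrightarrow> x \<in> K"
  using coset_zero coset_self by auto

lemma coset_add:
  "x \<in> carrier M \<Longrightarrow> y \<in> carrier M \<Longrightarrow> (K +>\<^bsub>M\<^esub> x) <+>\<^bsub>M\<^esub> (K +>\<^bsub>M\<^esub> y) = K +>\<^bsub>M\<^esub> (x \<oplus>\<^bsub>M\<^esub> y)"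
  using abelian_subgroup.a_rcos_sum[OF submodule_abelian] .

lemma coset_smult:
  assumes c: "c \<in> carrier R" and x: "x \<in> carrier M"
  shows "(\<Union>y\<in>K +>\<^bsub>M\<^esub> x. K +>\<^bsub>M\<^esub> (c \<odot>\<^bsub>M\<^esub> y)) = K +>\<^bsub>M\<^esub> (c \<odot>\<^bsub>M\<^esub> x)"
proof -
  have "K +>\<^bsub>M\<^esub> (c \<odot>\<^bsub>M\<^esub> y) = K +>\<^bsub>M\<^esub> (c \<odot>\<^bsub>M\<^esub> x)" if y: "y \<in> K +>\<^bsub>M\<^esub> x" for y
  proof -
    obtain z where z: "z \<in> K" "y = z \<oplus>\<^bsub>M\<^esub> x" using y coset_mem by blast
    have zM: "z \<in> carrier M" using z(1) submoduleE(1)[OF K] by blast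
    have "c \<odot>\<^bsub>M\<^esub> y = c \<odot>\<^bsub>M\<^esub> z \<oplus>\<^bsub>M\<^esub> c \<odot>\<^bsub>M\<^esub> x" using z c x zM by (simp add: smult_r_distr)
    moreover have "c \<odot>\<^bsub>M\<^esub> z \<in> K" using submoduleE(4)[OF K] c z by blast
    ultimately show ?thesis using coset_eqI[of "c \<odot>\<^bsub>M\<^esub> x" "c \<odot>\<^bsub>M\<^esub> y"] c x coset_mem by blast
  qed
  then show ?thesis using coset_self[OF x] by blast
qed

end

end

section \<open>From free quotients to Jordan chains\<close>

context homogeneous_matrix begin

lemma VS_plain: "Q \<in> PR \<Longrightarrow> plain_module (ST Q) (VS Q)"
  using cring.free_module_plain_module[OF ST_cring] .

lemma Z_submodule:
  assumes Q: "Q \<in> PR"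
  shows "submodule (Z j Q) (ST Q) (VS Q)"
proof -
  interpret F: plain_module "ST Q" "VS Q" using Q by (rule VS_plain)
  obtain f where f: "unit_at f Q" using unit_at_ex[OF Q] by blast
  note lin = th_linear[OF f] and linj = F.linear_op_funpow[OF th_linear[OF f], of j]
  have z0: "(\<lambda>b\<in>B. \<zero>\<^bsub>LOC Q\<^esub>) = \<zero>\<^bsub>VS Q\<^esub>" by (simp add: free_module_simps ST_simps)
  note Zq = Z_eq[OF f, of j, unfolded z0]
  show ?thesis
  proof (rule F.submoduleI)
    show "Z j Q \<subseteq> carrier (VS Q)" unfolding Zq by blast
    show "\<zero>\<^bsub>VS Q\<^esub> \<in> Z j Q" unfolding Zq
      using F.linear_op_zero[OF lin] F.linear_op_zero[OF linj] F.M.zero_closed by (metis (mono_tags, lifting) mem_Collect_eq)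
    show "\<ominus>\<^bsub>VS Q\<^esub> y \<in> Z j Q" if "y \<in> Z j Q" for y
    proof -
      obtain w where w: "y \<in> carrier (VS Q)" "th f Q y = \<zero>\<^bsub>VS Q\<^esub>" "w \<in> carrier (VS Q)" "y = (th f Q ^^ j) w"
        using \<open>y \<in> Z j Q\<close> unfolding Zq by blast
      have "th f Q (\<ominus>\<^bsub>VS Q\<^esub> y) = \<zero>\<^bsub>VS Q\<^esub>" using F.linear_op_minus[OF lin w(1)] w(2) by simp
      moreover have "\<ominus>\<^bsub>VS Q\<^esub> y = (th f Q ^^ j) (\<ominus>\<^bsub>VS Q\<^esub> w)" using F.linear_op_minus[OF linj w(3)] w(4) by simp
      ultimately show ?thesis unfolding Zq using w(1,3) F.M.a_inv_closed by blast
    qed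
    show "y \<oplus>\<^bsub>VS Q\<^esub> y' \<in> Z j Q" if yy: "y \<in> Z j Q" "y' \<in> Z j Q" for y y'
    proof -
      obtain w where w: "y \<in> carrier (VS Q)" "th f Q y = \<zero>\<^bsub>VS Q\<^esub>" "w \<in> carrier (VS Q)" "y = (th f Q ^^ j) w"
        using yy(1) unfolding Zq by blast
      obtain w' where w': "y' \<in> carrier (VS Q)" "th f Q y' = \<zero>\<^bsub>VS Q\<^esub>" "w' \<in> carrier (VS Q)" "y' = (th f Q ^^ j) w'"
        using yy(2) unfolding Zq by blast
      have "th f Q (y \<oplus>\<^bsub>VS Q\<^esub> y') = \<zero>\<^bsub>VS Q\<^esub>" using lin w w' by (simp add: F.linear_op_def)
      moreover have "y \<oplus>\<^bsub>VS Q\<^esub> y' = (th f Q ^^ j) (w \<oplus>\<^bsub>VS Q\<^esub> w')" using linj w w' by (simp add: F.linear_op_def)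
      ultimately show ?thesis unfolding Zq using w(1,3) w'(1,3) F.M.a_closed by blast
    qed
    show "c \<odot>\<^bsub>VS Q\<^esub> y \<in> Z j Q" if cy: "c \<in> carrier (ST Q)" "y \<in> Z j Q" for c y
    proof -
      obtain w where w: "y \<in> carrier (VS Q)" "th f Q y = \<zero>\<^bsub>VS Q\<^esub>" "w \<in> carrier (VS Q)" "y = (th f Q ^^ j) w"
        using cy(2) unfolding Zq by blast
      have "th f Q (c \<odot>\<^bsub>VS Q\<^esub> y) = \<zero>\<^bsub>VS Q\<^esub>" using lin w cy by (simp add: F.linear_op_def)
      moreover have "c \<odot>\<^bsub>VS Q\<^esub> y = (th f Q ^^ j) (c \<odot>\<^bsub>VS Q\<^esub> w)" using linj w cy by (simp add: F.linear_op_def)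
      ultimately show ?thesis unfolding Zq using w(1,3) F.smult_closed[OF cy(1)] by blast
    qed
  qed
qed

lemma vsec_add: "vsec 0 B P s \<Longrightarrow> vsec 0 B P t \<Longrightarrow> vsec 0 B P (\<lambda>Q. s Q \<oplus>\<^bsub>VS Q\<^esub> t Q)"
  unfolding free_module_simps ST_simps
  by (rule vsec_restrict[OF vsec_PR]) (auto simp: vsec_def intro: sec_add)

lemma vsec_smult: "sec 0 P c \<Longrightarrow> vsec 0 B P t \<Longrightarrow> vsec 0 B P (\<lambda>Q. c Q \<odot>\<^bsub>VS Q\<^esub> t Q)"
  unfolding free_module_simps ST_simps
proof (rule vsec_restrict[OF vsec_PR], assumption)
  fix b assume *: "sec 0 P c" "vsec 0 B P t" "b \<in> B"
  then have "sec 0 P (\<lambda>Q. t Q b)" unfolding vsec_def by blast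
  from sec_mult[OF *(1) this] show "sec 0 P (\<lambda>Q. c Q \<otimes>\<^bsub>LOC Q\<^esub> t Q b)" by simp
qed

lemma quotient_add: "Y \<oplus>\<^bsub>quotient_module N N1 N2\<^esub> Y' = Y <+>\<^bsub>N\<^esub> Y'"
  by (simp add: quotient_module_def)

lemma quotient_smult: "c \<odot>\<^bsub>quotient_module N N1 N2\<^esub> Y = (\<Union>y\<in>Y. N2 +>\<^bsub>N\<^esub> (c \<odot>\<^bsub>N\<^esub> y))"
  by (simp add: quotient_module_def)

lemma Z_sub: "Q \<in> PR \<Longrightarrow> y \<in> Z j Q \<Longrightarrow> y \<in> carrier (VS Q)"
  unfolding Z_def by blast

lemma sheaf_add_section:
  assumes W: "is_open W" and s: "s \<in> sections (Fsh i) W" and t: "t \<in> sections (Fsh i) W"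
  shows "sheaf_add (Fsh i) W s t \<in> sections (Fsh i) W"
  unfolding sections_Fsh[OF W]
proof (intro conjI ballI)
  show "sheaf_add (Fsh i) W s t \<in> extensional W" by (simp add: sheaf_add_def)
  fix P assume P: "P \<in> W"
  obtain u where u: "vsec 0 B P u" "near P (\<lambda>Q. u Q \<in> Z (i - 1) Q \<and> s Q = Z i Q +>\<^bsub>VS Q\<^esub> u Q)"
    using s P sections_Fsh[OF W] unfolding qsec_def by blast
  obtain w where w: "vsec 0 B P w" "near P (\<lambda>Q. w Q \<in> Z (i - 1) Q \<and> t Q = Z i Q +>\<^bsub>VS Q\<^esub> w Q)"
    using t P sections_Fsh[OF W] unfolding qsec_def by blast
  let ?v = "\<lambda>Q. u Q \<oplus>\<^bsub>VS Q\<^esub> w Q"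
  have "near P (\<lambda>Q. ?v Q \<in> Z (i - 1) Q \<and> sheaf_add (Fsh i) W s t Q = Z i Q +>\<^bsub>VS Q\<^esub> ?v Q)"
  proof (rule near_mono2[OF near_conj[OF u(2) w(2)] near_open[OF W P]])
    fix Q assume Q: "Q \<in> PR" "(u Q \<in> Z (i - 1) Q \<and> s Q = Z i Q +>\<^bsub>VS Q\<^esub> u Q) \<and> w Q \<in> Z (i - 1) Q \<and> t Q = Z i Q +>\<^bsub>VS Q\<^esub> w Q"
      "Q \<in> W"
    interpret F: plain_module "ST Q" "VS Q" using Q(1) by (rule VS_plain)
    have uw: "u Q \<in> carrier (VS Q)" "w Q \<in> carrier (VS Q)" using Q(2) Z_sub[OF Q(1)] by blast+
    have "?v Q \<in> Z (i - 1) Q" using F.submoduleE(5)[OF Z_submodule[OF Q(1)]] Q(2) by blast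
    moreover have "sheaf_add (Fsh i) W s t Q = Z i Q +>\<^bsub>VS Q\<^esub> ?v Q"
      using Q F.coset_add[OF Z_submodule[OF Q(1)] uw]
      by (simp add: sheaf_add_def stalk_Fsh quotient_add)
    ultimately show "?v Q \<in> Z (i - 1) Q \<and> sheaf_add (Fsh i) W s t Q = Z i Q +>\<^bsub>VS Q\<^esub> ?v Q" by blast
  qed
  then show "qsec i P (sheaf_add (Fsh i) W s t)" unfolding qsec_def using vsec_add[OF u(1) w(1)] by blast
qed

lemma sheaf_smult_section:
  assumes W: "is_open W" and s: "s \<in> sections (Fsh i) W" and c: "\<And>P. P \<in> W \<Longrightarrow> sec 0 P c"
  shows "sheaf_smult (Fsh i) W c s \<in> sections (Fsh i) W"
  unfolding sections_Fsh[OF W]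
proof (intro conjI ballI)
  show "sheaf_smult (Fsh i) W c s \<in> extensional W" by (simp add: sheaf_smult_def)
  fix P assume P: "P \<in> W"
  obtain u where u: "vsec 0 B P u" "near P (\<lambda>Q. u Q \<in> Z (i - 1) Q \<and> s Q = Z i Q +>\<^bsub>VS Q\<^esub> u Q)"
    using s P sections_Fsh[OF W] unfolding qsec_def by blast
  let ?v = "\<lambda>Q. c Q \<odot>\<^bsub>VS Q\<^esub> u Q"
  have "near P (\<lambda>Q. ?v Q \<in> Z (i - 1) Q \<and> sheaf_smult (Fsh i) W c s Q = Z i Q +>\<^bsub>VS Q\<^esub> ?v Q)"
  proof (rule near_mono2[OF u(2) near_open[OF W P]])
    fix Q assume Q: "Q \<in> PR" "u Q \<in> Z (i - 1) Q \<and> s Q = Z i Q +>\<^bsub>VS Q\<^esub> u Q" "Q \<in> W"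
    interpret F: plain_module "ST Q" "VS Q" using Q(1) by (rule VS_plain)
    have cQ: "c Q \<in> carrier (ST Q)" using sec_mem[OF c[OF Q(3)]] by (simp add: ST_simps)
    have uQ: "u Q \<in> carrier (VS Q)" using Q(2) Z_sub[OF Q(1)] by blast
    have "?v Q \<in> Z (i - 1) Q" using F.submoduleE(4)[OF Z_submodule[OF Q(1)]] Q(2) cQ by blast
    moreover have "sheaf_smult (Fsh i) W c s Q = Z i Q +>\<^bsub>VS Q\<^esub> ?v Q"
      using Q F.coset_smult[OF Z_submodule[OF Q(1)] cQ uQ]
      by (simp add: sheaf_smult_def stalk_Fsh quotient_smult)
    ultimately show "?v Q \<in> Z (i - 1) Q \<and> sheaf_smult (Fsh i) W c s Q = Z i Q +>\<^bsub>VS Q\<^esub> ?v Q" by blast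
  qed
  then show "qsec i P (sheaf_smult (Fsh i) W c s)" unfolding qsec_def using vsec_smult[OF c[OF P] u(1)] by blast
qed

lemma zero_section:
  assumes W: "is_open W"
  shows "(\<lambda>Q\<in>W. Z i Q) \<in> sections (Fsh i) W"
  unfolding sections_Fsh[OF W]
proof (intro conjI ballI)
  fix P assume P: "P \<in> W"
  have PR: "P \<in> PR" using P open_sub[OF W] by blast
  have "near P (\<lambda>Q. (\<lambda>b\<in>B. \<zero>\<^bsub>LOC Q\<^esub>) \<in> Z (i - 1) Q \<and> (\<lambda>Q\<in>W. Z i Q) Q = Z i Q +>\<^bsub>VS Q\<^esub> (\<lambda>b\<in>B. \<zero>\<^bsub>LOC Q\<^esub>))"
  proof (rule near_mono[OF near_open[OF W P]])
    fix Q assume Q: "Q \<in> PR" "Q \<in> W"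
    interpret F: plain_module "ST Q" "VS Q" using Q(1) by (rule VS_plain)
    have z: "(\<lambda>b\<in>B. \<zero>\<^bsub>LOC Q\<^esub>) \<in> Z j Q" for j
      using subgroup.one_closed[OF submodule.axioms(1)[OF Z_submodule[OF Q(1), of j]]]
      by (simp add: free_module_simps ST_simps)
    show "(\<lambda>b\<in>B. \<zero>\<^bsub>LOC Q\<^esub>) \<in> Z (i - 1) Q \<and> (\<lambda>Q\<in>W. Z i Q) Q = Z i Q +>\<^bsub>VS Q\<^esub> (\<lambda>b\<in>B. \<zero>\<^bsub>LOC Q\<^esub>)"
      using z F.coset_zero[OF Z_submodule[OF Q(1)] z] Q(2) by simp
  qed
  then show "qsec i P (\<lambda>Q\<in>W. Z i Q)" unfolding qsec_def using vsec_zero[OF PR] by blast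
qed simp

lemma section_restrict:
  assumes "is_open W" "is_open W'" "W' \<subseteq> W" "s \<in> sections (Fsh i) W"
  shows "restrict s W' \<in> sections (Fsh i) W'"
  unfolding sections_Fsh[OF assms(2)]
proof (intro conjI ballI)
  fix P assume P: "P \<in> W'"
  then obtain u where u: "vsec 0 B P u" "near P (\<lambda>Q. u Q \<in> Z (i - 1) Q \<and> s Q = Z i Q +>\<^bsub>VS Q\<^esub> u Q)"
    using assms sections_Fsh[OF assms(1)] unfolding qsec_def by blast
  have "near P (\<lambda>Q. u Q \<in> Z (i - 1) Q \<and> restrict s W' Q = Z i Q +>\<^bsub>VS Q\<^esub> u Q)"
    by (rule near_mono2[OF u(2) near_open[OF assms(2) P]]) simp
  then show "qsec i P (restrict s W')" unfolding qsec_def using u(1) by blast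
qed simp

text \<open>
  The representatives come from the preimages of the standard sections of the free sheaf.  An element
  of the stalk, or a relation in it, extends to a neighbourhood of \<open>P\<close>, where the isomorphism applies.
\<close>

lemma free_quotient_stalk:
  assumes V: "is_open V" "P \<in> V" and iso: "sheaf_iso_on R D V (Fsh i) (free_sheaf R D {..<n::nat})"
  shows "\<exists>s. (\<forall>c<n. s c \<in> Z (i - 1) P) \<and>
    (\<forall>y\<in>Z (i - 1) P. \<exists>\<alpha>\<in>{..<n} \<rightarrow> carrier (ST P). \<exists>z\<in>Z i P.
      y = plain_module.lincomb (VS P) {..<n} \<alpha> s \<oplus>\<^bsub>VS P\<^esub> z) \<and>
    (\<forall>\<alpha>\<in>{..<n} \<rightarrow> carrier (ST P). plain_module.lincomb (VS P) {..<n} \<alpha> s \<in> Z i P \<longrightarrow>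
      (\<forall>c<n. \<alpha> c = \<zero>\<^bsub>ST P\<^esub>))"
proof -
  let ?N = "{..<n}" and ?F = "Fsh i" and ?O = "free_sheaf R D {..<n}"
  have PR: "P \<in> PR" using V open_sub by blast
  interpret F: plain_module "ST P" "VS P" using PR by (rule VS_plain)
  note Zi = Z_submodule[OF PR, of i]
  obtain \<phi> where \<phi>': "\<forall>W. is_open W \<and> W \<subseteq> V \<longrightarrow>
     bij_betw (\<phi> W) (sections ?F W) (sections ?O W) \<and>
     (\<forall>s\<in>sections ?F W. \<forall>t\<in>sections ?F W.
        \<phi> W (sheaf_add ?F W s t) = sheaf_add ?O W (\<phi> W s) (\<phi> W t)) \<and>
     (\<forall>c\<in>twist R D 0 W. \<forall>s\<in>sections ?F W.
        \<phi> W (sheaf_smult ?F W c s) = sheaf_smult ?O W c (\<phi> W s)) \<and>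
     (\<forall>W'. is_open W' \<and> W' \<subseteq> W \<longrightarrow>
        (\<forall>s\<in>sections ?F W. \<phi> W' (restrict s W') = restrict (\<phi> W s) W'))"
    by (rule exE[OF iso[unfolded sheaf_iso_on_def]])
  have \<phi>: "\<And>W. is_open W \<Longrightarrow> W \<subseteq> V \<Longrightarrow> bij_betw (\<phi> W) (sections ?F W) (sections ?O W)"
    "\<And>W s t. is_open W \<Longrightarrow> W \<subseteq> V \<Longrightarrow> s \<in> sections ?F W \<Longrightarrow> t \<in> sections ?F W \<Longrightarrow>
      \<phi> W (sheaf_add ?F W s t) = sheaf_add ?O W (\<phi> W s) (\<phi> W t)"
    "\<And>W c s. is_open W \<Longrightarrow> W \<subseteq> V \<Longrightarrow> c \<in> twist R D 0 W \<Longrightarrow> s \<in> sections ?F W \<Longrightarrow>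
      \<phi> W (sheaf_smult ?F W c s) = sheaf_smult ?O W c (\<phi> W s)"
    "\<And>W W' s. is_open W \<Longrightarrow> W \<subseteq> V \<Longrightarrow> is_open W' \<Longrightarrow> W' \<subseteq> W \<Longrightarrow> s \<in> sections ?F W \<Longrightarrow>
      \<phi> W' (restrict s W') = restrict (\<phi> W s) W'"
    using \<phi>' by simp_all
  have secO: "sections ?O W = twist_power R D 0 ?N W" "stalk ?O Q = free_module (ST Q) ?N" for W Q
    by (simp_all add: free_sheaf_def)
  have e: "(\<lambda>Q\<in>V. \<lambda>c'\<in>?N. if c = c' then \<one>\<^bsub>LOC Q\<^esub> else \<zero>\<^bsub>LOC Q\<^esub>) \<in> sections ?O V" for c
    unfolding secO twist_power_iff[OF V(1)]
  proof (intro conjI ballI)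
    fix Q assume Q: "Q \<in> V"
    then have QP: "Q \<in> PR" using open_sub[OF V(1)] by blast
    show "vsec 0 ?N Q (\<lambda>Q\<in>V. \<lambda>c'\<in>?N. if c = c' then \<one>\<^bsub>LOC Q\<^esub> else \<zero>\<^bsub>LOC Q\<^esub>)"
    proof (rule vsec_restrict_open[OF V(1) Q])
      show "vsec 0 ?N Q (\<lambda>Q. \<lambda>c'\<in>?N. if c = c' then \<one>\<^bsub>LOC Q\<^esub> else \<zero>\<^bsub>LOC Q\<^esub>)"
      proof (rule vsec_restrict[OF QP])
        show "sec 0 Q (\<lambda>Q. if c = c' then \<one>\<^bsub>LOC Q\<^esub> else \<zero>\<^bsub>LOC Q\<^esub>)" for c'
          using sec_one[OF QP] sec_zero[OF QP] by (cases "c = c'") simp_all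
      qed
    qed
  qed simp
  have "\<forall>c. \<exists>s\<in>sections ?F V. \<phi> V s = (\<lambda>Q\<in>V. \<lambda>c'\<in>?N. if c = c' then \<one>\<^bsub>LOC Q\<^esub> else \<zero>\<^bsub>LOC Q\<^esub>)"
  proof
    fix c
    have "(\<lambda>Q\<in>V. \<lambda>c'\<in>?N. if c = c' then \<one>\<^bsub>LOC Q\<^esub> else \<zero>\<^bsub>LOC Q\<^esub>) \<in> \<phi> V ` sections ?F V"
      using e bij_betw_imp_surj_on[OF \<phi>(1)[OF V(1) order.refl]] by blast
    then obtain s where "(\<lambda>Q\<in>V. \<lambda>c'\<in>?N. if c = c' then \<one>\<^bsub>LOC Q\<^esub> else \<zero>\<^bsub>LOC Q\<^esub>) = \<phi> V s"
      "s \<in> sections ?F V" by (rule imageE)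
    then show "\<exists>s\<in>sections ?F V. \<phi> V s = (\<lambda>Q\<in>V. \<lambda>c'\<in>?N. if c = c' then \<one>\<^bsub>LOC Q\<^esub> else \<zero>\<^bsub>LOC Q\<^esub>)"
      by (intro bexI[of _ s]) (rule sym)
  qed
  then obtain \<sigma>s where \<sigma>s: "\<And>c. \<sigma>s c \<in> sections ?F V"
    "\<And>c. \<phi> V (\<sigma>s c) = (\<lambda>Q\<in>V. \<lambda>c'\<in>?N. if c = c' then \<one>\<^bsub>LOC Q\<^esub> else \<zero>\<^bsub>LOC Q\<^esub>)" by metis
  have "\<forall>c. \<exists>s. s \<in> Z (i - 1) P \<and> \<sigma>s c P = Z i P +>\<^bsub>VS P\<^esub> s"
  proof
    fix c
    have "qsec i P (\<sigma>s c)" using \<sigma>s(1)[of c] V sections_Fsh[OF V(1)] by blast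
    then obtain u where "near P (\<lambda>Q. u Q \<in> Z (i - 1) Q \<and> \<sigma>s c Q = Z i Q +>\<^bsub>VS Q\<^esub> u Q)"
      unfolding qsec_def by blast
    from near_at[OF this] show "\<exists>s. s \<in> Z (i - 1) P \<and> \<sigma>s c P = Z i P +>\<^bsub>VS P\<^esub> s" by blast
  qed
  then obtain s where s: "\<And>c. s c \<in> Z (i - 1) P" "\<And>c. \<sigma>s c P = Z i P +>\<^bsub>VS P\<^esub> s c" by metis
  have sM: "s c \<in> carrier (VS P)" for c using Z_sub[OF PR s(1)] .
  \<comment> \<open>Additivity determines the image of zero, since a section that equals its own double is zero.\<close>
  have phi_zero: "\<phi> W (\<lambda>Q\<in>W. Z i Q) = (\<lambda>Q\<in>W. \<lambda>c\<in>?N. \<zero>\<^bsub>LOC Q\<^esub>)"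
    if W: "is_open W" "W \<subseteq> V" for W
  proof -
    let ?\<tau> = "\<lambda>Q\<in>W. Z i Q"
    have \<tau>: "?\<tau> \<in> sections ?F W" by (rule zero_section[OF W(1)])
    have "sheaf_add ?F W ?\<tau> ?\<tau> = ?\<tau>" unfolding sheaf_add_def
    proof (rule restrict_eqI)
      fix Q assume Q: "Q \<in> W"
      then have QP: "Q \<in> PR" using open_sub[OF W(1)] by blast
      interpret G: plain_module "ST Q" "VS Q" using QP by (rule VS_plain)
      note ZQ = Z_submodule[OF QP, of i]
      have z: "\<zero>\<^bsub>VS Q\<^esub> \<in> Z i Q" using subgroup.one_closed[OF submodule.axioms(1)[OF ZQ]] by simp
      show "?\<tau> Q \<oplus>\<^bsub>stalk ?F Q\<^esub> ?\<tau> Q = Z i Q"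
        using Q G.coset_add[OF ZQ G.M.zero_closed G.M.zero_closed] G.coset_zero[OF ZQ z]
        by (simp add: stalk_Fsh[OF QP] quotient_add)
    qed
    then have eq: "sheaf_add ?O W (\<phi> W ?\<tau>) (\<phi> W ?\<tau>) = \<phi> W ?\<tau>" using \<phi>(2)[OF W(1,2) \<tau> \<tau>] by simp
    have "\<phi> W ?\<tau> \<in> sections ?O W" using \<phi>(1)[OF W(1,2)] \<tau> unfolding bij_betw_def by blast
    then have x: "\<phi> W ?\<tau> \<in> extensional W" "\<And>Q. Q \<in> W \<Longrightarrow> \<phi> W ?\<tau> Q \<in> ?N \<rightarrow>\<^sub>E loc_deg R D Q 0"
      unfolding secO twist_power_iff[OF W(1)] using vsec_mem by blast+
    have "\<phi> W ?\<tau> Q = (\<lambda>c\<in>?N. \<zero>\<^bsub>LOC Q\<^esub>)" if Q: "Q \<in> W" for Q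
    proof (rule PiE_eq_restrictI[OF x(2)[OF Q]])
      fix c assume c: "c \<in> ?N"
      have QP: "Q \<in> PR" using Q open_sub[OF W(1)] by blast
      interpret L: cring "LOC Q" using QP by (rule LOC_cring)
      have "\<phi> W ?\<tau> Q c \<oplus>\<^bsub>LOC Q\<^esub> \<phi> W ?\<tau> Q c = \<phi> W ?\<tau> Q c"
        using fun_cong[OF fun_cong[OF eq], of Q c] Q c by (simp add: sheaf_add_def secO free_module_simps ST_simps)
      moreover have "\<phi> W ?\<tau> Q c \<in> carrier (LOC Q)" using x(2)[OF Q] c ST_sub by (auto simp: PiE_iff)
      ultimately show "\<phi> W ?\<tau> Q c = \<zero>\<^bsub>LOC Q\<^esub>" using L.add.r_cancel_one by blast
    qed
    then show "\<phi> W ?\<tau> = (\<lambda>Q\<in>W. \<lambda>c\<in>?N. \<zero>\<^bsub>LOC Q\<^esub>)" using x(1) by (auto simp: extensional_def fun_eq_iff)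
  qed
  \<comment> \<open>The isomorphism sends a linear combination of the chosen sections \<open>\<sigma>s c\<close> to the section of the free
    sheaf with these coefficients; \<open>m\<close> counts the summands.\<close>
  have comb: "\<exists>\<tau>\<in>sections ?F W. \<phi> W \<tau> = (\<lambda>Q\<in>W. \<lambda>c\<in>?N. if c < m then \<alpha> c Q else \<zero>\<^bsub>LOC Q\<^esub>) \<and>
      \<tau> P = Z i P +>\<^bsub>VS P\<^esub> F.lincomb {..<m} (\<lambda>c. \<alpha> c P) s"
    if W: "is_open W" "W \<subseteq> V" "P \<in> W" and \<alpha>': "\<forall>c<n. \<forall>Q\<in>W. sec 0 Q (\<alpha> c)" and m: "m \<le> n" for W \<alpha> m
    using m
  proof (induction m)
    case 0
    let ?\<tau> = "\<lambda>Q\<in>W. Z i Q"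
    have \<tau>: "?\<tau> \<in> sections ?F W" by (rule zero_section[OF W(1)])
    have "\<phi> W ?\<tau> = (\<lambda>Q\<in>W. \<lambda>c\<in>?N. \<zero>\<^bsub>LOC Q\<^esub>)" by (rule phi_zero[OF W(1,2)])
    moreover have "?\<tau> P = Z i P +>\<^bsub>VS P\<^esub> F.lincomb {..<0} (\<lambda>c. \<alpha> c P) s"
      using W(3) F.coset_zero[OF Zi subgroup.one_closed[OF submodule.axioms(1)[OF Zi]]] by simp
    ultimately show ?case by (intro bexI[OF _ \<tau>] conjI) (simp_all only: not_less_zero if_False)
  next
    case (Suc m)
    have \<alpha>: "\<And>c Q. c < n \<Longrightarrow> Q \<in> W \<Longrightarrow> sec 0 Q (\<alpha> c)" using \<alpha>' by blast
    from Suc.IH[OF Suc_leD[OF Suc.prems]] obtain \<tau> where \<tau>: "\<tau> \<in> sections ?F W"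
      "\<phi> W \<tau> = (\<lambda>Q\<in>W. \<lambda>c\<in>?N. if c < m then \<alpha> c Q else \<zero>\<^bsub>LOC Q\<^esub>)"
      "\<tau> P = Z i P +>\<^bsub>VS P\<^esub> F.lincomb {..<m} (\<lambda>c. \<alpha> c P) s" by (elim bexE conjE)
    have mn: "m < n" using Suc.prems by simp
    let ?a = "restrict (\<alpha> m) W"
    have a: "sec 0 Q ?a" if "Q \<in> W" for Q
      by (rule sec_cong[OF \<alpha>[OF mn that] near_mono[OF near_open[OF W(1) that]]]) simp
    have at: "?a \<in> twist R D 0 W" unfolding twist_iff[OF W(1)] using a by simp
    have r: "restrict (\<sigma>s m) W \<in> sections ?F W" by (rule section_restrict[OF V(1) W(1,2) \<sigma>s(1)])
    have sm: "sheaf_smult ?F W ?a (restrict (\<sigma>s m) W) \<in> sections ?F W"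
      by (rule sheaf_smult_section[OF W(1) r a])
    let ?\<tau> = "sheaf_add ?F W \<tau> (sheaf_smult ?F W ?a (restrict (\<sigma>s m) W))"
    have t: "?\<tau> \<in> sections ?F W" by (rule sheaf_add_section[OF W(1) \<tau>(1) sm])
    have "\<phi> W ?\<tau> = sheaf_add ?O W (\<phi> W \<tau>) (sheaf_smult ?O W ?a (restrict (\<phi> V (\<sigma>s m)) W))"
      using \<phi>(2)[OF W(1,2) \<tau>(1) sm] \<phi>(3)[OF W(1,2) at r] \<phi>(4)[OF V(1) order.refl W(1,2) \<sigma>s(1)] by simp
    also have "\<dots> = (\<lambda>Q\<in>W. \<lambda>c\<in>?N. if c < Suc m then \<alpha> c Q else \<zero>\<^bsub>LOC Q\<^esub>)"
      unfolding sheaf_add_def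
    proof (rule restrict_eqI)
      fix Q assume Q: "Q \<in> W"
      then have QP: "Q \<in> PR" using open_sub[OF W(1)] by blast
      interpret L: cring "LOC Q" using QP by (rule LOC_cring)
      have ac: "\<alpha> c Q \<in> carrier (LOC Q)" if "c < n" for c using sec_mem[OF \<alpha>[OF that Q]] ST_sub by blast
      have key: "(if c < m then \<alpha> c Q else \<zero>\<^bsub>LOC Q\<^esub>) \<oplus>\<^bsub>LOC Q\<^esub>
          \<alpha> m Q \<otimes>\<^bsub>LOC Q\<^esub> (if m = c then \<one>\<^bsub>LOC Q\<^esub> else \<zero>\<^bsub>LOC Q\<^esub>)
        = (if c < Suc m then \<alpha> c Q else \<zero>\<^bsub>LOC Q\<^esub>)" if "c < n" for c
        using ac[OF that] ac[OF mn] by (cases c m rule: linorder_cases) simp_all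
      have QV: "Q \<in> V" using Q W(2) by blast
      show "\<phi> W \<tau> Q \<oplus>\<^bsub>stalk ?O Q\<^esub> sheaf_smult ?O W ?a (restrict (\<phi> V (\<sigma>s m)) W) Q
        = (\<lambda>c\<in>?N. if c < Suc m then \<alpha> c Q else \<zero>\<^bsub>LOC Q\<^esub>)"
        using Q QV unfolding \<tau>(2) \<sigma>s(2)
        by (simp add: sheaf_smult_def secO free_module_simps ST_simps) (rule restrict_eqI, simp add: key)
    qed
    finally have 1: "\<phi> W ?\<tau> = (\<lambda>Q\<in>W. \<lambda>c\<in>?N. if c < Suc m then \<alpha> c Q else \<zero>\<^bsub>LOC Q\<^esub>)" .
    have aP: "\<alpha> c P \<in> carrier (ST P)" if "c < n" for c using sec_mem[OF \<alpha>[OF that W(3)]] by (simp add: ST_simps)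
    have l: "F.lincomb {..<m} (\<lambda>c. \<alpha> c P) s \<in> carrier (VS P)" using aP mn sM by (intro F.lincomb_closed) auto
    have as: "\<alpha> m P \<odot>\<^bsub>VS P\<^esub> s m \<in> carrier (VS P)" using aP[OF mn] sM by simp
    have "?\<tau> P = \<tau> P <+>\<^bsub>VS P\<^esub> (\<Union>y\<in>\<sigma>s m P. Z i P +>\<^bsub>VS P\<^esub> (\<alpha> m P \<odot>\<^bsub>VS P\<^esub> y))"
      using W(3) by (simp add: sheaf_add_def sheaf_smult_def stalk_Fsh[OF PR] quotient_add quotient_smult)
    also have "\<dots> = Z i P +>\<^bsub>VS P\<^esub> (F.lincomb {..<m} (\<lambda>c. \<alpha> c P) s \<oplus>\<^bsub>VS P\<^esub> \<alpha> m P \<odot>\<^bsub>VS P\<^esub> s m)"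
      unfolding s(2) \<tau>(3) F.coset_smult[OF Zi aP[OF mn] sM] by (rule F.coset_add[OF Zi l as])
    also have "F.lincomb {..<m} (\<lambda>c. \<alpha> c P) s \<oplus>\<^bsub>VS P\<^esub> \<alpha> m P \<odot>\<^bsub>VS P\<^esub> s m = F.lincomb {..<Suc m} (\<lambda>c. \<alpha> c P) s"
      unfolding lessThan_Suc using aP mn sM l as by (subst F.lincomb_insert) (auto simp: F.M.a_comm)
    finally have 2: "?\<tau> P = Z i P +>\<^bsub>VS P\<^esub> F.lincomb {..<Suc m} (\<lambda>c. \<alpha> c P) s" .
    show ?case by (rule rev_bexI[OF t]) (rule conjI[OF 1 2])
  qed
  show ?thesis
  proof (intro exI[of _ s] conjI ballI allI impI)
    show "s c \<in> Z (i - 1) P" for c by (rule s(1))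
    fix y assume y: "y \<in> Z (i - 1) P"
    obtain u where u: "vsec 0 B P u" "u P = y" "near P (\<lambda>Q. u Q \<in> Z (i - 1) Q)" using Z_germ[OF PR y] by blast
    from near_conj[OF vsec_near[OF fB u(1)] u(3)] obtain W0 where W0: "is_open W0" "P \<in> W0"
      "\<forall>Q\<in>W0. vsec 0 B Q u \<and> u Q \<in> Z (i - 1) Q" unfolding near_def by blast
    let ?W = "W0 \<inter> V"
    have W: "is_open ?W" "?W \<subseteq> V" "P \<in> ?W" using open_Int[OF W0(1) V(1)] W0 V by blast+
    let ?t = "\<lambda>Q\<in>?W. Z i Q +>\<^bsub>VS Q\<^esub> u Q"
    have t: "?t \<in> sections ?F ?W" unfolding sections_Fsh[OF W(1)]
    proof (intro conjI ballI)
      fix Q assume Q: "Q \<in> ?W"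
      have "near Q (\<lambda>Q. u Q \<in> Z (i - 1) Q \<and> ?t Q = Z i Q +>\<^bsub>VS Q\<^esub> u Q)"
        by (rule near_mono[OF near_open[OF W(1) Q]]) (use W0(3) in simp)
      then show "qsec i Q ?t" unfolding qsec_def using W0(3) Q by blast
    qed simp
    have "\<phi> ?W ?t \<in> sections ?O ?W" using \<phi>(1)[OF W(1,2)] t unfolding bij_betw_def by blast
    then have x: "\<phi> ?W ?t \<in> extensional ?W" "\<And>Q. Q \<in> ?W \<Longrightarrow> vsec 0 ?N Q (\<phi> ?W ?t)"
      unfolding secO twist_power_iff[OF W(1)] by blast+
    define \<alpha> where "\<alpha> = (\<lambda>c Q. \<phi> ?W ?t Q c)"
    have \<alpha>: "\<forall>c<n. \<forall>Q\<in>?W. sec 0 Q (\<alpha> c)"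
      using x(2) unfolding vsec_def \<alpha>_def by blast
    \<comment> \<open>By injectivity the class of \<open>y\<close> is the combination whose coefficients are the components of its image.\<close>
    obtain \<tau> where \<tau>: "\<tau> \<in> sections ?F ?W" "\<phi> ?W \<tau> = (\<lambda>Q\<in>?W. \<lambda>c\<in>?N. if c < n then \<alpha> c Q else \<zero>\<^bsub>LOC Q\<^esub>)"
      "\<tau> P = Z i P +>\<^bsub>VS P\<^esub> F.lincomb ?N (\<lambda>c. \<alpha> c P) s" using comb[OF W \<alpha> order.refl] by (elim bexE conjE)
    have "\<phi> ?W \<tau> = \<phi> ?W ?t" unfolding \<tau>(2)
    proof (rule extensionalityI[of _ ?W])
      fix Q assume Q: "Q \<in> ?W"
      have "(\<lambda>c\<in>?N. if c < n then \<alpha> c Q else \<zero>\<^bsub>LOC Q\<^esub>) = \<phi> ?W ?t Q"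
        using PiE_eq_restrictI[OF vsec_mem[OF x(2)[OF Q]], of "\<lambda>c. if c < n then \<alpha> c Q else \<zero>\<^bsub>LOC Q\<^esub>"]
        by (simp add: \<alpha>_def)
      then show "(\<lambda>Q\<in>?W. \<lambda>c\<in>?N. if c < n then \<alpha> c Q else \<zero>\<^bsub>LOC Q\<^esub>) Q = \<phi> ?W ?t Q" using Q by simp
    qed (use x(1) in simp_all)
    then have "\<tau> = ?t" using \<phi>(1)[OF W(1,2)] \<tau>(1) t unfolding bij_betw_def inj_on_def by blast
    then have "Z i P +>\<^bsub>VS P\<^esub> F.lincomb ?N (\<lambda>c. \<alpha> c P) s = Z i P +>\<^bsub>VS P\<^esub> y" using \<tau>(3) W(3) u(2) by simp
    then obtain z where z: "z \<in> Z i P" "y = z \<oplus>\<^bsub>VS P\<^esub> F.lincomb ?N (\<lambda>c. \<alpha> c P) s"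
      using F.coset_eqD[OF Zi Z_sub[OF PR y]] by blast
    have aP: "(\<lambda>c. \<alpha> c P) \<in> ?N \<rightarrow> carrier (ST P)" using \<alpha> W(3) sec_mem by (auto simp: ST_simps)
    have "y = F.lincomb ?N (\<lambda>c. \<alpha> c P) s \<oplus>\<^bsub>VS P\<^esub> z"
      unfolding z(2) using Z_sub[OF PR z(1)] F.lincomb_closed[OF aP] sM by (intro F.M.a_comm) auto
    then show "\<exists>\<alpha>\<in>?N \<rightarrow> carrier (ST P). \<exists>z\<in>Z i P. y = F.lincomb ?N \<alpha> s \<oplus>\<^bsub>VS P\<^esub> z" using aP z(1) by blast
  next
    fix \<alpha>0 c assume \<alpha>0: "\<alpha>0 \<in> ?N \<rightarrow> carrier (ST P)" and m: "F.lincomb ?N \<alpha>0 s \<in> Z i P" and c: "c < n"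
    have "\<forall>c. \<exists>\<alpha>. c < n \<longrightarrow> sec 0 P \<alpha> \<and> \<alpha> P = \<alpha>0 c" using sec_germ[OF PR] \<alpha>0 by (auto simp: ST_simps Pi_iff)
    then obtain \<alpha> where \<alpha>: "\<And>c. c < n \<Longrightarrow> sec 0 P (\<alpha> c)" "\<And>c. c < n \<Longrightarrow> \<alpha> c P = \<alpha>0 c" by metis
    have "near P (\<lambda>Q. \<forall>c\<in>?N. sec 0 Q (\<alpha> c))" using \<alpha>(1) by (intro near_ball PR sec_near) auto
    then obtain W0 where W0: "is_open W0" "P \<in> W0" "\<forall>Q\<in>W0. \<forall>c\<in>?N. sec 0 Q (\<alpha> c)" unfolding near_def by blast
    let ?W = "W0 \<inter> V"
    have W: "is_open ?W" "?W \<subseteq> V" "P \<in> ?W" using open_Int[OF W0(1) V(1)] W0 V by blast+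
    have "\<forall>c<n. \<forall>Q\<in>?W. sec 0 Q (\<alpha> c)" using W0(3) by blast
    from comb[OF W this order.refl] obtain \<tau> where \<tau>: "\<tau> \<in> sections ?F ?W"
      "\<phi> ?W \<tau> = (\<lambda>Q\<in>?W. \<lambda>c\<in>?N. if c < n then \<alpha> c Q else \<zero>\<^bsub>LOC Q\<^esub>)"
      "\<tau> P = Z i P +>\<^bsub>VS P\<^esub> F.lincomb ?N (\<lambda>c. \<alpha> c P) s" by (elim bexE conjE)
    have "F.lincomb ?N (\<lambda>c. \<alpha> c P) s = F.lincomb ?N \<alpha>0 s"
      using \<alpha>0 sM \<alpha>(2) by (intro F.lincomb_cong) auto
    then have tP: "\<tau> P = Z i P" using \<tau>(3) F.coset_zero[OF Zi m] by simp
    obtain u where u: "vsec 0 B P u" "near P (\<lambda>Q. u Q \<in> Z (i - 1) Q \<and> \<tau> Q = Z i Q +>\<^bsub>VS Q\<^esub> u Q)"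
      using \<tau>(1) W(3) unfolding sections_Fsh[OF W(1)] qsec_def by blast
    \<comment> \<open>The combination vanishes in the quotient at \<open>P\<close>, hence on a neighbourhood, and so do the coefficients of
      its image.\<close>
    have "u P \<in> Z i P" using near_at[OF u(2)] tP F.coset_eq_self_iff[OF Zi vsec_VS[OF u(1)]] by simp
    from near_conj[OF Z_near[OF u(1) this] u(2)] obtain W1 where W1: "is_open W1" "P \<in> W1"
      "\<forall>Q\<in>W1. u Q \<in> Z i Q \<and> u Q \<in> Z (i - 1) Q \<and> \<tau> Q = Z i Q +>\<^bsub>VS Q\<^esub> u Q" unfolding near_def by blast
    let ?W1 = "W1 \<inter> ?W"
    have W': "is_open ?W1" "?W1 \<subseteq> V" "P \<in> ?W1" "?W1 \<subseteq> ?W" using open_Int[OF W1(1) W(1)] W1(2) W by blast+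
    have "restrict \<tau> ?W1 = (\<lambda>Q\<in>?W1. Z i Q)"
    proof (rule restrict_eqI)
      fix Q assume Q: "Q \<in> ?W1"
      then have QP: "Q \<in> PR" using open_sub[OF W'(1)] by blast
      interpret G: plain_module "ST Q" "VS Q" using QP by (rule VS_plain)
      show "\<tau> Q = Z i Q" using W1(3) Q G.coset_zero[OF Z_submodule[OF QP]] by auto
    qed
    moreover have "\<phi> ?W1 (\<lambda>Q\<in>?W1. Z i Q) = (\<lambda>Q\<in>?W1. \<lambda>c\<in>?N. \<zero>\<^bsub>LOC Q\<^esub>)"
      by (rule phi_zero[OF W'(1,2)])
    ultimately have "restrict (\<phi> ?W \<tau>) ?W1 = (\<lambda>Q\<in>?W1. \<lambda>c\<in>?N. \<zero>\<^bsub>LOC Q\<^esub>)"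
      using \<phi>(4)[OF W(1,2) W'(1,4) \<tau>(1)] by simp
    from fun_cong[OF fun_cong[OF this, of P], of c] have "\<phi> ?W \<tau> P c = \<zero>\<^bsub>LOC P\<^esub>"
      using W'(3) c by simp
    then show "\<alpha>0 c = \<zero>\<^bsub>ST P\<^esub>" using W'(3) W(3) c \<alpha>(2)[OF c] unfolding \<tau>(2) by (simp add: ST_simps)
  qed
qed

lemma local_op_eq:
  assumes P: "P \<in> PR"
  shows "\<exists>f. unit_at f P \<and>
    local_op R D B d RA P = mat_op (RF P) B (\<lambda>b b'. rho P (fr P (A b b') f))"
proof -
  define g where "g = (SOME f. f \<in> D d \<and> f \<notin> P)"
  have "\<exists>f. f \<in> D d \<and> f \<notin> P" using degree[OF P] unfolding D_eq by blast
  then have g: "g \<in> D d" "g \<notin> P" unfolding g_def by (metis (mono_tags, lifting) someI_ex)+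
  then obtain f where f: "g = \<pi> f" "f \<in> H d" unfolding D_eq by blast
  have "local_op R D B d RA P = mat_op (RF P) B (\<lambda>b b'. rho P (fr P (A b b') f))"
    unfolding local_op_def mat_op_def Let_def g_def[symmetric] f(1) fr_def rho_def mx_def ..
  moreover have "unit_at f P" using P f g(2) unfolding unit_at_def by blast
  ultimately show ?thesis by blast
qed

lemma has_jordan_type_iff:
  "has_jordan_type K V \<theta> p a \<longleftrightarrow> (\<exists>x. (\<forall>i\<in>{1..p}. \<forall>c<a i. x i c \<in> carrier V \<and> (\<theta> ^^ i) (x i c) = \<zero>\<^bsub>V\<^esub>) \<and>
    is_basis_family K V (jordan_index p a) (chain_family \<theta> x))"
  unfolding has_jordan_type_def jordan_index_def chain_family_def ..

lemma zero_VS: "\<zero>\<^bsub>VS Q\<^esub> = (\<lambda>b\<in>B. \<zero>\<^bsub>LOC Q\<^esub>)"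
  by (simp add: free_module_simps ST_simps)

lemma ker_im_Z:
  assumes f: "unit_at f P" and c: "chains (ST P) (VS P) (th f P) q a x"
  shows "chains.ker_im (VS P) (th f P) m = Z m P"
  unfolding chains.ker_im_def[OF c] Z_eq[OF f] zero_VS by blast

lemma vmap_th:
  assumes f: "unit_at f P" and x: "x \<in> carrier (VS P)"
  shows "reduction.vmap (rho P) B ((th f P ^^ n) x) =
    (mat_op (RF P) B (\<lambda>b b'. rho P (fr P (A b b') f)) ^^ n) (reduction.vmap (rho P) B x)"
proof -
  interpret r: local_reduction "ST P" "RF P" "rho P" by (rule local_reduction_ST[OF unit_at_PR[OF f]])
  show ?thesis unfolding th_def
    using x entry_closed[OF f] fB by (intro r.vmap_mat_op_pow) (auto simp: ST_simps free_module_simps)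
qed

text \<open>
  The representatives lie in the image of \<open>\<theta>\<^bsup>i-1\<^esup>\<close>, so each of them is the end of a chain of length \<open>i\<close>.
  By \<open>chains_basis\<close> these chains form a basis of the stalk, and their reductions form a Jordan basis.
\<close>

theorem jordan_type_of_locally_free:
  assumes P: "P \<in> PR"
    and free: "\<And>i. i \<in> {1..p} \<Longrightarrow> \<exists>V. is_open V \<and> P \<in> V \<and> sheaf_iso_on R D V (Fsh i) (free_sheaf R D {..<a i})"
  shows "has_jordan_type (RF P) (free_module (RF P) B) (local_op R D B d RA P) p a"
proof -
  obtain f where f: "unit_at f P" and op: "local_op R D B d RA P = mat_op (RF P) B (\<lambda>b b'. rho P (fr P (A b b') f))"
    using local_op_eq[OF P] by blast
  interpret F: plain_module "ST P" "VS P" using P by (rule VS_plain)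
  interpret r: local_reduction "ST P" "RF P" "rho P" by (rule local_reduction_ST[OF P])
  let ?\<theta> = "th f P" and ?J = "jordan_index p a"
  let ?good = "\<lambda>i s. (\<forall>c<a i. s c \<in> Z (i - 1) P) \<and>
    (\<forall>y\<in>Z (i - 1) P. \<exists>\<alpha>\<in>{..<a i} \<rightarrow> carrier (ST P). \<exists>z\<in>Z i P. y = F.lincomb {..<a i} \<alpha> s \<oplus>\<^bsub>VS P\<^esub> z) \<and>
    (\<forall>\<alpha>\<in>{..<a i} \<rightarrow> carrier (ST P). F.lincomb {..<a i} \<alpha> s \<in> Z i P \<longrightarrow> (\<forall>c<a i. \<alpha> c = \<zero>\<^bsub>ST P\<^esub>))"
  have "\<exists>s. i \<in> {1..p} \<longrightarrow> ?good i s" for i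
  proof (cases "i \<in> {1..p}")
    case True
    then obtain V where V: "is_open V" "P \<in> V" "sheaf_iso_on R D V (Fsh i) (free_sheaf R D {..<a i})"
      using free by blast
    show ?thesis using free_quotient_stalk[OF V] by (elim exE) (rule exI, rule impI)
  next
    case False
    then show ?thesis by (intro exI impI) (rule notE)
  qed
  then have "\<forall>i. \<exists>s. i \<in> {1..p} \<longrightarrow> ?good i s" by (intro allI)
  from choice[OF this] obtain s where s': "\<forall>i. i \<in> {1..p} \<longrightarrow> ?good i (s i)" by (elim exE)
  have s: "?good i (s i)" if "i \<in> {1..p}" for i using s' that by (elim allE impE)
  have "\<forall>i c. \<exists>x. i \<in> {1..p} \<longrightarrow> c < a i \<longrightarrow> x \<in> carrier (VS P) \<and> s i c = (?\<theta> ^^ (i - 1)) x"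
  proof (intro allI)
    fix i c
    show "\<exists>x. i \<in> {1..p} \<longrightarrow> c < a i \<longrightarrow> x \<in> carrier (VS P) \<and> s i c = (?\<theta> ^^ (i - 1)) x"
      using s[of i] unfolding Z_eq[OF f] by blast
  qed
  then obtain x where x: "\<And>i c. i \<in> {1..p} \<Longrightarrow> c < a i \<Longrightarrow> x i c \<in> carrier (VS P)"
    "\<And>i c. i \<in> {1..p} \<Longrightarrow> c < a i \<Longrightarrow> s i c = (?\<theta> ^^ (i - 1)) (x i c)" by metis
  have end0: "(?\<theta> ^^ i) (x i c) = \<zero>\<^bsub>VS P\<^esub>" if ic: "i \<in> {1..p}" "c < a i" for i c
  proof -
    have "s i c \<in> Z (i - 1) P" using s[OF ic(1)] ic(2) by blast
    then have "?\<theta> (s i c) = \<zero>\<^bsub>VS P\<^esub>" unfolding Z_eq[OF f] zero_VS by blast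
    moreover have "(?\<theta> ^^ i) (x i c) = ?\<theta> (s i c)" unfolding x(2)[OF ic] using ic(1) by (cases i) auto
    ultimately show ?thesis by simp
  qed
  have ch: "chains (ST P) (VS P) ?\<theta> p a x"
    by unfold_locales (use th_linear[OF f] x(1) end0 in auto)
  interpret C: chains "ST P" "VS P" ?\<theta> p a x by (rule ch)
  note kZ = ker_im_Z[OF f ch]
  have lc: "F.lincomb {..<a i} \<alpha> (\<lambda>c. (?\<theta> ^^ (i - 1)) (x i c)) = F.lincomb {..<a i} \<alpha> (s i)"
    if "i \<in> {1..p}" "\<alpha> \<in> {..<a i} \<rightarrow> carrier (ST P)" for i \<alpha>
    using that x s[OF that(1)] Z_sub[OF P] by (intro F.lincomb_cong) auto
  have basis: "is_basis_family (ST P) (VS P) ?J (chain_family ?\<theta> x)"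
  proof (rule C.chains_basis)
    show "(?\<theta> ^^ p) y = \<zero>\<^bsub>VS P\<^esub>" if "y \<in> carrier (VS P)" for y by (rule th_nilpotent[OF f that])
    fix i assume i: "i \<in> {1..p}"
    show "\<exists>\<alpha>\<in>{..<a i} \<rightarrow> carrier (ST P). \<exists>z\<in>C.ker_im i.
      y = F.lincomb {..<a i} \<alpha> (\<lambda>c. (?\<theta> ^^ (i - 1)) (x i c)) \<oplus>\<^bsub>VS P\<^esub> z" if "y \<in> C.ker_im (i - 1)" for y
      using s[OF i] that lc[OF i] unfolding kZ by metis
    show "\<alpha> c = \<zero>\<^bsub>ST P\<^esub>" if "\<alpha> \<in> {..<a i} \<rightarrow> carrier (ST P)" "c < a i"
      "F.lincomb {..<a i} \<alpha> (\<lambda>c. (?\<theta> ^^ (i - 1)) (x i c)) \<in> C.ker_im i" for \<alpha> c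
      using s[OF i] that lc[OF i] unfolding kZ by metis
  qed
  have vB: "chain_family ?\<theta> x \<in> ?J \<rightarrow> (B \<rightarrow>\<^sub>E carrier (ST P))"
    using F.is_basis_familyD(1)[OF basis finite_jordan_index] by (simp add: free_module_simps)
  interpret G: plain_module "RF P" "free_module (RF P) B" by (rule r.S.free_module_plain_module)
  let ?y = "\<lambda>i c. r.vmap B (x i c)"
  have xB: "x i c \<in> B \<rightarrow>\<^sub>E carrier (ST P)" if "i \<in> {1..p}" "c < a i" for i c
    using x(1)[OF that] by (simp add: free_module_simps)
  have pow: "(local_op R D B d RA P ^^ n) (?y i c) = r.vmap B ((?\<theta> ^^ n) (x i c))" if "i \<in> {1..p}" "c < a i" for n i c
    unfolding op vmap_th[OF f x(1)[OF that]] ..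
  show ?thesis unfolding has_jordan_type_iff
  proof (intro exI[of _ ?y] conjI ballI allI impI)
    fix i c assume ic: "i \<in> {1..p}" "c < a i"
    show "?y i c \<in> carrier (free_module (RF P) B)"
      using r.vmap_closed[OF xB[OF ic]] by (simp add: free_module_simps)
    show "(local_op R D B d RA P ^^ i) (?y i c) = \<zero>\<^bsub>free_module (RF P) B\<^esub>"
    proof -
      have "(local_op R D B d RA P ^^ i) (?y i c) = r.vmap B ((?\<theta> ^^ i) (x i c))" by (rule pow[OF ic])
      also have "\<dots> = \<zero>\<^bsub>free_module (RF P) B\<^esub>"
        unfolding end0[OF ic] by (auto simp: r.vmap_def free_module_simps intro!: restrict_eqI)
      finally show ?thesis .
    qed
  next
    show "is_basis_family (RF P) (free_module (RF P) B) ?J (chain_family (local_op R D B d RA P) ?y)"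
    proof (rule G.is_basis_family_reindex[OF finite_jordan_index bij_betw_id
          r.basis_map[OF basis vB fB finite_jordan_index]])
      fix z assume "z \<in> ?J"
      then show "chain_family (local_op R D B d RA P) ?y z = r.vmap B (chain_family ?\<theta> x (id z))"
        using pow by (auto simp: chain_family_def jordan_index_def)
    qed
  qed
qed

end

section \<open>From constant Jordan type to free quotients\<close>

lemma (in cring) dual_matrix_cong:
  assumes g: "dual_matrix R B I v g" and eq: "\<And>b i. b \<in> B \<Longrightarrow> i \<in> I \<Longrightarrow> g' b i = g b i"
    and v: "\<And>i b. i \<in> I \<Longrightarrow> b \<in> B \<Longrightarrow> v i b \<in> carrier R"
  shows "dual_matrix R B I v g'"
proof -
  have gc: "g b i \<in> carrier R" if "b \<in> B" "i \<in> I" for b i using g that by (simp add: dual_matrix_def)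
  have "(\<Oplus>i\<in>I. g' b i \<otimes> v i b') = (\<Oplus>i\<in>I. g b i \<otimes> v i b')" if "b \<in> B" "b' \<in> B" for b b'
    using that gc v eq by (intro finsum_cong') auto
  moreover have "(\<Oplus>b\<in>B. v i b \<otimes> g' b i') = (\<Oplus>b\<in>B. v i b \<otimes> g b i')" if "i \<in> I" "i' \<in> I" for i i'
    using that gc v eq by (intro finsum_cong') auto
  ultimately show ?thesis using g gc eq by (simp add: dual_matrix_def)
qed

context homogeneous_matrix begin

lemma sec_product_sum:
  assumes "finite I" "P \<in> PR" "\<And>i. i \<in> I \<Longrightarrow> sec 0 P (s i)" "\<And>i. i \<in> I \<Longrightarrow> sec 0 P (t i)"
  shows "sec 0 P (\<lambda>Q. \<Oplus>\<^bsub>LOC Q\<^esub>i\<in>I. s i Q \<otimes>\<^bsub>LOC Q\<^esub> t i Q)"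
proof (rule sec_finsum[OF assms(1,2) _ sec_zero[OF assms(2)]])
  fix i assume i: "i \<in> I"
  from sec_mult[OF assms(3)[OF i] assms(4)[OF i]] show "sec 0 P (\<lambda>Q. s i Q \<otimes>\<^bsub>LOC Q\<^esub> t i Q)" by simp
qed

lemma ST_product_sum:
  assumes "Q \<in> PR" "\<And>i. i \<in> I \<Longrightarrow> s i \<in> loc_deg R D Q 0" "\<And>i. i \<in> I \<Longrightarrow> t i \<in> loc_deg R D Q 0"
  shows "(\<Oplus>\<^bsub>ST Q\<^esub>i\<in>I. s i \<otimes>\<^bsub>ST Q\<^esub> t i) = (\<Oplus>\<^bsub>LOC Q\<^esub>i\<in>I. s i \<otimes>\<^bsub>LOC Q\<^esub> t i)"
  unfolding ST_simps(2)
proof (rule finsum_ST[OF assms(1)], rule Pi_I)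
  fix i assume i: "i \<in> I"
  from loc_deg_mult[OF assms(1) assms(2)[OF i] assms(3)[OF i]]
  show "s i \<otimes>\<^bsub>LOC Q\<^esub> t i \<in> loc_deg R D Q 0" by simp
qed

lemma dual_matrix_LOC:
  assumes Q: "Q \<in> PR" and v: "\<And>i b. i \<in> I \<Longrightarrow> b \<in> B \<Longrightarrow> v i b \<in> loc_deg R D Q 0"
    and g: "\<And>i b. i \<in> I \<Longrightarrow> b \<in> B \<Longrightarrow> g b i \<in> loc_deg R D Q 0"
  shows "dual_matrix (ST Q) B I v g \<longleftrightarrow>
    (\<forall>b\<in>B. \<forall>b'\<in>B. (\<Oplus>\<^bsub>LOC Q\<^esub> i\<in>I. g b i \<otimes>\<^bsub>LOC Q\<^esub> v i b') = (if b = b' then \<one>\<^bsub>LOC Q\<^esub> else \<zero>\<^bsub>LOC Q\<^esub>)) \<and>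
    (\<forall>i\<in>I. \<forall>i'\<in>I. (\<Oplus>\<^bsub>LOC Q\<^esub> b\<in>B. v i b \<otimes>\<^bsub>LOC Q\<^esub> g b i') = (if i = i' then \<one>\<^bsub>LOC Q\<^esub> else \<zero>\<^bsub>LOC Q\<^esub>))"
proof -
  have 1: "(\<Oplus>\<^bsub>ST Q\<^esub> i\<in>I. g b i \<otimes>\<^bsub>ST Q\<^esub> v i b') = (\<Oplus>\<^bsub>LOC Q\<^esub> i\<in>I. g b i \<otimes>\<^bsub>LOC Q\<^esub> v i b')"
    if "b \<in> B" "b' \<in> B" for b b' using that v g by (intro ST_product_sum Q)
  have 2: "(\<Oplus>\<^bsub>ST Q\<^esub> b\<in>B. v i b \<otimes>\<^bsub>ST Q\<^esub> g b i') = (\<Oplus>\<^bsub>LOC Q\<^esub> b\<in>B. v i b \<otimes>\<^bsub>LOC Q\<^esub> g b i')"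
    if "i \<in> I" "i' \<in> I" for i i' using that v g by (intro ST_product_sum Q)
  have 3: "(\<forall>b\<in>B. \<forall>i\<in>I. g b i \<in> carrier (ST Q)) \<longleftrightarrow> True" using g by (simp add: ST_simps)
  show ?thesis unfolding dual_matrix_def 3 using 1 2 by (simp add: ST_simps(4,5) cong: ball_cong)
qed

text \<open>A family of sections that is a basis at a point is a basis nearby, since its inverse matrix extends.\<close>

lemma basis_near:
  assumes P: "P \<in> PR" and I: "finite I" and v: "\<And>i. i \<in> I \<Longrightarrow> vsec 0 B P (v i)"
    and b: "is_basis_family (ST P) (VS P) I (\<lambda>i. v i P)"
  shows "\<exists>g. (\<forall>b\<in>B. \<forall>i\<in>I. sec 0 P (g b i)) \<and>
    near P (\<lambda>Q. dual_matrix (ST Q) B I (\<lambda>i. v i Q) (\<lambda>b i. g b i Q))"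
proof -
  interpret S: cring "ST P" using P by (rule ST_cring)
  obtain g0 where g0: "dual_matrix (ST P) B I (\<lambda>i. v i P) g0" using S.basis_dual_matrix[OF I fB b] by blast
  define g where "g = (\<lambda>b i. SOME s. sec 0 P s \<and> s P = g0 b i)"
  have g': "sec 0 P (g b i) \<and> g b i P = g0 b i" if "b \<in> B" "i \<in> I" for b i
  proof -
    have "g0 b i \<in> loc_deg R D P 0" using g0 that unfolding dual_matrix_def ST_simps by blast
    from someI_ex[OF sec_germ[OF P this]] show ?thesis unfolding g_def .
  qed
  have g: "sec 0 P (g b i)" "g b i P = g0 b i" if "b \<in> B" "i \<in> I" for b i
    using g'[OF that] by (rule conjunct1, rule conjunct2)
  have vs: "sec 0 P (\<lambda>Q. v i Q b)" if "i \<in> I" "b \<in> B" for i b using v[OF that(1)] that(2) unfolding vsec_def by blast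
  have "near P (\<lambda>Q. \<forall>b\<in>B. \<forall>i\<in>I. v i Q b \<in> loc_deg R D Q 0)"
    by (intro near_ball fB I P sec_near_mem[OF vs])
  moreover have "near P (\<lambda>Q. \<forall>b\<in>B. \<forall>i\<in>I. g b i Q \<in> loc_deg R D Q 0)"
    by (intro near_ball fB I P sec_near_mem[OF g(1)])
  ultimately have mem: "near P (\<lambda>Q. (\<forall>b\<in>B. \<forall>i\<in>I. v i Q b \<in> loc_deg R D Q 0) \<and> (\<forall>b\<in>B. \<forall>i\<in>I. g b i Q \<in> loc_deg R D Q 0))"
    by (rule near_conj)
  have delta: "sec 0 P (\<lambda>Q. if c then \<one>\<^bsub>LOC Q\<^esub> else \<zero>\<^bsub>LOC Q\<^esub>)" for c
    using sec_one[OF P] sec_zero[OF P] by (cases c) simp_all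
  have dP: "dual_matrix (ST P) B I (\<lambda>i. v i P) (\<lambda>b i. g b i P)"
    by (rule S.dual_matrix_cong[OF g0 g(2)]) (use sec_mem[OF vs] in \<open>simp_all add: ST_simps\<close>)
  have dP': "(\<forall>b\<in>B. \<forall>b'\<in>B. (\<Oplus>\<^bsub>LOC P\<^esub> i\<in>I. g b i P \<otimes>\<^bsub>LOC P\<^esub> v i P b') = (if b = b' then \<one>\<^bsub>LOC P\<^esub> else \<zero>\<^bsub>LOC P\<^esub>)) \<and>
    (\<forall>i\<in>I. \<forall>i'\<in>I. (\<Oplus>\<^bsub>LOC P\<^esub> b\<in>B. v i P b \<otimes>\<^bsub>LOC P\<^esub> g b i' P) = (if i = i' then \<one>\<^bsub>LOC P\<^esub> else \<zero>\<^bsub>LOC P\<^esub>))"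
    by (rule iffD1[OF dual_matrix_LOC[OF P] dP]) (rule sec_mem[OF vs] sec_mem[OF g(1)]; assumption)+
  have 1: "near P (\<lambda>Q. \<forall>b\<in>B. \<forall>b'\<in>B. (\<Oplus>\<^bsub>LOC Q\<^esub> i\<in>I. g b i Q \<otimes>\<^bsub>LOC Q\<^esub> v i Q b') = (if b = b' then \<one>\<^bsub>LOC Q\<^esub> else \<zero>\<^bsub>LOC Q\<^esub>))"
  proof (intro near_ball fB P)
    fix b b' assume b: "b \<in> B" "b' \<in> B"
    show "near P (\<lambda>Q. (\<Oplus>\<^bsub>LOC Q\<^esub> i\<in>I. g b i Q \<otimes>\<^bsub>LOC Q\<^esub> v i Q b') = (if b = b' then \<one>\<^bsub>LOC Q\<^esub> else \<zero>\<^bsub>LOC Q\<^esub>))"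
    proof (rule sec_eq[OF sec_product_sum[OF I P] delta])
      show "sec 0 P (g b i)" if "i \<in> I" for i by (rule g(1)[OF b(1) that])
      show "sec 0 P (\<lambda>Q. v i Q b')" if "i \<in> I" for i by (rule vs[OF that b(2)])
      show "(\<Oplus>\<^bsub>LOC P\<^esub>i\<in>I. g b i P \<otimes>\<^bsub>LOC P\<^esub> v i P b') = (if b = b' then \<one>\<^bsub>LOC P\<^esub> else \<zero>\<^bsub>LOC P\<^esub>)"
        using dP' b by blast
    qed
  qed
  have 2: "near P (\<lambda>Q. \<forall>i\<in>I. \<forall>i'\<in>I. (\<Oplus>\<^bsub>LOC Q\<^esub> b\<in>B. v i Q b \<otimes>\<^bsub>LOC Q\<^esub> g b i' Q) = (if i = i' then \<one>\<^bsub>LOC Q\<^esub> else \<zero>\<^bsub>LOC Q\<^esub>))"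
  proof (intro near_ball I P)
    fix i i' assume i: "i \<in> I" "i' \<in> I"
    show "near P (\<lambda>Q. (\<Oplus>\<^bsub>LOC Q\<^esub> b\<in>B. v i Q b \<otimes>\<^bsub>LOC Q\<^esub> g b i' Q) = (if i = i' then \<one>\<^bsub>LOC Q\<^esub> else \<zero>\<^bsub>LOC Q\<^esub>))"
    proof (rule sec_eq[OF sec_product_sum[OF fB P] delta])
      show "sec 0 P (\<lambda>Q. v i Q b)" if "b \<in> B" for b by (rule vs[OF i(1) that])
      show "sec 0 P (g b i')" if "b \<in> B" for b by (rule g(1)[OF that i(2)])
      show "(\<Oplus>\<^bsub>LOC P\<^esub>b\<in>B. v i P b \<otimes>\<^bsub>LOC P\<^esub> g b i' P) = (if i = i' then \<one>\<^bsub>LOC P\<^esub> else \<zero>\<^bsub>LOC P\<^esub>)"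
        using dP' i by blast
    qed
  qed
  have "near P (\<lambda>Q. dual_matrix (ST Q) B I (\<lambda>i. v i Q) (\<lambda>b i. g b i Q))"
  proof (rule near_mono2[OF near_conj[OF 1 2] mem])
    fix Q assume Q: "Q \<in> PR"
      "(\<forall>b\<in>B. \<forall>b'\<in>B. (\<Oplus>\<^bsub>LOC Q\<^esub> i\<in>I. g b i Q \<otimes>\<^bsub>LOC Q\<^esub> v i Q b') = (if b = b' then \<one>\<^bsub>LOC Q\<^esub> else \<zero>\<^bsub>LOC Q\<^esub>)) \<and>
       (\<forall>i\<in>I. \<forall>i'\<in>I. (\<Oplus>\<^bsub>LOC Q\<^esub> b\<in>B. v i Q b \<otimes>\<^bsub>LOC Q\<^esub> g b i' Q) = (if i = i' then \<one>\<^bsub>LOC Q\<^esub> else \<zero>\<^bsub>LOC Q\<^esub>))"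
      "(\<forall>b\<in>B. \<forall>i\<in>I. v i Q b \<in> loc_deg R D Q 0) \<and> (\<forall>b\<in>B. \<forall>i\<in>I. g b i Q \<in> loc_deg R D Q 0)"
    show "dual_matrix (ST Q) B I (\<lambda>i. v i Q) (\<lambda>b i. g b i Q)"
      using Q(2) by (subst dual_matrix_LOC[OF Q(1)]) (use Q(3) in blast)+
  qed
  then show ?thesis using g(1) by blast
qed

text \<open>Another choice of the trivialising element changes the operator by a unit, hence not its images.\<close>

lemma op_image:
  assumes f: "unit_at f Q" and f': "unit_at f' Q" and w: "w \<in> carrier (free_module (RF Q) B)"
  shows "(mat_op (RF Q) B (\<lambda>b b'. rho Q (fr Q (A b b') f)) ^^ m) w
    \<in> (mat_op (RF Q) B (\<lambda>b b'. rho Q (fr Q (A b b') f')) ^^ m) ` carrier (free_module (RF Q) B)"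
proof -
  have Q: "Q \<in> PR" using unit_at_PR[OF f] .
  interpret r: local_reduction "ST Q" "RF Q" "rho Q" by (rule local_reduction_ST[OF Q])
  interpret G: plain_module "RF Q" "free_module (RF Q) B" by (rule r.S.free_module_plain_module)
  let ?t = "mat_op (RF Q) B (\<lambda>b b'. rho Q (fr Q (A b b') f))"
  let ?t' = "mat_op (RF Q) B (\<lambda>b b'. rho Q (fr Q (A b b') f'))"
  have ent: "rho Q (fr Q (A b b') h) \<in> carrier (RF Q)" if "unit_at h Q" "b \<in> B" "b' \<in> B" for b b' h
    using entry_closed[OF that] by (intro r.hom_closed) (simp add: ST_simps)
  have lin': "G.linear_op ?t'" using fB ent[OF f'] by (intro r.S.mat_op_linear) auto
  let ?c = "rho Q (fr Q f' f)"
  have cD: "fr Q f' f \<in> carrier (ST Q)" unfolding ST_simps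
    using f f' by (intro fr_in_loc_deg) (auto simp: unit_at_def hfr_def)
  then have c: "?c \<in> carrier (RF Q)" by (rule r.hom_closed)
  have step: "?t x = ?t' (?c \<odot>\<^bsub>free_module (RF Q) B\<^esub> x)" if x: "x \<in> carrier (free_module (RF Q) B)" for x
    unfolding mat_op_def free_module_simps
  proof (rule restrict_eqI, rule r.S.finsum_cong')
    fix b b' assume b: "b \<in> B" "b' \<in> B"
    have xb: "x b' \<in> carrier (RF Q)" using x b by (auto simp: free_module_simps PiE_iff)
    have "fr Q (A b b') f = fr Q (A b b') f' \<otimes>\<^bsub>ST Q\<^esub> fr Q f' f"
      using Q unit_at_away[OF f] unit_at_away[OF f'] unfolding ST_simps
      by (simp add: fr_mult) (rule fr_eqI, auto)
    then have "rho Q (fr Q (A b b') f) = rho Q (fr Q (A b b') f') \<otimes>\<^bsub>RF Q\<^esub> ?c"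
      using entry_closed[OF f' b] cD by (simp add: ST_simps(1))
    then show "rho Q (fr Q (A b b') f) \<otimes>\<^bsub>RF Q\<^esub> x b' = rho Q (fr Q (A b b') f') \<otimes>\<^bsub>RF Q\<^esub> (\<lambda>b\<in>B. ?c \<otimes>\<^bsub>RF Q\<^esub> x b) b'"
      using b xb c ent[OF f' b] by (simp add: r.S.m_assoc)
  qed (use x c ent[OF f'] in \<open>auto simp: free_module_simps PiE_iff\<close>)
  show ?thesis
  proof (induction m)
    case 0
    show ?case using w by simp
  next
    case (Suc m)
    then obtain u where u: "u \<in> carrier (free_module (RF Q) B)" "(?t ^^ m) w = (?t' ^^ m) u" by (rule imageE) 
    have pu: "(?t' ^^ m) u \<in> carrier (free_module (RF Q) B)"
      by (rule G.linear_op_closed[OF G.linear_op_funpow[OF lin'] u(1)])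
    have "(?t ^^ Suc m) w = ?t' (?c \<odot>\<^bsub>free_module (RF Q) B\<^esub> (?t' ^^ m) u)" using u(2) step[OF pu] by simp
    also have "?c \<odot>\<^bsub>free_module (RF Q) B\<^esub> (?t' ^^ m) u = (?t' ^^ m) (?c \<odot>\<^bsub>free_module (RF Q) B\<^esub> u)"
      using G.linear_op_funpow[OF lin', of m] c u(1) by (simp add: G.linear_op_def)
    finally have "(?t ^^ Suc m) w = (?t' ^^ Suc m) (?c \<odot>\<^bsub>free_module (RF Q) B\<^esub> u)" by simp
    then show ?case using G.smult_closed[OF c u(1)] by (rule image_eqI)
  qed
qed

context
  fixes a :: "nat \<Rightarrow> nat"
begin

abbreviation "J \<equiv> jordan_index p a"

definition jt_at :: "'a set \<Rightarrow> bool" where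
  "jt_at Q \<longleftrightarrow> has_jordan_type (RF Q) (free_module (RF Q) B) (local_op R D B d RA Q) p a"

text \<open>
  At a point of Jordan type \<open>a\<close> the image of \<open>\<theta>\<^sup>m\<close> over the residue field has the dimension that \<open>a\<close>
  prescribes, which by \<open>chain_coords_vanish\<close> leaves no room for the first \<open>m\<close> members of the chains.
\<close>

lemma coords_in_mx:
  assumes f: "unit_at f Q" and jt: "jt_at Q"
    and x: "\<And>i c. i \<in> {1..p} \<Longrightarrow> c < a i \<Longrightarrow> x i c \<in> carrier (VS Q)"
    and g: "dual_matrix (ST Q) B J (chain_family (th f Q) x) g"
    and w: "w \<in> carrier (VS Q)" and z: "(i, k, j) \<in> J" "j < m"
  shows "(\<Oplus>\<^bsub>ST Q\<^esub>b\<in>B. (th f Q ^^ m) w b \<otimes>\<^bsub>ST Q\<^esub> g b (i, k, j)) \<in> mx Q"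
proof -
  have Q: "Q \<in> PR" using unit_at_PR[OF f] .
  interpret r: local_reduction "ST Q" "RF Q" "rho Q" by (rule local_reduction_ST[OF Q])
  interpret F: plain_module "ST Q" "VS Q" using Q by (rule VS_plain)
  interpret G: plain_module "RF Q" "free_module (RF Q) B" by (rule r.S.free_module_plain_module)
  let ?v = "chain_family (th f Q) x"
  let ?op = "mat_op (RF Q) B (\<lambda>b b'. rho Q (fr Q (A b b') f))"
  let ?y = "\<lambda>i c. r.vmap B (x i c)"
  note fJ = finite_jordan_index[of p a]
  have vVS: "?v z \<in> carrier (VS Q)" if "z \<in> J" for z
    using that x th_pow_closed[OF f] by (auto simp: chain_family_def jordan_index_def)
  then have vB: "?v \<in> J \<rightarrow> (B \<rightarrow>\<^sub>E carrier (ST Q))" by (intro Pi_I) (simp add: free_module_simps)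
  have basis: "is_basis_family (ST Q) (VS Q) J ?v" by (rule r.R.dual_matrix_basis[OF fJ fB vB g])
  have red: "r.vmap B (?v z) = chain_family ?op ?y z" if "z \<in> J" for z
    using that vmap_th[OF f x] by (auto simp: chain_family_def jordan_index_def)
  have rbasis: "is_basis_family (RF Q) (free_module (RF Q) B) J (chain_family ?op ?y)"
    by (rule G.is_basis_family_reindex[OF fJ bij_betw_id r.basis_map[OF basis vB fB fJ]]) (simp add: red)
  obtain f' where f': "unit_at f' Q" and lop: "local_op R D B d RA Q = mat_op (RF Q) B (\<lambda>b b'. rho Q (fr Q (A b b') f'))"
    using local_op_eq[OF Q] by blast
  let ?op' = "mat_op (RF Q) B (\<lambda>b b'. rho Q (fr Q (A b b') f'))"
  have ent: "rho Q (fr Q (A b b') h) \<in> carrier (RF Q)" if "unit_at h Q" "b \<in> B" "b' \<in> B" for b b' h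
    using entry_closed[OF that] by (intro r.hom_closed) (simp add: ST_simps)
  have lin: "G.linear_op ?op" "G.linear_op ?op'" using fB ent[OF f] ent[OF f'] by (auto intro!: r.S.mat_op_linear)
  obtain \<xi> where \<xi>: "\<forall>i\<in>{1..p}. \<forall>c<a i. \<xi> i c \<in> carrier (free_module (RF Q) B) \<and> (?op' ^^ i) (\<xi> i c) = \<zero>\<^bsub>free_module (RF Q) B\<^esub>"
    "is_basis_family (RF Q) (free_module (RF Q) B) J (chain_family ?op' \<xi>)"
    using jt unfolding jt_at_def has_jordan_type_iff lop by blast
  have ch: "chains (RF Q) (free_module (RF Q) B) ?op' p a \<xi>"
    by unfold_locales (use lin(2) \<xi>(1) in auto)
  let ?W = "(th f Q ^^ m) w"
  let ?\<beta> = "\<lambda>z. \<Oplus>\<^bsub>ST Q\<^esub>b\<in>B. ?W b \<otimes>\<^bsub>ST Q\<^esub> g b z"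
  have W: "?W \<in> B \<rightarrow>\<^sub>E carrier (ST Q)" using th_pow_closed[OF f w] by (simp add: free_module_simps)
  have \<beta>: "?\<beta> z \<in> carrier (ST Q)" if "z \<in> J" for z
    using W g that unfolding dual_matrix_def by (intro r.R.finsum_closed) (auto simp: PiE_iff)
  have "?W = F.lincomb J ?\<beta> ?v" using r.R.dual_matrix_expand[OF fJ fB vB g W] by simp
  then have "r.vmap B ?W = G.lincomb J (\<lambda>z. rho Q (?\<beta> z)) (\<lambda>z. r.vmap B (?v z))"
    using r.vmap_lincomb[OF fJ _ vB, of ?\<beta>] \<beta> by simp
  also have "\<dots> = G.lincomb J (\<lambda>z. rho Q (?\<beta> z)) (chain_family ?op ?y)"
    using red G.is_basis_familyD(1)[OF rbasis fJ] \<beta> by (intro G.lincomb_cong) auto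
  finally have eq: "(?op ^^ m) (r.vmap B w) = G.lincomb J (\<lambda>z. rho Q (?\<beta> z)) (chain_family ?op ?y)"
    using vmap_th[OF f w] by simp
  have vw: "r.vmap B w \<in> carrier (free_module (RF Q) B)"
    using r.vmap_closed[of w B] w by (simp add: free_module_simps)
  have "rho Q (?\<beta> (i, k, j)) = \<zero>\<^bsub>RF Q\<^esub>"
    by (rule G.chain_coords_vanish[OF r.S_field lin(1) op_image[OF f f'] ch \<xi>(2) rbasis vw _ eq z])
      (use \<beta> in auto)
  then show ?thesis using rho_zero_iff[OF Q \<beta>[OF z(1)]] by simp
qed

lemma vsec_chain:
  assumes f: "unit_at f P" and x: "\<And>i c. i \<in> {1..p} \<Longrightarrow> c < a i \<Longrightarrow> vsec 0 B P (x i c)" and z: "z \<in> J"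
  shows "vsec 0 B P (\<lambda>Q. chain_family (th f Q) (\<lambda>i c. x i c Q) z)"
proof -
  obtain i c j where ij: "z = (i, c, j)" "i \<in> {1..p}" "c < a i" using z by (cases z) (auto simp: jordan_index_def)
  show ?thesis unfolding chain_family_def ij(1) prod.case by (rule vsec_th_pow[OF x[OF ij(2,3)] f])
qed

lemma near_pairs:
  assumes "P \<in> PR" "\<And>i c. i \<in> {1..p} \<Longrightarrow> c < a i \<Longrightarrow> near P (\<lambda>Q. \<Phi> Q i c)"
  shows "near P (\<lambda>Q. \<forall>i\<in>{1..p}. \<forall>c\<in>{..<a i}. \<Phi> Q i c)"
proof (rule near_ball[OF _ assms(1)])
  fix i assume i: "i \<in> {1..p}"
  show "near P (\<lambda>Q. \<forall>c\<in>{..<a i}. \<Phi> Q i c)"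
    by (rule near_ball[OF _ assms(1)]) (use assms(2)[OF i] in simp_all)
qed simp

text \<open>Since the ring is reduced, the coordinates that lie in every nearby maximal ideal vanish.\<close>

lemma rank_condition:
  assumes f: "unit_at f P" and jt: "near P jt_at"
    and x: "\<And>i c. i \<in> {1..p} \<Longrightarrow> c < a i \<Longrightarrow> vsec 0 B P (x i c)"
    and b: "is_basis_family (ST P) (VS P) J (chain_family (th f P) (\<lambda>i c. x i c P))"
    and w: "w \<in> carrier (VS P)" and e: "e \<in> J \<rightarrow> carrier (ST P)"
    and eq: "(th f P ^^ m) w = plain_module.lincomb (VS P) J e (chain_family (th f P) (\<lambda>i c. x i c P))"
    and z: "(i, k, j) \<in> J" "j < m"
  shows "e (i, k, j) = \<zero>\<^bsub>ST P\<^esub>"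
proof -
  have P: "P \<in> PR" using unit_at_PR[OF f] .
  interpret S: cring "ST P" using P by (rule ST_cring)
  interpret F: plain_module "ST P" "VS P" using P by (rule VS_plain)
  let ?v = "\<lambda>Q. chain_family (th f Q) (\<lambda>i c. x i c Q)"
  note fJ = finite_jordan_index[of p a]
  have vs: "vsec 0 B P (\<lambda>Q. ?v Q z)" if "z \<in> J" for z by (rule vsec_chain[OF f x that])
  obtain g where g: "\<forall>b\<in>B. \<forall>z\<in>J. sec 0 P (g b z)"
    "near P (\<lambda>Q. dual_matrix (ST Q) B J (\<lambda>z. ?v Q z) (\<lambda>b z. g b z Q))"
    using basis_near[OF P fJ vs b] by blast
  obtain ws where ws: "vsec 0 B P ws" "ws P = w" using vsec_germ[OF P] w unfolding VS_carrier by blast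
  let ?z = "(i, k, j)"
  let ?\<beta> = "\<lambda>Q. \<Oplus>\<^bsub>LOC Q\<^esub>b\<in>B. (th f Q ^^ m) (ws Q) b \<otimes>\<^bsub>LOC Q\<^esub> g b ?z Q"
  have ts: "vsec 0 B P (\<lambda>Q. (th f Q ^^ m) (ws Q))" by (rule vsec_th_pow[OF ws(1) f])
  have ts': "sec 0 P (\<lambda>Q. (th f Q ^^ m) (ws Q) b)" if "b \<in> B" for b using ts that unfolding vsec_def by blast
  have gs: "sec 0 P (g b ?z)" if "b \<in> B" for b using g(1) that z(1) by blast
  have \<beta>s: "sec 0 P ?\<beta>" by (rule sec_product_sum[OF fB P ts' gs])
  have gm: "near P (\<lambda>Q. \<forall>b\<in>B. g b ?z Q \<in> loc_deg R D Q 0)" by (intro near_ball fB P sec_near_mem[OF gs])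
  have xm: "near P (\<lambda>Q. \<forall>i\<in>{1..p}. \<forall>c\<in>{..<a i}. x i c Q \<in> carrier (VS Q))"
    by (rule near_pairs[OF P near_VS[OF x]])
  have "near P (\<lambda>Q. ?\<beta> Q \<in> mx Q)"
  proof (rule near_mono2[OF near_conj[OF near_conj[OF unit_at_near[OF f] jt] near_conj[OF g(2) near_VS[OF ws(1)]]] near_conj[OF gm xm]])
    fix Q assume Q: "Q \<in> PR"
      "(unit_at f Q \<and> jt_at Q) \<and> dual_matrix (ST Q) B J (\<lambda>z. ?v Q z) (\<lambda>b z. g b z Q) \<and> ws Q \<in> carrier (VS Q)"
      "(\<forall>b\<in>B. g b ?z Q \<in> loc_deg R D Q 0) \<and> (\<forall>i\<in>{1..p}. \<forall>c\<in>{..<a i}. x i c Q \<in> carrier (VS Q))"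
    then have fQ: "unit_at f Q" and wQ: "ws Q \<in> carrier (VS Q)" by auto
    have "(\<Oplus>\<^bsub>ST Q\<^esub>b\<in>B. (th f Q ^^ m) (ws Q) b \<otimes>\<^bsub>ST Q\<^esub> g b ?z Q) \<in> mx Q"
      by (rule coords_in_mx[OF fQ, where x = "\<lambda>i c. x i c Q", OF _ _ _ wQ z]) (use Q in auto)
    moreover have "(\<Oplus>\<^bsub>ST Q\<^esub>b\<in>B. (th f Q ^^ m) (ws Q) b \<otimes>\<^bsub>ST Q\<^esub> g b ?z Q) = ?\<beta> Q"
      using Q(1,3) th_pow_closed[OF fQ wQ, of m] by (intro ST_product_sum) (auto simp: VS_carrier PiE_iff)
    ultimately show "?\<beta> Q \<in> mx Q" by simp
  qed
  then have 0: "?\<beta> P = \<zero>\<^bsub>LOC P\<^esub>" by (rule sec_reduced[OF \<beta>s])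
  have vB: "(\<lambda>z. ?v P z) \<in> J \<rightarrow> (B \<rightarrow>\<^sub>E carrier (ST P))"
    using F.is_basis_familyD(1)[OF b fJ] by (simp add: free_module_simps)
  have "e ?z = (\<Oplus>\<^bsub>ST P\<^esub>b\<in>B. F.lincomb J e (\<lambda>z. ?v P z) b \<otimes>\<^bsub>ST P\<^esub> g b ?z P)"
    by (rule S.dual_matrix_coords[OF fJ fB vB near_at[OF g(2)] e z(1), symmetric])
  also have "\<dots> = (\<Oplus>\<^bsub>ST P\<^esub>b\<in>B. (th f P ^^ m) w b \<otimes>\<^bsub>ST P\<^esub> g b ?z P)" using eq by simp
  also have "\<dots> = ?\<beta> P" unfolding ws(2)
    using th_pow_closed[OF f w, of m] near_at[OF gm] by (intro ST_product_sum P) (auto simp: VS_carrier PiE_iff)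
  finally show ?thesis using 0 by (simp add: ST_simps)
qed

text \<open>
  The sections \<open>x\<close> generate Jordan chains at \<open>Q\<close> for the operator \<open>\<Theta>/f\<close>, and the sections \<open>g\<close> are the
  inverse of the matrix that these chains form.
\<close>

definition good_chains :: "'p \<Rightarrow> (nat \<Rightarrow> nat \<Rightarrow> 'a set \<Rightarrow> 'i \<Rightarrow> ('a \<times> 'a) set) \<Rightarrow>
    ('i \<Rightarrow> nat \<times> nat \<times> nat \<Rightarrow> 'a set \<Rightarrow> ('a \<times> 'a) set) \<Rightarrow> 'a set \<Rightarrow> bool" where
  "good_chains f x g Q \<longleftrightarrow> unit_at f Q \<and>
    chains (ST Q) (VS Q) (th f Q) p a (\<lambda>i c. x i c Q) \<and>
    dual_matrix (ST Q) B J (chain_family (th f Q) (\<lambda>i c. x i c Q)) (\<lambda>b z. g b z Q) \<and>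
    (\<forall>i\<in>{1..p}. \<forall>c\<in>{..<a i}. vsec 0 B Q (x i c)) \<and> (\<forall>b\<in>B. \<forall>z\<in>J. sec 0 Q (g b z))"

text \<open>
  After lifting, correcting and extending, the vectors form Jordan chains on a neighbourhood.  Two
  extensions to sections are needed: that of the first lift is what allows \<open>rank_condition\<close> to compare the
  points near \<open>P\<close>, and that of the corrected lift provides the chains.
\<close>

lemma good_chains_near:
  assumes P: "P \<in> PR" and jt: "near P jt_at"
  shows "\<exists>f x g. near P (good_chains f x g)"
proof -
  obtain f where f: "unit_at f P" and lop: "local_op R D B d RA P = mat_op (RF P) B (\<lambda>b b'. rho P (fr P (A b b') f))"
    using local_op_eq[OF P] by blast
  interpret r: local_reduction "ST P" "RF P" "rho P" by (rule local_reduction_ST[OF P])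
  interpret F: plain_module "ST P" "VS P" using P by (rule VS_plain)
  interpret G: plain_module "RF P" "free_module (RF P) B" by (rule r.S.free_module_plain_module)
  note fJ = finite_jordan_index[of p a]
  let ?op = "mat_op (RF P) B (\<lambda>b b'. rho P (fr P (A b b') f))"
  have entS: "fr P (A b b') f \<in> carrier (ST P)" if "b \<in> B" "b' \<in> B" for b b'
    using entry_closed[OF f that] by (simp add: ST_simps)
  obtain \<xi> where \<xi>: "\<forall>i\<in>{1..p}. \<forall>c<a i. \<xi> i c \<in> carrier (free_module (RF P) B) \<and> (?op ^^ i) (\<xi> i c) = \<zero>\<^bsub>free_module (RF P) B\<^esub>"
    "is_basis_family (RF P) (free_module (RF P) B) J (chain_family ?op \<xi>)"
    using near_at[OF jt] unfolding jt_at_def has_jordan_type_iff lop by blast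
  define x0 where "x0 = (\<lambda>i c. \<lambda>b\<in>B. SOME s. s \<in> carrier (ST P) \<and> rho P s = \<xi> i c b)"
  have x0: "x0 i c \<in> B \<rightarrow>\<^sub>E carrier (ST P)" "r.vmap B (x0 i c) = \<xi> i c" if ic: "i \<in> {1..p}" "c < a i" for i c
  proof -
    have \<xi>c: "\<xi> i c \<in> B \<rightarrow>\<^sub>E carrier (RF P)" using \<xi>(1) ic by (simp add: free_module_simps)
    have e: "x0 i c b \<in> carrier (ST P) \<and> rho P (x0 i c b) = \<xi> i c b" if "b \<in> B" for b
    proof -
      have "\<xi> i c b \<in> carrier (RF P)" using \<xi>c that by blast
      then have "\<exists>s. s \<in> carrier (ST P) \<and> rho P s = \<xi> i c b" using r.surj by blast
      from someI_ex[OF this] show ?thesis using that by (simp add: x0_def)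
    qed
    show "x0 i c \<in> B \<rightarrow>\<^sub>E carrier (ST P)" using e by (auto simp: x0_def PiE_iff)
    show "r.vmap B (x0 i c) = \<xi> i c"
      unfolding r.vmap_def by (rule PiE_eq_restrictI[OF \<xi>c, symmetric]) (use e in simp)
  qed
  have x0V: "x0 i c \<in> carrier (VS P)" if "i \<in> {1..p}" "c < a i" for i c
    using x0(1)[OF that] by (simp add: free_module_simps)
  define xs where "xs = (\<lambda>i c. SOME s. vsec 0 B P s \<and> s P = x0 i c)"
  have xs: "vsec 0 B P (xs i c)" "xs i c P = x0 i c" if "i \<in> {1..p}" "c < a i" for i c
  proof -
    have "x0 i c \<in> B \<rightarrow>\<^sub>E loc_deg R D P 0" using x0V[OF that] by (simp add: VS_carrier)
    from someI_ex[OF vsec_germ[OF P this]] show "vsec 0 B P (xs i c)" "xs i c P = x0 i c" unfolding xs_def by blast+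
  qed
  have cf: "chain_family (th f P) (\<lambda>i c. xs i c P) z = chain_family (th f P) x0 z" if "z \<in> J" for z
    using that xs(2) by (auto simp: chain_family_def jordan_index_def)
  have redz: "r.vmap B (chain_family (th f P) x0 z) = chain_family ?op \<xi> z"
    "chain_family ?op (\<lambda>i c. r.vmap B (x0 i c)) z = chain_family ?op \<xi> z" if "z \<in> J" for z
    using that vmap_th[OF f x0V] x0(2) by (auto simp: chain_family_def jordan_index_def)
  have cB: "chain_family (th f P) x0 \<in> J \<rightarrow> (B \<rightarrow>\<^sub>E carrier (ST P))"
  proof
    fix z assume "z \<in> J"
    then have "chain_family (th f P) x0 z \<in> carrier (VS P)"
      using th_pow_closed[OF f x0V] by (auto simp: chain_family_def jordan_index_def)
    then show "chain_family (th f P) x0 z \<in> B \<rightarrow>\<^sub>E carrier (ST P)" by (simp add: free_module_simps)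
  qed
  have b0: "is_basis_family (ST P) (VS P) J (chain_family (th f P) x0)"
    by (rule r.lift_basis[OF fJ fB cB], rule G.is_basis_family_reindex[OF fJ bij_betw_id \<xi>(2)]) (simp add: redz)
  have bxs: "is_basis_family (ST P) (VS P) J (chain_family (th f P) (\<lambda>i c. xs i c P))"
    by (rule F.is_basis_family_reindex[OF fJ bij_betw_id b0]) (simp add: cf)
  have "\<exists>x'. chains (ST P) (VS P) (mat_op (ST P) B (\<lambda>b b'. fr P (A b b') f)) p a x' \<and>
    is_basis_family (ST P) (VS P) J (chain_family (mat_op (ST P) B (\<lambda>b b'. fr P (A b b') f)) x')"
  proof (rule r.lift_chains[OF fB entS x0(1)])
    show "is_basis_family (RF P) (free_module (RF P) B) J (chain_family ?op (\<lambda>i c. r.vmap B (x0 i c)))"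
      by (rule G.is_basis_family_reindex[OF fJ bij_betw_id \<xi>(2)]) (simp add: redz)
    show "(?op ^^ i) (r.vmap B (x0 i c)) = (\<lambda>b\<in>B. \<zero>\<^bsub>RF P\<^esub>)" if "i \<in> {1..p}" "c < a i" for i c
      using \<xi>(1) that x0(2)[OF that] by (simp add: free_module_simps)
    fix w e m i c j
    assume *: "w \<in> B \<rightarrow>\<^sub>E carrier (ST P)" "e \<in> J \<rightarrow> carrier (ST P)"
      "(mat_op (ST P) B (\<lambda>b b'. fr P (A b b') f) ^^ m) w = F.lincomb J e (chain_family (mat_op (ST P) B (\<lambda>b b'. fr P (A b b') f)) x0)"
      "(i, c, j) \<in> J" "j < m"
    have "F.lincomb J e (chain_family (th f P) x0) = F.lincomb J e (chain_family (th f P) (\<lambda>i c. xs i c P))"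
      using *(2) F.is_basis_familyD(1)[OF bxs fJ] by (intro F.lincomb_cong) (simp_all add: cf)
    then have "(th f P ^^ m) w = F.lincomb J e (chain_family (th f P) (\<lambda>i c. xs i c P))"
      using *(3) by (simp add: th_def)
    then show "e (i, c, j) = \<zero>\<^bsub>ST P\<^esub>"
      using *(1) by (intro rank_condition[OF f jt xs(1) bxs _ *(2) _ *(4,5)]) (simp_all add: free_module_simps)
  qed simp_all
  then obtain x1 where ch: "chains (ST P) (VS P) (th f P) p a x1"
    and b1: "is_basis_family (ST P) (VS P) J (chain_family (th f P) x1)" unfolding th_def by blast
  interpret C: chains "ST P" "VS P" "th f P" p a x1 by (rule ch)
  define x where "x = (\<lambda>i c. SOME s. vsec 0 B P s \<and> s P = x1 i c)"
  have x: "vsec 0 B P (x i c)" "x i c P = x1 i c" if "i \<in> {1..p}" "c < a i" for i c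
  proof -
    have "x1 i c \<in> B \<rightarrow>\<^sub>E loc_deg R D P 0" using C.x_closed[OF that] by (simp add: VS_carrier)
    from someI_ex[OF vsec_germ[OF P this]] show "vsec 0 B P (x i c)" "x i c P = x1 i c" unfolding x_def by blast+
  qed
  have bx: "is_basis_family (ST P) (VS P) J (\<lambda>z. chain_family (th f P) (\<lambda>i c. x i c P) z)"
    by (rule F.is_basis_family_reindex[OF fJ bij_betw_id b1])
      (use x(2) in \<open>auto simp: chain_family_def jordan_index_def\<close>)
  obtain g where g: "\<forall>b\<in>B. \<forall>z\<in>J. sec 0 P (g b z)"
    "near P (\<lambda>Q. dual_matrix (ST Q) B J (\<lambda>z. chain_family (th f Q) (\<lambda>i c. x i c Q) z) (\<lambda>b z. g b z Q))"
    using basis_near[OF P fJ vsec_chain[OF f x(1)] bx] by blast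
  have gs: "near P (\<lambda>Q. \<forall>b\<in>B. \<forall>z\<in>J. sec 0 Q (g b z))"
    by (intro near_ball fB fJ P sec_near) (use g(1) in blast)
  have xsn: "near P (\<lambda>Q. \<forall>i\<in>{1..p}. \<forall>c\<in>{..<a i}. vsec 0 B Q (x i c))"
    by (rule near_pairs[OF P vsec_near[OF fB x(1)]])
  have xe: "near P (\<lambda>Q. \<forall>i\<in>{1..p}. \<forall>c\<in>{..<a i}. (th f Q ^^ i) (x i c Q) = (\<lambda>b\<in>B. \<zero>\<^bsub>LOC Q\<^esub>))"
  proof (rule near_pairs[OF P])
    fix i c assume ic: "i \<in> {1..p}" "c < a i"
    show "near P (\<lambda>Q. (th f Q ^^ i) (x i c Q) = (\<lambda>b\<in>B. \<zero>\<^bsub>LOC Q\<^esub>))"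
      by (rule vsec_eq[OF fB vsec_th_pow[OF x(1)[OF ic] f] vsec_zero[OF P]])
        (simp add: x(2)[OF ic] C.chain_end[OF ic] zero_VS)
  qed
  have "near P (good_chains f x g)"
  proof (rule near_mono2[OF near_conj[OF near_conj[OF unit_at_near[OF f] g(2)] xe] near_conj[OF gs xsn]])
    fix Q assume Q: "Q \<in> PR"
      "(unit_at f Q \<and> dual_matrix (ST Q) B J (\<lambda>z. chain_family (th f Q) (\<lambda>i c. x i c Q) z) (\<lambda>b z. g b z Q)) \<and>
        (\<forall>i\<in>{1..p}. \<forall>c\<in>{..<a i}. (th f Q ^^ i) (x i c Q) = (\<lambda>b\<in>B. \<zero>\<^bsub>LOC Q\<^esub>))"
      "(\<forall>b\<in>B. \<forall>z\<in>J. sec 0 Q (g b z)) \<and> (\<forall>i\<in>{1..p}. \<forall>c\<in>{..<a i}. vsec 0 B Q (x i c))"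
    then have fQ: "unit_at f Q" by blast
    interpret H: plain_module "ST Q" "VS Q" using Q(1) by (rule VS_plain)
    have "chains (ST Q) (VS Q) (th f Q) p a (\<lambda>i c. x i c Q)"
      by unfold_locales (use th_linear[OF fQ] Q(2,3) vsec_VS in \<open>auto simp: zero_VS\<close>)
    then show "good_chains f x g Q" unfolding good_chains_def using Q fQ by blast
  qed
  then show ?thesis by blast
qed

end

lemma PiE_LOC: "y \<in> I \<rightarrow>\<^sub>E loc_deg R D Q n \<Longrightarrow> c \<in> I \<Longrightarrow> y c \<in> carrier (LOC Q)"
  by (rule subsetD[OF ST_sub]) (rule PiE_mem)

lemma VS_LOC: "y \<in> carrier (VS Q) \<Longrightarrow> b \<in> B \<Longrightarrow> y b \<in> carrier (LOC Q)"
  unfolding VS_carrier by (rule PiE_LOC)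

context
  fixes a :: "nat \<Rightarrow> nat"
begin

text \<open>
  For \<open>y\<close> in the kernel and in the image of \<open>\<theta>\<^bsup>i-1\<^esup>\<close> these coordinates determine its class in the stalk of \<open>\<F>\<^sub>i\<close>.
\<close>

definition end_coords :: "('i \<Rightarrow> nat \<times> nat \<times> nat \<Rightarrow> 'a set \<Rightarrow> ('a \<times> 'a) set) \<Rightarrow> nat \<Rightarrow> 'a set \<Rightarrow>
    ('i \<Rightarrow> ('a \<times> 'a) set) \<Rightarrow> nat \<Rightarrow> ('a \<times> 'a) set" where
  "end_coords g i Q y = (\<lambda>c\<in>{..<a i}. \<Oplus>\<^bsub>LOC Q\<^esub>b\<in>B. y b \<otimes>\<^bsub>LOC Q\<^esub> g b (i, c, i - 1) Q)"

definition end_comb :: "'p \<Rightarrow> (nat \<Rightarrow> nat \<Rightarrow> 'a set \<Rightarrow> 'i \<Rightarrow> ('a \<times> 'a) set) \<Rightarrow> nat \<Rightarrow> 'a set \<Rightarrow>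
    (nat \<Rightarrow> ('a \<times> 'a) set) \<Rightarrow> 'i \<Rightarrow> ('a \<times> 'a) set" where
  "end_comb f x i Q \<alpha> = plain_module.lincomb (VS Q) {..<a i} \<alpha> (\<lambda>c. (th f Q ^^ (i - 1)) (x i c Q))"

context
  fixes f x g Q i
  assumes good: "good_chains a f x g Q" and i: "i \<in> {1..p}"
begin

lemma good_facts:
  "unit_at f Q" "Q \<in> PR" "chains (ST Q) (VS Q) (th f Q) p a (\<lambda>i c. x i c Q)"
  "dual_matrix (ST Q) B (jordan_index p a) (chain_family (th f Q) (\<lambda>i c. x i c Q)) (\<lambda>b z. g b z Q)"
  "\<And>i c. i \<in> {1..p} \<Longrightarrow> c < a i \<Longrightarrow> vsec 0 B Q (x i c)"
  "\<And>b z. b \<in> B \<Longrightarrow> z \<in> jordan_index p a \<Longrightarrow> sec 0 Q (g b z)"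
  using good unit_at_PR unfolding good_chains_def by blast+

lemma top_index: "c < a i \<Longrightarrow> (i, c, i - 1) \<in> jordan_index p a"
  using i by (auto simp: jordan_index_def)

lemma coords_ST:
  assumes y: "y \<in> carrier (VS Q)" and z: "z \<in> jordan_index p a"
  shows "(\<Oplus>\<^bsub>LOC Q\<^esub>b\<in>B. y b \<otimes>\<^bsub>LOC Q\<^esub> g b z Q) = (\<Oplus>\<^bsub>ST Q\<^esub>b\<in>B. y b \<otimes>\<^bsub>ST Q\<^esub> g b z Q)"
  using y sec_mem[OF good_facts(6)[OF _ z]] good_facts(2)
  by (intro ST_product_sum[symmetric]) (auto simp: VS_carrier PiE_iff)

lemma coords_expand:
  assumes y: "y \<in> carrier (VS Q)"
  defines "w \<equiv> \<lambda>z. \<Oplus>\<^bsub>ST Q\<^esub>b\<in>B. y b \<otimes>\<^bsub>ST Q\<^esub> g b z Q"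
  shows "w \<in> jordan_index p a \<rightarrow> carrier (ST Q)"
    "y = plain_module.lincomb (VS Q) (jordan_index p a) w (chain_family (th f Q) (\<lambda>i c. x i c Q))"
proof -
  interpret S: cring "ST Q" using good_facts(2) by (rule ST_cring)
  interpret C: chains "ST Q" "VS Q" "th f Q" p a "\<lambda>i c. x i c Q" by (rule good_facts(3))
  have vB: "C.v \<in> jordan_index p a \<rightarrow> (B \<rightarrow>\<^sub>E carrier (ST Q))"
    using C.v_closed by (simp add: free_module_simps)
  have yB: "y \<in> B \<rightarrow>\<^sub>E carrier (ST Q)" using y by (simp add: free_module_simps)
  show "y = C.lincomb (jordan_index p a) w C.v" unfolding w_def
    using S.dual_matrix_expand[OF finite_jordan_index fB vB good_facts(4) yB] by simp
  show "w \<in> jordan_index p a \<rightarrow> carrier (ST Q)" unfolding w_def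
    using yB good_facts(4) unfolding dual_matrix_def by (intro Pi_I S.finsum_closed) (auto simp: PiE_iff)
qed

lemma end_coords_closed:
  assumes y: "y \<in> carrier (VS Q)"
  shows "end_coords g i Q y \<in> {..<a i} \<rightarrow>\<^sub>E loc_deg R D Q 0"
proof -
  have "(\<Oplus>\<^bsub>LOC Q\<^esub>b\<in>B. y b \<otimes>\<^bsub>LOC Q\<^esub> g b (i, c, i - 1) Q) \<in> loc_deg R D Q 0" if "c < a i" for c
    unfolding coords_ST[OF y top_index[OF that]]
    using coords_expand(1)[OF y] top_index[OF that] by (auto simp: ST_simps(1))
  then show ?thesis unfolding end_coords_def by auto
qed

lemma chain_basis: "is_basis_family (ST Q) (VS Q) (jordan_index p a) (chain_family (th f Q) (\<lambda>i c. x i c Q))"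
proof -
  interpret S: cring "ST Q" using good_facts(2) by (rule ST_cring)
  interpret C: chains "ST Q" "VS Q" "th f Q" p a "\<lambda>i c. x i c Q" by (rule good_facts(3))
  show ?thesis using C.v_closed
    by (intro S.dual_matrix_basis[OF finite_jordan_index fB _ good_facts(4)]) (simp add: free_module_simps)
qed

text \<open>
  An element of the kernel has coordinates only at ends of chains, and being in the image of \<open>\<theta>\<^bsup>i-1\<^esup>\<close> removes
  the chains shorter than \<open>i\<close>; being in the image of \<open>\<theta>\<^sup>i\<close> moreover removes those of length \<open>i\<close>.
\<close>

lemma Z_iff_end_coords:
  assumes y: "y \<in> carrier (VS Q)"
  shows "y \<in> Z i Q \<Longrightarrow> end_coords g i Q y = (\<lambda>c\<in>{..<a i}. \<zero>\<^bsub>LOC Q\<^esub>)"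
    "y \<in> Z (i - 1) Q \<Longrightarrow> end_coords g i Q y = (\<lambda>c\<in>{..<a i}. \<zero>\<^bsub>LOC Q\<^esub>) \<Longrightarrow> y \<in> Z i Q"
proof -
  interpret C: chains "ST Q" "VS Q" "th f Q" p a "\<lambda>i c. x i c Q" by (rule good_facts(3))
  define w where "w = (\<lambda>z. \<Oplus>\<^bsub>ST Q\<^esub>b\<in>B. y b \<otimes>\<^bsub>ST Q\<^esub> g b z Q)"
  note w = coords_expand[OF y, folded w_def]
  have kZ: "C.ker_im m = Z m Q" for m by (rule ker_im_Z[OF good_facts(1,3)])
  have gw: "end_coords g i Q y = (\<lambda>c\<in>{..<a i}. w (i, c, i - 1))"
    unfolding end_coords_def w_def using coords_ST[OF y top_index] by (intro restrict_eqI) simp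
  have Zm: "y \<in> Z m Q \<longleftrightarrow> (\<forall>i c j. (i, c, j) \<in> jordan_index p a \<longrightarrow> j < m \<or> j + 1 < i \<longrightarrow> w (i, c, j) = \<zero>\<^bsub>ST Q\<^esub>)" for m
    using C.ker_im_coords[OF chain_basis w(1), of m] w(2) kZ by simp
  show "end_coords g i Q y = (\<lambda>c\<in>{..<a i}. \<zero>\<^bsub>LOC Q\<^esub>)" if "y \<in> Z i Q"
    unfolding gw
  proof (rule restrict_eqI)
    fix c assume "c \<in> {..<a i}"
    then have "(i, c, i - 1) \<in> jordan_index p a" using top_index by simp
    moreover have "i - 1 < i" using i by simp
    ultimately have "w (i, c, i - 1) = \<zero>\<^bsub>ST Q\<^esub>" using that unfolding Zm by blast
    then show "w (i, c, i - 1) = \<zero>\<^bsub>LOC Q\<^esub>" by (simp add: ST_simps(5))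
  qed
  assume y1: "y \<in> Z (i - 1) Q" and g0: "end_coords g i Q y = (\<lambda>c\<in>{..<a i}. \<zero>\<^bsub>LOC Q\<^esub>)"
  show "y \<in> Z i Q" unfolding Zm
  proof (intro allI impI)
    fix i' c j assume z: "(i', c, j) \<in> jordan_index p a" "j < i \<or> j + 1 < i'"
    show "w (i', c, j) = \<zero>\<^bsub>ST Q\<^esub>"
    proof (cases "j < i - 1 \<or> j + 1 < i'")
      case True
      then show ?thesis using y1 z(1) unfolding Zm by blast
    next
      case False
      moreover have "j < i'" "c < a i'" using z(1) by (auto simp: jordan_index_def)
      ultimately have "i' = i" "j = i - 1" using z(2) by linarith+
      moreover from this have "c < a i" using \<open>c < a i'\<close> by simp
      ultimately have "i' = i" "j = i - 1" "c < a i" by blast+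
      then show ?thesis using fun_cong[OF g0, of c] unfolding gw by (simp add: ST_simps(5))
    qed
  qed
qed

lemma end_coords_add:
  assumes y: "y \<in> carrier (VS Q)" "y' \<in> carrier (VS Q)"
  shows "end_coords g i Q (y \<oplus>\<^bsub>VS Q\<^esub> y') = (\<lambda>c\<in>{..<a i}. end_coords g i Q y c \<oplus>\<^bsub>LOC Q\<^esub> end_coords g i Q y' c)"
proof -
  interpret L: cring "LOC Q" using good_facts(2) by (rule LOC_cring)
  have yc: "y b \<in> carrier (LOC Q)" "y' b \<in> carrier (LOC Q)" if "b \<in> B" for b
    using VS_LOC y that by blast+
  show ?thesis
  proof (subst end_coords_def, rule restrict_eqI)
    fix c assume c: "c \<in> {..<a i}"
    have gc: "g b (i, c, i - 1) Q \<in> carrier (LOC Q)" if "b \<in> B" for b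
      using sec_mem[OF good_facts(6)[OF that top_index]] c ST_sub by auto
    have "(\<Oplus>\<^bsub>LOC Q\<^esub>b\<in>B. (y \<oplus>\<^bsub>VS Q\<^esub> y') b \<otimes>\<^bsub>LOC Q\<^esub> g b (i, c, i - 1) Q)
      = (\<Oplus>\<^bsub>LOC Q\<^esub>b\<in>B. y b \<otimes>\<^bsub>LOC Q\<^esub> g b (i, c, i - 1) Q \<oplus>\<^bsub>LOC Q\<^esub> y' b \<otimes>\<^bsub>LOC Q\<^esub> g b (i, c, i - 1) Q)"
      using yc gc by (intro L.finsum_cong') (auto simp: free_module_simps ST_simps L.l_distr)
    also have "\<dots> = end_coords g i Q y c \<oplus>\<^bsub>LOC Q\<^esub> end_coords g i Q y' c"
      using yc gc c unfolding end_coords_def by (subst L.finsum_addf) auto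
    finally show "(\<Oplus>\<^bsub>LOC Q\<^esub>b\<in>B. (y \<oplus>\<^bsub>VS Q\<^esub> y') b \<otimes>\<^bsub>LOC Q\<^esub> g b (i, c, i - 1) Q)
      = end_coords g i Q y c \<oplus>\<^bsub>LOC Q\<^esub> end_coords g i Q y' c" .
  qed
qed

lemma end_coords_smult:
  assumes s: "s \<in> carrier (ST Q)" and y: "y \<in> carrier (VS Q)"
  shows "end_coords g i Q (s \<odot>\<^bsub>VS Q\<^esub> y) = (\<lambda>c\<in>{..<a i}. s \<otimes>\<^bsub>LOC Q\<^esub> end_coords g i Q y c)"
proof -
  interpret L: cring "LOC Q" using good_facts(2) by (rule LOC_cring)
  have sc: "s \<in> carrier (LOC Q)" using s ST_sub by (auto simp: ST_simps)
  have yc: "y b \<in> carrier (LOC Q)" if "b \<in> B" for b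
    using VS_LOC y that by blast+
  show ?thesis
  proof (subst end_coords_def, rule restrict_eqI)
    fix c assume c: "c \<in> {..<a i}"
    have gc: "g b (i, c, i - 1) Q \<in> carrier (LOC Q)" if "b \<in> B" for b
      using sec_mem[OF good_facts(6)[OF that top_index]] c ST_sub by auto
    have "(\<Oplus>\<^bsub>LOC Q\<^esub>b\<in>B. (s \<odot>\<^bsub>VS Q\<^esub> y) b \<otimes>\<^bsub>LOC Q\<^esub> g b (i, c, i - 1) Q)
      = (\<Oplus>\<^bsub>LOC Q\<^esub>b\<in>B. s \<otimes>\<^bsub>LOC Q\<^esub> (y b \<otimes>\<^bsub>LOC Q\<^esub> g b (i, c, i - 1) Q))"
      using yc gc sc by (intro L.finsum_cong') (auto simp: free_module_simps ST_simps L.m_assoc)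
    also have "\<dots> = s \<otimes>\<^bsub>LOC Q\<^esub> (\<Oplus>\<^bsub>LOC Q\<^esub>b\<in>B. y b \<otimes>\<^bsub>LOC Q\<^esub> g b (i, c, i - 1) Q)"
      using yc gc sc fB by (intro L.finsum_rdistr[symmetric]) auto
    also have "\<dots> = s \<otimes>\<^bsub>LOC Q\<^esub> end_coords g i Q y c" using c by (simp add: end_coords_def)
    finally show "(\<Oplus>\<^bsub>LOC Q\<^esub>b\<in>B. (s \<odot>\<^bsub>VS Q\<^esub> y) b \<otimes>\<^bsub>LOC Q\<^esub> g b (i, c, i - 1) Q) = s \<otimes>\<^bsub>LOC Q\<^esub> end_coords g i Q y c" .
  qed
qed

lemma end_comb_facts:
  assumes \<alpha>: "\<alpha> \<in> {..<a i} \<rightarrow>\<^sub>E loc_deg R D Q 0"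
  shows "end_comb f x i Q \<alpha> \<in> Z (i - 1) Q" "end_coords g i Q (end_comb f x i Q \<alpha>) = \<alpha>"
proof -
  interpret S: cring "ST Q" using good_facts(2) by (rule ST_cring)
  interpret C: chains "ST Q" "VS Q" "th f Q" p a "\<lambda>i c. x i c Q" by (rule good_facts(3))
  have \<alpha>S: "\<alpha> \<in> {..<a i} \<rightarrow> carrier (ST Q)" using \<alpha> by (auto simp: ST_simps(1) PiE_iff)
  note tc = C.top_closed[where i = i and \<alpha> = \<alpha>, OF \<alpha>S]
  have e: "end_comb f x i Q \<alpha> = C.lincomb (jordan_index p a) (C.top i \<alpha>) C.v"
    unfolding end_comb_def by (rule C.lincomb_top[OF i \<alpha>S])
  have kZ: "C.ker_im m = Z m Q" for m by (rule ker_im_Z[OF good_facts(1,3)])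
  show tZ: "end_comb f x i Q \<alpha> \<in> Z (i - 1) Q"
    unfolding e kZ[symmetric] C.ker_im_coords[OF chain_basis tc] by (auto simp: C.top_def)
  have tV: "end_comb f x i Q \<alpha> \<in> carrier (VS Q)" using Z_sub[OF good_facts(2) tZ] .
  have vB: "C.v \<in> jordan_index p a \<rightarrow> (B \<rightarrow>\<^sub>E carrier (ST Q))"
    using C.v_closed by (simp add: free_module_simps)
  show "end_coords g i Q (end_comb f x i Q \<alpha>) = \<alpha>" unfolding end_coords_def
  proof (rule PiE_eq_restrictI[OF \<alpha>, symmetric])
    fix c assume c: "c \<in> {..<a i}"
    then have z: "(i, c, i - 1) \<in> jordan_index p a" using top_index by simp
    have "(\<Oplus>\<^bsub>LOC Q\<^esub>b\<in>B. end_comb f x i Q \<alpha> b \<otimes>\<^bsub>LOC Q\<^esub> g b (i, c, i - 1) Q) = C.top i \<alpha> (i, c, i - 1)"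
      unfolding coords_ST[OF tV z] unfolding e
      by (rule S.dual_matrix_coords[OF finite_jordan_index fB vB good_facts(4) tc z])
    then show "\<alpha> c = (\<Oplus>\<^bsub>LOC Q\<^esub>b\<in>B. end_comb f x i Q \<alpha> b \<otimes>\<^bsub>LOC Q\<^esub> g b (i, c, i - 1) Q)"
      by (simp add: C.top_def)
  qed
qed

definition representative :: "('i \<Rightarrow> ('a \<times> 'a) set) set \<Rightarrow> 'i \<Rightarrow> ('a \<times> 'a) set" where
  "representative Y = (SOME y. y \<in> Y)"

lemma end_coords_representative:
  assumes s: "s \<in> Z (i - 1) Q"
  shows "end_coords g i Q (representative (Z i Q +>\<^bsub>VS Q\<^esub> s)) = end_coords g i Q s"
proof -
  interpret F: plain_module "ST Q" "VS Q" using good_facts(2) by (rule VS_plain)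
  interpret L: cring "LOC Q" using good_facts(2) by (rule LOC_cring)
  note Zi = Z_submodule[OF good_facts(2), of i]
  have sV: "s \<in> carrier (VS Q)" using Z_sub[OF good_facts(2) s] .
  have "representative (Z i Q +>\<^bsub>VS Q\<^esub> s) \<in> Z i Q +>\<^bsub>VS Q\<^esub> s"
    unfolding representative_def by (rule someI[where P = "\<lambda>y. y \<in> Z i Q +>\<^bsub>VS Q\<^esub> s", OF F.coset_self[OF Zi sV]])
  then obtain z where z: "z \<in> Z i Q" "representative (Z i Q +>\<^bsub>VS Q\<^esub> s) = z \<oplus>\<^bsub>VS Q\<^esub> s" using F.coset_mem[OF Zi] by blast
  have zV: "z \<in> carrier (VS Q)" using Z_sub[OF good_facts(2) z(1)] .
  have gs: "end_coords g i Q s c \<in> carrier (LOC Q)" if "c < a i" for c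
    using PiE_LOC[OF end_coords_closed[OF sV]] that by simp
  show ?thesis unfolding z(2) end_coords_add[OF zV sV] Z_iff_end_coords(1)[OF zV z(1)]
    by (rule PiE_eq_restrictI[OF end_coords_closed[OF sV], symmetric]) (use gs in simp)
qed

lemma end_comb_end_coords:
  assumes s: "s \<in> Z (i - 1) Q"
  shows "Z i Q +>\<^bsub>VS Q\<^esub> end_comb f x i Q (end_coords g i Q s) = Z i Q +>\<^bsub>VS Q\<^esub> s"
proof -
  interpret F: plain_module "ST Q" "VS Q" using good_facts(2) by (rule VS_plain)
  interpret L: cring "LOC Q" using good_facts(2) by (rule LOC_cring)
  note Zi = Z_submodule[OF good_facts(2), of i] and Zi1 = Z_submodule[OF good_facts(2), of "i - 1"]
  have sV: "s \<in> carrier (VS Q)" using Z_sub[OF good_facts(2) s] .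
  let ?t = "end_comb f x i Q (end_coords g i Q s)"
  note t = end_comb_facts[OF end_coords_closed[OF sV]]
  have tV: "?t \<in> carrier (VS Q)" using Z_sub[OF good_facts(2) t(1)] .
  let ?z = "?t \<oplus>\<^bsub>VS Q\<^esub> \<ominus>\<^bsub>VS Q\<^esub> s"
  have z1: "?z \<in> Z (i - 1) Q" using F.submoduleE(3,5)[OF Zi1] t(1) s by blast
  have zV: "?z \<in> carrier (VS Q)" using Z_sub[OF good_facts(2) z1] .
  have zs: "?t = ?z \<oplus>\<^bsub>VS Q\<^esub> s" using tV sV by (simp add: F.M.a_assoc F.M.l_neg)
  have eq: "end_coords g i Q s = (\<lambda>c\<in>{..<a i}. end_coords g i Q ?z c \<oplus>\<^bsub>LOC Q\<^esub> end_coords g i Q s c)"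
    using end_coords_add[OF zV sV] zs t(2) by simp
  have "end_coords g i Q ?z = (\<lambda>c\<in>{..<a i}. \<zero>\<^bsub>LOC Q\<^esub>)"
  proof (rule PiE_eq_restrictI[OF end_coords_closed[OF zV]])
    fix c assume c: "c \<in> {..<a i}"
    have "end_coords g i Q s c \<in> carrier (LOC Q)" "end_coords g i Q ?z c \<in> carrier (LOC Q)"
      using PiE_LOC[OF end_coords_closed[OF sV] c] PiE_LOC[OF end_coords_closed[OF zV] c] by blast+
    moreover have "end_coords g i Q s c = end_coords g i Q ?z c \<oplus>\<^bsub>LOC Q\<^esub> end_coords g i Q s c"
      by (rule trans[OF fun_cong[OF eq, of c]]) (use c in simp)
    ultimately show "end_coords g i Q ?z c = \<zero>\<^bsub>LOC Q\<^esub>" using L.add.r_cancel_one'[of "end_coords g i Q s c" "end_coords g i Q ?z c"] by blast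
  qed
  then have "?z \<in> Z i Q" by (rule Z_iff_end_coords(2)[OF zV z1])
  then have "?t \<in> Z i Q +>\<^bsub>VS Q\<^esub> s" using zs F.coset_mem[OF Zi] by blast
  then show ?thesis using F.coset_eqI[OF Zi sV] by simp
qed

lemma end_coords_sec:
  assumes s: "vsec 0 B Q s"
  shows "vsec 0 {..<a i} Q (\<lambda>Q. end_coords g i Q (s Q))"
  unfolding end_coords_def
proof (rule vsec_restrict[OF good_facts(2)], rule sec_product_sum[OF fB good_facts(2)])
  fix c b assume c: "c \<in> {..<a i}" and b: "b \<in> B"
  show "sec 0 Q (\<lambda>Q. s Q b)" using s b unfolding vsec_def by blast
  show "sec 0 Q (g b (i, c, i - 1))" using good_facts(6)[OF b top_index] c by simp
qed

end

lemma end_comb_sec: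
  assumes good: "near P (good_chains a f x g)" and i: "i \<in> {1..p}" and \<alpha>: "vsec 0 {..<a i} P \<alpha>"
  shows "vsec 0 B P (\<lambda>Q. end_comb f x i Q (\<alpha> Q))"
proof (rule vsec_cong)
  note gP = good_facts[OF near_at[OF good] i]
  have P: "P \<in> PR" by (rule gP(2))
  let ?y = "\<lambda>c Q. (th f Q ^^ (i - 1)) (x i c Q)"
  have y: "vsec 0 B P (?y c)" if "c < a i" for c by (rule vsec_th_pow[OF gP(5)[OF i that] gP(1)])
  show "vsec 0 B P (\<lambda>Q. \<lambda>b\<in>B. \<Oplus>\<^bsub>LOC Q\<^esub>c\<in>{..<a i}. \<alpha> Q c \<otimes>\<^bsub>LOC Q\<^esub> ?y c Q b)"
  proof (rule vsec_restrict[OF P], rule sec_product_sum[OF _ P])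
    fix b c assume "b \<in> B" "c \<in> {..<a i}"
    then show "sec 0 P (\<lambda>Q. \<alpha> Q c)" "sec 0 P (\<lambda>Q. ?y c Q b)" using \<alpha> y unfolding vsec_def by blast+
  qed simp
  show "near P (\<lambda>Q. (\<lambda>b\<in>B. \<Oplus>\<^bsub>LOC Q\<^esub>c\<in>{..<a i}. \<alpha> Q c \<otimes>\<^bsub>LOC Q\<^esub> ?y c Q b) = end_comb f x i Q (\<alpha> Q))"
  proof (rule near_mono2[OF good vsec_near_mem[OF _ \<alpha>]])
    fix Q assume Q: "good_chains a f x g Q" "\<alpha> Q \<in> {..<a i} \<rightarrow>\<^sub>E loc_deg R D Q 0"
    note gQ = good_facts[OF Q(1) i]
    interpret S: cring "ST Q" using gQ(2) by (rule ST_cring)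
    have yV: "?y c Q \<in> carrier (VS Q)" if "c < a i" for c
      by (rule th_pow_closed[OF gQ(1) vsec_VS[OF gQ(5)[OF i that]]])
    have yB: "(\<lambda>c. ?y c Q) \<in> {..<a i} \<rightarrow> (B \<rightarrow>\<^sub>E carrier (ST Q))"
      using yV by (intro Pi_I) (simp add: free_module_simps)
    have \<alpha>S: "\<alpha> Q \<in> {..<a i} \<rightarrow> carrier (ST Q)" using Q(2) by (auto simp: ST_simps(1) PiE_iff)
    have "end_comb f x i Q (\<alpha> Q) = (\<lambda>b\<in>B. \<Oplus>\<^bsub>ST Q\<^esub>c\<in>{..<a i}. \<alpha> Q c \<otimes>\<^bsub>ST Q\<^esub> ?y c Q b)"
      unfolding end_comb_def by (rule S.lincomb_free[OF _ \<alpha>S yB]) simp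
    also have "\<dots> = (\<lambda>b\<in>B. \<Oplus>\<^bsub>LOC Q\<^esub>c\<in>{..<a i}. \<alpha> Q c \<otimes>\<^bsub>LOC Q\<^esub> ?y c Q b)"
    proof (rule restrict_eqI, rule ST_product_sum[OF gQ(2)])
      fix b c assume "b \<in> B" "c \<in> {..<a i}"
      then show "\<alpha> Q c \<in> loc_deg R D Q 0" "?y c Q b \<in> loc_deg R D Q 0"
        using Q(2) yV by (auto simp: VS_carrier PiE_iff)
    qed
    finally show "(\<lambda>b\<in>B. \<Oplus>\<^bsub>LOC Q\<^esub>c\<in>{..<a i}. \<alpha> Q c \<otimes>\<^bsub>LOC Q\<^esub> ?y c Q b) = end_comb f x i Q (\<alpha> Q)" by simp
  qed simp
qed

text \<open>
  The isomorphism takes the coordinates at the ends of the chains of length \<open>i\<close> of any representative; its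
  inverse takes the class of a combination of these ends.
\<close>

lemma quotient_iso:
  assumes V: "is_open V" and good: "\<And>Q. Q \<in> V \<Longrightarrow> good_chains a f x g Q" and i: "i \<in> {1..p}"
  shows "sheaf_iso_on R D V (Fsh i) (free_sheaf R D {..<a i})"
proof -
  let ?N = "{..<a i}" and ?F = "Fsh i" and ?O = "free_sheaf R D {..<a i}"
  let ?\<rho> = "\<lambda>Q Y. end_coords g i Q (representative Y)"
  define \<phi> where "\<phi> = (\<lambda>W t. \<lambda>Q\<in>W. ?\<rho> Q (t Q))"
  have secO: "sections ?O W = twist_power R D 0 ?N W" "stalk ?O Q = free_module (ST Q) ?N" for W Q
    by (simp_all add: free_sheaf_def)
  have one: "bij_betw (\<phi> W) (sections ?F W) (sections ?O W) \<and>
     (\<forall>s\<in>sections ?F W. \<forall>t\<in>sections ?F W. \<phi> W (sheaf_add ?F W s t) = sheaf_add ?O W (\<phi> W s) (\<phi> W t)) \<and>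
     (\<forall>c\<in>twist R D 0 W. \<forall>s\<in>sections ?F W. \<phi> W (sheaf_smult ?F W c s) = sheaf_smult ?O W c (\<phi> W s)) \<and>
     (\<forall>W'. is_open W' \<and> W' \<subseteq> W \<longrightarrow> (\<forall>s\<in>sections ?F W. \<phi> W' (restrict s W') = restrict (\<phi> W s) W'))"
    if W: "is_open W" "W \<subseteq> V" for W
  proof -
    have gW: "good_chains a f x g Q" if "Q \<in> W" for Q using good that W(2) by blast
    have PRW: "Q \<in> PR" if "Q \<in> W" for Q using open_sub[OF W(1)] that by blast
    have rp: "\<exists>s\<in>Z (i - 1) Q. t Q = Z i Q +>\<^bsub>VS Q\<^esub> s" if "t \<in> sections ?F W" "Q \<in> W" for t Q
    proof -
      have "qsec i Q t" using that sections_Fsh[OF W(1)] by blast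
      then obtain u where "near Q (\<lambda>Q. u Q \<in> Z (i - 1) Q \<and> t Q = Z i Q +>\<^bsub>VS Q\<^esub> u Q)" unfolding qsec_def by blast
      from near_at[OF this] show ?thesis by blast
    qed
    have into: "\<phi> W t \<in> sections ?O W" if t: "t \<in> sections ?F W" for t
      unfolding secO twist_power_iff[OF W(1)]
    proof (intro conjI ballI)
      show "\<phi> W t \<in> extensional W" by (simp add: \<phi>_def)
      fix P assume P: "P \<in> W"
      have "qsec i P t" using t P sections_Fsh[OF W(1)] by blast
      then obtain u where u: "vsec 0 B P u" "near P (\<lambda>Q. u Q \<in> Z (i - 1) Q \<and> t Q = Z i Q +>\<^bsub>VS Q\<^esub> u Q)"
        unfolding qsec_def by blast
      show "vsec 0 ?N P (\<phi> W t)"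
      proof (rule vsec_cong[OF end_coords_sec[OF gW[OF P] i u(1)]], rule near_mono2[OF u(2) near_open[OF W(1) P]])
        fix Q assume Q: "u Q \<in> Z (i - 1) Q \<and> t Q = Z i Q +>\<^bsub>VS Q\<^esub> u Q" "Q \<in> W"
        then show "end_coords g i Q (u Q) = \<phi> W t Q"
          using end_coords_representative[OF gW[OF Q(2)] i, of "u Q"] by (simp add: \<phi>_def)
      qed
    qed
    have section_of: "(\<lambda>Q\<in>W. Z i Q +>\<^bsub>VS Q\<^esub> end_comb f x i Q (\<alpha> Q)) \<in> sections ?F W" if \<alpha>: "\<alpha> \<in> sections ?O W" for \<alpha>
      unfolding sections_Fsh[OF W(1)]
    proof (intro conjI ballI)
      fix P assume P: "P \<in> W"
      have \<alpha>W: "vsec 0 ?N Q \<alpha>" if "Q \<in> W" for Q using \<alpha> that unfolding secO twist_power_iff[OF W(1)] by blast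
      have gn: "near P (good_chains a f x g)" by (rule near_mono[OF near_open[OF W(1) P] gW])
      have "near P (\<lambda>Q. end_comb f x i Q (\<alpha> Q) \<in> Z (i - 1) Q \<and>
        (\<lambda>Q\<in>W. Z i Q +>\<^bsub>VS Q\<^esub> end_comb f x i Q (\<alpha> Q)) Q = Z i Q +>\<^bsub>VS Q\<^esub> end_comb f x i Q (\<alpha> Q))"
      proof (rule near_mono[OF near_open[OF W(1) P]])
        fix Q assume "Q \<in> W"
        then show "end_comb f x i Q (\<alpha> Q) \<in> Z (i - 1) Q \<and>
          (\<lambda>Q\<in>W. Z i Q +>\<^bsub>VS Q\<^esub> end_comb f x i Q (\<alpha> Q)) Q = Z i Q +>\<^bsub>VS Q\<^esub> end_comb f x i Q (\<alpha> Q)"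
          using end_comb_facts(1)[OF gW i vsec_mem[OF \<alpha>W]] by simp
      qed
      then show "qsec i P (\<lambda>Q\<in>W. Z i Q +>\<^bsub>VS Q\<^esub> end_comb f x i Q (\<alpha> Q))"
        unfolding qsec_def using end_comb_sec[OF gn i \<alpha>W[OF P]] by blast
    qed simp
    have bij: "bij_betw (\<phi> W) (sections ?F W) (sections ?O W)"
    proof (rule bij_betw_byWitness[where f' = "\<lambda>\<alpha>. \<lambda>Q\<in>W. Z i Q +>\<^bsub>VS Q\<^esub> end_comb f x i Q (\<alpha> Q)"])
      show "\<forall>t\<in>sections ?F W. (\<lambda>Q\<in>W. Z i Q +>\<^bsub>VS Q\<^esub> end_comb f x i Q (\<phi> W t Q)) = t"
      proof
        fix t assume t: "t \<in> sections ?F W"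
        show "(\<lambda>Q\<in>W. Z i Q +>\<^bsub>VS Q\<^esub> end_comb f x i Q (\<phi> W t Q)) = t"
        proof (rule extensionalityI[of _ W])
          show "t \<in> extensional W" using t sections_Fsh[OF W(1)] by blast
          fix Q assume Q: "Q \<in> W"
          obtain s where s: "s \<in> Z (i - 1) Q" "t Q = Z i Q +>\<^bsub>VS Q\<^esub> s" using rp[OF t Q] by blast
          show "(\<lambda>Q\<in>W. Z i Q +>\<^bsub>VS Q\<^esub> end_comb f x i Q (\<phi> W t Q)) Q = t Q"
            using Q end_coords_representative[OF gW[OF Q] i s(1)] end_comb_end_coords[OF gW[OF Q] i s(1)] s(2) by (simp add: \<phi>_def)
        qed simp
      qed
      show "\<forall>\<alpha>\<in>sections ?O W. \<phi> W (\<lambda>Q\<in>W. Z i Q +>\<^bsub>VS Q\<^esub> end_comb f x i Q (\<alpha> Q)) = \<alpha>"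
      proof
        fix \<alpha> assume \<alpha>: "\<alpha> \<in> sections ?O W"
        have \<alpha>W: "\<alpha> \<in> extensional W" "\<And>Q. Q \<in> W \<Longrightarrow> vsec 0 ?N Q \<alpha>"
          using \<alpha> unfolding secO twist_power_iff[OF W(1)] by blast+
        show "\<phi> W (\<lambda>Q\<in>W. Z i Q +>\<^bsub>VS Q\<^esub> end_comb f x i Q (\<alpha> Q)) = \<alpha>"
        proof (rule extensionalityI[of _ W])
          fix Q assume Q: "Q \<in> W"
          note tf = end_comb_facts[OF gW[OF Q] i vsec_mem[OF \<alpha>W(2)[OF Q]]]
          show "\<phi> W (\<lambda>Q\<in>W. Z i Q +>\<^bsub>VS Q\<^esub> end_comb f x i Q (\<alpha> Q)) Q = \<alpha> Q"
            using Q end_coords_representative[OF gW[OF Q] i tf(1)] tf(2) by (simp add: \<phi>_def)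
        qed (use \<alpha>W(1) in \<open>simp_all add: \<phi>_def\<close>)
      qed
      show "\<phi> W ` sections ?F W \<subseteq> sections ?O W" using into by (rule image_subsetI)
      show "(\<lambda>\<alpha>. \<lambda>Q\<in>W. Z i Q +>\<^bsub>VS Q\<^esub> end_comb f x i Q (\<alpha> Q)) ` sections ?O W \<subseteq> sections ?F W"
        using section_of by (rule image_subsetI)
    qed
    have add: "\<phi> W (sheaf_add ?F W s t) = sheaf_add ?O W (\<phi> W s) (\<phi> W t)"
      if s: "s \<in> sections ?F W" and t: "t \<in> sections ?F W" for s t
      unfolding \<phi>_def sheaf_add_def
    proof (rule restrict_eqI)
      fix Q assume Q: "Q \<in> W"
      note PQ = PRW[OF Q]
      interpret F: plain_module "ST Q" "VS Q" using PQ by (rule VS_plain)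
      obtain u where u: "u \<in> Z (i - 1) Q" "s Q = Z i Q +>\<^bsub>VS Q\<^esub> u" using rp[OF s Q] by blast
      obtain w where w: "w \<in> Z (i - 1) Q" "t Q = Z i Q +>\<^bsub>VS Q\<^esub> w" using rp[OF t Q] by blast
      note uV = Z_sub[OF PQ u(1)] and wV = Z_sub[OF PQ w(1)]
      have uw: "u \<oplus>\<^bsub>VS Q\<^esub> w \<in> Z (i - 1) Q" using F.submoduleE(5)[OF Z_submodule[OF PQ]] u(1) w(1) by blast
      have st: "s Q \<oplus>\<^bsub>stalk ?F Q\<^esub> t Q = Z i Q +>\<^bsub>VS Q\<^esub> (u \<oplus>\<^bsub>VS Q\<^esub> w)"
        unfolding u(2) w(2) stalk_Fsh[OF PQ] quotient_add by (rule F.coset_add[OF Z_submodule[OF PQ] uV wV])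
      show "?\<rho> Q ((\<lambda>P\<in>W. s P \<oplus>\<^bsub>stalk ?F P\<^esub> t P) Q) =
        (\<lambda>Q\<in>W. ?\<rho> Q (s Q)) Q \<oplus>\<^bsub>stalk ?O Q\<^esub> (\<lambda>Q\<in>W. ?\<rho> Q (t Q)) Q"
        using Q end_coords_representative[OF gW[OF Q] i uw] end_coords_representative[OF gW[OF Q] i u(1)] end_coords_representative[OF gW[OF Q] i w(1)]
          end_coords_add[OF gW[OF Q] i uV wV]
        by (simp add: st[unfolded u(2) w(2)] u(2) w(2) secO free_module_simps ST_simps(3))
    qed
    have smult: "\<phi> W (sheaf_smult ?F W c s) = sheaf_smult ?O W c (\<phi> W s)"
      if c: "c \<in> twist R D 0 W" and s: "s \<in> sections ?F W" for c s
      unfolding \<phi>_def sheaf_smult_def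
    proof (rule restrict_eqI)
      fix Q assume Q: "Q \<in> W"
      note PQ = PRW[OF Q]
      interpret F: plain_module "ST Q" "VS Q" using PQ by (rule VS_plain)
      have cQ: "c Q \<in> carrier (ST Q)" using c Q sec_mem unfolding twist_iff[OF W(1)] ST_simps(1) by blast
      obtain u where u: "u \<in> Z (i - 1) Q" "s Q = Z i Q +>\<^bsub>VS Q\<^esub> u" using rp[OF s Q] by blast
      note uV = Z_sub[OF PQ u(1)]
      have cu: "c Q \<odot>\<^bsub>VS Q\<^esub> u \<in> Z (i - 1) Q" using F.submoduleE(4)[OF Z_submodule[OF PQ]] u(1) cQ by blast
      have st: "c Q \<odot>\<^bsub>stalk ?F Q\<^esub> s Q = Z i Q +>\<^bsub>VS Q\<^esub> (c Q \<odot>\<^bsub>VS Q\<^esub> u)"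
        unfolding u(2) stalk_Fsh[OF PQ] quotient_smult by (rule F.coset_smult[OF Z_submodule[OF PQ] cQ uV])
      show "?\<rho> Q ((\<lambda>P\<in>W. c P \<odot>\<^bsub>stalk ?F P\<^esub> s P) Q) = c Q \<odot>\<^bsub>stalk ?O Q\<^esub> (\<lambda>Q\<in>W. ?\<rho> Q (s Q)) Q"
        using Q end_coords_representative[OF gW[OF Q] i cu] end_coords_representative[OF gW[OF Q] i u(1)] end_coords_smult[OF gW[OF Q] i cQ uV]
        by (simp add: st[unfolded u(2)] u(2) secO free_module_simps ST_simps(2))
    qed
    have "\<phi> W' (restrict s W') = restrict (\<phi> W s) W'" if "W' \<subseteq> W" for W' s
      using that by (auto simp: \<phi>_def fun_eq_iff)
    then show ?thesis using bij add smult by blast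
  qed
  show ?thesis unfolding sheaf_iso_on_def
    by (intro exI[of _ \<phi>] allI impI) (rule one, blast+)
qed

theorem locally_free_of_jordan_type:
  assumes U: "is_open U" and jt: "\<And>Q. Q \<in> U \<Longrightarrow> jt_at a Q" and i: "i \<in> {1..p}"
  shows "locally_free_of_rank R D U (Fsh i) (a i)"
  unfolding locally_free_of_rank_def
proof
  fix P assume P: "P \<in> U"
  have PR: "P \<in> PR" using P open_sub[OF U] by blast
  have "near P (jt_at a)" by (rule near_mono[OF near_open[OF U P] jt])
  from good_chains_near[OF PR this] obtain f x g where "near P (good_chains a f x g)" by blast
  from near_conj[OF this near_open[OF U P]] obtain V where V: "is_open V" "P \<in> V"
    "\<forall>Q\<in>V. good_chains a f x g Q \<and> Q \<in> U" unfolding near_def by blast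
  have "sheaf_iso_on R D V (Fsh i) (free_sheaf R D {..<a i})"
    by (rule quotient_iso[OF V(1) _ i]) (use V(3) in blast)
  then show "\<exists>V. is_open V \<and> P \<in> V \<and> V \<subseteq> U \<and> sheaf_iso_on R D V (Fsh i) (free_sheaf R D {..<a i})"
    using V by blast
qed

theorem jordan_type_iff_locally_free:
  assumes U: "is_open U"
  shows "(\<forall>v\<in>U. has_jordan_type (RF v) (free_module (RF v) B) (local_op R D B d RA v) p a) \<longleftrightarrow>
    (\<forall>i\<in>{1..p}. locally_free_of_rank R D U (Fsh i) (a i))"
proof
  assume "\<forall>v\<in>U. has_jordan_type (RF v) (free_module (RF v) B) (local_op R D B d RA v) p a"
  then show "\<forall>i\<in>{1..p}. locally_free_of_rank R D U (Fsh i) (a i)"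
    using locally_free_of_jordan_type[OF U] unfolding jt_at_def by blast
next
  assume free: "\<forall>i\<in>{1..p}. locally_free_of_rank R D U (Fsh i) (a i)"
  show "\<forall>v\<in>U. has_jordan_type (RF v) (free_module (RF v) B) (local_op R D B d RA v) p a"
  proof
    fix v assume v: "v \<in> U"
    then have "v \<in> PR" using open_sub[OF U] by blast
    then show "has_jordan_type (RF v) (free_module (RF v) B) (local_op R D B d RA v) p a"
    proof (rule jordan_type_of_locally_free)
      fix i assume "i \<in> {1..p}"
      then show "\<exists>V. is_open V \<and> v \<in> V \<and> sheaf_iso_on R D V (Fsh i) (free_sheaf R D {..<a i})"
        using free v unfolding locally_free_of_rank_def by blast
    qed
  qed
qed

end

end

section \<open>Prime ideals avoiding an element\<close>

text \<open>
  Ideals of the ring that a type forms.  Polynomials are treated in this way and are carried over to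
  the coordinate ring by its presentation.
\<close>

definition ideal_set :: "'a::comm_ring_1 set \<Rightarrow> bool" where
  "ideal_set I \<longleftrightarrow> 0 \<in> I \<and> (\<forall>x\<in>I. \<forall>y\<in>I. x + y \<in> I) \<and> (\<forall>x\<in>I. \<forall>c. c * x \<in> I)"

lemma ideal_setD:
  assumes "ideal_set I"
  shows "0 \<in> I" "x \<in> I \<Longrightarrow> y \<in> I \<Longrightarrow> x + y \<in> I" "x \<in> I \<Longrightarrow> c * x \<in> I" "x \<in> I \<Longrightarrow> x * c \<in> I"
    "x \<in> I \<Longrightarrow> - x \<in> I" "x \<in> I \<Longrightarrow> y \<in> I \<Longrightarrow> x - y \<in> I"
proof -
  show *: "0 \<in> I" "x \<in> I \<Longrightarrow> y \<in> I \<Longrightarrow> x + y \<in> I" "x \<in> I \<Longrightarrow> c * x \<in> I" for x y c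
    using assms by (auto simp: ideal_set_def)
  show "x \<in> I \<Longrightarrow> x * c \<in> I" using *(3)[of x c] by (simp add: mult.commute)
  show neg: "x \<in> I \<Longrightarrow> - x \<in> I" for x using *(3)[of x "-1"] by simp
  show "x \<in> I \<Longrightarrow> y \<in> I \<Longrightarrow> x - y \<in> I" using *(2)[of x "-y"] neg[of y] by simp
qed

lemma ideal_set_sum: "ideal_set I \<Longrightarrow> (\<And>a. a \<in> A \<Longrightarrow> f a \<in> I) \<Longrightarrow> sum f A \<in> I"
  by (induction A rule: infinite_finite_induct) (auto simp: ideal_setD)

lemma ideal_set_add_principal:
  assumes I: "ideal_set I"
  shows "ideal_set {x + c * a | x c. x \<in> I}" "I \<subseteq> {x + c * a | x c. x \<in> I}" "a \<in> {x + c * a | x c. x \<in> I}"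
proof -
  show "I \<subseteq> {x + c * a | x c. x \<in> I}"
  proof
    fix x assume "x \<in> I"
    then show "x \<in> {x + c * a | x c. x \<in> I}" by (intro CollectI exI[of _ x] exI[of _ 0]) simp
  qed
  show "a \<in> {x + c * a | x c. x \<in> I}" using ideal_setD(1)[OF I]
    by - (rule CollectI, rule exI[of _ 0], rule exI[of _ 1], simp)
  show "ideal_set {x + c * a | x c. x \<in> I}"
    unfolding ideal_set_def
  proof (intro conjI ballI allI)
    show "0 \<in> {x + c * a | x c. x \<in> I}" using ideal_setD(1)[OF I] by (auto intro!: exI[of _ 0])
  next
    fix u v assume "u \<in> {x + c * a | x c. x \<in> I}" "v \<in> {x + c * a | x c. x \<in> I}"
    then obtain x c y d where "u = x + c * a" "v = y + d * a" "x \<in> I" "y \<in> I" by auto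
    then show "u + v \<in> {x + c * a | x c. x \<in> I}" using ideal_setD(2)[OF I, of x y]
      by (intro CollectI exI[of _ "x + y"] exI[of _ "c + d"]) (auto simp: algebra_simps)
  next
    fix u e assume "u \<in> {x + c * a | x c. x \<in> I}"
    then obtain x c where "u = x + c * a" "x \<in> I" by auto
    then show "e * u \<in> {x + c * a | x c. x \<in> I}" using ideal_setD(3)[OF I, of x e]
      by (intro CollectI exI[of _ "e * x"] exI[of _ "e * c"]) (auto simp: algebra_simps)
  qed
qed

text \<open>
  An ideal that is maximal among those containing no power of \<open>y\<close> is prime: if \<open>a\<close> and \<open>b\<close> do not belong
  to it, then enlarging it by either of them catches a power of \<open>y\<close>, and the product of these two
  powers involves \<open>a b\<close>.
\<close>

lemma prime_avoiding_powers:
  fixes y :: "'a::comm_ring_1"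
  assumes I: "ideal_set I" and y: "\<And>n::nat. y ^ n \<notin> I"
  shows "\<exists>P. ideal_set P \<and> I \<subseteq> P \<and> (\<forall>n::nat. y ^ n \<notin> P) \<and> (\<forall>a b. a * b \<in> P \<longrightarrow> a \<in> P \<or> b \<in> P)"
proof -
  define \<P> where "\<P> = {P. ideal_set P \<and> I \<subseteq> P \<and> (\<forall>n::nat. y ^ n \<notin> P)}"
  have "\<exists>M\<in>\<P>. \<forall>Y\<in>\<P>. M \<subseteq> Y \<longrightarrow> Y = M"
  proof (rule subset_Zorn_nonempty)
    show "\<P> \<noteq> {}" using I y unfolding \<P>_def by blast
    fix C assume C: "C \<noteq> {}" "subset.chain \<P> C"
    then have CS: "C \<subseteq> {P. ideal_set P \<and> I \<subseteq> P \<and> (\<forall>n::nat. y ^ n \<notin> P)}" and lin: "\<And>Y Y'. Y \<in> C \<Longrightarrow> Y' \<in> C \<Longrightarrow> Y \<subseteq> Y' \<or> Y' \<subseteq> Y"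
      unfolding \<P>_def subset_chain_def by blast+
    have "ideal_set (\<Union>C)" unfolding ideal_set_def
    proof (intro conjI ballI allI)
      show "0 \<in> \<Union>C" using C(1) CS by (auto simp: ideal_set_def)
      show "c * x \<in> \<Union>C" if x: "x \<in> \<Union>C" for c x
      proof -
        obtain Y where Y: "Y \<in> C" "x \<in> Y" using x by blast
        then have "ideal_set Y" using CS by blast
        then show ?thesis using Y ideal_setD(3) by blast
      qed
      fix x x' assume "x \<in> \<Union>C" "x' \<in> \<Union>C"
      then obtain Y Y' where Y: "Y \<in> C" "Y' \<in> C" "x \<in> Y" "x' \<in> Y'" by auto
      have YI: "ideal_set Y" "ideal_set Y'" using Y(1,2) CS by blast+
      consider "Y \<subseteq> Y'" | "Y' \<subseteq> Y" using lin[OF Y(1,2)] by blast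
      then show "x + x' \<in> \<Union>C"
      proof cases
        case 1
        then have "x + x' \<in> Y'" using Y(3,4) by (intro ideal_setD(2)[OF YI(2)]) blast+
        then show ?thesis using Y(2) by blast
      next
        case 2
        then have "x + x' \<in> Y" using Y(3,4) by (intro ideal_setD(2)[OF YI(1)]) blast+
        then show ?thesis using Y(1) by blast
      qed
    qed
    then show "\<Union>C \<in> \<P>" using C(1) CS unfolding \<P>_def by blast
  qed
  then obtain M where MP: "M \<in> \<P>" and MM: "\<forall>Y\<in>\<P>. M \<subseteq> Y \<longrightarrow> Y = M" by (elim bexE)
  have M: "ideal_set M" "I \<subseteq> M" "\<And>n::nat. y ^ n \<notin> M" using MP unfolding \<P>_def by auto
  have max: "Y = M" if "ideal_set Y" "I \<subseteq> Y" "\<forall>n::nat. y ^ n \<notin> Y" "M \<subseteq> Y" for Y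
  proof -
    have "Y \<in> \<P>" unfolding \<P>_def using that(1-3) by simp
    then show ?thesis using MM[rule_format, of Y] that(4) by simp
  qed
  have "a \<in> M \<or> b \<in> M" if ab: "a * b \<in> M" for a b
  proof (rule ccontr)
    assume "\<not> (a \<in> M \<or> b \<in> M)"
    then have nab: "a \<notin> M" "b \<notin> M" by auto
    have pow: "\<exists>(n::nat) x c. y ^ n = x + c * a \<and> x \<in> M" if "a \<notin> M" for a
    proof -
      let ?Y = "{x + c * a | x c. x \<in> M}"
      note Y = ideal_set_add_principal[OF M(1), of a]
      have "\<not> (\<forall>n::nat. y ^ n \<notin> ?Y)"
      proof
        assume "\<forall>n::nat. y ^ n \<notin> ?Y"
        then have "?Y = M" by (rule max[OF Y(1) subset_trans[OF M(2) Y(2)] _ Y(2)])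
        then show False using Y(3) that by simp
      qed
      then obtain n :: nat where "y ^ n \<in> ?Y" by auto
      then show ?thesis by (intro exI[of _ n]) auto
    qed
    obtain n :: nat and x c where 1: "y ^ n = x + c * a" "x \<in> M" using pow[OF nab(1)] by (elim exE conjE)
    obtain k :: nat and x' c' where 2: "y ^ k = x' + c' * b" "x' \<in> M" using pow[OF nab(2)] by (elim exE conjE)
    note * = 1 2
    have "y ^ (n + k) = x * (x' + c' * b) + (c * a) * x' + (c * c') * (a * b)"
      by (simp add: power_add * algebra_simps)
    also have "\<dots> \<in> M"
      by (intro ideal_setD(2)[OF M(1)] ideal_setD(3)[OF M(1) *(4)] ideal_setD(4)[OF M(1) *(2)]
        ideal_setD(3)[OF M(1) ab])
    finally show False using M(3) by blast
  qed
  then show ?thesis using M by blast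
qed

section \<open>The grading of the polynomial ring\<close>

definition wt :: "(('h \<times> nat) \<Rightarrow>\<^sub>0 nat) \<Rightarrow> nat" where
  "wt m = (\<Sum>(x, i)\<in>Poly_Mapping.keys m. Poly_Mapping.lookup m (x, i) * i)"

lemma wt_add: "wt (m + m') = wt m + wt m'"
  unfolding wt_def case_prod_beta
  using setsum_keys_plus_distrib[of "\<lambda>v k. k * snd v" m m'] by (simp add: algebra_simps)

lemma wt_single: "wt (Poly_Mapping.single (x, i) k) = k * i"
  by (cases "k = 0") (simp_all add: wt_def)

lemma wt_zero [simp]: "wt 0 = 0"
  by (simp add: wt_def)

lemma homogeneous_iff: "weighted_homogeneous n f \<longleftrightarrow> (\<forall>m\<in>Poly_Mapping.keys f. wt m = n)"
  unfolding weighted_homogeneous_def wt_def ..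

lemma homogeneous_zero: "weighted_homogeneous n 0"
  by (simp add: homogeneous_iff)

lemma homogeneous_add:
  "weighted_homogeneous n f \<Longrightarrow> weighted_homogeneous n g \<Longrightarrow> weighted_homogeneous n (f + g)"
  using keys_add[of f g] by (auto simp: homogeneous_iff)

lemma homogeneous_uminus: "weighted_homogeneous n f \<Longrightarrow> weighted_homogeneous n (- f)"
  by (simp add: homogeneous_iff)

lemma homogeneous_diff:
  "weighted_homogeneous n f \<Longrightarrow> weighted_homogeneous n g \<Longrightarrow> weighted_homogeneous n (f - g)"
  using homogeneous_add[OF _ homogeneous_uminus, of n f g] by simp

lemma homogeneous_mult:
  "weighted_homogeneous m f \<Longrightarrow> weighted_homogeneous n g \<Longrightarrow> weighted_homogeneous (m + n) (f * g)"
  using keys_mult[of f g] by (fastforce simp: homogeneous_iff wt_add)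

lemma homogeneous_const: "weighted_homogeneous 0 (const_pol c)"
  by (simp add: homogeneous_iff const_pol_def)

lemma homogeneous_one: "weighted_homogeneous 0 (1 :: ('k::field, 'h) pring)"
  using homogeneous_const[of 1] by (simp add: const_pol_def)

lemma homogeneous_X: "weighted_homogeneous i (X_pol x i)"
  by (simp add: homogeneous_iff X_pol_def wt_single)

lemma homogeneous_const_mult: "weighted_homogeneous n f \<Longrightarrow> weighted_homogeneous n (const_pol c * f)"
  using homogeneous_mult[OF homogeneous_const] by fastforce

lemma homogeneous_sum: "(\<And>a. a \<in> A \<Longrightarrow> weighted_homogeneous n (f a)) \<Longrightarrow> weighted_homogeneous n (sum f A)"
  by (induction A rule: infinite_finite_induct) (auto intro: homogeneous_zero homogeneous_add)

lemma homogeneous_tens: "(\<And>y z. weighted_homogeneous n (\<beta> y z)) \<Longrightarrow> weighted_homogeneous n (tens \<beta> xs)"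
  unfolding tens_def by (induction xs) (auto intro: homogeneous_zero homogeneous_add)

lemma homogeneous_of_nat_mult: "weighted_homogeneous n f \<Longrightarrow> weighted_homogeneous n (of_nat k * f)"
  by (induction k) (auto simp: algebra_simps intro: homogeneous_zero homogeneous_add)

definition hcomp :: "nat \<Rightarrow> ('k::field, 'h) pring \<Rightarrow> ('k, 'h) pring" where
  "hcomp n f = Abs_poly_mapping (\<lambda>m. if wt m = n then Poly_Mapping.lookup f m else 0)"

lemma lookup_hcomp: "Poly_Mapping.lookup (hcomp n f) m = (if wt m = n then Poly_Mapping.lookup f m else 0)"
proof -
  have "finite {m. (if wt m = n then Poly_Mapping.lookup f m else 0) \<noteq> 0}"
    by (rule finite_subset[of _ "Poly_Mapping.keys f"]) (auto simp: in_keys_iff split: if_splits)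
  then show ?thesis unfolding hcomp_def by (subst lookup_Abs_poly_mapping) auto
qed

lemma hcomp_add: "hcomp n (f + g) = hcomp n f + hcomp n g"
  by (rule poly_mapping_eqI) (simp add: lookup_hcomp lookup_add)

lemma hcomp_zero: "hcomp n 0 = 0"
  by (rule poly_mapping_eqI) (simp add: lookup_hcomp)

lemma hcomp_single: "hcomp n (Poly_Mapping.single m c) = (if wt m = n then Poly_Mapping.single m c else 0)"
  by (rule poly_mapping_eqI) (auto simp: lookup_hcomp lookup_single when_def)

lemma hcomp_homogeneous: "weighted_homogeneous k f \<Longrightarrow> hcomp n f = (if n = k then f else 0)"
  by (rule poly_mapping_eqI) (auto simp: lookup_hcomp homogeneous_iff in_keys_iff)

lemma homogeneous_hcomp: "weighted_homogeneous n (hcomp n f)"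
  by (auto simp: homogeneous_iff in_keys_iff lookup_hcomp split: if_splits)

text \<open>
  By bilinearity it suffices to compare monomials, whose weights add up.
\<close>

lemma hcomp_mult: "hcomp n (f * g) = (\<Sum>j\<le>n. hcomp j f * hcomp (n - j) g)"
proof (induction f rule: poly_mapping_single_induct)
  case zero
  show ?case by (simp add: hcomp_zero)
next
  case (add f k c)
  have "hcomp n (Poly_Mapping.single k c * g) = (\<Sum>j\<le>n. hcomp j (Poly_Mapping.single k c) * hcomp (n - j) g)"
  proof (induction g rule: poly_mapping_single_induct)
    case zero
    show ?case by (simp add: hcomp_zero)
  next
    case (add g l d)
    have "hcomp n (Poly_Mapping.single k c * Poly_Mapping.single l d)
      = (\<Sum>j\<le>n. hcomp j (Poly_Mapping.single k c) * hcomp (n - j) (Poly_Mapping.single l d))"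
    proof (cases "wt k + wt l = n")
      case True
      have "(\<Sum>j\<le>n. hcomp j (Poly_Mapping.single k c) * hcomp (n - j) (Poly_Mapping.single l d))
        = (\<Sum>j\<in>{wt k}. hcomp j (Poly_Mapping.single k c) * hcomp (n - j) (Poly_Mapping.single l d))"
        using True by (intro sum.mono_neutral_right) (auto simp: hcomp_single)
      then show ?thesis using True by (auto simp: hcomp_single mult_single wt_add)
    next
      case False
      have "(\<Sum>j\<le>n. hcomp j (Poly_Mapping.single k c) * hcomp (n - j) (Poly_Mapping.single l d)) = 0"
        using False by (intro sum.neutral) (auto simp: hcomp_single)
      then show ?thesis using False by (auto simp: hcomp_single mult_single wt_add)
    qed
    then show ?case using add by (simp add: distrib_left hcomp_add sum.distrib)
  qed
  then show ?case using add by (simp add: distrib_right hcomp_add sum.distrib)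
qed

lemma hcomp_vanish: "n > Max (insert 0 (wt ` Poly_Mapping.keys f)) \<Longrightarrow> hcomp n f = 0"
proof (rule poly_mapping_eqI)
  fix m assume n: "n > Max (insert 0 (wt ` Poly_Mapping.keys f))"
  show "Poly_Mapping.lookup (hcomp n f) m = Poly_Mapping.lookup 0 m"
  proof (cases "m \<in> Poly_Mapping.keys f")
    case True
    then have "wt m \<le> Max (insert 0 (wt ` Poly_Mapping.keys f))" by (intro Max_ge) auto
    then have "wt m < n" using n by (rule le_less_trans)
    then show ?thesis by (simp add: lookup_hcomp)
  qed (simp add: lookup_hcomp in_keys_iff)
qed

lemma hcomp_decompose:
  obtains N where "f = (\<Sum>n\<le>N. hcomp n f)" "\<And>n. n > N \<Longrightarrow> hcomp n f = 0"
proof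
  let ?N = "Max (insert 0 (wt ` Poly_Mapping.keys f))"
  show "hcomp n f = 0" if "n > ?N" for n using hcomp_vanish that by blast
  show "f = (\<Sum>n\<le>?N. hcomp n f)"
  proof (rule poly_mapping_eqI)
    fix m
    show "Poly_Mapping.lookup f m = Poly_Mapping.lookup (\<Sum>n\<le>?N. hcomp n f) m"
    proof (cases "m \<in> Poly_Mapping.keys f")
      case True
      then have "wt m \<le> ?N" by (intro Max_ge) auto
      then show ?thesis by (simp add: lookup_sum lookup_hcomp)
    qed (simp add: lookup_sum lookup_hcomp in_keys_iff)
  qed
qed

text \<open>
  The elements all of whose components lie in \<open>P\<close> form the largest homogeneous ideal in \<open>P\<close>.  It is prime:
  in a product of two elements outside it, the product of the highest components outside \<open>P\<close> is
  congruent modulo \<open>P\<close> to a component of the product.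
\<close>

lemma homogeneous_core_prime:
  assumes P: "ideal_set P" and prime: "\<And>a b. a * b \<in> P \<Longrightarrow> a \<in> P \<or> b \<in> P"
  defines "C \<equiv> {f. \<forall>n. hcomp n f \<in> P}"
  shows "ideal_set C" "f * g \<in> C \<Longrightarrow> f \<in> C \<or> g \<in> C"
proof -
  show "ideal_set C" unfolding ideal_set_def C_def using ideal_setD[OF P]
    by (auto simp: hcomp_zero hcomp_add hcomp_mult intro!: ideal_set_sum[OF P])
  show "f \<in> C \<or> g \<in> C" if fg: "f * g \<in> C"
  proof (rule ccontr)
    assume nfg: "\<not> (f \<in> C \<or> g \<in> C)"
    have top: "\<exists>m. hcomp m f \<notin> P \<and> (\<forall>j>m. hcomp j f \<in> P)" if "f \<notin> C" for f
    proof -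
      obtain N where N: "\<And>n. n > N \<Longrightarrow> hcomp n f = 0" using hcomp_decompose by blast
      let ?A = "{n. hcomp n f \<notin> P}"
      have "?A \<subseteq> {..N}" using N ideal_setD(1)[OF P] by (force simp: not_less)
      then have fin: "finite ?A" by (rule finite_subset) simp
      have ne: "?A \<noteq> {}" using that by (auto simp: C_def)
      have "hcomp (Max ?A) f \<notin> P" using Max_in[OF fin ne] by simp
      moreover have "hcomp j f \<in> P" if "j > Max ?A" for j using Max_ge[OF fin, of j] that by (auto simp: not_less)
      ultimately show ?thesis by blast
    qed
    obtain m where m: "hcomp m f \<notin> P" "\<forall>j>m. hcomp j f \<in> P" using top[of f] nfg by blast
    obtain k where k: "hcomp k g \<notin> P" "\<forall>j>k. hcomp j g \<in> P" using top[of g] nfg by blast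
    let ?rest = "\<Sum>j\<in>{..m + k} - {m}. hcomp j f * hcomp (m + k - j) g"
    have "hcomp (m + k) (f * g) = hcomp m f * hcomp k g + ?rest"
      unfolding hcomp_mult by (subst sum.remove[of _ m]) auto
    then have eq: "hcomp m f * hcomp k g = hcomp (m + k) (f * g) - ?rest" by simp
    have rest: "?rest \<in> P"
    proof (rule ideal_set_sum[OF P])
      fix j assume j: "j \<in> {..m + k} - {m}"
      show "hcomp j f * hcomp (m + k - j) g \<in> P"
      proof (cases "j > m")
        case True
        then show ?thesis using m(2) ideal_setD(4)[OF P] by blast
      next
        case False
        then have "m + k - j > k" using j by auto
        then show ?thesis using k(2) ideal_setD(3)[OF P] by blast
      qed
    qed
    have "hcomp (m + k) (f * g) \<in> P" using fg by (simp add: C_def)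
    then have "hcomp m f * hcomp k g \<in> P" unfolding eq using rest by (rule ideal_setD(6)[OF P])
    then show False using prime m(1) k(1) by blast
  qed
qed

section \<open>The coordinate ring as a quotient of the polynomial ring\<close>

context
  fixes G :: "('k::field, 'h::comm_ring_1) group_scheme" and r :: nat
begin

abbreviation "VI \<equiv> V_ideal G r"

definition pol_class :: "('k, 'h) pring \<Rightarrow> ('k, 'h) pring set set" where
  "pol_class f = red_class G r (coord_class G r f)"

lemma VI_ideal_set: "ideal_set VI"
proof -
  interpret I: ideal VI "ring_of_type_algebra :: ('k, 'h) pring ring" by (rule V_ideal_ideal)
  show ?thesis unfolding ideal_set_def
    using additive_subgroup.zero_closed[OF I.additive_subgroup_axioms]
      additive_subgroup.a_closed[OF I.additive_subgroup_axioms] I.I_l_closed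
    by (simp add: ring_of_type_simps)
qed

lemma VI_relation: "f \<in> V_relations G r \<Longrightarrow> f \<in> VI"
proof -
  assume "f \<in> V_relations G r"
  interpret ring "ring_of_type_algebra :: ('k, 'h) pring ring" by (rule ring_from_type_algebra)
  show ?thesis using genideal_self[of "V_relations G r"] \<open>f \<in> _\<close>
    by (auto simp: V_ideal_def ring_of_type_simps)
qed

lemma VI_minimal:
  assumes I: "ideal_set I" and "V_relations G r \<subseteq> I"
  shows "VI \<subseteq> I"
proof -
  interpret ring "ring_of_type_algebra :: ('k, 'h) pring ring" by (rule ring_from_type_algebra)
  have "ideal I (ring_of_type_algebra :: ('k, 'h) pring ring)"
  proof (rule idealI)
    show "ring (ring_of_type_algebra :: ('k, 'h) pring ring)" by (rule ring_axioms)
    show "subgroup I (add_monoid (ring_of_type_algebra :: ('k, 'h) pring ring))"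
    proof (rule group.subgroupI[OF add.is_group])
      show "I \<noteq> {}" using ideal_setD(1)[OF I] by blast
      show "inv\<^bsub>add_monoid ring_of_type_algebra\<^esub> f \<in> I" if f: "f \<in> I" for f :: "('k, 'h) pring"
      proof -
        have "f + (\<ominus>\<^bsub>ring_of_type_algebra\<^esub> f) = 0" using r_neg[of f] by (simp add: ring_of_type_simps)
        then have "\<ominus>\<^bsub>ring_of_type_algebra\<^esub> f = - f" by (metis add_eq_0_iff)
        then show ?thesis using ideal_setD(5)[OF I f] by (simp add: a_inv_def)
      qed
    qed (use ideal_setD[OF I] in \<open>auto simp: ring_of_type_simps\<close>)
  qed (use ideal_setD[OF I] in \<open>auto simp: ring_of_type_simps\<close>)
  then show ?thesis unfolding V_ideal_def using assms(2) by (intro genideal_minimal)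
qed

text \<open>
  The comultiplication relation has degree \<open>j + l\<close> and the counit relation degree \<open>0\<close>; the others are evident.
\<close>

lemma V_relations_homogeneous: "f \<in> V_relations G r \<Longrightarrow> \<exists>n. weighted_homogeneous n f"
  unfolding V_relations_def Let_def
proof (elim UnE CollectE exE conjE)
  fix x i assume "f = X_pol x i"
  then show ?thesis by (auto intro: homogeneous_X)
next
  fix x y i assume "f = X_pol (x + y) i - (X_pol x i + X_pol y i)"
  then show ?thesis by (auto intro!: exI[of _ i] homogeneous_diff homogeneous_add homogeneous_X)
next
  fix c x i assume "f = X_pol (scl G c x) i - const_pol c * X_pol x i"
  then show ?thesis by (auto intro!: exI[of _ i] homogeneous_diff homogeneous_const_mult homogeneous_X)
next
  fix i assume "f = X_pol 1 i - (if i = 0 then 1 else 0)"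
  then show ?thesis by (auto intro!: exI[of _ i] homogeneous_diff homogeneous_X homogeneous_one homogeneous_zero)
next
  fix x y i assume f: "f = X_pol (x * y) i - (\<Sum>j\<le>i. X_pol x j * X_pol y (i - j))"
  have "weighted_homogeneous i (X_pol x j * X_pol y (i - j))" if "j \<le> i" for j
    using homogeneous_mult[OF homogeneous_X[of j x] homogeneous_X[of "i - j" y]] that by simp
  then show ?thesis unfolding f by (auto intro!: exI[of _ i] homogeneous_diff homogeneous_X homogeneous_sum)
next
  fix x j l assume "f = of_nat ((j + l) choose j) * X_pol x (j + l) - tens (\<lambda>y z. X_pol y j * X_pol z l) (comul G x)"
  then show ?thesis
    by (auto intro!: exI[of _ "j + l"] homogeneous_diff homogeneous_of_nat_mult homogeneous_tens homogeneous_mult homogeneous_X)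
next
  fix x assume "f = X_pol x 0 - const_pol (counit G x)"
  then show ?thesis by (auto intro!: exI[of _ 0] homogeneous_diff homogeneous_X homogeneous_const)
qed

text \<open>
  An ideal generated by homogeneous elements contains the components of its elements.
\<close>

lemma VI_hcomp: "f \<in> VI \<Longrightarrow> hcomp n f \<in> VI"
proof -
  assume "f \<in> VI"
  let ?C = "{f. \<forall>n. hcomp n f \<in> VI}"
  have "ideal_set ?C" unfolding ideal_set_def using ideal_setD[OF VI_ideal_set]
    by (auto simp: hcomp_zero hcomp_add hcomp_mult intro!: ideal_set_sum[OF VI_ideal_set])
  moreover have "V_relations G r \<subseteq> ?C"
  proof clarify
    fix f n assume f: "f \<in> V_relations G r"
    then obtain k where "weighted_homogeneous k f" using V_relations_homogeneous by blast
    then show "hcomp n f \<in> VI"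
      using VI_relation[OF f] ideal_setD(1)[OF VI_ideal_set] by (simp add: hcomp_homogeneous)
  qed
  ultimately show ?thesis using VI_minimal \<open>f \<in> VI\<close> by blast
qed

lemma coord_class_facts:
  "cring (coord_ring G r)" "carrier (coord_ring G r) = range (coord_class G r)"
  "coord_class G r (f + g) = coord_class G r f \<oplus>\<^bsub>coord_ring G r\<^esub> coord_class G r g"
  "coord_class G r (f * g) = coord_class G r f \<otimes>\<^bsub>coord_ring G r\<^esub> coord_class G r g"
  "coord_class G r 1 = \<one>\<^bsub>coord_ring G r\<^esub>" "coord_class G r f = \<zero>\<^bsub>coord_ring G r\<^esub> \<longleftrightarrow> f \<in> VI"
proof -
  let ?S = "ring_of_type_algebra :: ('k, 'h) pring ring"
  interpret I: ideal VI ?S by (rule V_ideal_ideal)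
  have "cring ?S" by (rule cring_from_type_algebra)
  then show "cring (coord_ring G r)" unfolding coord_ring_def by (rule I.quotient_is_cring)
  have cl: "coord_class G r \<in> ring_hom ?S (coord_ring G r)"
    using I.rcos_ring_hom by (simp add: coord_class_def[abs_def] coord_ring_def)
  have "carrier ?S = UNIV" by (simp add: ring_of_type_simps)
  then show "carrier (coord_ring G r) = range (coord_class G r)"
    by (auto simp: coord_ring_def FactRing_def A_RCOSETS_def' coord_class_def)
  show "coord_class G r (f + g) = coord_class G r f \<oplus>\<^bsub>coord_ring G r\<^esub> coord_class G r g"
    using ring_hom_add[OF cl, of f g] by (simp add: ring_of_type_simps)
  show "coord_class G r (f * g) = coord_class G r f \<otimes>\<^bsub>coord_ring G r\<^esub> coord_class G r g"
    using ring_hom_mult[OF cl, of f g] by (simp add: ring_of_type_simps)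
  show "coord_class G r 1 = \<one>\<^bsub>coord_ring G r\<^esub>"
    using ring_hom_one[OF cl] by (simp add: ring_of_type_simps)
  have z: "\<zero>\<^bsub>coord_ring G r\<^esub> = VI" by (simp add: coord_ring_def FactRing_def)
  show "coord_class G r f = \<zero>\<^bsub>coord_ring G r\<^esub> \<longleftrightarrow> f \<in> VI"
    unfolding z coord_class_def using I.a_rcos_const[of f] I.a_rcos_self[of f] by (auto simp: ring_of_type_simps)
qed

lemma coord_pow: "coord_class G r f [^]\<^bsub>coord_ring G r\<^esub> n = coord_class G r (f ^ n)"
proof -
  interpret cring "coord_ring G r" by (rule coord_class_facts(1))
  show ?thesis by (induction n) (simp_all add: coord_class_facts(4,5) m_comm coord_class_facts(2) mult.commute)
qed

lemma nilradical_eq: "nilradical (coord_ring G r) = coord_class G r ` {f. \<exists>n. f ^ n \<in> VI}"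
proof -
  have "coord_class G r f [^]\<^bsub>coord_ring G r\<^esub> n = \<zero>\<^bsub>coord_ring G r\<^esub> \<longleftrightarrow> f ^ n \<in> VI" for f and n :: nat
    by (simp add: coord_pow coord_class_facts(6))
  then show ?thesis unfolding nilradical_def coord_class_facts(2) by blast
qed

lemma radical_ideal_set: "ideal_set {f. \<exists>n. f ^ n \<in> VI}"
proof -
  note V = ideal_setD[OF VI_ideal_set]
  show ?thesis unfolding ideal_set_def
  proof (intro conjI ballI allI)
    show "0 \<in> {f. \<exists>n. f ^ n \<in> VI}" using V(1) by (auto intro: exI[of _ 1])
    fix f assume "f \<in> {f. \<exists>n. f ^ n \<in> VI}"
    then obtain n where n: "f ^ n \<in> VI" by auto
    show "c * f \<in> {f. \<exists>n. f ^ n \<in> VI}" for c using V(3)[OF n, of "c ^ n"] by (auto simp: power_mult_distrib)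
    fix g assume "g \<in> {f. \<exists>n. f ^ n \<in> VI}"
    then obtain k where k: "g ^ k \<in> VI" by auto
    have "(f + g) ^ (n + k) \<in> VI" unfolding binomial_ring
    proof (rule ideal_set_sum[OF VI_ideal_set])
      fix j assume j: "j \<in> {..n + k}"
      show "of_nat (n + k choose j) * f ^ j * g ^ (n + k - j) \<in> VI"
      proof (cases "n \<le> j")
        case True
        then have "f ^ j = f ^ n * f ^ (j - n)" by (simp flip: power_add)
        then have "f ^ j \<in> VI" using V(4)[OF n] by simp
        then show ?thesis using V(3,4) by blast
      next
        case False
        then have "n + k - j = k + (n - j)" by simp
        then have "g ^ (n + k - j) = g ^ k * g ^ (n - j)" by (simp add: power_add)
        then have "g ^ (n + k - j) \<in> VI" using V(4)[OF k] by simp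
        then show ?thesis using V(3) by blast
      qed
    qed
    then show "f + g \<in> {f. \<exists>n. f ^ n \<in> VI}" by blast
  qed
qed

end

section \<open>The reduced coordinate ring\<close>

lemma image_ideal:
  fixes \<pi> :: "'p::comm_ring_1 \<Rightarrow> 'a"
  assumes R: "cring R" and carr: "carrier R = range \<pi>" and add: "\<And>x y. \<pi> (x + y) = \<pi> x \<oplus>\<^bsub>R\<^esub> \<pi> y"
    and mult: "\<And>x y. \<pi> (x * y) = \<pi> x \<otimes>\<^bsub>R\<^esub> \<pi> y" and I: "ideal_set I"
  shows "ideal (\<pi> ` I) R"
proof -
  interpret cring R by (rule R)
  have c: "\<pi> x \<in> carrier R" for x using carr by blast
  have z: "\<pi> 0 = \<zero>\<^bsub>R\<^esub>" using add[of 0 0] c[of 0] by (metis add.r_cancel_one' add_0)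
  show ?thesis
  proof (rule idealI)
    show "ring R" by (rule ring_axioms)
    show "subgroup (\<pi> ` I) (add_monoid R)"
    proof (rule group.subgroupI[OF add.is_group])
      show "\<pi> ` I \<subseteq> carrier (add_monoid R)" using c by auto
      show "\<pi> ` I \<noteq> {}" using ideal_setD(1)[OF I] by blast
      show "inv\<^bsub>add_monoid R\<^esub> u \<in> \<pi> ` I" if u: "u \<in> \<pi> ` I" for u
      proof -
        obtain x where x: "u = \<pi> x" "x \<in> I" using u by blast
        have "\<pi> (- x) \<oplus>\<^bsub>R\<^esub> \<pi> x = \<zero>\<^bsub>R\<^esub>" using add[of "- x" x] z by simp
        then have "\<ominus>\<^bsub>R\<^esub> \<pi> x = \<pi> (- x)" by (intro minus_equality) (simp_all add: c)
        then show ?thesis using ideal_setD(5)[OF I x(2)] x(1) by (simp add: a_inv_def)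
      qed
      show "u \<otimes>\<^bsub>add_monoid R\<^esub> v \<in> \<pi> ` I" if "u \<in> \<pi> ` I" "v \<in> \<pi> ` I" for u v
      proof -
        obtain x y where "u = \<pi> x" "x \<in> I" "v = \<pi> y" "y \<in> I" using \<open>u \<in> _\<close> \<open>v \<in> _\<close> by blast
        then show ?thesis using ideal_setD(2)[OF I, of x y] by (simp add: add[symmetric])
      qed
    qed
    fix u a assume u: "u \<in> \<pi> ` I" "a \<in> carrier R"
    then obtain x c where x: "u = \<pi> x" "x \<in> I" "a = \<pi> c" using carr by blast
    show "a \<otimes>\<^bsub>R\<^esub> u \<in> \<pi> ` I" using ideal_setD(3)[OF I x(2), of c] x by (simp add: mult[symmetric])
    show "u \<otimes>\<^bsub>R\<^esub> a \<in> \<pi> ` I" using ideal_setD(4)[OF I x(2), of c] x by (simp add: mult[symmetric])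
  qed
qed

lemma preimage_ideal_set:
  fixes \<pi> :: "'p::comm_ring_1 \<Rightarrow> 'a"
  assumes R: "cring R" and carr: "carrier R = range \<pi>" and add: "\<And>x y. \<pi> (x + y) = \<pi> x \<oplus>\<^bsub>R\<^esub> \<pi> y"
    and mult: "\<And>x y. \<pi> (x * y) = \<pi> x \<otimes>\<^bsub>R\<^esub> \<pi> y" and J: "ideal J R"
  shows "ideal_set {x. \<pi> x \<in> J}"
proof -
  interpret cring R by (rule R)
  interpret J: ideal J R by (rule J)
  have c: "\<pi> x \<in> carrier R" for x using carr by blast
  have z: "\<pi> 0 = \<zero>\<^bsub>R\<^esub>" using add[of 0 0] c[of 0] by (metis add.r_cancel_one' add_0)
  show ?thesis unfolding ideal_set_def by (auto simp: z add mult c J.I_l_closed)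
qed

lemma quotient_presentation:
  fixes \<pi> :: "'p::comm_ring_1 \<Rightarrow> 'a"
  assumes R: "cring R" and carr: "carrier R = range \<pi>" and add: "\<And>x y. \<pi> (x + y) = \<pi> x \<oplus>\<^bsub>R\<^esub> \<pi> y"
    and mult: "\<And>x y. \<pi> (x * y) = \<pi> x \<otimes>\<^bsub>R\<^esub> \<pi> y" and one: "\<pi> 1 = \<one>\<^bsub>R\<^esub>" and J: "ideal J R"
  defines "\<psi> \<equiv> \<lambda>x. J +>\<^bsub>R\<^esub> \<pi> x"
  shows "cring (R Quot J)" "carrier (R Quot J) = range \<psi>" "\<psi> (x + y) = \<psi> x \<oplus>\<^bsub>R Quot J\<^esub> \<psi> y"
    "\<psi> (x * y) = \<psi> x \<otimes>\<^bsub>R Quot J\<^esub> \<psi> y" "\<psi> 1 = \<one>\<^bsub>R Quot J\<^esub>" "\<psi> x = \<zero>\<^bsub>R Quot J\<^esub> \<longleftrightarrow> \<pi> x \<in> J"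
proof -
  interpret J: ideal J R by (rule J)
  have c: "\<pi> x \<in> carrier R" for x using carr by blast
  show "cring (R Quot J)" by (rule J.quotient_is_cring[OF R])
  show "carrier (R Quot J) = range \<psi>" unfolding \<psi>_def FactRing_def A_RCOSETS_def' carr by auto
  note h = J.rcos_ring_hom
  show "\<psi> (x + y) = \<psi> x \<oplus>\<^bsub>R Quot J\<^esub> \<psi> y" unfolding \<psi>_def add by (rule ring_hom_add[OF h c c])
  show "\<psi> (x * y) = \<psi> x \<otimes>\<^bsub>R Quot J\<^esub> \<psi> y" unfolding \<psi>_def mult by (rule ring_hom_mult[OF h c c])
  show "\<psi> 1 = \<one>\<^bsub>R Quot J\<^esub>" unfolding \<psi>_def one by (rule ring_hom_one[OF h])
  have z: "\<zero>\<^bsub>R Quot J\<^esub> = J" by (simp add: FactRing_def)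
  show "\<psi> x = \<zero>\<^bsub>R Quot J\<^esub> \<longleftrightarrow> \<pi> x \<in> J"
    unfolding z \<psi>_def using J.a_rcos_const[of "\<pi> x"] J.a_rcos_self[OF c[of x]] by auto
qed

context
  fixes G :: "('k::field, 'h::comm_ring_1) group_scheme" and r :: nat
begin

lemma relations_mem:
  "CHAR('k) ^ r \<le> i \<Longrightarrow> X_pol x i \<in> V_ideal G r"
  "X_pol (x + y) i - (X_pol x i + X_pol y i) \<in> V_ideal G r"
  "X_pol (scl G c x) i - const_pol c * X_pol x i \<in> V_ideal G r"
  "X_pol 1 i - (if i = 0 then 1 else 0) \<in> V_ideal G r"
  "i < CHAR('k) ^ r \<Longrightarrow> X_pol (x * y) i - (\<Sum>j\<le>i. X_pol x j * X_pol y (i - j)) \<in> V_ideal G r"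
  "j < CHAR('k) ^ r \<Longrightarrow> l < CHAR('k) ^ r \<Longrightarrow> of_nat ((j + l) choose j) * X_pol x (j + l)
     - tens (\<lambda>y z. X_pol y j * X_pol z l) (comul G x) \<in> V_ideal G r"
  "X_pol x 0 - const_pol (counit G x) \<in> V_ideal G r"
  by (rule VI_relation, unfold V_relations_def Let_def, blast)+

lemma nilradical_ideal: "ideal (nilradical (coord_ring G r)) (coord_ring G r)"
  unfolding nilradical_eq using coord_class_facts[of G r] radical_ideal_set[of G r]
  by (intro image_ideal[where \<pi> = "coord_class G r"]) auto

lemma pol_class_facts:
  "cring (red_ring G r)" "carrier (red_ring G r) = range (pol_class G r)"
  "pol_class G r (f + g) = pol_class G r f \<oplus>\<^bsub>red_ring G r\<^esub> pol_class G r g"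
  "pol_class G r (f * g) = pol_class G r f \<otimes>\<^bsub>red_ring G r\<^esub> pol_class G r g"
  "pol_class G r 1 = \<one>\<^bsub>red_ring G r\<^esub>"
  "pol_class G r f = \<zero>\<^bsub>red_ring G r\<^esub> \<longleftrightarrow> (\<exists>n. f ^ n \<in> V_ideal G r)"
proof -
  have p: "pol_class G r f = nilradical (coord_ring G r) +>\<^bsub>coord_ring G r\<^esub> coord_class G r f" for f
    by (simp add: pol_class_def red_class_def)
  note q = quotient_presentation[of "coord_ring G r" "coord_class G r", OF coord_class_facts(1-5) nilradical_ideal,
      folded p red_ring_def]
  show "cring (red_ring G r)" "carrier (red_ring G r) = range (pol_class G r)"
    "pol_class G r (f + g) = pol_class G r f \<oplus>\<^bsub>red_ring G r\<^esub> pol_class G r g"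
    "pol_class G r (f * g) = pol_class G r f \<otimes>\<^bsub>red_ring G r\<^esub> pol_class G r g"
    "pol_class G r 1 = \<one>\<^bsub>red_ring G r\<^esub>"
    by (rule q)+
  have "coord_class G r f \<in> nilradical (coord_ring G r) \<longleftrightarrow> (\<exists>n::nat. coord_class G r f [^]\<^bsub>coord_ring G r\<^esub> n = \<zero>\<^bsub>coord_ring G r\<^esub>)"
    unfolding nilradical_def coord_class_facts(2) by blast
  also have "\<dots> \<longleftrightarrow> (\<exists>n. f ^ n \<in> V_ideal G r)" unfolding coord_pow coord_class_facts(6) ..
  finally show "pol_class G r f = \<zero>\<^bsub>red_ring G r\<^esub> \<longleftrightarrow> (\<exists>n. f ^ n \<in> V_ideal G r)" using q(6)[of f] by blast
qed

lemma pol_class_zero: "f \<in> V_ideal G r \<Longrightarrow> pol_class G r f = \<zero>\<^bsub>red_ring G r\<^esub>"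
  unfolding pol_class_facts(6) by (rule exI[of _ 1]) simp

lemma red_presentation:
  "graded_presentation (red_ring G r) (red_grading G r) (pol_class G r) (\<lambda>n. {f. weighted_homogeneous n f})"
proof (rule graded_presentation.intro[OF pol_class_facts(1)], unfold_locales)
  show "red_grading G r n = pol_class G r ` {f. weighted_homogeneous n f}" for n
    unfolding red_grading_def pol_class_def ..
qed (simp_all add: pol_class_facts(2-5) homogeneous_zero homogeneous_add homogeneous_uminus homogeneous_mult homogeneous_one)

text \<open>
  If \<open>f x\<close> is not nilpotent, then some prime ideal avoids its powers, and so does its homogeneous core.
  The core contains neither \<open>f\<close> nor \<open>x\<close>; because \<open>f\<close> has positive degree, it is a point of Proj.
\<close>

lemma red_vanishing:
  assumes x: "weighted_homogeneous m x" and f: "weighted_homogeneous e f" "0 < e"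
    and van: "\<And>Q. Q \<in> Proj (red_ring G r) (red_grading G r) \<Longrightarrow> pol_class G r f \<notin> Q \<Longrightarrow> pol_class G r x \<in> Q"
  shows "pol_class G r (f * x) = \<zero>\<^bsub>red_ring G r\<^esub>"
proof (rule ccontr)
  assume "pol_class G r (f * x) \<noteq> \<zero>\<^bsub>red_ring G r\<^esub>"
  then have "(f * x) ^ n \<notin> V_ideal G r" for n using pol_class_facts(6) by blast
  from prime_avoiding_powers[OF VI_ideal_set this]
  obtain P where P: "ideal_set P" "V_ideal G r \<subseteq> P" "\<forall>n::nat. (f * x) ^ n \<notin> P"
    and prime: "\<forall>a b. a * b \<in> P \<longrightarrow> a \<in> P \<or> b \<in> P" by (elim exE conjE)
  have "f * x \<notin> P" using P(3)[rule_format, of 1] by simp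
  then have fP: "f \<notin> P" and xP: "x \<notin> P" using ideal_setD(3,4)[OF P(1)] by blast+
  define C where "C = {f. \<forall>n. hcomp n f \<in> P}"
  have CI: "ideal_set C" unfolding C_def by (rule homogeneous_core_prime(1)[OF P(1)]) (use prime in simp)
  have Cp: "g * h \<in> C \<Longrightarrow> g \<in> C \<or> h \<in> C" for g h
    unfolding C_def by (rule homogeneous_core_prime(2)[OF P(1)]) (use prime in simp_all)
  have VC: "V_ideal G r \<subseteq> C" using VI_hcomp P(2) unfolding C_def by blast
  have hC: "g \<in> C \<longleftrightarrow> g \<in> P" if "weighted_homogeneous k g" for g k
    unfolding C_def using hcomp_homogeneous[OF that] ideal_setD(1)[OF P(1)] by auto
  \<comment> \<open>Primeness also makes the core contain the kernel of the projection to the reduced ring.\<close>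
  have Cpow: "g \<in> C" if "g ^ n \<in> C" for g and n :: nat
    using that
  proof (induction n)
    case 0
    then have "1 * g \<in> C" by (intro ideal_setD(4)[OF CI]) simp
    then show ?case by simp
  next
    case (Suc n)
    then show ?case using Cp[of g "g ^ n"] by auto
  qed
  interpret red: graded_presentation "red_ring G r" "red_grading G r" "pol_class G r" "\<lambda>n. {f. weighted_homogeneous n f}"
    by (rule red_presentation)
  have memC: "pol_class G r g \<in> pol_class G r ` C \<longleftrightarrow> g \<in> C" for g
  proof
    assume "pol_class G r g \<in> pol_class G r ` C"
    then obtain c where c: "c \<in> C" "pol_class G r g = pol_class G r c" by blast
    have "pol_class G r (g - c) \<oplus>\<^bsub>red_ring G r\<^esub> pol_class G r c = pol_class G r c"
      using c(2) red.\<pi>_add[of "g - c" c] by simp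
    then have "pol_class G r (g - c) = \<zero>\<^bsub>red_ring G r\<^esub>"
      using red.add.r_cancel_one'[of "pol_class G r (g - c)" "pol_class G r c"] by simp
    then obtain n where "(g - c) ^ n \<in> V_ideal G r" using pol_class_facts(6) by blast
    then have "g - c \<in> C" using VC Cpow by blast
    then show "g \<in> C" using ideal_setD(2)[OF CI _ c(1)] by fastforce
  qed blast
  let ?Q = "pol_class G r ` C"
  have Q: "ideal ?Q (red_ring G r)"
    by (rule image_ideal[OF pol_class_facts(1,2) _ _ CI]) (simp_all add: pol_class_facts(3,4))
  have QP: "primeideal ?Q (red_ring G r)"
  proof (rule primeidealI[OF Q pol_class_facts(1)])
    show "carrier (red_ring G r) \<noteq> ?Q" using memC[of f] hC[OF f(1)] fP red.\<pi>_closed[of f] by metis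
    fix a b assume "a \<in> carrier (red_ring G r)" "b \<in> carrier (red_ring G r)" and ab: "a \<otimes>\<^bsub>red_ring G r\<^esub> b \<in> ?Q"
    then obtain g h where g: "a = pol_class G r g" "b = pol_class G r h" unfolding pol_class_facts(2) by blast
    then have "g * h \<in> C" using ab memC[of "g * h"] by (simp add: pol_class_facts(4))
    then show "a \<in> ?Q \<or> b \<in> ?Q" using Cp g by blast
  qed
  let ?S = "?Q \<inter> (\<Union>n. red_grading G r n)"
  have Scar: "?S \<subseteq> carrier (red_ring G r)" by auto
  have gen: "?Q = genideal (red_ring G r) ?S"
  proof (rule subset_antisym)
    show "genideal (red_ring G r) ?S \<subseteq> ?Q" by (rule red.genideal_minimal[OF Q]) blast
    show "?Q \<subseteq> genideal (red_ring G r) ?S"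
    proof
      fix u assume "u \<in> ?Q"
      then obtain g where g: "u = pol_class G r g" "g \<in> C" by blast
      note J = preimage_ideal_set[OF pol_class_facts(1,2) _ _ red.genideal_ideal[OF Scar]]
      have JI: "ideal_set {x. pol_class G r x \<in> genideal (red_ring G r) ?S}"
        by (rule J) (simp_all add: pol_class_facts(3,4))
      obtain N where N: "g = (\<Sum>n\<le>N. hcomp n g)" using hcomp_decompose by blast
      have "(\<Sum>n\<le>N. hcomp n g) \<in> {x. pol_class G r x \<in> genideal (red_ring G r) ?S}"
      proof (rule ideal_set_sum[OF JI])
        fix n
        have "hcomp n g \<in> C" using hC[OF homogeneous_hcomp[of n g]] g(2) by (auto simp: C_def)
        moreover have "pol_class G r (hcomp n g) \<in> red_grading G r n"
          unfolding red.D_eq using homogeneous_hcomp[of n g] by blast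
        ultimately have "pol_class G r (hcomp n g) \<in> ?S" by blast
        then show "hcomp n g \<in> {x. pol_class G r x \<in> genideal (red_ring G r) ?S}"
          using red.genideal_self[OF Scar] by blast
      qed
      then show "u \<in> genideal (red_ring G r) ?S" using N g(1) by simp
    qed
  qed
  have fQ: "pol_class G r f \<notin> ?Q" unfolding memC hC[OF f(1)] by (rule fP)
  have "pol_class G r f \<in> red_grading G r e" unfolding red.D_eq using f(1) by blast
  then have "\<not> (\<Union>n\<in>{0<..}. red_grading G r n) \<subseteq> ?Q" using fQ f(2) by blast
  then have "?Q \<in> Proj (red_ring G r) (red_grading G r)" unfolding Proj_def using QP gen by simp
  from van[OF this fQ] have "x \<in> P" unfolding memC hC[OF x] .
  then show False using xP by blast
qed

end

lemma homogeneous_power: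
  fixes f :: "('k::field, 'h) pring"
  shows "weighted_homogeneous n f \<Longrightarrow> weighted_homogeneous (k * n) (f ^ k)"
  by (induction k) (auto intro: homogeneous_one homogeneous_mult)

lemma const_pol_simps:
  "const_pol 0 = 0" "const_pol 1 = 1" "const_pol (a + b) = const_pol a + const_pol b"
  "const_pol (a * b) = const_pol a * const_pol b"
  by (simp_all add: const_pol_def single_add mult_single)

lemma const_pol_of_nat: "const_pol (of_nat n) = of_nat n"
  by (induction n) (simp_all add: const_pol_simps)

lemma ideal_set_tens: "ideal_set I \<Longrightarrow> (\<And>y z. \<beta> y z \<in> I) \<Longrightarrow> tens \<beta> xs \<in> I"
  unfolding tens_def by (induction xs) (auto simp: ideal_setD)

lemma monomial_mem_ideal:
  fixes I :: "('k::field, 'h) pring set"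
  assumes I: "ideal_set I" and XI: "\<And>x i. 0 < i \<Longrightarrow> X_pol x i \<in> I" and m: "0 < wt m"
  shows "Poly_Mapping.single m c \<in> I"
proof -
  have "wt m \<noteq> 0" using m by simp
  then obtain v where v: "v \<in> Poly_Mapping.keys m" "Poly_Mapping.lookup m v * snd v \<noteq> 0"
    unfolding wt_def case_prod_beta by (elim sum.not_neutral_contains_not_neutral) simp
  let ?s = "Poly_Mapping.single v (1::nat)"
  have m': "?s + (m - ?s) = m"
    using v by (intro poly_mapping_eqI) (auto simp: lookup_add lookup_minus lookup_single when_def in_keys_iff)
  have "X_pol (fst v) (snd v) * Poly_Mapping.single (m - ?s) c \<in> I"
    using v by (intro ideal_setD(4)[OF I] XI) simp
  then show ?thesis by (simp add: X_pol_def mult_single m'[simplified])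
qed

lemma homogeneous_mem_ideal:
  fixes I :: "('k::field, 'h) pring set"
  assumes I: "ideal_set I" and XI: "\<And>x i. 0 < i \<Longrightarrow> X_pol x i \<in> I"
    and f: "weighted_homogeneous n f" "0 < n"
  shows "f \<in> I"
proof -
  have "hcomp n g \<in> I" for g
  proof (induction g rule: poly_mapping_single_induct)
    case zero
    show ?case by (simp add: hcomp_zero ideal_setD(1)[OF I])
  next
    case (add g k c)
    have "hcomp n (Poly_Mapping.single k c) \<in> I"
      using monomial_mem_ideal[OF I XI, of k c] f(2) ideal_setD(1)[OF I] by (auto simp: hcomp_single)
    then show ?case unfolding hcomp_add using add by (intro ideal_setD(2)[OF I])
  qed
  from this[of f] show ?thesis using hcomp_homogeneous[OF f(1), of n] by simp
qed

text \<open>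
  Here \<open>i = p\<^sup>v m\<close> with \<open>m\<close> prime to \<open>p\<close>, and \<open>p\<^sup>v m choose p\<^sup>v\<close> has the same multiplicity of \<open>p\<close> as \<open>m\<close>.
\<close>

lemma not_dvd_binomial_prime_power:
  assumes p: "Factorial_Ring.prime p" and i: "0 < i"
  shows "p ^ multiplicity p i \<le> i" "\<not> p dvd (i choose p ^ multiplicity p i)"
proof -
  let ?v = "multiplicity p i"
  have "p ^ ?v dvd i" by (rule multiplicity_dvd)
  then obtain m where m: "i = p ^ ?v * m" by (elim dvdE)
  show "p ^ ?v \<le> i" using \<open>p ^ ?v dvd i\<close> i by (rule dvd_imp_le)
  have m0: "m > 0" using m i by (cases m) auto
  have "multiplicity p i = ?v + multiplicity p m"
    using p m0 by (subst m) (simp add: prime_elem_multiplicity_mult_distrib prime_gt_0_nat)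
  then have "multiplicity p m = 0" by simp
  moreover have "multiplicity p (p ^ ?v * m choose p ^ ?v) = multiplicity p m"
    by (rule const_p_fac[OF m0 p])
  ultimately have "multiplicity p (i choose p ^ ?v) = 0" using m by simp
  moreover have "(i choose p ^ ?v) \<noteq> 0" using \<open>p ^ ?v \<le> i\<close> by simp
  ultimately show "\<not> p dvd (i choose p ^ ?v)"
    using multiplicity_eq_zero_iff[of "i choose p ^ ?v" p] prime_gt_1_nat[OF p] by simp
qed

context
  fixes G :: "('k::field, 'h::comm_ring_1) group_scheme" and r :: nat
  assumes char: "CHAR('k) > 0" and r: "r \<ge> 1"
begin

text \<open>
  Let \<open>p\<^sup>v\<close> be the exact power of \<open>p\<close> that divides \<open>i\<close>.  The comultiplication relation in degrees \<open>p\<^sup>v\<close> and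
  \<open>i - p\<^sup>v\<close> writes an invertible multiple of \<open>X x i\<close> through products of coordinates of smaller index.
\<close>

lemma X_pol_mem_ideal:
  assumes I: "ideal_set I" "V_ideal G r \<subseteq> I" and base: "\<And>x s. s < r \<Longrightarrow> X_pol x (CHAR('k) ^ s) \<in> I"
    and i: "0 < i"
  shows "X_pol x i \<in> I"
  using i
proof (induction i arbitrary: x rule: less_induct)
  case (less i)
  let ?p = "CHAR('k)"
  let ?j = "?p ^ multiplicity ?p i"
  have p: "Factorial_Ring.prime ?p" using char by (rule prime_CHAR_semidom)
  note j = not_dvd_binomial_prime_power[OF p less.prems]
  show ?case
  proof (cases "?p ^ r \<le> i")
    case True
    then show ?thesis using relations_mem(1) I(2) by blast
  next
    case False
    then have iq: "i < ?p ^ r" by simp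
    show ?thesis
    proof (cases "?j = i")
      case True
      have "?p ^ multiplicity ?p i < ?p ^ r" using True iq by simp
      then have "multiplicity ?p i < r" using prime_gt_1_nat[OF p] by (simp add: power_strict_increasing_iff)
      then have "X_pol x ?j \<in> I" by (rule base)
      then show ?thesis using True by simp
    next
      case False
      then have ji: "?j < i" using j(1) by simp
      have jp: "0 < ?j" using char by simp
      let ?c = "i choose ?j"
      let ?t = "tens (\<lambda>y z. X_pol y ?j * X_pol z (i - ?j)) (comul G x)"
      have "of_nat ((?j + (i - ?j)) choose ?j) * X_pol x (?j + (i - ?j)) - ?t \<in> V_ideal G r"
        using ji iq by (intro relations_mem(6)) simp_all
      then have rel: "of_nat ?c * X_pol x i - ?t \<in> I" using I(2) ji by auto
      have t: "?t \<in> I" using less.IH[OF ji jp] by (intro ideal_set_tens[OF I(1)] ideal_setD(4)[OF I(1)])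
      have "of_nat ?c * X_pol x i \<in> I" using ideal_setD(2)[OF I(1) rel t] by simp
      then have c: "const_pol (of_nat ?c) * X_pol x i \<in> I" by (simp add: const_pol_of_nat)
      have nz: "(of_nat ?c :: 'k) \<noteq> 0" using j(2) by (simp add: of_nat_eq_0_iff_char_dvd)
      have "const_pol (inverse (of_nat ?c)) * (const_pol (of_nat ?c) * X_pol x i) \<in> I"
        by (rule ideal_setD(3)[OF I(1) c])
      then show ?thesis using nz by (simp add: mult.assoc[symmetric] const_pol_simps(4)[symmetric] const_pol_simps(2))
    qed
  qed
qed

text \<open>
  The powers of \<open>X x p\<^sup>s\<close> to the exponent \<open>p\<^bsup>r-1-s\<^esup>\<close> have degree \<open>p\<^bsup>r-1\<^esup>\<close>.  If these all vanish at a point, then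
  so do all coordinates of positive degree.
\<close>

lemma red_degree:
  assumes P: "P \<in> Proj (red_ring G r) (red_grading G r)"
  shows "\<exists>f. weighted_homogeneous (CHAR('k) ^ (r - 1)) f \<and> pol_class G r f \<notin> P"
proof (rule ccontr)
  let ?p = "CHAR('k)"
  assume "\<not> (\<exists>f. weighted_homogeneous (?p ^ (r - 1)) f \<and> pol_class G r f \<notin> P)"
  then have all: "pol_class G r f \<in> P" if "weighted_homogeneous (?p ^ (r - 1)) f" for f using that by blast
  interpret red: graded_presentation "red_ring G r" "red_grading G r" "pol_class G r" "\<lambda>n. {f. weighted_homogeneous n f}"
    by (rule red_presentation)
  define I where "I = {f. pol_class G r f \<in> P}"
  have I: "ideal_set I" unfolding I_def
    by (rule preimage_ideal_set[OF pol_class_facts(1,2) _ _ primeideal.axioms(1)[OF red.PR_prime[OF P]]])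
      (simp_all add: pol_class_facts(3,4))
  have VI: "V_ideal G r \<subseteq> I"
  proof
    fix f assume "f \<in> V_ideal G r"
    then show "f \<in> I" using red.prime_zero[OF P] by (simp add: I_def pol_class_zero red.\<pi>_zero)
  qed
  have pow: "f \<in> I" if "f ^ n \<in> I" for f and n :: nat
    using that
  proof (induction n)
    case 0
    then have "1 * f \<in> I" by (intro ideal_setD(4)[OF I]) simp
    then show ?case by simp
  next
    case (Suc n)
    then show ?case using red.prime_mult[OF P, of f "f ^ n"] by (auto simp: I_def)
  qed
  have base: "X_pol x (?p ^ s) \<in> I" if "s < r" for x s
  proof -
    have "weighted_homogeneous (?p ^ (r - 1 - s) * ?p ^ s) (X_pol x (?p ^ s) ^ (?p ^ (r - 1 - s)) :: ('k, 'h) pring)"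
      by (rule homogeneous_power[OF homogeneous_X])
    moreover have "?p ^ (r - 1 - s) * ?p ^ s = ?p ^ (r - 1)" using that by (simp flip: power_add)
    ultimately have "X_pol x (?p ^ s) ^ (?p ^ (r - 1 - s)) \<in> I" unfolding I_def using all by simp
    then show ?thesis by (rule pow)
  qed
  have "red_grading G r n \<subseteq> P" if n: "0 < n" for n
  proof
    fix u assume "u \<in> red_grading G r n"
    then obtain f where f: "u = pol_class G r f" "weighted_homogeneous n f" unfolding red.D_eq by blast
    have "f \<in> I" using homogeneous_mem_ideal[OF I X_pol_mem_ideal[OF I VI base] f(2) n] by blast
    then show "u \<in> P" by (simp add: I_def f(1))
  qed
  then have "(\<Union>n\<in>{0<..}. red_grading G r n) \<subseteq> P" by auto
  then show False using P unfolding Proj_def by blast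
qed

lemma red_reduced_presentation:
  "reduced_presentation (red_ring G r) (red_grading G r) (pol_class G r) (\<lambda>n. {f. weighted_homogeneous n f}) (CHAR('k) ^ (r - 1))"
proof (rule reduced_presentation.intro[OF red_presentation], unfold_locales)
  show "\<exists>f\<in>{f. weighted_homogeneous (CHAR('k) ^ (r - 1)) f}. pol_class G r f \<notin> P"
    if "P \<in> Proj (red_ring G r) (red_grading G r)" for P
    using red_degree[OF that] by simp
  show "pol_class G r (f * x) = \<zero>\<^bsub>red_ring G r\<^esub>"
    if "x \<in> {f. weighted_homogeneous m f}" "f \<in> {f. weighted_homogeneous e f}" "0 < e"
      "\<And>Q. Q \<in> Proj (red_ring G r) (red_grading G r) \<Longrightarrow> pol_class G r f \<notin> Q \<Longrightarrow> pol_class G r x \<in> Q" for x m f e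
    using that by (intro red_vanishing) simp_all
qed

end

section \<open>The universal operator\<close>

text \<open>
  The degree \<open>d\<close> of the operator is a parameter with a defining equation, which keeps the power of \<open>p\<close>
  opaque to simplification.
\<close>

locale infinitesimal_module =
  fixes G :: "('k::field, 'h::comm_ring_1) group_scheme" and M :: "('k, 'h, 'm::ab_group_add) G_mod" and r d :: nat
  assumes char: "CHAR('k) > 0" and r: "r \<ge> 1" and d_eq: "d = CHAR('k) ^ (r - 1)"
    and inf: "infinitesimal_group_scheme G r" and mod: "fin_dim_G_module G M"
begin

sublocale GS: affine_group_scheme G using inf by (simp add: infinitesimal_group_scheme_def)
sublocale GM: fin_dim_G_module G M by (rule mod)
sublocale V: vector_space "scl G" by (rule GS.vector_space_scl)
sublocale W: vector_space "mscl M" by (rule GM.vector_space_mscl)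

lemma basis_G: "V.independent (basis_G G)" "V.span (basis_G G) = UNIV" "finite (basis_G G)"
proof -
  show i: "V.independent (basis_G G)"
    unfolding basis_G_def by (rule V.independent_extend_basis[OF V.independent_empty])
  show "V.span (basis_G G) = UNIV"
    unfolding basis_G_def by (rule V.span_extend_basis[OF V.independent_empty])
  obtain S where "finite S" "V.span S = UNIV" using inf unfolding infinitesimal_group_scheme_def by auto
  then show "finite (basis_G G)" using V.independent_span_bound[OF _ i] by simp
qed

lemma basis_M: "W.independent (basis_M M)" "W.span (basis_M M) = UNIV" "finite (basis_M M)"
proof -
  show i: "W.independent (basis_M M)"
    unfolding basis_M_def by (rule W.independent_extend_basis[OF W.independent_empty])
  show "W.span (basis_M M) = UNIV"
    unfolding basis_M_def by (rule W.span_extend_basis[OF W.independent_empty])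
  obtain S where "finite S" "W.span S = UNIV" using GM.finite_dim_M by auto
  then show "finite (basis_M M)" using W.independent_span_bound[OF _ i] by simp
qed

abbreviation "E \<equiv> basis_G G"
abbreviation "B \<equiv> basis_M M"

text \<open>
  The member of the dual basis of \<open>kG\<close> that belongs to \<open>e\<close>.
\<close>

definition dual :: "'h \<Rightarrow> 'h \<Rightarrow> 'k" where
  "dual e = (\<lambda>x. V.representation E x e)"

definition mcoord :: "'m \<Rightarrow> 'm \<Rightarrow> 'k" where
  "mcoord b v = W.representation B v b"

definition act_coeff :: "'h \<Rightarrow> 'm \<Rightarrow> 'm \<Rightarrow> 'k" where
  "act_coeff e b' b = mcoord b' (act M (dual e) b)"

text \<open>
  The coefficient of \<open>t\<^sup>n\<close> in the universal one-parameter subgroup is the element \<open>\<Sum>e. X e n \<otimes> e\<^sup>*\<close> of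
  \<open>k[V(G)] \<otimes> kG\<close>; this is the matrix of its action on \<open>M\<close>.  The case \<open>n = d\<close> is \<open>\<Theta>\<close>.
\<close>

definition push_matrix :: "nat \<Rightarrow> 'm \<Rightarrow> 'm \<Rightarrow> ('k, 'h) pring" where
  "push_matrix n b' b = (\<Sum>e\<in>E. X_pol e n * const_pol (act_coeff e b' b))"

lemma group_algebra_iff:
  "f \<in> group_algebra G \<longleftrightarrow> (\<forall>x y. f (x + y) = f x + f y) \<and> (\<forall>c x. f (scl G c x) = c * f x)"
proof -
  have "vector_space ((*) :: 'k \<Rightarrow> 'k \<Rightarrow> 'k)" using GS.counit_linear by (simp add: Vector_Spaces.linear_iff)
  then show ?thesis using V.vector_space_axioms by (auto simp: group_algebra_def Vector_Spaces.linear_iff)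
qed

lemma dual_mem: "dual e \<in> group_algebra G"
  unfolding group_algebra_iff dual_def
  using V.representation_add[OF basis_G(1)] V.representation_scale[OF basis_G(1)] by (simp add: basis_G(2))

lemma dual_expand: "x = (\<Sum>e\<in>E. scl G (dual e x) e)"
  using V.sum_representation_eq[OF basis_G(1) _ basis_G(3) order_refl, of x] by (simp add: dual_def basis_G(2))

lemma mcoord_linear:
  "mcoord b (v + w) = mcoord b v + mcoord b w" "mcoord b (mscl M c v) = c * mcoord b v" "mcoord b 0 = 0"
  "mcoord b (sum g A) = (\<Sum>a\<in>A. mcoord b (g a))"
proof -
  show add: "mcoord b (v + w) = mcoord b v + mcoord b w" for v w
    unfolding mcoord_def using W.representation_add[OF basis_M(1)] by (simp add: basis_M(2))
  show scale: "mcoord b (mscl M c v) = c * mcoord b v" for c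
    unfolding mcoord_def using W.representation_scale[OF basis_M(1)] by (simp add: basis_M(2))
  show z: "mcoord b 0 = 0" unfolding mcoord_def by (simp add: W.representation_zero)
  show "mcoord b (sum g A) = (\<Sum>a\<in>A. mcoord b (g a))"
    by (induction A rule: infinite_finite_induct) (simp_all add: z add)
qed

lemma mcoord_expand: "v = (\<Sum>b\<in>B. mscl M (mcoord b v) b)"
  using W.sum_representation_eq[OF basis_M(1) _ basis_M(3) order_refl, of v] by (simp add: mcoord_def basis_M(2))

lemma mcoord_basis: "b \<in> B \<Longrightarrow> mcoord b' b = (if b = b' then 1 else 0)"
  unfolding mcoord_def using W.representation_basis[OF basis_M(1), of b] by auto

lemma act_linear_simps:
  assumes "f \<in> group_algebra G"
  shows "act M f (v + w) = act M f v + act M f w" "act M f (mscl M c v) = mscl M c (act M f v)" "act M f 0 = 0"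
    "act M f (sum g A) = (\<Sum>a\<in>A. act M f (g a))"
proof -
  have l: "Vector_Spaces.linear (mscl M) (mscl M) (act M f)" by (rule GM.act_linear[OF assms])
  show add: "act M f (v + w) = act M f v + act M f w" for v w using l by (simp add: Vector_Spaces.linear_iff)
  show "act M f (mscl M c v) = mscl M c (act M f v)" using l by (simp add: Vector_Spaces.linear_iff)
  show z: "act M f 0 = 0" using add[of 0 0] by simp
  show "act M f (sum g A) = (\<Sum>a\<in>A. act M f (g a))"
    by (induction A rule: infinite_finite_induct) (simp_all add: z add)
qed

lemma mcoord_act: "f \<in> group_algebra G \<Longrightarrow> mcoord b (act M f v) = (\<Sum>c\<in>B. mcoord c v * mcoord b (act M f c))"
  by (subst mcoord_expand[of v]) (simp add: act_linear_simps mcoord_linear)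

lemma act_sum:
  assumes "finite A" and "\<And>a. a \<in> A \<Longrightarrow> f a \<in> group_algebra G"
  shows "(\<lambda>x. \<Sum>a\<in>A. c a * f a x) \<in> group_algebra G \<and>
    act M (\<lambda>x. \<Sum>a\<in>A. c a * f a x) m = (\<Sum>a\<in>A. mscl M (c a) (act M (f a) m))"
  using assms(1,2)
proof (induction A rule: finite_induct)
  case empty
  have "act M (\<lambda>x. 0 * dual 0 x) m = mscl M 0 (act M (dual 0) m)" by (rule GM.act_scl[OF dual_mem])
  then show ?case by (simp add: group_algebra_iff)
next
  case (insert a A)
  let ?g = "\<lambda>x. \<Sum>a\<in>A. c a * f a x"
  have IH: "?g \<in> group_algebra G" "act M ?g m = (\<Sum>a\<in>A. mscl M (c a) (act M (f a) m))" using insert by auto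
  have a: "(\<lambda>x. c a * f a x) \<in> group_algebra G"
    using insert(4)[of a] by (simp add: group_algebra_iff algebra_simps)
  have "act M (\<lambda>x. c a * f a x + ?g x) m = act M (\<lambda>x. c a * f a x) m + act M ?g m"
    by (rule GM.act_add[OF a IH(1)])
  moreover have "act M (\<lambda>x. c a * f a x) m = mscl M (c a) (act M (f a) m)" using insert(4)[of a] by (intro GM.act_scl) simp
  moreover have "(\<lambda>x. c a * f a x + ?g x) \<in> group_algebra G"
    using a IH(1) by (simp add: group_algebra_iff algebra_simps)
  ultimately show ?case using insert(1,2) IH(2) by simp
qed

lemma act_expand:
  assumes f: "f \<in> group_algebra G"
  shows "act M f m = (\<Sum>e\<in>E. mscl M (f e) (act M (dual e) m))"
proof -
  have add: "f (x + y) = f x + f y" and scale: "f (scl G c x) = c * f x" for x y c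
    using f unfolding group_algebra_iff by blast+
  have z: "f 0 = 0" using scale[of 0 0] by simp
  have sum: "f (sum g A) = (\<Sum>a\<in>A. f (g a))" for g and A :: "'h set"
    by (induction A rule: infinite_finite_induct) (simp_all add: z add)
  have "f x = (\<Sum>e\<in>E. f e * dual e x)" for x
    by (subst dual_expand[of x]) (simp add: sum scale mult.commute)
  then have "f = (\<lambda>x. \<Sum>e\<in>E. f e * dual e x)" by (rule ext)
  then show ?thesis using act_sum[OF basis_G(3), of dual f m] dual_mem by simp
qed

lemma convolution_mem:
  assumes f: "f \<in> group_algebra G" and g: "g \<in> group_algebra G"
  shows "convolution G f g \<in> group_algebra G"
proof -
  have "form2 G (\<lambda>y z. f y * g z)"
    using f g unfolding form2_def form1_def group_algebra_iff
      group_algebra_iff[unfolded group_algebra_def mem_Collect_eq]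
    by (auto simp: algebra_simps)
  from GS.comul_add[OF this] GS.comul_scl[OF this] show ?thesis
    unfolding group_algebra_iff convolution_def by simp
qed

text \<open>Congruence modulo the relations of \<open>k[V(G)]\<close>.\<close>

definition eqv :: "('k, 'h) pring \<Rightarrow> ('k, 'h) pring \<Rightarrow> bool" (infix "\<doteq>" 50) where
  "f \<doteq> g \<longleftrightarrow> f - g \<in> V_ideal G r"

lemma eqv_refl: "f \<doteq> f"
  using ideal_setD(1)[OF VI_ideal_set] by (simp add: eqv_def)

lemma eqv_sym: "f \<doteq> g \<Longrightarrow> g \<doteq> f"
  using ideal_setD(5)[OF VI_ideal_set, of "f - g"] by (simp add: eqv_def)

lemma eqv_trans [trans]: "f \<doteq> g \<Longrightarrow> g \<doteq> h \<Longrightarrow> f \<doteq> h"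
  using ideal_setD(2)[OF VI_ideal_set, of "f - g" _ _ "g - h"] by (simp add: eqv_def)

lemma eqv_add: "f \<doteq> g \<Longrightarrow> f' \<doteq> g' \<Longrightarrow> f + f' \<doteq> g + g'"
  using ideal_setD(2)[OF VI_ideal_set, of "f - g" _ _ "f' - g'"] by (simp add: eqv_def algebra_simps)

lemma eqv_mult:
  assumes "f \<doteq> g" "f' \<doteq> g'"
  shows "f * f' \<doteq> g * g'"
proof -
  have "f * f' - g * g' = (f - g) * f' + g * (f' - g')" by (simp add: algebra_simps)
  moreover have "\<dots> \<in> V_ideal G r"
    using assms unfolding eqv_def
    by (intro ideal_setD(2)[OF VI_ideal_set] ideal_setD(3,4)[OF VI_ideal_set])
  ultimately show ?thesis by (simp add: eqv_def)
qed

lemma eqv_sum: "(\<And>a. a \<in> A \<Longrightarrow> f a \<doteq> g a) \<Longrightarrow> sum f A \<doteq> sum g A"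
  by (induction A rule: infinite_finite_induct) (auto intro: eqv_refl eqv_add)

lemma const_pol_sum: "const_pol (sum f A) = (\<Sum>a\<in>A. const_pol (f a))"
  by (induction A rule: infinite_finite_induct) (simp_all add: const_pol_simps)

lemma X_pol_expand: "X_pol y n \<doteq> (\<Sum>e\<in>E. X_pol e n * const_pol (dual e y))"
proof -
  have add: "X_pol (x + y) n \<doteq> X_pol x n + X_pol y n" for x y unfolding eqv_def by (rule relations_mem)
  have "X_pol 0 n \<doteq> 0"
    using ideal_setD(5)[OF VI_ideal_set relations_mem(2)[of 0 0 n G r]] by (simp add: eqv_def)
  then have sum: "X_pol (sum g A) n \<doteq> (\<Sum>a\<in>A. X_pol (g a) n)" for g and A :: "'h set"
    by (induction A rule: infinite_finite_induct) (auto intro: eqv_trans[OF add] eqv_add eqv_refl)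
  have "X_pol y n \<doteq> (\<Sum>e\<in>E. X_pol (scl G (dual e y) e) n)"
    using sum[of "\<lambda>e. scl G (dual e y) e" E] dual_expand[of y] by simp
  also have "\<dots> \<doteq> (\<Sum>e\<in>E. X_pol e n * const_pol (dual e y))"
    by (intro eqv_sum) (simp add: eqv_def relations_mem(3) mult.commute[of "X_pol _ _"])
  finally show ?thesis .
qed

text \<open>
  The coefficient of \<open>t\<^sup>0\<close> is the counit, which acts as the identity.
\<close>

lemma push_matrix_zero:
  assumes "b \<in> B" "b' \<in> B"
  shows "push_matrix 0 b' b \<doteq> (if b' = b then 1 else 0)"
proof -
  have c: "counit G \<in> group_algebra G" using GS.counit_linear by (simp add: group_algebra_def)
  have "push_matrix 0 b' b \<doteq> (\<Sum>e\<in>E. const_pol (counit G e) * const_pol (act_coeff e b' b))"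
    unfolding push_matrix_def by (intro eqv_sum eqv_mult eqv_refl) (simp add: eqv_def relations_mem)
  also have "(\<Sum>e\<in>E. const_pol (counit G e) * const_pol (act_coeff e b' b))
    = const_pol (\<Sum>e\<in>E. counit G e * act_coeff e b' b)"
    by (simp add: const_pol_sum const_pol_simps)
  also have "(\<Sum>e\<in>E. counit G e * act_coeff e b' b) = mcoord b' (act M (counit G) b)"
    by (simp add: act_expand[OF c] mcoord_linear act_coeff_def)
  also have "\<dots> = (if b' = b then 1 else 0)" using mcoord_basis[OF assms(1), of b'] by (auto simp: GM.act_one)
  also have "const_pol \<dots> = (if b' = b then 1 else 0)" by (simp add: const_pol_simps)
  finally show ?thesis .
qed

text \<open>
  A product of two members of the dual basis acts through their convolution, expanded in the dual basis.
\<close>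

lemma act_coeff_mult:
  "(\<Sum>c\<in>B. act_coeff e b c * act_coeff e' c b') = (\<Sum>x\<in>E. convolution G (dual e) (dual e') x * act_coeff x b b')"
proof -
  have "(\<Sum>c\<in>B. act_coeff e b c * act_coeff e' c b') = mcoord b (act M (dual e) (act M (dual e') b'))"
    by (simp add: mcoord_act[OF dual_mem, of b e "act M (dual e') b'"] act_coeff_def mult.commute)
  also have "\<dots> = mcoord b (act M (convolution G (dual e) (dual e')) b')"
    by (simp add: GM.act_mult[OF dual_mem dual_mem])
  also have "\<dots> = (\<Sum>x\<in>E. convolution G (dual e) (dual e') x * act_coeff x b b')"
    by (simp add: act_expand[OF convolution_mem[OF dual_mem dual_mem]] mcoord_linear act_coeff_def)
  finally show ?thesis .
qed

lemma tens_expand: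
  "(\<Sum>e\<in>E. \<Sum>e'\<in>E. X_pol e m * X_pol e' n * const_pol (tens (\<lambda>y z. dual e y * dual e' z) cs))
    \<doteq> tens (\<lambda>y z. X_pol y m * X_pol z n) cs"
proof (induction cs)
  case Nil
  show ?case by (simp add: tens_def const_pol_simps eqv_refl)
next
  case (Cons yz cs)
  obtain y z where yz: "yz = (y, z)" by (cases yz)
  have "(\<Sum>e\<in>E. \<Sum>e'\<in>E. X_pol e m * X_pol e' n * const_pol (tens (\<lambda>y z. dual e y * dual e' z) (yz # cs)))
    = (\<Sum>e\<in>E. X_pol e m * const_pol (dual e y)) * (\<Sum>e'\<in>E. X_pol e' n * const_pol (dual e' z))
      + (\<Sum>e\<in>E. \<Sum>e'\<in>E. X_pol e m * X_pol e' n * const_pol (tens (\<lambda>y z. dual e y * dual e' z) cs))"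
    unfolding sum_product sum.distrib[symmetric]
    by (intro sum.cong refl) (simp add: tens_def yz const_pol_simps algebra_simps)
  also have "\<dots> \<doteq> X_pol y m * X_pol z n + tens (\<lambda>y z. X_pol y m * X_pol z n) cs"
    by (intro eqv_add eqv_mult Cons eqv_sym[OF X_pol_expand])
  also have "\<dots> = tens (\<lambda>y z. X_pol y m * X_pol z n) (yz # cs)" by (simp add: tens_def yz)
  finally show ?case .
qed

text \<open>
  The product of the coefficients of \<open>t\<^sup>m\<close> and \<open>t\<^sup>n\<close> in \<open>kG\<close> is evaluated through the comultiplication of \<open>k[G]\<close>, to
  which the universal one-parameter subgroup matches the comultiplication of \<open>t\<close>.
\<close>

lemma push_matrix_mult:
  assumes "m < CHAR('k) ^ r" "n < CHAR('k) ^ r"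
  shows "(\<Sum>c\<in>B. push_matrix m b c * push_matrix n c b') \<doteq> of_nat ((m + n) choose m) * push_matrix (m + n) b b'"
proof -
  let ?K = "\<lambda>e e' x. const_pol (convolution G (dual e) (dual e') x) :: ('k, 'h) pring"
  have "(\<Sum>c\<in>B. push_matrix m b c * push_matrix n c b')
    = (\<Sum>c\<in>B. \<Sum>e\<in>E. \<Sum>e'\<in>E. X_pol e m * X_pol e' n * const_pol (act_coeff e b c * act_coeff e' c b'))"
    unfolding push_matrix_def sum_product by (intro sum.cong refl) (simp add: const_pol_simps algebra_simps)
  also have "\<dots> = (\<Sum>e\<in>E. \<Sum>c\<in>B. \<Sum>e'\<in>E. X_pol e m * X_pol e' n * const_pol (act_coeff e b c * act_coeff e' c b'))"
    by (rule sum.swap)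
  also have "\<dots> = (\<Sum>e\<in>E. \<Sum>e'\<in>E. \<Sum>c\<in>B. X_pol e m * X_pol e' n * const_pol (act_coeff e b c * act_coeff e' c b'))"
    by (intro sum.cong refl sum.swap)
  also have "\<dots> = (\<Sum>e\<in>E. \<Sum>e'\<in>E. X_pol e m * X_pol e' n * const_pol (\<Sum>c\<in>B. act_coeff e b c * act_coeff e' c b'))"
    by (simp add: sum_distrib_left const_pol_sum)
  also have "\<dots> = (\<Sum>e\<in>E. \<Sum>e'\<in>E. \<Sum>x\<in>E. X_pol e m * X_pol e' n * ?K e e' x * const_pol (act_coeff x b b'))"
    unfolding act_coeff_mult by (simp add: sum_distrib_left const_pol_sum const_pol_simps mult.assoc)
  also have "\<dots> = (\<Sum>e\<in>E. \<Sum>x\<in>E. \<Sum>e'\<in>E. X_pol e m * X_pol e' n * ?K e e' x * const_pol (act_coeff x b b'))"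
    by (intro sum.cong refl sum.swap)
  also have "\<dots> = (\<Sum>x\<in>E. \<Sum>e\<in>E. \<Sum>e'\<in>E. X_pol e m * X_pol e' n * ?K e e' x * const_pol (act_coeff x b b'))"
    by (rule sum.swap)
  also have "\<dots> = (\<Sum>x\<in>E. (\<Sum>e\<in>E. \<Sum>e'\<in>E. X_pol e m * X_pol e' n * ?K e e' x) * const_pol (act_coeff x b b'))"
    by (simp add: sum_distrib_right)
  also have "\<dots> \<doteq> (\<Sum>x\<in>E. of_nat ((m + n) choose m) * X_pol x (m + n) * const_pol (act_coeff x b b'))"
  proof (intro eqv_sum eqv_mult eqv_refl)
    fix x
    have "(\<Sum>e\<in>E. \<Sum>e'\<in>E. X_pol e m * X_pol e' n * ?K e e' x) \<doteq> tens (\<lambda>y z. X_pol y m * X_pol z n) (comul G x)"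
      unfolding convolution_def by (rule tens_expand)
    also have "\<dots> \<doteq> of_nat ((m + n) choose m) * X_pol x (m + n)"
      by (rule eqv_sym) (simp add: eqv_def relations_mem(6) assms)
    finally show "(\<Sum>e\<in>E. \<Sum>e'\<in>E. X_pol e m * X_pol e' n * ?K e e' x) \<doteq> of_nat ((m + n) choose m) * X_pol x (m + n)" .
  qed
  also have "\<dots> = of_nat ((m + n) choose m) * push_matrix (m + n) b b'"
    by (simp add: push_matrix_def sum_distrib_left mult.assoc)
  finally show ?thesis .
qed

lemma q_eq: "CHAR('k) ^ r = CHAR('k) * d"
  using r by (cases r) (simp_all add: d_eq)

text \<open>
  The multiplication rule applies as long as \<open>n d < p\<^sup>r\<close>, that is for \<open>n < p\<close>, and so it reaches the
  exponent \<open>p\<close>.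
\<close>

lemma mat_pow_push:
  "n \<le> CHAR('k) \<Longrightarrow> \<exists>k. \<forall>b\<in>B. \<forall>b'\<in>B. mat_pow B (push_matrix d) n b b' \<doteq> of_nat k * push_matrix (n * d) b b'"
proof (induction n)
  case 0
  show ?case
  proof (intro exI[of _ 1] ballI)
    fix b b' assume "b \<in> B" "b' \<in> B"
    from eqv_sym[OF push_matrix_zero[OF this(2,1)]]
    show "mat_pow B (push_matrix d) 0 b b' \<doteq> of_nat 1 * push_matrix (0 * d) b b'" by simp
  qed
next
  case (Suc n)
  then obtain k where k: "\<forall>b\<in>B. \<forall>b'\<in>B. mat_pow B (push_matrix d) n b b' \<doteq> of_nat k * push_matrix (n * d) b b'"
    by auto
  have p: "Factorial_Ring.prime CHAR('k)" using char by (rule prime_CHAR_semidom)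
  have dq: "d < CHAR('k) ^ r" "n * d < CHAR('k) ^ r"
    unfolding q_eq using Suc.prems char prime_gt_1_nat[OF p] by (simp_all add: d_eq)
  let ?k = "k * ((d + n * d) choose d)"
  have "mat_pow B (push_matrix d) (Suc n) b b' \<doteq> of_nat ?k * push_matrix (Suc n * d) b b'" if "b \<in> B" "b' \<in> B" for b b'
  proof -
    have "mat_pow B (push_matrix d) (Suc n) b b' \<doteq> (\<Sum>c\<in>B. push_matrix d b c * (of_nat k * push_matrix (n * d) c b'))"
      using k that by (auto intro!: eqv_sum eqv_mult eqv_refl)
    also have "\<dots> = of_nat k * (\<Sum>c\<in>B. push_matrix d b c * push_matrix (n * d) c b')"
      by (simp add: sum_distrib_left mult.left_commute)
    also have "\<dots> \<doteq> of_nat k * (of_nat ((d + n * d) choose d) * push_matrix (d + n * d) b b')"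
      by (intro eqv_mult eqv_refl push_matrix_mult dq)
    also have "\<dots> = of_nat ?k * push_matrix (Suc n * d) b b'" by (simp add: mult.assoc)
    finally show ?thesis .
  qed
  then show ?case by blast
qed

text \<open>
  The power \<open>\<Theta>\<^sup>p\<close> is a multiple of the coefficient of \<open>t\<close> to the power \<open>p d = p\<^sup>r\<close>, which is zero.
\<close>

lemma push_matrix_nilpotent:
  assumes "b \<in> B" "b' \<in> B"
  shows "pol_class G r (mat_pow B (push_matrix d) CHAR('k) b b') = \<zero>\<^bsub>red_ring G r\<^esub>"
proof -
  obtain k where k: "mat_pow B (push_matrix d) CHAR('k) b b' \<doteq> of_nat k * push_matrix (CHAR('k) * d) b b'"
    using mat_pow_push[of "CHAR('k)"] assms by auto
  have "push_matrix (CHAR('k) * d) b b' \<in> V_ideal G r"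
    unfolding push_matrix_def q_eq[symmetric]
    by (intro ideal_set_sum[OF VI_ideal_set] ideal_setD(4)[OF VI_ideal_set] relations_mem(1)) simp
  then have "of_nat k * push_matrix (CHAR('k) * d) b b' \<in> V_ideal G r" by (rule ideal_setD(3)[OF VI_ideal_set])
  with k have "mat_pow B (push_matrix d) CHAR('k) b b' \<in> V_ideal G r"
    using ideal_setD(2)[OF VI_ideal_set] unfolding eqv_def by fastforce
  then show ?thesis by (rule pol_class_zero)
qed

lemma push_matrix_homogeneous: "weighted_homogeneous n (push_matrix n b b')"
  unfolding push_matrix_def
  using homogeneous_const_mult[OF homogeneous_X] by (intro homogeneous_sum) (simp add: mult.commute[of "X_pol _ _"])

lemma coord_class_finsum:
  assumes "finite A"
  shows "(\<Oplus>\<^bsub>coord_ring G r\<^esub> a\<in>A. coord_class G r (f a)) = coord_class G r (sum f A)"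
proof -
  interpret C: cring "coord_ring G r" by (rule coord_class_facts(1))
  have c: "coord_class G r g \<in> carrier (coord_ring G r)" for g unfolding coord_class_facts(2) by blast
  have z: "coord_class G r 0 = \<zero>\<^bsub>coord_ring G r\<^esub>"
    unfolding coord_class_facts(6) by (rule ideal_setD(1)[OF VI_ideal_set])
  show ?thesis using assms
    by (induction A rule: finite_induct) (simp_all add: z c coord_class_facts(3) C.finsum_insert)
qed

text \<open>
  The element \<open>u\<^sub>r\<close> picks the coefficient with index \<open>d = p\<^bsup>r-1\<^esup>\<close>, which is smaller than \<open>p\<^sup>r\<close>.
\<close>

lemma Theta_red_eq: "Theta_red G r M = (\<lambda>b' b. pol_class G r (push_matrix d b' b))"
proof (intro ext)
  fix b' b
  have p: "Factorial_Ring.prime CHAR('k)" using char by (rule prime_CHAR_semidom)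
  have dq: "d < CHAR('k) ^ r" unfolding q_eq using char prime_gt_1_nat[OF p] by (simp add: d_eq)
  have u: "(\<Sum>i<CHAR('k) ^ r. const_pol (u_elem CHAR('k) r i) * X_pol e i) = (X_pol e d :: ('k, 'h) pring)" for e :: 'h
  proof -
    have "(\<Sum>i<CHAR('k) ^ r. const_pol (u_elem CHAR('k) r i) * X_pol e i)
      = (\<Sum>i<CHAR('k) ^ r. if i = d then X_pol e i else (0 :: ('k, 'h) pring))"
      by (intro sum.cong refl) (simp add: u_elem_def const_pol_simps d_eq)
    also have "\<dots> = X_pol e d" using dq by simp
    finally show ?thesis .
  qed
  have "Theta_matrix G r M b' b = (\<Oplus>\<^bsub>coord_ring G r\<^esub> e\<in>E. coord_class G r (X_pol e d * const_pol (act_coeff e b' b)))"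
    unfolding Theta_matrix_def Theta_G_def universal_push_def u coord_class_facts(4) act_coeff_def mcoord_def dual_def ..
  also have "\<dots> = coord_class G r (push_matrix d b' b)"
    unfolding push_matrix_def by (rule coord_class_finsum[OF basis_G(3)])
  finally show "Theta_red G r M b' b = pol_class G r (push_matrix d b' b)" by (simp add: Theta_red_def pol_class_def)
qed

lemma push_homogeneous_matrix:
  "homogeneous_matrix (red_ring G r) (red_grading G r) (pol_class G r) (\<lambda>n. {f. weighted_homogeneous n f}) d
    B (push_matrix d) CHAR('k)"
  by (rule homogeneous_matrix.intro[OF red_reduced_presentation[OF char r, folded d_eq]], unfold_locales)
    (simp_all add: basis_M push_matrix_homogeneous push_matrix_nilpotent)

end

theorem proposition3p8:
  fixes G :: "('k::alg_closed_field, 'h::comm_ring_1) group_scheme"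
    and M :: "('k, 'h, 'm::ab_group_add) G_mod"
    and r :: nat
    and U :: "('k, 'h) pring set set set set"
    and a :: "nat \<Rightarrow> nat"
  assumes "CHAR('k) > 0"
    and "r \<ge> 1"
    and "infinitesimal_group_scheme G r"
    and "fin_dim_G_module G M"
    and "PG_open G r U"
  shows "constant_jordan_type_on G r M U a \<longleftrightarrow>
    (\<forall>i\<in>{1..CHAR('k)}. F_locally_free_on G r M i U (a i))"
proof -
  interpret infinitesimal_module G M r "CHAR('k) ^ (r - 1)" by (rule infinitesimal_module.intro) (rule assms refl)+
  interpret hm: homogeneous_matrix "red_ring G r" "red_grading G r" "pol_class G r" "\<lambda>n. {f. weighted_homogeneous n f}"
    "CHAR('k) ^ (r - 1)" "basis_M M" "push_matrix (CHAR('k) ^ (r - 1))" "CHAR('k)"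
    by (rule push_homogeneous_matrix)
  have F: "F_sheaf G r M i = hm.Fsh i" for i
    unfolding F_sheaf_def Let_def hm.Fsh_def Theta_red_eq by simp
  show ?thesis
    using hm.jordan_type_iff_locally_free[OF assms(5), of a]
    unfolding constant_jordan_type_on_def F_locally_free_on_def Let_def F Theta_red_eq .
qed

end
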